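(* Let $\Omega\subset\mathbb{C}$ be a bounded simply connected domain whose boundary $\Gamma$ is a Weil-Petersson curve, let $\nu$ be the outward unit normal of $\Omega$ on $\Gamma$ and $\tau$ the unit tangent vector field such that $(\nu,\tau)$ is a direct frame. Let $a\in\Omega$. For any uniformization $f:\mathbb{D}\to\Omega$ such that $f(0)=a$, the maps $$u=\frac{f_\theta}{|f_\theta|}\circ f^{-1}\qquad\text{and}\qquad v=\frac{f_r}{|f_r|}\circ f^{-1}$$ are the canonical harmonic maps of degree $1$ associated to the data $(\tau,a)$ and $(\nu,a)$, respectively.
   Context: $\mathbb{D}$ is the open unit disk. A uniformization is a biholomorphic map $f:\mathbb{D}\to\Omega$, extended to a homeomorphism of closures; $f_r=(xf_x+yf_y)/r$ and $f_\theta=-yf_x+xf_y$ are its radial and angular derivatives ($r=\sqrt{x^2+y^2}$). A quasicircle is the boundary of the image of $\mathbb{D}$ by a quasiconformal map $\mathbb{C}\to\mathbb{C}$. A Jordan curve $\Gamma$ enclosing $\Omega$ is Weil-Petersson if it is a quasicircle and some uniformization $f:\mathbb{D}\to\Omega$ satisfies $\int_{\mathbb{D}}|f''/f'|^2dz<\infty$; then it is rectifiable and $\tau,\nu$ are in $H^{1/2}(\Gamma,\mathbb{S}^1)$ with degree $1$. For $g\in H^{1/2}(\Gamma,\mathbb{S}^1)$ (i.e. $g\circ f\in H^{1/2}(\mathbb{S}^1,\mathbb{S}^1)$) of degree $1$, the canonical harmonic map of degree $1$ associated to $(g,a)$ is the unique map $w:\Omega\setminus\{a\}\to\mathbb{S}^1$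 such that: $w\in H^1(\Omega\setminus\overline{B(a,\rho)})$ for all small $\rho>0$; $\deg(w_{|\partial B(a,\rho)})=1$ for small $\rho$; $w=g$ on $\Gamma$ (the trace of $w\circ f$ on $\mathbb{S}^1$ is $g\circ f$); and $\star\langle dw,-iw\rangle=d\Phi$, where $\star dx=dy$, $\star dy=-dx$, $\Phi=\tilde\Phi\circ f^{-1}$ with $f$ a uniformization such that $f(0)=a$, and $\tilde\Phi$ is the solution, unique up to a constant, of $\Delta\tilde\Phi=2\pi\delta_0$ in $\mathbb{D}$, $\partial_r\tilde\Phi=\langle\partial_\theta(g\circ f),i(g\circ f)\rangle$ on $\mathbb{S}^1$ (weak sense, datum in $H^{-1/2}$). *)

theory Defs
  imports "HOL-Complex_Analysis.Complex_Analysis"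
begin

section \<open>Partial derivatives and Sobolev spaces on planar open sets\<close>

definition pd_x :: "(complex \<Rightarrow> 'b::real_normed_vector) \<Rightarrow> complex \<Rightarrow> 'b" where
  "pd_x h z = frechet_derivative h (at z) 1"

definition pd_y :: "(complex \<Rightarrow> 'b::real_normed_vector) \<Rightarrow> complex \<Rightarrow> 'b" where
  "pd_y h z = frechet_derivative h (at z) \<i>"

definition C1_on :: "complex set \<Rightarrow> (complex \<Rightarrow> 'b::real_normed_vector) \<Rightarrow> bool" where
  "C1_on U h \<longleftrightarrow> (\<forall>z\<in>U. h differentiable (at z)) \<and> continuous_on U (pd_x h) \<and> continuous_on U (pd_y h)"

definition radial_deriv :: "(complex \<Rightarrow> complex) \<Rightarrow> complex \<Rightarrow> complex" where
  "radial_deriv f z = (Re z *\<^sub>R pd_x f z + Im z *\<^sub>R pd_y f z) /\<^sub>R norm z"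

definition angular_deriv :: "(complex \<Rightarrow> complex) \<Rightarrow> complex \<Rightarrow> complex" where
  "angular_deriv f z = - Im z *\<^sub>R pd_x f z + Re z *\<^sub>R pd_y f z"

definition L2 :: "'a measure \<Rightarrow> ('a \<Rightarrow> 'b::{banach,second_countable_topology}) \<Rightarrow> bool" where
  "L2 M h \<longleftrightarrow> h \<in> borel_measurable M \<and> integrable M (\<lambda>x. (norm (h x))\<^sup>2)"

definition test_function :: "complex set \<Rightarrow> (complex \<Rightarrow> real) \<Rightarrow> bool" where
  "test_function U \<phi> \<longleftrightarrow> C1_on UNIV \<phi> \<and> compact (closure {z. \<phi> z \<noteq> 0}) \<and> closure {z. \<phi> z \<noteq> 0} \<subseteq> U"

definition locally_integrable ::
  "complex set \<Rightarrow> (complex \<Rightarrow> 'b::{banach,second_countable_topology}) \<Rightarrow> bool" where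
  "locally_integrable U h \<longleftrightarrow> (\<forall>K. compact K \<and> K \<subseteq> U \<longrightarrow> integrable (lebesgue_on K) h)"

text \<open>\<open>weak_gradient U h p q\<close>: the distributional derivatives of \<open>h\<close> on the open set \<open>U\<close> are
  \<open>\<partial>\<^sub>x h = p\<close> and \<open>\<partial>\<^sub>y h = q\<close>.\<close>
definition weak_gradient :: "complex set \<Rightarrow> (complex \<Rightarrow> 'b::{banach,second_countable_topology}) \<Rightarrow>
    (complex \<Rightarrow> 'b) \<Rightarrow> (complex \<Rightarrow> 'b) \<Rightarrow> bool" where
  "weak_gradient U h p q \<longleftrightarrow>
     locally_integrable U h \<and> locally_integrable U p \<and> locally_integrable U q \<and>
     (\<forall>\<phi>. test_function U \<phi> \<longrightarrow>
        (LINT z|lebesgue_on U. pd_x \<phi> z *\<^sub>R h z) = - (LINT z|lebesgue_on U. \<phi> z *\<^sub>R p z) \<and>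
        (LINT z|lebesgue_on U. pd_y \<phi> z *\<^sub>R h z) = - (LINT z|lebesgue_on U. \<phi> z *\<^sub>R q z))"

definition H1 :: "complex set \<Rightarrow> (complex \<Rightarrow> 'b::{banach,second_countable_topology}) \<Rightarrow> bool" where
  "H1 U h \<longleftrightarrow> L2 (lebesgue_on U) h \<and>
     (\<exists>p q. weak_gradient U h p q \<and> L2 (lebesgue_on U) p \<and> L2 (lebesgue_on U) q)"

section \<open>Uniformizations and Weil-Petersson curves\<close>

text \<open>The homeomorphism is the one between the closures; its restriction to the open disc is
  the biholomorphic map.\<close>
definition uniformization :: "(complex \<Rightarrow> complex) \<Rightarrow> complex set \<Rightarrow> bool" where
  "uniformization f \<Omega> \<longleftrightarrow>
     (\<exists>k. homeomorphism (cball 0 1) (closure \<Omega>) f k \<and> f ` ball 0 1 = \<Omega> \<and>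
          f holomorphic_on ball 0 1 \<and> k holomorphic_on \<Omega>)"

text \<open>Analytic definition of (orientation preserving) quasiconformality: a homeomorphism in
  \<open>W\<^sup>1\<^sup>,\<^sup>2\<^sub>l\<^sub>o\<^sub>c\<close> with \<open>|F\<^sub>z\<^sub>b\<^sub>a\<^sub>r| \<le> \<kappa> |F\<^sub>z|\<close> almost everywhere, \<open>\<kappa> < 1\<close>, where
  \<open>F\<^sub>z\<^sub>b\<^sub>a\<^sub>r = (F\<^sub>x + \<i> F\<^sub>y) / 2\<close> and \<open>F\<^sub>z = (F\<^sub>x - \<i> F\<^sub>y) / 2\<close>.\<close>
definition quasiconformal :: "(complex \<Rightarrow> complex) \<Rightarrow> bool" where
  "quasiconformal F \<longleftrightarrow>
     (\<exists>G. homeomorphism UNIV UNIV F G) \<and>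
     (\<exists>p q \<kappa>. weak_gradient UNIV F p q \<and>
        (\<forall>K. compact K \<longrightarrow> L2 (lebesgue_on K) p \<and> L2 (lebesgue_on K) q) \<and>
        0 \<le> \<kappa> \<and> \<kappa> < 1 \<and>
        (AE z in lebesgue. norm ((p z + \<i> * q z) / 2) \<le> \<kappa> * norm ((p z - \<i> * q z) / 2)))"

definition quasicircle :: "complex set \<Rightarrow> bool" where
  "quasicircle \<Gamma> \<longleftrightarrow> (\<exists>F. quasiconformal F \<and> \<Gamma> = frontier (F ` ball 0 1))"

definition jordan_curve :: "complex set \<Rightarrow> bool" where
  "jordan_curve \<Gamma> \<longleftrightarrow> (\<exists>c. simple_path c \<and> pathfinish c = pathstart c \<and> path_image c = \<Gamma>)"

definition weil_petersson_curve :: "complex set \<Rightarrow> bool" where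
  "weil_petersson_curve \<Gamma> \<longleftrightarrow> jordan_curve \<Gamma> \<and> quasicircle \<Gamma> \<and>
     (\<exists>f. uniformization f (inside \<Gamma>) \<and>
          (\<integral>\<^sup>+z\<in>ball 0 1. ennreal ((norm (deriv (deriv f) z / deriv f z))\<^sup>2) \<partial>lebesgue) < \<infinity>)"

section \<open>Outward normal of a rectifiable boundary\<close>

text \<open>Vanishing one-dimensional Hausdorff measure; on a rectifiable Jordan curve this is the same
  as vanishing arc length.\<close>
definition length_null :: "complex set \<Rightarrow> bool" where
  "length_null N \<longleftrightarrow>
     (\<forall>e>0. \<exists>A :: nat \<Rightarrow> complex set. (\<forall>i. bounded (A i)) \<and> N \<subseteq> (\<Union>i. A i) \<and>
        summable (\<lambda>i. diameter (A i)) \<and> (\<Sum>i. diameter (A i)) < e)"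

text \<open>At \<open>p\<close> the boundary is tangent to the line orthogonal to \<open>n\<close>: near \<open>p\<close>, the domain contains
  every sector about \<open>- n\<close> of opening less than \<open>\<pi>\<close>, and its closure misses the opposite one.\<close>
definition outward_unit_normal :: "complex set \<Rightarrow> complex \<Rightarrow> complex \<Rightarrow> bool" where
  "outward_unit_normal \<Omega> p n \<longleftrightarrow> norm n = 1 \<and>
     (\<forall>\<epsilon>>0. \<exists>\<delta>>0. \<forall>z\<in>ball p \<delta>.
        ((z - p) \<bullet> n < - \<epsilon> * norm (z - p) \<longrightarrow> z \<in> \<Omega>) \<and>
        ((z - p) \<bullet> n > \<epsilon> * norm (z - p) \<longrightarrow> z \<notin> closure \<Omega>))"

text \<open>A rectifiable curve has a tangent only at almost every point. That \<open>(\<nu>, \<tau>)\<close> is a direct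
  orthonormal frame means \<open>\<tau> = \<i> \<nu>\<close>.\<close>
definition normal_tangent_frame ::
  "complex set \<Rightarrow> (complex \<Rightarrow> complex) \<Rightarrow> (complex \<Rightarrow> complex) \<Rightarrow> bool" where
  "normal_tangent_frame \<Omega> \<nu> \<tau> \<longleftrightarrow>
     (\<exists>N. length_null N \<and>
        (\<forall>p\<in>frontier \<Omega> - N. outward_unit_normal \<Omega> p (\<nu> p) \<and> \<tau> p = \<i> * \<nu> p))"

section \<open>The space \<open>H\<^sup>1\<^sup>/\<^sup>2\<close> of the circle, degree and traces\<close>

abbreviation circle_measure :: "real measure" where
  "circle_measure \<equiv> lebesgue_on {0..2 * pi}"

definition fourier_coeff :: "(complex \<Rightarrow> complex) \<Rightarrow> int \<Rightarrow> complex" where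
  "fourier_coeff h n = (LINT t|circle_measure. h (cis t) * cis (- of_int n * t)) / of_real (2 * pi)"

definition H_half :: "(complex \<Rightarrow> complex) \<Rightarrow> bool" where
  "H_half h \<longleftrightarrow> L2 circle_measure (\<lambda>t. h (cis t)) \<and>
     (\<lambda>n. \<bar>real_of_int n\<bar> * (norm (fourier_coeff h n))\<^sup>2) summable_on UNIV"

definition H_half_S1 :: "(complex \<Rightarrow> complex) \<Rightarrow> bool" where
  "H_half_S1 h \<longleftrightarrow> H_half h \<and> (AE t in circle_measure. norm (h (cis t)) = 1)"

text \<open>The duality pairing between \<open>\<partial>\<^sub>\<theta> A \<in> H\<^sup>-\<^sup>1\<^sup>/\<^sup>2\<close> and \<open>B \<in> H\<^sup>1\<^sup>/\<^sup>2\<close>, for the real inner product of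
  \<open>\<complex>\<close>: it extends \<open>\<integral> \<langle>\<partial>\<^sub>\<theta> A, B\<rangle> d\<theta>\<close> from smooth \<open>A\<close> by Parseval's formula.\<close>
definition dtheta_pairing :: "(complex \<Rightarrow> complex) \<Rightarrow> (complex \<Rightarrow> complex) \<Rightarrow> real" where
  "dtheta_pairing A B =
     2 * pi * (\<Sum>\<^sub>\<infinity>n. (\<i> * of_int n * fourier_coeff A n) \<bullet> fourier_coeff B n)"

text \<open>The distribution \<open>\<langle>\<partial>\<^sub>\<theta> G, \<i> G\<rangle>\<close> on the circle, applied to the test function \<open>\<phi>\<close>.\<close>
definition angular_current :: "(complex \<Rightarrow> complex) \<Rightarrow> (complex \<Rightarrow> real) \<Rightarrow> real" where
  "angular_current G \<phi> = dtheta_pairing G (\<lambda>z. \<phi> z *\<^sub>R (\<i> * G z))"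

definition H_half_degree :: "(complex \<Rightarrow> complex) \<Rightarrow> real" where
  "H_half_degree G = angular_current G (\<lambda>_. 1) / (2 * pi)"

definition annulus :: "real \<Rightarrow> complex set" where
  "annulus \<rho> = ball 0 1 - cball 0 \<rho>"

text \<open>The trace operator is the continuous extension to \<open>H\<^sup>1\<close> of the restriction to the circle
  of functions that are \<open>C\<^sup>1\<close> up to the boundary.\<close>
definition outer_trace :: "real \<Rightarrow> (complex \<Rightarrow> complex) \<Rightarrow> (complex \<Rightarrow> complex) \<Rightarrow> bool" where
  "outer_trace \<rho> W h \<longleftrightarrow>
     L2 (lebesgue_on (annulus \<rho>)) W \<and> L2 circle_measure (\<lambda>t. h (cis t)) \<and>
     (\<exists>p q (V :: nat \<Rightarrow> complex \<Rightarrow> complex).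
        weak_gradient (annulus \<rho>) W p q \<and>
        L2 (lebesgue_on (annulus \<rho>)) p \<and> L2 (lebesgue_on (annulus \<rho>)) q \<and>
        (\<forall>n. C1_on UNIV (V n)) \<and>
        (\<lambda>n. LINT z|lebesgue_on (annulus \<rho>).
           (norm (V n z - W z))\<^sup>2 + (norm (pd_x (V n) z - p z))\<^sup>2 + (norm (pd_y (V n) z - q z))\<^sup>2)
          \<longlonglongrightarrow> 0 \<and>
        (\<lambda>n. LINT t|circle_measure. (norm (V n (cis t) - h (cis t)))\<^sup>2) \<longlonglongrightarrow> 0)"

section \<open>Canonical harmonic maps\<close>

text \<open>\<open>\<Delta>\<Phi> = 2 \<pi> \<delta>\<^sub>0\<close> in the disc with Neumann datum \<open>\<langle>\<partial>\<^sub>\<theta> G, \<i> G\<rangle>\<close>, in the weak form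
  \<open>\<integral> \<nabla>\<Phi> \<bullet> \<nabla>\<phi> = \<langle>\<partial>\<^sub>r \<Phi>, \<phi>\<rangle> - 2 \<pi> \<phi>(0)\<close>, \<open>\<phi> \<in> C\<^sup>1\<close> up to the boundary. Since \<open>\<Delta> ln |z| = 2 \<pi> \<delta>\<^sub>0\<close>,
  solutions with a datum in \<open>H\<^sup>-\<^sup>1\<^sup>/\<^sup>2\<close> are those for which \<open>\<Phi> - ln |z|\<close> has finite energy; it is
  harmonic, so its smooth representative is taken.\<close>
definition neumann_solution :: "(complex \<Rightarrow> complex) \<Rightarrow> (complex \<Rightarrow> real) \<Rightarrow> bool" where
  "neumann_solution G \<Phi> \<longleftrightarrow>
     (\<exists>\<Psi>. C1_on (ball 0 1) \<Psi> \<and> H1 (ball 0 1) \<Psi> \<and>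
          (\<forall>z\<in>ball 0 1 - {0}. \<Phi> z = ln (norm z) + \<Psi> z)) \<and>
     (\<forall>\<phi>. C1_on UNIV \<phi> \<longrightarrow>
        (LINT z|lebesgue_on (ball 0 1). pd_x \<Phi> z * pd_x \<phi> z + pd_y \<Phi> z * pd_y \<phi> z)
          = angular_current G \<phi> - 2 * pi * \<phi> 0)"

text \<open>A 1-form \<open>p dx + q dy\<close> is represented by \<open>(p, q)\<close>; \<open>\<star>dx = dy\<close> and \<open>\<star>dy = - dx\<close>.\<close>
definition hodge_star :: "real \<times> real \<Rightarrow> real \<times> real" where
  "hodge_star \<alpha> = (- snd \<alpha>, fst \<alpha>)"

text \<open>As \<open>\<star>\<langle>dw, - \<i> w\<rangle> = d\<Phi>\<close> with \<open>\<Phi>\<close> smooth off \<open>a\<close>, every solution has a smooth representative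
  on \<open>\<Omega> - {a}\<close>; it is the map \<open>w\<close> considered here. This gives a meaning to its restriction to
  circles about \<open>a\<close>, whose degree is the winding number. The boundary datum \<open>g\<close> matters only on
  \<open>frontier \<Omega>\<close>, up to sets of length zero.\<close>
definition canonical_conditions ::
  "complex set \<Rightarrow> (complex \<Rightarrow> complex) \<Rightarrow> complex \<Rightarrow> (complex \<Rightarrow> complex) \<Rightarrow> bool" where
  "canonical_conditions \<Omega> g a w \<longleftrightarrow>
     C1_on (\<Omega> - {a}) w \<and> (\<forall>z\<in>\<Omega> - {a}. norm (w z) = 1) \<and>
     (\<forall>\<^sub>F \<rho> in at_right 0. H1 (\<Omega> - cball a \<rho>) w) \<and>
     (\<forall>\<^sub>F \<rho> in at_right 0. winding_number (w \<circ> circlepath a \<rho>) 0 = 1) \<and>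
     (\<exists>f \<Phi>. uniformization f \<Omega> \<and> f 0 = a \<and>
        H_half_S1 (g \<circ> f) \<and> H_half_degree (g \<circ> f) = 1 \<and>
        (\<forall>\<rho>\<in>{0<..<1}. outer_trace \<rho> (w \<circ> f) (g \<circ> f)) \<and>
        neumann_solution (g \<circ> f) \<Phi> \<and>
        (\<forall>z\<in>\<Omega> - {a}.
           hodge_star (pd_x w z \<bullet> (- \<i> * w z), pd_y w z \<bullet> (- \<i> * w z)) =
             (pd_x (\<Phi> \<circ> inv_into (ball 0 1) f) z, pd_y (\<Phi> \<circ> inv_into (ball 0 1) f) z)))"

text \<open>\<open>w\<close> is \<^emph>\<open>the unique\<close> map on \<open>\<Omega> - {a}\<close> subject to the conditions.\<close>
definition canonical_harmonic_map ::
  "complex set \<Rightarrow> (complex \<Rightarrow> complex) \<Rightarrow> complex \<Rightarrow> (complex \<Rightarrow> complex) \<Rightarrow> bool" where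
  "canonical_harmonic_map \<Omega> g a w \<longleftrightarrow> canonical_conditions \<Omega> g a w \<and>
     (\<forall>w'. canonical_conditions \<Omega> g a w' \<longrightarrow> (\<forall>z\<in>\<Omega> - {a}. w' z = w z))"

end

theory Submission imports Defs begin

text \<open>
  Write \<open>f' = exp L\<close>. For a Weil-Petersson curve \<open>L' = f''/f'\<close> is square integrable on the disc, for one
  and then for every uniformization, since two of them differ by a Moebius map. In the disc,
  \<open>f\<^sub>\<theta> = \<i> z f'\<close> and \<open>f\<^sub>r = z f' / \<bar>z\<bar>\<close>, so both maps are \<open>c exp(\<i> Im(log(z f')))\<close> with \<open>c = \<i>\<close> or
  \<open>c = 1\<close>, and their conjugate potential is \<open>\<Phi> = ln \<bar>z f'\<bar> = ln \<bar>z\<bar> + Re L\<close>.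

  A Dirichlet function has nontangential limits almost everywhere. This gives conical limits of \<open>f'\<close>, hence the
  direction of the outward normal at almost every boundary point; as \<open>f\<close> expands boundary distances
  where these limits are attained uniformly, exceptional sets of length zero pull back to null sets.
  The boundary pairings in \<open>H\<^sup>1\<^sup>/\<^sup>2\<close> are limits of pairings on the circles \<open>\<bar>z\<bar> = e\<^sup>s\<close>, \<open>s \<rightarrow> 0\<close>: the
  energy dominates \<open>\<bar>n\<bar> \<bar>c\<^sub>n(s)\<bar>\<^sup>2\<close> uniformly in \<open>s\<close> by a summable sequence. The Neumann problem
  then follows from Green's formula on annuli, and the degree by testing it with the constant \<open>1\<close>.

  For uniqueness, the difference of two Neumann solutions has finite energy and is orthogonal to its
  own dilations, hence is constant. A competitor thus has the same \<open>\<langle>dw, - \<i> w\<rangle>\<close>, so it is a constant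
  multiple of the canonical map, and the constant is \<open>1\<close> because the traces agree.
\<close>

section \<open>Planar Lebesgue measure\<close>

text \<open>The obstacle is the boundary. The logarithm \<open>L\<close> need not be bounded or
  continuous up to the circle, and nothing is assumed about measurability of \<open>\<nu>\<close>
  and \<open>\<tau>\<close>. The boundary datum is therefore reached only as an almost everywhere
  limit along the circles of radius \<open>exp (rsq k)\<close>, and every boundary statement is a
  limit of statements on these circles. The coordinate \<open>log z\<close> suits this: circles
  become vertical lines, Dirichlet energy is kept by conformal invariance, and the derivatives in
  \<open>s\<close> and \<open>t\<close> are \<open>rad\<close> and \<open>ang\<close>, on which
  Fourier series act. Dilations by \<open>exp (rsq k)\<close> provide the functions that are regular
  across the circle: the approximants defining a trace and the admissible test functions of the
  Neumann problem. Their convergence in L2 is \<open>dilation_L2\<close>. A second obstacle is that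
  \<open>canonical_conditions\<close> lets each competitor bring its own uniformization; the
  boundary analysis is therefore done for every uniformization sending 0 to \<open>a\<close>, and a
  rotation identifies the resulting maps on \<open>\<Omega>\<close>.\<close>

lemma sets_borel_lebesgue: "U \<in> sets borel \<Longrightarrow> U \<in> sets lebesgue"
  by (simp add: sets_completionI_sets)

text \<open>The differentiable change of variables formula used below lives on
  \<open>real^2\<close>; this real-linear identification and its inverse \<open>of_vec\<close> carry
  it to \<open>complex\<close>.\<close>

definition to_vec :: "complex \<Rightarrow> real^2" where
  "to_vec z = (\<chi> i. if i = 1 then Re z else Im z)"

definition of_vec :: "real^2 \<Rightarrow> complex" where
  "of_vec x = Complex (x $ 1) (x $ 2)"

lemma of_to_vec [simp]: "of_vec (to_vec z) = z"
  by (simp add: of_vec_def to_vec_def)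

lemma to_of_vec [simp]: "to_vec (of_vec x) = x"
  by (simp add: of_vec_def to_vec_def vec_eq_iff forall_2)

lemma to_vec_nth [simp]: "to_vec z $ 1 = Re z" "to_vec z $ 2 = Im z"
  by (simp_all add: to_vec_def)

lemma Re_of_vec [simp]: "Re (of_vec x) = x $ 1" and Im_of_vec [simp]: "Im (of_vec x) = x $ 2"
  by (simp_all add: of_vec_def)

lemma bounded_linear_to_vec: "bounded_linear to_vec"
  by (intro linear_conv_bounded_linear[THEN iffD1] linearI) (auto simp: to_vec_def vec_eq_iff)

lemma bounded_linear_of_vec: "bounded_linear of_vec"
  by (intro linear_conv_bounded_linear[THEN iffD1] linearI) (auto simp: of_vec_def complex_eq_iff)

lemma continuous_to_vec: "continuous_on S to_vec"
  using bounded_linear_to_vec by (rule linear_continuous_on)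

lemma continuous_of_vec: "continuous_on S of_vec"
  using bounded_linear_of_vec by (rule linear_continuous_on)

lemma measurable_to_vec [measurable]: "to_vec \<in> borel_measurable borel"
  by (intro borel_measurable_continuous_onI continuous_to_vec)

lemma measurable_of_vec [measurable]: "of_vec \<in> borel_measurable borel"
  by (intro borel_measurable_continuous_onI continuous_of_vec)

text \<open>Lebesgue measure is characterized by its values on boxes, and \<open>to_vec\<close> maps
  boxes to boxes with the same side lengths.\<close>

lemma lborel_eq_distr_to_vec: "(lborel :: (real^2) measure) = distr lborel borel to_vec"
proof (rule lborel_eqI)
  fix l u :: "real^2"
  assume lu: "\<And>b. b \<in> Basis \<Longrightarrow> l \<bullet> b \<le> u \<bullet> b"
  have l1: "l $ i \<le> u $ i" for i
    using lu[of "axis i 1"] by (simp add: axis_in_Basis_iff inner_axis)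
  have eq: "to_vec -` box l u = box (of_vec l) (of_vec u)"
    by (auto simp: mem_box_cart in_box_complex_iff forall_2)
  have "inj (\<lambda>i::2. axis i (1::real))" by (auto simp: inj_def axis_eq_axis)
  have B: "(Basis :: (real^2) set) = (\<lambda>i. axis i 1) ` UNIV"
    by (auto simp: Basis_vec_def)
  have P: "(\<Prod>b\<in>Basis. (u - l) \<bullet> b) = (u$1 - l$1) * (u$2 - l$2)"
    unfolding B by (subst prod.reindex[OF \<open>inj _\<close>]) (simp add: UNIV_2 inner_axis)
  have "emeasure (distr lborel borel to_vec) (box l u) = emeasure lborel (box (of_vec l) (of_vec u))"
    by (subst emeasure_distr) (simp_all add: eq)
  also have "\<dots> = (\<Prod>b\<in>Basis. (of_vec u - of_vec l) \<bullet> b)"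
    by (rule emeasure_lborel_box) (use l1 in \<open>auto simp: Basis_complex_def\<close>)
  also have "\<dots> = (\<Prod>b\<in>Basis. (u - l) \<bullet> b)"
    by (simp add: P Basis_complex_def)
  finally show "emeasure (distr lborel borel to_vec) (box l u) = ennreal (\<Prod>b\<in>Basis. (u - l) \<bullet> b)" .
qed simp

lemma measurable_Complex_pair [measurable]: "(\<lambda>p. Complex (fst p) (snd p)) \<in> borel_measurable (lborel \<Otimes>\<^sub>M lborel)"
proof -
  have "(\<lambda>p. Complex (fst p) (snd p)) = (\<lambda>p. of_real (fst p) + \<i> * of_real (snd p))"
    by (auto simp: fun_eq_iff complex_eq_iff)
  also have "\<dots> \<in> borel_measurable (lborel \<Otimes>\<^sub>M lborel)" by measurable
  finally show ?thesis .
qed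

text \<open>The product form makes Fubini available in the coordinates \<open>Re\<close> and
  \<open>Im\<close>; again it suffices to compare boxes.\<close>

lemma lborel_complex_eq: "(lborel :: complex measure) = distr (lborel \<Otimes>\<^sub>M lborel) borel (\<lambda>p. Complex (fst p) (snd p))"
proof (rule lborel_eqI)
  fix l u :: complex
  assume lu: "\<And>b. b \<in> Basis \<Longrightarrow> l \<bullet> b \<le> u \<bullet> b"
  have l1: "Re l \<le> Re u" "Im l \<le> Im u" using lu[of 1] lu[of \<i>] by (auto simp: Basis_complex_def)
  have eq: "(\<lambda>p. Complex (fst p) (snd p)) -` box l u = {Re l<..<Re u} \<times> {Im l<..<Im u}"
    by (auto simp: in_box_complex_iff)
  have "emeasure (distr (lborel \<Otimes>\<^sub>M lborel) borel (\<lambda>p. Complex (fst p) (snd p))) (box l u)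
     = emeasure (lborel \<Otimes>\<^sub>M lborel) ({Re l<..<Re u} \<times> {Im l<..<Im u})"
    by (subst emeasure_distr) (simp_all add: eq space_pair_measure)
  also have "\<dots> = ennreal (\<Prod>b\<in>Basis. (u - l) \<bullet> b)"
    by (subst lborel.emeasure_pair_measure_Times) (use l1 in \<open>auto simp: Basis_complex_def ennreal_mult\<close>)
  finally show "emeasure (distr (lborel \<Otimes>\<^sub>M lborel) borel (\<lambda>p. Complex (fst p) (snd p))) (box l u)
    = ennreal (\<Prod>b\<in>Basis. (u - l) \<bullet> b)" .
qed simp

lemma nn_integral_lborel_complex:
  assumes [measurable]: "F \<in> borel_measurable borel"
  shows "(\<integral>\<^sup>+z. F z \<partial>(lborel :: complex measure)) = (\<integral>\<^sup>+x. \<integral>\<^sup>+y. F (Complex x y) \<partial>lborel \<partial>lborel)"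
  unfolding lborel_complex_eq
  by (subst nn_integral_distr) (simp_all add: lborel.nn_integral_fst[symmetric])

lemma integral_lborel_complex:
  fixes F :: "complex \<Rightarrow> 'b::{banach,second_countable_topology}"
  assumes "integrable lborel F"
  shows "(LINT z|lborel. F z) = (LINT x|lborel. LINT y|lborel. F (Complex x y))"
    and "integrable lborel (\<lambda>x. LINT y|lborel. F (Complex x y))"
    and "AE x in lborel. integrable lborel (\<lambda>y. F (Complex x y))"
proof -
  have [measurable]: "F \<in> borel_measurable borel" using assms by auto
  have i: "integrable (lborel \<Otimes>\<^sub>M lborel) (\<lambda>p. F (Complex (fst p) (snd p)))"
    using assms unfolding lborel_complex_eq by (subst (asm) integrable_distr_eq) auto
  then have i': "integrable (lborel \<Otimes>\<^sub>M lborel) (\<lambda>(x, y). F (Complex x y))"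
    by (simp add: case_prod_beta')
  have "(LINT z|lborel. F z) = (LINT p|(lborel \<Otimes>\<^sub>M lborel). F (Complex (fst p) (snd p)))"
    unfolding lborel_complex_eq by (subst integral_distr) auto
  also have "\<dots> = (LINT x|lborel. LINT y|lborel. F (Complex x y))"
    using lborel_pair.integral_fst'[OF i] by simp
  finally show "(LINT z|lborel. F z) = (LINT x|lborel. LINT y|lborel. F (Complex x y))" .
  show "integrable lborel (\<lambda>x. LINT y|lborel. F (Complex x y))"
    using lborel_pair.integrable_fst'[OF i] by simp
  show "AE x in lborel. integrable lborel (\<lambda>y. F (Complex x y))"
    using lborel_pair.AE_integrable_fst'[OF i] by simp
qed

lemma integral_lborel_complex':
  fixes F :: "complex \<Rightarrow> 'b::{banach,second_countable_topology}"
  assumes "integrable lborel F"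
  shows "(LINT z|lborel. F z) = (LINT y|lborel. LINT x|lborel. F (Complex x y))"
proof -
  have [measurable]: "F \<in> borel_measurable borel" using assms by auto
  have i: "integrable (lborel \<Otimes>\<^sub>M lborel) (\<lambda>(x, y). F (Complex x y))"
    using assms unfolding lborel_complex_eq by (subst (asm) integrable_distr_eq) (auto simp: case_prod_beta')
  show ?thesis
    using lborel_pair.integral_snd[OF i] integral_lborel_complex(1)[OF assms]
      lborel_pair.integral_fst'[OF i] by simp
qed

text \<open>By the Cauchy-Riemann equations the real derivative of \<open>g\<close> is
  multiplication by \<open>deriv g z\<close>, a matrix whose determinant is the squared modulus. The
  measure of the image may be infinite, hence the two cases.\<close>

lemma emeasure_holomorphic_image:
  assumes S: "open S" "g holomorphic_on S" "inj_on g S"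
    and T: "T \<in> sets borel" "T \<subseteq> S" "g ` T \<in> sets borel"
  shows "emeasure lborel (g ` T) = (\<integral>\<^sup>+z. ennreal ((norm (deriv g z))\<^sup>2) * indicator T z \<partial>lborel)"
proof -
  define f where "f = to_vec \<circ> g \<circ> of_vec"
  define f' where "f' x = to_vec \<circ> (*) (deriv g (of_vec x)) \<circ> of_vec" for x
  define T' where "T' = of_vec -` T"
  have T'[measurable]: "T' \<in> sets borel"
    unfolding T'_def using measurable_sets[OF measurable_of_vec T(1)] by simp
  have fT: "f ` T' = of_vec -` (g ` T)"
  proof -
    have "of_vec -` (g ` T) = to_vec ` g ` T"
      by (auto simp: image_iff) (metis to_of_vec)+
    moreover have "T' = to_vec ` T" unfolding T'_def
      by auto (metis imageI to_of_vec)
    ultimately show ?thesis by (auto simp: f_def image_image)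
  qed
  have mfT[measurable]: "f ` T' \<in> sets borel"
    unfolding fT using measurable_sets[OF measurable_of_vec T(3)] by simp
  have em: "emeasure lborel A = emeasure lborel (of_vec -` A)" if "A \<in> sets borel" for A
  proof -
    have "emeasure lborel (of_vec -` A) = emeasure lborel (to_vec -` (of_vec -` A) \<inter> space lborel)"
      unfolding lborel_eq_distr_to_vec
      by (rule emeasure_distr) (use measurable_sets[OF measurable_of_vec that] in auto)
    then show ?thesis by (simp add: vimage_def)
  qed
  have dm: "borel_measurable borel = borel_measurable lborel" for M :: "'z measure" by simp
  have cd: "continuous_on S (deriv g)"
    using S by (intro holomorphic_on_imp_continuous_on holomorphic_deriv)
  have md: "(\<lambda>z. norm (deriv g z) ^ 2 * indicat_real T z) \<in> borel_measurable borel"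
  proof -
    have "(\<lambda>z. indicat_real S z *\<^sub>R (norm (deriv g z) ^ 2)) \<in> borel_measurable borel"
      by (rule borel_measurable_continuous_on_indicator)
        (use S cd in \<open>auto intro!: continuous_intros\<close>)
    then have "(\<lambda>z. indicat_real T z * (indicat_real S z *\<^sub>R (norm (deriv g z) ^ 2))) \<in> borel_measurable borel"
      using T by (intro borel_measurable_times) auto
    also have "(\<lambda>z. indicat_real T z * (indicat_real S z *\<^sub>R (norm (deriv g z) ^ 2))) = (\<lambda>z. norm (deriv g z) ^ 2 * indicat_real T z)"
      using T(2) by (auto simp: indicator_def fun_eq_iff)
    finally show ?thesis .
  qed
  have det: "\<bar>det (matrix (f' x))\<bar> = norm (deriv g (of_vec x)) ^ 2" for x
  proof -
    have "det (matrix (f' x)) = Re (deriv g (of_vec x)) ^ 2 + Im (deriv g (of_vec x)) ^ 2"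
      by (simp add: det_2 matrix_def f'_def axis_def power2_eq_square)
    then show ?thesis by (simp add: cmod_power2)
  qed
  have der: "(f has_derivative f' x) (at x within T')" if "x \<in> T'" for x
  proof -
    have "of_vec x \<in> S" using that T by (auto simp: T'_def)
    then have "(g has_field_derivative deriv g (of_vec x)) (at (of_vec x))"
      using S holomorphic_derivI by blast
    then have "(g has_derivative (*) (deriv g (of_vec x))) (at (of_vec x))"
      by (simp add: has_field_derivative_def)
    then have "(f has_derivative f' x) (at x)"
      unfolding f_def f'_def
      by (intro diff_chain_at bounded_linear.has_derivative[OF bounded_linear_to_vec, of id, simplified comp_def id_def]
         bounded_linear_imp_has_derivative bounded_linear_to_vec bounded_linear_of_vec) (auto simp: o_def)
    then show ?thesis by (rule has_derivative_at_withinI)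
  qed
  have inj: "inj_on f T'"
    using S(3) T(2) unfolding f_def T'_def inj_on_def
    by (metis comp_apply of_to_vec subsetD to_of_vec vimageE)
  have leb: "emeasure lebesgue (f ` T') = emeasure lborel (f ` T')"
    using mfT by (intro emeasure_completion[THEN trans]) (simp_all add: sets_completionI_sets main_part_sets)
  have cov: "f ` T' \<in> lmeasurable \<and> measure lebesgue (f ` T') = m
     \<longleftrightarrow> ((\<lambda>x. norm (deriv g (of_vec x)) ^ 2) has_integral m) T'" for m
    using has_measure_differentiable_image[of T' f f' m] der inj det sets_borel_lebesgue[OF T'] by simp
  have "emeasure lborel (g ` T) = emeasure lborel (f ` T')"
    using em[OF T(3)] fT by simp
  also have "\<dots> = (\<integral>\<^sup>+x. ennreal (norm (deriv g (of_vec x)) ^ 2 * indicat_real T (of_vec x)) \<partial>lborel)"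
    (is "_ = ?N")
  proof (cases "f ` T' \<in> lmeasurable")
    case True
    let ?m = "measure lebesgue (f ` T')"
    have "((\<lambda>x. norm (deriv g (of_vec x)) ^ 2) has_integral ?m) T'" using cov True by blast
    then have "((\<lambda>x. norm (deriv g (of_vec x)) ^ 2 * indicat_real T (of_vec x)) has_integral ?m) UNIV"
      by (subst (asm) has_integral_restrict_UNIV[symmetric])
        (auto elim!: has_integral_eq[rotated] simp: T'_def indicator_def)
    then have "?N = ennreal ?m"
      by (intro nn_integral_has_integral_lborel) (auto intro!: measurable_compose[OF measurable_of_vec md])
    moreover have "emeasure lborel (f ` T') = ennreal ?m"
      unfolding leb[symmetric] using emeasure_eq_measure2[OF True] .
    ultimately show ?thesis by simp
  next
    \<comment> \<open>The change of variables theorem speaks of finite measure only, but it is an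
      equivalence: a finite integral would force the image to have finite measure.\<close>
    case False
    then have "emeasure lborel (f ` T') = \<infinity>"
      unfolding leb[symmetric] using sets_borel_lebesgue[OF mfT] unfolding fmeasurable_def
      by (simp add: less_top[symmetric])
    moreover have "?N = \<infinity>"
    proof (rule ccontr)
      assume "?N \<noteq> \<infinity>"
      then obtain r where "?N = ennreal r" "r \<ge> 0" by (cases ?N) auto
      then have "((\<lambda>x. norm (deriv g (of_vec x)) ^ 2 * indicat_real T (of_vec x)) has_integral r) UNIV"
        by (intro nn_integral_has_integral) (auto intro!: measurable_compose[OF measurable_of_vec md])
      then have "((\<lambda>x. norm (deriv g (of_vec x)) ^ 2) has_integral r) T'"
        by (subst has_integral_restrict_UNIV[symmetric])
        (auto elim!: has_integral_eq[rotated] simp: T'_def indicator_def)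
      then show False using cov False by blast
    qed
    ultimately show ?thesis by simp
  qed
  also have "\<dots> = (\<integral>\<^sup>+z. ennreal ((norm (deriv g z))\<^sup>2 * indicat_real T z) \<partial>lborel)"
    unfolding lborel_eq_distr_to_vec
    by (subst nn_integral_distr) (auto intro!: measurable_compose[OF _ measurable_ennreal] measurable_compose[OF measurable_of_vec md])
  finally show ?thesis by (simp add: ennreal_mult' ennreal_indicator)
qed


lemma open_holomorphic_image:
  assumes S: "open S" "g holomorphic_on S" "inj_on g S"
  shows "open (g ` S)"
  by (rule invariance_of_domain) (use S holomorphic_on_imp_continuous_on in auto)

text \<open>An equality of measures serves all integrands at once. Extending \<open>g\<close> by 0
  makes the map Borel on the whole plane, and the density vanishes where that extension is
  used.\<close>

lemma density_holomorphic_image: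
  assumes S: "open S" "g holomorphic_on S" "inj_on g S"
  shows "density lborel (indicator (g ` S))
    = distr (density lborel (\<lambda>z. ennreal ((norm (deriv g z))\<^sup>2) * indicator S z)) borel (\<lambda>z. indicator S z *\<^sub>R g z)"
    (is "?L = distr ?D borel ?g")
proof (rule measure_eqI)
  have [measurable]: "S \<in> sets borel" "g ` S \<in> sets borel"
    using S open_holomorphic_image[OF S] by auto
  have cd: "continuous_on S (deriv g)"
    using S by (intro holomorphic_on_imp_continuous_on holomorphic_deriv)
  have "(\<lambda>z. indicat_real S z *\<^sub>R (norm (deriv g z) ^ 2)) \<in> borel_measurable borel"
    by (rule borel_measurable_continuous_on_indicator) (use S cd in \<open>auto intro!: continuous_intros\<close>)
  then have "(\<lambda>z. ennreal (indicat_real S z *\<^sub>R (norm (deriv g z) ^ 2))) \<in> borel_measurable borel"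
    by measurable
  also have "(\<lambda>z. ennreal (indicat_real S z *\<^sub>R (norm (deriv g z) ^ 2))) = (\<lambda>z. ennreal ((norm (deriv g z))\<^sup>2) * indicator S z)"
    by (auto simp: indicator_def)
  finally have md [measurable]: "(\<lambda>z. ennreal ((norm (deriv g z))\<^sup>2) * indicator S z) \<in> borel_measurable borel" .
  have mg [measurable]: "?g \<in> borel_measurable borel"
    by (rule borel_measurable_continuous_on_indicator) (use S holomorphic_on_imp_continuous_on in auto)
  fix A assume "A \<in> sets ?L"
  then have [measurable]: "A \<in> sets borel" by simp
  define T where "T = S \<inter> (?g -` A)"
  have [measurable]: "?g -` A \<in> sets borel" using measurable_sets[OF mg, of A] by simp
  have T: "T \<in> sets borel" "T \<subseteq> S" by (auto simp: T_def)
  have gT: "g ` T = g ` S \<inter> A" by (auto simp: T_def)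
  have "emeasure ?L A = emeasure lborel (g ` T)"
    by (subst emeasure_density) (auto simp: gT indicator_inter_arith[symmetric])
  also have "\<dots> = (\<integral>\<^sup>+z. ennreal ((norm (deriv g z))\<^sup>2) * indicator T z \<partial>lborel)"
    by (rule emeasure_holomorphic_image[OF S T]) (simp add: gT)
  also have "\<dots> = (\<integral>\<^sup>+z. (ennreal ((norm (deriv g z))\<^sup>2) * indicator S z) * indicator (?g -` A) z \<partial>lborel)"
    by (intro nn_integral_cong) (auto simp: T_def indicator_def)
  also have "\<dots> = emeasure ?D (?g -` A)" by (subst emeasure_density) auto
  also have "\<dots> = emeasure (distr ?D borel ?g) A"
    by (subst emeasure_distr) auto
  finally show "emeasure ?L A = emeasure (distr ?D borel ?g) A" .
qed auto

lemma measurable_deriv_sq: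
  assumes S: "open S" "g holomorphic_on S"
  shows "(\<lambda>z. ennreal ((norm (deriv g z))\<^sup>2) * indicator S z) \<in> borel_measurable borel"
proof -
  have cd: "continuous_on S (deriv g)"
    using S by (intro holomorphic_on_imp_continuous_on holomorphic_deriv)
  have "(\<lambda>z. indicat_real S z *\<^sub>R (norm (deriv g z) ^ 2)) \<in> borel_measurable borel"
    by (rule borel_measurable_continuous_on_indicator) (use S cd in \<open>auto intro!: continuous_intros\<close>)
  then have "(\<lambda>z. ennreal (indicat_real S z *\<^sub>R (norm (deriv g z) ^ 2))) \<in> borel_measurable borel"
    by measurable
  also have "(\<lambda>z. ennreal (indicat_real S z *\<^sub>R (norm (deriv g z) ^ 2))) = (\<lambda>z. ennreal ((norm (deriv g z))\<^sup>2) * indicator S z)"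
    by (auto simp: indicator_def)
  finally show ?thesis .
qed

lemma nn_integral_holomorphic_image:
  assumes S: "open S" "g holomorphic_on S" "inj_on g S"
    and [measurable]: "F \<in> borel_measurable borel"
  shows "(\<integral>\<^sup>+z. F z * indicator (g ` S) z \<partial>lborel)
    = (\<integral>\<^sup>+z. ennreal ((norm (deriv g z))\<^sup>2) * F (g z) * indicator S z \<partial>lborel)"
proof -
  have [measurable]: "S \<in> sets borel" "g ` S \<in> sets borel"
    using S open_holomorphic_image[OF S] by auto
  note [measurable] = measurable_deriv_sq[OF S(1,2)]
  have mg [measurable]: "(\<lambda>z. indicator S z *\<^sub>R g z) \<in> borel_measurable borel"
    by (rule borel_measurable_continuous_on_indicator) (use S holomorphic_on_imp_continuous_on in auto)
  have "(\<integral>\<^sup>+z. F z * indicator (g ` S) z \<partial>lborel) = (\<integral>\<^sup>+z. F z \<partial>density lborel (indicator (g ` S)))"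
    by (subst nn_integral_density) (auto simp: mult.commute)
  also have "\<dots> = (\<integral>\<^sup>+z. F (indicator S z *\<^sub>R g z) \<partial>density lborel (\<lambda>z. ennreal ((norm (deriv g z))\<^sup>2) * indicator S z))"
    unfolding density_holomorphic_image[OF S] by (subst nn_integral_distr) auto
  also have "\<dots> = (\<integral>\<^sup>+z. ennreal ((norm (deriv g z))\<^sup>2) * indicator S z * F (indicator S z *\<^sub>R g z) \<partial>lborel)"
    by (subst nn_integral_density) auto
  also have "\<dots> = (\<integral>\<^sup>+z. ennreal ((norm (deriv g z))\<^sup>2) * F (g z) * indicator S z \<partial>lborel)"
    by (intro nn_integral_cong) (auto simp: indicator_def)
  finally show ?thesis .
qed

lemma set_integral_holomorphic_image:
  fixes F :: "complex \<Rightarrow> 'b::{banach,second_countable_topology}"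
  assumes S: "open S" "g holomorphic_on S" "inj_on g S"
    and F: "set_borel_measurable borel (g ` S) F"
  shows "set_integrable lborel (g ` S) F \<longleftrightarrow> set_integrable lborel S (\<lambda>z. (norm (deriv g z))\<^sup>2 *\<^sub>R F (g z))" (is ?I)
    and "set_lebesgue_integral lborel (g ` S) F = set_lebesgue_integral lborel S (\<lambda>z. (norm (deriv g z))\<^sup>2 *\<^sub>R F (g z))" (is ?E)
proof -
  define F' where "F' z = indicator (g ` S) z *\<^sub>R F z" for z
  have [measurable]: "F' \<in> borel_measurable borel"
    using F by (simp add: F'_def[abs_def] set_borel_measurable_def)
  have [measurable]: "S \<in> sets borel" "g ` S \<in> sets borel"
    using S open_holomorphic_image[OF S] by auto
  note [measurable] = measurable_deriv_sq[OF S(1,2)]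
  have mg [measurable]: "(\<lambda>z. indicator S z *\<^sub>R g z) \<in> borel_measurable borel"
    by (rule borel_measurable_continuous_on_indicator) (use S holomorphic_on_imp_continuous_on in auto)
  define w where "w z = (norm (deriv g z))\<^sup>2 * indicat_real S z" for z
  have "w = (\<lambda>z. enn2real (ennreal ((norm (deriv g z))\<^sup>2) * indicator S z))"
    by (auto simp: w_def indicator_def fun_eq_iff)
  then have [measurable]: "w \<in> borel_measurable borel" by simp
  have w: "ennreal ((norm (deriv g z))\<^sup>2) * indicator S z = ennreal (w z)" for z
    by (auto simp: w_def indicator_def)
  have eq: "(\<lambda>z. w z *\<^sub>R F' (indicator S z *\<^sub>R g z)) = (\<lambda>z. indicator S z *\<^sub>R ((norm (deriv g z))\<^sup>2 *\<^sub>R F (g z)))"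
    by (auto simp: w_def F'_def indicator_def fun_eq_iff)
  have F'_ind: "indicat_real (g ` S) z *\<^sub>R F' z = F' z" for z by (auto simp: F'_def indicator_def)
  have eq2: "integrable lborel F' \<longleftrightarrow> integrable (density lborel (\<lambda>z. ennreal (indicat_real (g ` S) z))) F'"
    by (subst integrable_density) (auto simp: F'_ind)
  have D: "density lborel (\<lambda>z. ennreal (indicat_real (g ` S) z))
    = distr (density lborel (\<lambda>z. ennreal (w z))) borel (\<lambda>z. indicator S z *\<^sub>R g z)"
    using density_holomorphic_image[OF S] by (simp add: w ennreal_indicator)
  have "set_integrable lborel (g ` S) F \<longleftrightarrow> integrable lborel F'"
    by (simp add: set_integrable_def F'_def[abs_def])
  also have "\<dots> \<longleftrightarrow> integrable (density lborel (\<lambda>z. ennreal (w z))) (\<lambda>z. F' (indicator S z *\<^sub>R g z))"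
    unfolding eq2 D by (subst integrable_distr_eq) auto
  also have "\<dots> \<longleftrightarrow> integrable lborel (\<lambda>z. w z *\<^sub>R F' (indicator S z *\<^sub>R g z))"
    by (subst integrable_density) (auto simp: w_def)
  finally show ?I unfolding eq by (simp add: set_integrable_def)
  have "set_lebesgue_integral lborel (g ` S) F = (LINT z|density lborel (\<lambda>z. ennreal (indicat_real (g ` S) z)). F' z)"
    by (subst integral_density) (simp_all add: F'_ind, simp add: set_lebesgue_integral_def F'_def[abs_def])
  also have "\<dots> = (LINT z|density lborel (\<lambda>z. ennreal (w z)). F' (indicator S z *\<^sub>R g z))"
    unfolding D by (subst integral_distr) auto
  also have "\<dots> = (LINT z|lborel. w z *\<^sub>R F' (indicator S z *\<^sub>R g z))"
    by (subst integral_density) (auto simp: w_def)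
  finally show ?E unfolding eq by (simp add: set_lebesgue_integral_def)
qed

text \<open>The definitions integrate over \<open>lebesgue_on U\<close>, while Fubini and the change
  of variables are carried out over \<open>lborel\<close>; for Borel integrands the two
  agree.\<close>

lemma lebesgue_on_iff_lborel:
  fixes F :: "'a::euclidean_space \<Rightarrow> 'b::{banach,second_countable_topology}"
  assumes U: "U \<in> sets borel" and F: "set_borel_measurable borel U F"
  shows "integrable (lebesgue_on U) F \<longleftrightarrow> set_integrable lborel U F"
    and "(LINT z|lebesgue_on U. F z) = set_lebesgue_integral lborel U F"
    and "F \<in> borel_measurable (lebesgue_on U)"
proof -
  have F': "(\<lambda>x. indicat_real U x *\<^sub>R F x) \<in> borel_measurable lborel"
    using F by (simp add: set_borel_measurable_def)
  have U': "U \<inter> space lebesgue \<in> sets lebesgue" using sets_borel_lebesgue[OF U] by simp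
  show "integrable (lebesgue_on U) F \<longleftrightarrow> set_integrable lborel U F"
    using integrable_restrict_space[OF U', of F] integrable_completion[OF F']
    by (simp add: set_integrable_def)
  show "(LINT z|lebesgue_on U. F z) = set_lebesgue_integral lborel U F"
    using integral_restrict_space[OF U', of F] integral_completion[OF F']
    by (simp add: set_lebesgue_integral_def)
  show "F \<in> borel_measurable (lebesgue_on U)"
    using borel_measurable_restrict_space_iff[OF U', of F] measurable_completion[OF F'] by simp
qed

lemma set_borel_measurable_continuous_open:
  fixes F :: "'a::euclidean_space \<Rightarrow> 'b::{real_normed_vector,second_countable_topology}"
  assumes "continuous_on U F" "U \<in> sets borel"
  shows "set_borel_measurable borel U F"
  using assms unfolding set_borel_measurable_def
  by (intro borel_measurable_continuous_on_indicator) auto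

section \<open>Gradients\<close>

text \<open>\<open>pd_x\<close> and \<open>pd_y\<close> carry information only at points of
  differentiability. Recording differentiability together with the two values lets product and chain
  rules be composed, and \<open>has_grad_pd\<close> reads off the partial derivatives at the
  end.\<close>

definition has_grad :: "(complex \<Rightarrow> 'b::real_normed_vector) \<Rightarrow> 'b \<Rightarrow> 'b \<Rightarrow> complex \<Rightarrow> bool" where
  "has_grad h A B z \<longleftrightarrow> (h has_derivative (\<lambda>v. Re v *\<^sub>R A + Im v *\<^sub>R B)) (at z)"

lemma has_grad_pd:
  assumes "has_grad h A B z"
  shows "pd_x h z = A" "pd_y h z = B" "h differentiable (at z)"
proof -
  have "(h has_derivative (\<lambda>v. Re v *\<^sub>R A + Im v *\<^sub>R B)) (at z)" using assms by (simp add: has_grad_def)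
  then have "frechet_derivative h (at z) = (\<lambda>v. Re v *\<^sub>R A + Im v *\<^sub>R B)"
    by (simp add: frechet_derivative_at[symmetric])
  then show "pd_x h z = A" "pd_y h z = B" by (simp_all add: pd_x_def pd_y_def)
  show "h differentiable (at z)" using assms by (auto simp: has_grad_def differentiable_def)
qed

lemma differentiable_has_grad:
  assumes "h differentiable (at z)"
  shows "has_grad h (pd_x h z) (pd_y h z) z"
proof -
  have d: "(h has_derivative frechet_derivative h (at z)) (at z)"
    using assms frechet_derivative_works by blast
  interpret linear "frechet_derivative h (at z)" using d by (rule has_derivative_linear)
  have "frechet_derivative h (at z) v = Re v *\<^sub>R pd_x h z + Im v *\<^sub>R pd_y h z" for v
  proof -
    have "v = Re v *\<^sub>R 1 + Im v *\<^sub>R \<i>" by (simp add: complex_eq_iff)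
    then have "frechet_derivative h (at z) v = frechet_derivative h (at z) (Re v *\<^sub>R 1 + Im v *\<^sub>R \<i>)" by simp
    then show ?thesis by (simp add: add scaleR pd_x_def pd_y_def)
  qed
  then have "frechet_derivative h (at z) = (\<lambda>v. Re v *\<^sub>R pd_x h z + Im v *\<^sub>R pd_y h z)" by blast
  with d show ?thesis by (simp add: has_grad_def)
qed

lemma C1_onI:
  assumes "\<And>z. z \<in> U \<Longrightarrow> has_grad h (A z) (B z) z" "continuous_on U A" "continuous_on U B"
  shows "C1_on U h"
proof -
  have "\<forall>z\<in>U. A z = pd_x h z" "\<forall>z\<in>U. B z = pd_y h z" using assms(1) has_grad_pd by metis+
  then show ?thesis unfolding C1_on_def using assms has_grad_pd(3) by (metis continuous_on_cong)
qed

lemma C1_onD: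
  assumes "C1_on U h"
  shows "z \<in> U \<Longrightarrow> has_grad h (pd_x h z) (pd_y h z) z" "continuous_on U (pd_x h)" "continuous_on U (pd_y h)"
    "continuous_on U h"
proof -
  show "z \<in> U \<Longrightarrow> has_grad h (pd_x h z) (pd_y h z) z"
    using assms differentiable_has_grad by (auto simp: C1_on_def)
  show "continuous_on U (pd_x h)" "continuous_on U (pd_y h)" using assms by (auto simp: C1_on_def)
  show "continuous_on U h" using assms unfolding C1_on_def
    by (metis continuous_at_imp_continuous_on differentiable_imp_continuous_within)
qed

lemma C1_on_subset:
  assumes "C1_on U h" "V \<subseteq> U" shows "C1_on V h"
  using C1_onD(1)[OF assms(1)] continuous_on_subset[OF C1_onD(2)[OF assms(1)] assms(2)]
    continuous_on_subset[OF C1_onD(3)[OF assms(1)] assms(2)] assms by (auto simp: C1_on_def)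

lemma has_grad_cong:
  assumes "open U" "z \<in> U" "\<And>w. w \<in> U \<Longrightarrow> h w = g w"
  shows "has_grad h A B z \<longleftrightarrow> has_grad g A B z"
  unfolding has_grad_def
proof
  assume "(h has_derivative (\<lambda>v. Re v *\<^sub>R A + Im v *\<^sub>R B)) (at z)"
  then show "(g has_derivative (\<lambda>v. Re v *\<^sub>R A + Im v *\<^sub>R B)) (at z)"
    by (rule has_derivative_transform_within_open) (use assms in auto)
next
  assume "(g has_derivative (\<lambda>v. Re v *\<^sub>R A + Im v *\<^sub>R B)) (at z)"
  then show "(h has_derivative (\<lambda>v. Re v *\<^sub>R A + Im v *\<^sub>R B)) (at z)"
    by (rule has_derivative_transform_within_open) (use assms in auto)
qed

lemma C1_on_cong:
  assumes "open U" "\<And>w. w \<in> U \<Longrightarrow> h w = g w" "C1_on U h"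
  shows "C1_on U g"
proof (rule C1_onI)
  show "has_grad g (pd_x h z) (pd_y h z) z" if "z \<in> U" for z
    using C1_onD(1)[OF assms(3) that] has_grad_cong[OF assms(1) that assms(2)] by simp
qed (use C1_onD[OF assms(3)] in auto)

lemma C1_on_Un:
  assumes "open U" "open V" "C1_on U h" "C1_on V h"
  shows "C1_on (U \<union> V) h"
proof -
  have "\<forall>z\<in>U \<union> V. h differentiable (at z)" using assms(3,4) by (auto simp: C1_on_def)
  moreover have "continuous_on (U \<union> V) (pd_x h)" "continuous_on (U \<union> V) (pd_y h)"
    using continuous_on_open_Un[OF assms(1,2)] assms(3,4) unfolding C1_on_def by blast+
  ultimately show ?thesis unfolding C1_on_def by blast
qed

lemma has_grad_holomorphic:
  assumes "(f has_field_derivative d) (at z)"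
  shows "has_grad f d (\<i> * d) z"
proof -
  have "(\<lambda>v. Re v *\<^sub>R d + Im v *\<^sub>R (\<i> * d)) = (*) d"
    by (auto simp: fun_eq_iff complex_eq_iff algebra_simps)
  then show ?thesis using assms by (simp add: has_grad_def has_field_derivative_def)
qed

lemma has_grad_linear:
  assumes "bounded_linear T" "has_grad h A B z"
  shows "has_grad (\<lambda>z. T (h z)) (T A) (T B) z"
proof -
  interpret bounded_linear T by fact
  have "((\<lambda>z. T (h z)) has_derivative (\<lambda>v. T (Re v *\<^sub>R A + Im v *\<^sub>R B))) (at z)"
    using has_derivative[OF assms(2)[unfolded has_grad_def]] .
  moreover have "T (Re v *\<^sub>R A + Im v *\<^sub>R B) = Re v *\<^sub>R T A + Im v *\<^sub>R T B" for v
    by (subst add) (simp only: scaleR)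
  ultimately show ?thesis by (simp only: has_grad_def)
qed

lemma has_grad_bilinear:
  assumes "bounded_bilinear P" "has_grad h A B z" "has_grad g C D z"
  shows "has_grad (\<lambda>z. P (h z) (g z)) (P (h z) C + P A (g z)) (P (h z) D + P B (g z)) z"
proof -
  interpret bounded_bilinear P by fact
  have "((\<lambda>z. P (h z) (g z)) has_derivative (\<lambda>v. P (h z) (Re v *\<^sub>R C + Im v *\<^sub>R D) + P (Re v *\<^sub>R A + Im v *\<^sub>R B) (g z))) (at z)"
    using FDERIV[OF assms(2)[unfolded has_grad_def] assms(3)[unfolded has_grad_def]] .
  then show ?thesis unfolding has_grad_def
    by (rule has_derivative_eq_rhs)
      (simp add: fun_eq_iff add_left add_right scaleR_left scaleR_right scaleR_add_right)
qed

lemmas has_grad_scaleR = has_grad_bilinear[OF bounded_bilinear_scaleR]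
lemmas has_grad_mult = has_grad_bilinear[OF bounded_bilinear_mult]

lemma has_grad_const: "has_grad (\<lambda>_. c) 0 0 z"
  by (simp add: has_grad_def)

lemma has_grad_add: "has_grad h A B z \<Longrightarrow> has_grad g C D z \<Longrightarrow> has_grad (\<lambda>z. h z + g z) (A + C) (B + D) z"
  unfolding has_grad_def by (drule (1) has_derivative_add) (simp add: algebra_simps)

lemma has_grad_diff: "has_grad h A B z \<Longrightarrow> has_grad g C D z \<Longrightarrow> has_grad (\<lambda>z. h z - g z) (A - C) (B - D) z"
  unfolding has_grad_def by (drule (1) has_derivative_diff) (simp add: algebra_simps)

lemma has_grad_compose_holomorphic:
  assumes h: "has_grad h A B (g z)" and g: "(g has_field_derivative d) (at z)"
  shows "has_grad (\<lambda>z. h (g z)) (Re d *\<^sub>R A + Im d *\<^sub>R B) (Re d *\<^sub>R B - Im d *\<^sub>R A) z"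
proof -
  have "((\<lambda>z. h (g z)) has_derivative (\<lambda>v. Re (d * v) *\<^sub>R A + Im (d * v) *\<^sub>R B)) (at z)"
    using diff_chain_at[OF g[unfolded has_field_derivative_def] h[unfolded has_grad_def]] by (simp add: o_def)
  then show ?thesis unfolding has_grad_def
    by (rule has_derivative_eq_rhs) (auto simp: fun_eq_iff algebra_simps)
qed

lemma C1_on_compose_holomorphic:
  assumes "C1_on V h" "open U" "g holomorphic_on U" "g ` U \<subseteq> V"
  shows "C1_on U (\<lambda>z. h (g z))"
proof (rule C1_onI)
  have cg: "continuous_on U g" and cd: "continuous_on U (deriv g)"
    using assms holomorphic_on_imp_continuous_on holomorphic_deriv by blast+
  have cA: "continuous_on U (\<lambda>z. pd_x h (g z))" and cB: "continuous_on U (\<lambda>z. pd_y h (g z))"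
    using C1_onD(2,3)[OF assms(1)] cg assms(4) by (auto intro: continuous_on_compose2)
  show "has_grad (\<lambda>z. h (g z)) (Re (deriv g z) *\<^sub>R pd_x h (g z) + Im (deriv g z) *\<^sub>R pd_y h (g z))
     (Re (deriv g z) *\<^sub>R pd_y h (g z) - Im (deriv g z) *\<^sub>R pd_x h (g z)) z" if "z \<in> U" for z
    using that assms by (intro has_grad_compose_holomorphic C1_onD(1)[OF assms(1)] holomorphic_derivI[of _ U]) auto
  show "continuous_on U (\<lambda>z. Re (deriv g z) *\<^sub>R pd_x h (g z) + Im (deriv g z) *\<^sub>R pd_y h (g z))"
    "continuous_on U (\<lambda>z. Re (deriv g z) *\<^sub>R pd_y h (g z) - Im (deriv g z) *\<^sub>R pd_x h (g z))"
    by (intro continuous_intros cA cB cd)+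
qed

text \<open>Conformal invariance of the Dirichlet energy: a holomorphic change of variables
  multiplies the energy density by its Jacobian. With \<open>d\<close> equal to \<open>z\<close> it
  is also the polar decomposition of the gradient.\<close>

lemma norm_grad_compose:
  fixes A B :: "'b::real_inner"
  shows "(norm (Re d *\<^sub>R A + Im d *\<^sub>R B))\<^sup>2 + (norm (Re d *\<^sub>R B - Im d *\<^sub>R A))\<^sup>2
    = (norm d)\<^sup>2 * ((norm A)\<^sup>2 + (norm B)\<^sup>2)"
  by (simp add: power2_norm_eq_inner inner_add_left inner_add_right inner_diff_left inner_diff_right
      cmod_power2 inner_commute[of B A] algebra_simps) (simp add: inner_complex_def power2_eq_square algebra_simps)

lemma C1_on_scaleR:
  assumes "C1_on U k" "C1_on U h"
  shows "C1_on U (\<lambda>z. k z *\<^sub>R h z)"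
  by (rule C1_onI[OF has_grad_scaleR[OF C1_onD(1)[OF assms(1)] C1_onD(1)[OF assms(2)]]])
    (assumption | intro continuous_intros C1_onD(2-4)[OF assms(1)] C1_onD(2-4)[OF assms(2)])+

lemma C1_on_mult:
  fixes h :: "complex \<Rightarrow> 'b::real_normed_algebra"
  assumes "C1_on U k" "C1_on U h"
  shows "C1_on U (\<lambda>z. k z * h z)"
  by (rule C1_onI[OF has_grad_mult[OF C1_onD(1)[OF assms(1)] C1_onD(1)[OF assms(2)]]])
    (assumption | intro continuous_intros C1_onD(2-4)[OF assms(1)] C1_onD(2-4)[OF assms(2)])+

lemma C1_on_const: "C1_on U (\<lambda>_. c)"
  by (rule C1_onI[OF has_grad_const]) auto

lemma C1_on_diff:
  assumes "C1_on U h" "C1_on U k" shows "C1_on U (\<lambda>z. h z - k z)"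
  by (rule C1_onI[OF has_grad_diff[OF C1_onD(1)[OF assms(1)] C1_onD(1)[OF assms(2)]]])
    (assumption | intro continuous_on_diff C1_onD(2,3)[OF assms(1)] C1_onD(2,3)[OF assms(2)])+

lemma C1_on_linear:
  assumes "bounded_linear T" "C1_on U h" shows "C1_on U (\<lambda>z. T (h z))"
  by (rule C1_onI[OF has_grad_linear[OF assms(1) C1_onD(1)[OF assms(2)]]])
    (assumption | intro bounded_linear.continuous_on[OF assms(1)] C1_onD(2,3)[OF assms(2)])+

lemma C1_on_prod:
  fixes h :: "'i \<Rightarrow> complex \<Rightarrow> real"
  assumes "finite I" "\<And>i. i \<in> I \<Longrightarrow> C1_on U (h i)"
  shows "C1_on U (\<lambda>z. \<Prod>i\<in>I. h i z)"
  using assms by (induction rule: finite_induct) (auto intro: C1_on_const C1_on_mult)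

lemma has_grad_real_compose:
  fixes h :: "complex \<Rightarrow> real"
  assumes "has_grad h A B z" "(m has_field_derivative d) (at (h z))"
  shows "has_grad (\<lambda>z. m (h z)) (d * A) (d * B) z"
  using diff_chain_at[OF assms(1)[unfolded has_grad_def] assms(2)[unfolded has_field_derivative_def]]
  by (simp add: has_grad_def o_def algebra_simps)

lemma C1_on_real_compose:
  fixes h :: "complex \<Rightarrow> real"
  assumes "C1_on U h" "\<And>t. (m has_field_derivative m' t) (at t)" "continuous_on UNIV m'"
  shows "C1_on U (\<lambda>z. m (h z))"
proof (rule C1_onI[OF has_grad_real_compose[OF C1_onD(1)[OF assms(1)] assms(2)]])
  have "continuous_on U (\<lambda>z. m' (h z))"
    by (rule continuous_on_compose2[OF assms(3) C1_onD(4)[OF assms(1)]]) simp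
  then show "continuous_on U (\<lambda>z. m' (h z) * pd_x h z)" "continuous_on U (\<lambda>z. m' (h z) * pd_y h z)"
    by (auto intro: continuous_on_mult C1_onD(2,3)[OF assms(1)])
qed auto

section \<open>Cutoff functions of class C1\<close>

lemma has_field_derivative_pos_part_sq:
  "((\<lambda>t::real. (max 0 t)\<^sup>2) has_field_derivative 2 * max 0 t) (at t)"
proof -
  consider "t < 0" | "t > 0" | "t = 0" by linarith
  then show ?thesis
  proof cases
    case 1
    then have "((\<lambda>t::real. 0) has_field_derivative 2 * max 0 t) (at t)" by simp
    then show ?thesis
      by (rule has_field_derivative_transform_within_open[of _ _ _ "{..<0}"]) (use 1 in auto)
  next
    case 2
    then have "((\<lambda>t::real. t\<^sup>2) has_field_derivative 2 * max 0 t) (at t)"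
      by (auto intro!: derivative_eq_intros)
    then show ?thesis
      by (rule has_field_derivative_transform_within_open[of _ _ _ "{0<..}"]) (use 2 in auto)
  next
    case 3
    have "((\<lambda>h. ((max 0 h)\<^sup>2) / h) \<longlongrightarrow> 0) (at (0::real))"
    proof (rule Lim_null_comparison)
      show "\<forall>\<^sub>F h in at (0::real). norm ((max 0 h)\<^sup>2 / h) \<le> \<bar>h\<bar>"
        by (intro always_eventually) (auto simp: max_def power2_eq_square)
      show "((\<lambda>h. \<bar>h\<bar>) \<longlongrightarrow> 0) (at (0::real))"
        by (auto intro!: tendsto_eq_intros)
    qed
    then show ?thesis using 3 by (simp add: DERIV_def)
  qed
qed

lemma C1_on_dist_sq: "C1_on U (\<lambda>w. (norm (w - z))\<^sup>2)"
proof (rule C1_onI)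
  show "has_grad (\<lambda>w. (norm (w - z))\<^sup>2) (2 * Re (w - z)) (2 * Im (w - z)) w" for w
  proof -
    have "((\<lambda>w. (w - z) \<bullet> (w - z)) has_derivative (\<lambda>v. (w - z) \<bullet> v + v \<bullet> (w - z))) (at w)"
      by (auto intro!: derivative_eq_intros)
    then show ?thesis unfolding has_grad_def power2_norm_eq_inner
      by (rule has_derivative_eq_rhs) (auto simp: fun_eq_iff inner_complex_def algebra_simps)
  qed
qed (auto intro!: continuous_intros)

text \<open>With \<open>m\<close> the squared positive part, \<open>b\<close> is
  \<open>m (1 - m x)\<close> for a rescaled squared distance \<open>x\<close>. Inside radius
  \<open>r\<close> the number \<open>x\<close> is at most 0, so \<open>b\<close> is 1; outside
  radius \<open>2 * r\<close> it is at least 3, so the inner \<open>m\<close> exceeds 1 and the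
  outer one vanishes.\<close>

lemma C1_bump:
  assumes "r > 0"
  shows "\<exists>b::complex \<Rightarrow> real. C1_on UNIV b \<and> (\<forall>w. 0 \<le> b w \<and> b w \<le> 1) \<and> (\<forall>w\<in>ball z r. b w = 1)
    \<and> (\<forall>w. w \<notin> cball z (2 * r) \<longrightarrow> b w = 0)"
proof -
  define m :: "real \<Rightarrow> real" where "m t = (max 0 t)\<^sup>2" for t
  define b where "b w = m (1 - m (((norm (w - z))\<^sup>2 - r\<^sup>2) / r\<^sup>2))" for w
  have c: "C1_on UNIV (\<lambda>w. m (h w))" if "C1_on UNIV h" for h
    unfolding m_def by (rule C1_on_real_compose[OF that has_field_derivative_pos_part_sq])
      (auto intro!: continuous_intros)
  have d: "C1_on UNIV (\<lambda>w. (h w - a) / e)" if "C1_on UNIV h" for h :: "complex \<Rightarrow> real" and a e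
    unfolding divide_inverse by (intro C1_on_mult C1_on_diff that C1_on_const)
  have "C1_on UNIV b" unfolding b_def by (intro c C1_on_diff d C1_on_const C1_on_dist_sq)
  moreover have "0 \<le> b w \<and> b w \<le> 1" for w unfolding b_def m_def
    by (auto simp: power_le_one)
  moreover have "b w = 1" if "w \<in> ball z r" for w
  proof -
    have "(norm (w - z))\<^sup>2 \<le> r\<^sup>2" using that by (intro power_mono) (auto simp: dist_norm norm_minus_commute)
    then have "((norm (w - z))\<^sup>2 - r\<^sup>2) / r\<^sup>2 \<le> 0" by (simp add: divide_nonpos_nonneg)
    then show ?thesis by (simp add: b_def m_def max_def)
  qed
  moreover have "b w = 0" if "w \<notin> cball z (2 * r)" for w
  proof -
    have "(2 * r)\<^sup>2 \<le> (norm (w - z))\<^sup>2" using that assms by (intro power_mono) (auto simp: dist_norm norm_minus_commute)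
    then have "((norm (w - z))\<^sup>2 - r\<^sup>2) / r\<^sup>2 \<ge> 1" using assms by (simp add: field_simps) (smt (verit) zero_le_power2)
    then have "1 \<le> m (((norm (w - z))\<^sup>2 - r\<^sup>2) / r\<^sup>2)" unfolding m_def by (simp add: max_def one_le_power)
    then show ?thesis by (simp add: b_def m_def[of "1 - _"])
  qed
  ultimately show ?thesis by blast
qed

text \<open>The product of the factors \<open>1 - bb z w\<close> over a finite subcover vanishes
  near \<open>K\<close>, since one factor does; subtracting it from 1 yields the cutoff without a
  partition of unity. The open set \<open>V\<close> is part of the conclusion so that derivatives
  are known on \<open>K\<close> as well.\<close>

lemma C1_cutoff:
  fixes K U :: "complex set"
  assumes "compact K" "open U" "K \<subseteq> U"
  obtains b :: "complex \<Rightarrow> real" and V where "test_function U b" "\<And>w. 0 \<le> b w" "\<And>w. b w \<le> 1"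
    "open V" "K \<subseteq> V" "\<And>w. w \<in> V \<Longrightarrow> b w = 1"
proof -
  have "\<forall>z\<in>K. \<exists>r>0. cball z (2 * r) \<subseteq> U"
  proof
    fix z assume "z \<in> K"
    then obtain e where "e > 0" "cball z e \<subseteq> U" using assms open_contains_cball by blast
    then show "\<exists>r>0. cball z (2 * r) \<subseteq> U" by (intro exI[of _ "e/2"]) auto
  qed
  then obtain r where r: "\<And>z. z \<in> K \<Longrightarrow> r z > 0" "\<And>z. z \<in> K \<Longrightarrow> cball z (2 * r z) \<subseteq> U" by metis
  have "\<forall>z\<in>K. \<exists>b::complex \<Rightarrow> real. C1_on UNIV b \<and> (\<forall>w. 0 \<le> b w \<and> b w \<le> 1)
      \<and> (\<forall>w\<in>ball z (r z). b w = 1) \<and> (\<forall>w. w \<notin> cball z (2 * r z) \<longrightarrow> b w = 0)"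
    using C1_bump[OF r(1)] by blast
  from bchoice[OF this] obtain bb :: "complex \<Rightarrow> complex \<Rightarrow> real" where
    bb: "\<And>z. z \<in> K \<Longrightarrow> C1_on UNIV (bb z) \<and> (\<forall>w. 0 \<le> bb z w \<and> bb z w \<le> 1)
      \<and> (\<forall>w\<in>ball z (r z). bb z w = 1) \<and> (\<forall>w. w \<notin> cball z (2 * r z) \<longrightarrow> bb z w = 0)"
    by blast
  have "K \<subseteq> (\<Union>z\<in>K. ball z (r z))"
    using r(1) centre_in_ball by blast
  then obtain I where I: "I \<subseteq> K" "finite I" "K \<subseteq> (\<Union>z\<in>I. ball z (r z))"
    by (rule compactE_image[OF assms(1) open_ball])
  define b where "b w = 1 - (\<Prod>z\<in>I. 1 - bb z w)" for w
  define V where "V = (\<Union>z\<in>I. ball z (r z))"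
  have c: "C1_on UNIV b" unfolding b_def
    by (intro C1_on_diff C1_on_const C1_on_prod I) (use bb I in auto)
  define C where "C = (\<Union>z\<in>I. cball z (2 * r z))"
  have "cball z (2 * r z) \<subseteq> U" if "z \<in> I" for z using r(2)[of z] I(1) that by blast
  then have C: "compact C" "C \<subseteq> U" unfolding C_def by (rule_tac [2] UN_least) (auto intro: compact_UN I)
  have "b w = 0" if "w \<notin> C" for w
  proof -
    have "bb z w = 0" if "z \<in> I" for z
      using bb[of z] I(1) that \<open>w \<notin> C\<close> unfolding C_def by blast
    then have "(\<Prod>z\<in>I. 1 - bb z w) = 1" by (intro prod.neutral) simp
    then show ?thesis by (simp add: b_def)
  qed
  then have "{w. b w \<noteq> 0} \<subseteq> C" by blast
  then have clo: "closure {w. b w \<noteq> 0} \<subseteq> C" using C(1) by (simp add: closure_minimal compact_imp_closed)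
  moreover have "compact (closure {w. b w \<noteq> 0})"
    using bounded_subset[OF compact_imp_bounded[OF C(1)] \<open>{w. b w \<noteq> 0} \<subseteq> C\<close>] by (simp add: compact_closure)
  ultimately have "test_function U b" unfolding test_function_def using c C by auto
  moreover have "0 \<le> b w" "b w \<le> 1" for w
    unfolding b_def using bb I(1) by (auto intro!: prod_le_1 prod_nonneg simp: subset_eq)
  moreover have "b w = 1" if "w \<in> V" for w
  proof -
    obtain z where z: "z \<in> I" "w \<in> ball z (r z)" using \<open>w \<in> V\<close> unfolding V_def by blast
    then have "1 - bb z w = 0" using bb[of z] I(1) by auto
    then have "(\<Prod>z\<in>I. 1 - bb z w) = 0" using z(1) I(2) by (intro prod_zero) auto
    then show ?thesis by (simp add: b_def)
  qed
  ultimately show thesis using that[of b V] I(3) by (simp add: V_def open_UN)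
qed

lemma test_functionD:
  assumes "test_function U k"
  shows "C1_on UNIV k" "compact (closure {z. k z \<noteq> 0})" "closure {z. k z \<noteq> 0} \<subseteq> U"
    "z \<notin> closure {z. k z \<noteq> 0} \<Longrightarrow> k z = 0 \<and> pd_x k z = 0 \<and> pd_y k z = 0"
proof -
  show "C1_on UNIV k" "compact (closure {z. k z \<noteq> 0})" "closure {z. k z \<noteq> 0} \<subseteq> U"
    using assms by (auto simp: test_function_def)
  assume z: "z \<notin> closure {z. k z \<noteq> 0}"
  have "k w = 0" if "w \<in> - closure {z. k z \<noteq> 0}" for w
    using that closure_subset[of "{z. k z \<noteq> 0}"] by blast
  note w0 = this
  have hg: "has_grad k 0 0 z"
  proof (rule iffD2[OF has_grad_cong])
    show "k w = 0" if "w \<in> - closure {z. k z \<noteq> 0}" for w by (rule w0[OF that])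
    show "has_grad (\<lambda>_. 0::real) 0 0 z" by (rule has_grad_const)
  qed (use z in \<open>simp_all add: open_Compl\<close>)
  show "k z = 0 \<and> pd_x k z = 0 \<and> pd_y k z = 0"
    using has_grad_pd(1,2)[OF hg] w0[of z] z by simp
qed

text \<open>Off the support of the test function the product vanishes, whatever the values of \<open>h\<close>.\<close>
lemma test_function_times_C1:
  assumes k: "test_function U k" and U: "open U" and h: "C1_on U h"
  shows "C1_on UNIV (\<lambda>z. k z *\<^sub>R h z)"
    and "pd_x (\<lambda>z. k z *\<^sub>R h z) z = k z *\<^sub>R pd_x h z + pd_x k z *\<^sub>R h z"
    and "pd_y (\<lambda>z. k z *\<^sub>R h z) z = k z *\<^sub>R pd_y h z + pd_y k z *\<^sub>R h z"
    and "compact (closure {z. k z *\<^sub>R h z \<noteq> 0})"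
proof -
  let ?C = "closure {z. k z \<noteq> 0}"
  have "C1_on U (\<lambda>z. k z *\<^sub>R h z)"
    by (intro C1_on_scaleR h C1_on_subset[OF test_functionD(1)[OF k]]) simp
  moreover have "C1_on (- ?C) (\<lambda>z. k z *\<^sub>R h z)"
  proof (rule C1_on_cong)
    show "C1_on (- ?C) (\<lambda>_. 0 :: 'a)" by (rule C1_on_const)
    show "0 = k w *\<^sub>R h w" if "w \<in> - ?C" for w
      using test_functionD(4)[OF k, of w] that by simp
  qed (simp add: open_Compl)
  ultimately have "C1_on (U \<union> - ?C) (\<lambda>z. k z *\<^sub>R h z)"
    by (intro C1_on_Un U) (simp_all add: open_Compl)
  moreover have "U \<union> - ?C = UNIV" using test_functionD(3)[OF k] by auto
  ultimately show "C1_on UNIV (\<lambda>z. k z *\<^sub>R h z)" by simp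
  have "has_grad (\<lambda>z. k z *\<^sub>R h z) (k z *\<^sub>R pd_x h z + pd_x k z *\<^sub>R h z) (k z *\<^sub>R pd_y h z + pd_y k z *\<^sub>R h z) z"
  proof (cases "z \<in> U")
    case True
    then show ?thesis using has_grad_scaleR[OF C1_onD(1)[OF test_functionD(1)[OF k]] C1_onD(1)[OF h True]] by simp
  next
    case False
    then have z: "z \<in> - ?C" using test_functionD(3)[OF k] by auto
    have "has_grad (\<lambda>z. k z *\<^sub>R h z) 0 0 z \<longleftrightarrow> has_grad (\<lambda>z. 0 :: 'a) 0 0 z"
    proof (rule has_grad_cong[OF _ z])
      show "k w *\<^sub>R h w = 0" if "w \<in> - ?C" for w
        using test_functionD(4)[OF k, of w] that by simp
    qed (simp add: open_Compl)
    then show ?thesis using test_functionD(4)[OF k, of z] z has_grad_const[of "0::'a" z] by simp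
  qed
  then show "pd_x (\<lambda>z. k z *\<^sub>R h z) z = k z *\<^sub>R pd_x h z + pd_x k z *\<^sub>R h z"
    and "pd_y (\<lambda>z. k z *\<^sub>R h z) z = k z *\<^sub>R pd_y h z + pd_y k z *\<^sub>R h z"
    by (simp_all only: has_grad_pd)
  have "closure {z. k z *\<^sub>R h z \<noteq> 0} \<subseteq> ?C" by (rule closure_mono) auto
  then show "compact (closure {z. k z *\<^sub>R h z \<noteq> 0})"
    using compact_Int_closed[OF test_functionD(2)[OF k] closed_closure] by (metis Int_absorb1)
qed


section \<open>Weak gradients\<close>

lemma integrable_cutoff_times:
  fixes p :: "complex \<Rightarrow> 'b::{banach,second_countable_topology}" and k :: "complex \<Rightarrow> real"
  assumes "compact C" "C \<subseteq> U" "continuous_on U p" "continuous_on UNIV k" "\<And>z. z \<notin> C \<Longrightarrow> k z = 0"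
  shows "integrable lborel (\<lambda>z. k z *\<^sub>R p z)"
proof -
  have "continuous_on C (\<lambda>z. k z *\<^sub>R p z)"
    by (rule continuous_on_scaleR[OF continuous_on_subset[OF assms(4)] continuous_on_subset[OF assms(3,2)]]) simp
  then have "integrable lborel (\<lambda>z. indicator C z *\<^sub>R (k z *\<^sub>R p z))"
    by (rule borel_integrable_compact[OF assms(1)])
  also have "(\<lambda>z. indicator C z *\<^sub>R (k z *\<^sub>R p z)) = (\<lambda>z. k z *\<^sub>R p z)"
    using assms(5) by (auto simp: fun_eq_iff indicator_def)
  finally show ?thesis .
qed

lemma pd_eq_0_off_support:
  assumes z: "z \<notin> closure {z. h z \<noteq> 0}"
  shows "h z = 0" "pd_x h z = 0" "pd_y h z = 0"
proof -
  have w0: "h w = 0" if "w \<in> - closure {z. h z \<noteq> 0}" for w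
    using that closure_subset[of "{z. h z \<noteq> 0}"] by blast
  have hg: "has_grad h 0 0 z"
  proof (rule iffD2[OF has_grad_cong])
    show "h w = (\<lambda>_. 0) w" if "w \<in> - closure {z. h z \<noteq> 0}" for w using w0[OF that] by simp
    show "has_grad (\<lambda>_. 0) 0 0 z" by (rule has_grad_const)
  qed (use z in \<open>simp_all add: open_Compl\<close>)
  show "h z = 0" "pd_x h z = 0" "pd_y h z = 0"
    using has_grad_pd(1,2)[OF hg] w0[of z] z by simp_all
qed

text \<open>By Fubini it is enough to integrate along horizontal or vertical lines, where the
  fundamental theorem of calculus leaves only values outside the support.\<close>

lemma integral_pd_compact_support:
  fixes h :: "complex \<Rightarrow> 'b::euclidean_space"
  assumes h: "C1_on UNIV h" and C: "compact (closure {z. h z \<noteq> 0})"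
  shows "(LINT z|lborel. pd_x h z) = 0" "(LINT z|lborel. pd_y h z) = 0"
proof -
  let ?C = "closure {z. h z \<noteq> 0}"
  have int: "integrable lborel p" if "continuous_on UNIV p" "\<And>z. z \<notin> ?C \<Longrightarrow> p z = 0" for p :: "complex \<Rightarrow> 'b"
  proof -
    have "integrable lborel (\<lambda>z. indicator ?C z *\<^sub>R p z)"
      by (rule borel_integrable_compact[OF C continuous_on_subset[OF that(1)]]) simp
    also have "(\<lambda>z. indicator ?C z *\<^sub>R p z) = p"
      using that(2) by (auto simp: fun_eq_iff indicator_def)
    finally show ?thesis .
  qed
  obtain R0 where R0: "\<And>z. z \<in> ?C \<Longrightarrow> norm z \<le> R0"
    using compact_imp_bounded[OF C] bounded_iff by blast
  \<comment> \<open>Positive, and strictly larger than the radius of the support, so that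
    \<open>h\<close> vanishes at both ends of each segment.\<close>
  define R where "R = max R0 0 + 1"
  have out: "h (Complex x y) = 0 \<and> pd_x h (Complex x y) = 0 \<and> pd_y h (Complex x y) = 0" if "R \<le> \<bar>x\<bar> \<or> R \<le> \<bar>y\<bar>" for x y
  proof -
    have "R0 < norm (Complex x y)"
      using that abs_Re_le_cmod[of "Complex x y"] abs_Im_le_cmod[of "Complex x y"] by (auto simp: R_def)
    then have "Complex x y \<notin> ?C" using R0 by fastforce
    then show ?thesis using pd_eq_0_off_support[of "Complex x y" h] by blast
  qed
  have R: "- R \<le> R" and Rp: "R > 0" by (simp_all add: R_def)
  note hd = C1_onD(1)[OF h UNIV_I, unfolded has_grad_def]
  have contx: "continuous_on {-R..R} (\<lambda>x. pd_x h (Complex x y))" for y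
    by (rule continuous_on_compose2[OF C1_onD(2)[OF h]]) (auto intro!: continuous_intros simp: Complex_eq)
  have conty: "continuous_on {-R..R} (\<lambda>y. pd_y h (Complex x y))" for x
    by (rule continuous_on_compose2[OF C1_onD(3)[OF h]]) (auto intro!: continuous_intros simp: Complex_eq)
  have dx: "((\<lambda>x. h (Complex x y)) has_vector_derivative pd_x h (Complex x y)) (at x within S)" for x y S
  proof -
    have "((\<lambda>x. Complex x y) has_derivative (\<lambda>t. of_real t)) (at x within S)"
      unfolding Complex_eq by (auto intro!: derivative_eq_intros)
    from has_derivative_compose[OF this hd]
    show ?thesis by (simp add: has_vector_derivative_def)
  qed
  have dy: "((\<lambda>y. h (Complex x y)) has_vector_derivative pd_y h (Complex x y)) (at y within S)" for x y S
  proof -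
    have "((\<lambda>y. Complex x y) has_derivative (\<lambda>t. \<i> * of_real t)) (at y within S)"
      unfolding Complex_eq by (auto intro!: derivative_eq_intros)
    from has_derivative_compose[OF this hd]
    show ?thesis by (simp add: has_vector_derivative_def)
  qed
  have "(LINT x|lborel. pd_x h (Complex x y)) = 0" for y
  proof -
    have "(LINT x|lborel. pd_x h (Complex x y)) = (LINT x|lborel. indicator {-R..R} x *\<^sub>R pd_x h (Complex x y))"
    proof (rule Bochner_Integration.integral_cong[OF refl])
      show "pd_x h (Complex x y) = indicator {-R..R} x *\<^sub>R pd_x h (Complex x y)" for x
      proof (cases "x \<in> {-R..R}")
        case False
        then have "R \<le> \<bar>x\<bar>" by auto
        then show ?thesis using out[of x y] by simp
      qed simp
    qed
    also have "\<dots> = h (Complex R y) - h (Complex (-R) y)"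
      by (rule integral_FTC_atLeastAtMost[OF R dx contx])
    finally show ?thesis using out[of R y] out[of "-R" y] Rp by simp
  qed
  moreover have "integrable lborel (pd_x h)"
    by (rule int[OF C1_onD(2)[OF h]]) (rule pd_eq_0_off_support(2))
  ultimately show "(LINT z|lborel. pd_x h z) = 0" by (simp add: integral_lborel_complex')
  have "(LINT y|lborel. pd_y h (Complex x y)) = 0" for x
  proof -
    have "(LINT y|lborel. pd_y h (Complex x y)) = (LINT y|lborel. indicator {-R..R} y *\<^sub>R pd_y h (Complex x y))"
    proof (rule Bochner_Integration.integral_cong[OF refl])
      show "pd_y h (Complex x y) = indicator {-R..R} y *\<^sub>R pd_y h (Complex x y)" for y
      proof (cases "y \<in> {-R..R}")
        case False
        then have "R \<le> \<bar>y\<bar>" by auto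
        then show ?thesis using out[of x y] by simp
      qed simp
    qed
    also have "\<dots> = h (Complex x R) - h (Complex x (-R))"
      by (rule integral_FTC_atLeastAtMost[OF R dy conty])
    finally show ?thesis using out[of x R] out[of x "-R"] Rp by simp
  qed
  moreover have "integrable lborel (pd_y h)"
    by (rule int[OF C1_onD(3)[OF h]]) (rule pd_eq_0_off_support(3))
  ultimately show "(LINT z|lborel. pd_y h z) = 0" by (simp add: integral_lborel_complex)
qed

lemma locally_integrable_continuous:
  assumes "continuous_on U h"
  shows "locally_integrable U h"
  unfolding locally_integrable_def
proof (intro allI impI)
  fix K assume "compact K \<and> K \<subseteq> U"
  then have K: "compact K" "continuous_on K h" "K \<in> sets borel"
    using assms continuous_on_subset by (auto simp: compact_imp_closed)
  show "integrable (lebesgue_on K) h"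
    using lebesgue_on_iff_lborel(1)[OF K(3) set_borel_measurable_continuous_open[OF K(2,3)]]
      borel_integrable_compact[OF K(1,2)] by (simp add: set_integrable_def)
qed

text \<open>Integration by parts: the product of \<open>h\<close> with a test function is C1 with
  compact support in the whole plane, so its partial derivatives have integral 0.\<close>

lemma weak_gradient_C1:
  fixes h :: "complex \<Rightarrow> 'b::euclidean_space"
  assumes U: "open U" and h: "C1_on U h"
  shows "weak_gradient U h (pd_x h) (pd_y h)"
  unfolding weak_gradient_def
proof (intro conjI allI impI locally_integrable_continuous C1_onD[OF h])
  fix k assume k: "test_function U k"
  let ?C = "closure {z. k z \<noteq> 0}"
  have kC: "z \<notin> ?C \<Longrightarrow> k z = 0" "z \<notin> ?C \<Longrightarrow> pd_x k z = 0" "z \<notin> ?C \<Longrightarrow> pd_y k z = 0" for z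
    using test_functionD(4)[OF k] by blast+
  note kU = test_functionD(3)[OF k] and ck = test_functionD(1)[OF k]
  have Ub: "U \<in> sets borel" using U by simp
  have conv: "(LINT z|lebesgue_on U. b z *\<^sub>R p z) = (LINT z|lborel. b z *\<^sub>R p z)"
    and int: "integrable lborel (\<lambda>z. b z *\<^sub>R p z)"
    if "continuous_on UNIV b" "\<And>z. z \<notin> ?C \<Longrightarrow> b z = 0" "continuous_on U p" for b and p :: "complex \<Rightarrow> 'b"
  proof -
    have "continuous_on U (\<lambda>z. b z *\<^sub>R p z)"
      by (rule continuous_on_scaleR[OF continuous_on_subset[OF that(1)] that(3)]) simp
    then have "(LINT z|lebesgue_on U. b z *\<^sub>R p z) = set_lebesgue_integral lborel U (\<lambda>z. b z *\<^sub>R p z)"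
      by (intro lebesgue_on_iff_lborel(2) Ub set_borel_measurable_continuous_open)
    also have "\<dots> = (LINT z|lborel. b z *\<^sub>R p z)"
      unfolding set_lebesgue_integral_def
      by (intro Bochner_Integration.integral_cong) (use that(2) kU in \<open>auto simp: indicator_def\<close>)
    finally show "(LINT z|lebesgue_on U. b z *\<^sub>R p z) = (LINT z|lborel. b z *\<^sub>R p z)" .
    show "integrable lborel (\<lambda>z. b z *\<^sub>R p z)"
      by (rule integrable_cutoff_times[OF test_functionD(2)[OF k] kU that(3,1,2)])
  qed
  have "0 = (LINT z|lborel. pd_x (\<lambda>z. k z *\<^sub>R h z) z)"
    using integral_pd_compact_support(1)[OF test_function_times_C1(1,4)[OF k U h]] by simp
  also have "\<dots> = (LINT z|lborel. k z *\<^sub>R pd_x h z + pd_x k z *\<^sub>R h z)"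
    by (simp only: test_function_times_C1(2)[OF k U h])
  also have "\<dots> = (LINT z|lborel. k z *\<^sub>R pd_x h z) + (LINT z|lborel. pd_x k z *\<^sub>R h z)"
    by (rule Bochner_Integration.integral_add[OF int[OF C1_onD(4)[OF ck] kC(1) C1_onD(2)[OF h]]
          int[OF C1_onD(2)[OF ck] kC(2) C1_onD(4)[OF h]]])
  also have "\<dots> = (LINT z|lebesgue_on U. k z *\<^sub>R pd_x h z) + (LINT z|lebesgue_on U. pd_x k z *\<^sub>R h z)"
    by (rule arg_cong2[where f = "(+)", OF conv[OF C1_onD(4)[OF ck] kC(1) C1_onD(2)[OF h], symmetric]
          conv[OF C1_onD(2)[OF ck] kC(2) C1_onD(4)[OF h], symmetric]])
  finally show "(LINT z|lebesgue_on U. pd_x k z *\<^sub>R h z) = - (LINT z|lebesgue_on U. k z *\<^sub>R pd_x h z)"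
    by (simp add: eq_neg_iff_add_eq_0 add.commute)
  have "0 = (LINT z|lborel. pd_y (\<lambda>z. k z *\<^sub>R h z) z)"
    using integral_pd_compact_support(2)[OF test_function_times_C1(1,4)[OF k U h]] by simp
  also have "\<dots> = (LINT z|lborel. k z *\<^sub>R pd_y h z + pd_y k z *\<^sub>R h z)"
    by (simp only: test_function_times_C1(3)[OF k U h])
  also have "\<dots> = (LINT z|lborel. k z *\<^sub>R pd_y h z) + (LINT z|lborel. pd_y k z *\<^sub>R h z)"
    by (rule Bochner_Integration.integral_add[OF int[OF C1_onD(4)[OF ck] kC(1) C1_onD(3)[OF h]]
          int[OF C1_onD(3)[OF ck] kC(3) C1_onD(4)[OF h]]])
  also have "\<dots> = (LINT z|lebesgue_on U. k z *\<^sub>R pd_y h z) + (LINT z|lebesgue_on U. pd_y k z *\<^sub>R h z)"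
    by (rule arg_cong2[where f = "(+)", OF conv[OF C1_onD(4)[OF ck] kC(1) C1_onD(3)[OF h], symmetric]
          conv[OF C1_onD(3)[OF ck] kC(3) C1_onD(4)[OF h], symmetric]])
  finally show "(LINT z|lebesgue_on U. pd_y k z *\<^sub>R h z) = - (LINT z|lebesgue_on U. k z *\<^sub>R pd_y h z)"
    by (simp add: eq_neg_iff_add_eq_0 add.commute)
qed

section \<open>Uniqueness of weak gradients\<close>

lemma integrable_lebesgue_on_iff:
  fixes f :: "'a::euclidean_space \<Rightarrow> 'b::{banach,second_countable_topology}"
  assumes "A \<in> sets lebesgue"
  shows "integrable (lebesgue_on A) f \<longleftrightarrow> integrable lebesgue (\<lambda>x. indicator A x *\<^sub>R f x)"
  using integrable_restrict_space[of A lebesgue f] assms by simp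

lemma integral_lebesgue_on_eq:
  fixes f :: "'a::euclidean_space \<Rightarrow> 'b::{banach,second_countable_topology}"
  assumes "A \<in> sets lebesgue"
  shows "(LINT x|lebesgue_on A. f x) = (LINT x|lebesgue. indicator A x *\<^sub>R f x)"
  using integral_restrict_space[of A lebesgue f] assms by simp

lemma sigma_finite_lebesgue: "sigma_finite_measure (lebesgue :: 'a::euclidean_space measure)"
proof
  have "\<exists>A::'a set set. countable A \<and> A \<subseteq> sets lborel \<and> \<Union>A = space lborel \<and> (\<forall>a\<in>A. emeasure lborel a \<noteq> \<infinity>)"
    by (rule lborel.sigma_finite_countable)
  then obtain A :: "'a set set" where A: "countable A" "A \<subseteq> sets lborel" "\<Union>A = space lborel" "\<forall>a\<in>A. emeasure lborel a \<noteq> \<infinity>"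
    by blast
  then show "\<exists>A::'a set set. countable A \<and> A \<subseteq> sets lebesgue \<and> \<Union>A = space lebesgue \<and> (\<forall>a\<in>A. emeasure lebesgue a \<noteq> \<infinity>)"
    by (intro exI[of _ A]) (auto simp: sets_completionI_sets subset_iff)
qed

text \<open>The fundamental lemma of the calculus of variations. Test functions squeezed onto a
  compact set converge to its indicator, so the integral of \<open>q\<close> over every compact
  subset of \<open>U\<close> vanishes; inner regularity extends this to measurable sets.\<close>

lemma AE_zero_if_orthogonal_to_test_functions:
  fixes q :: "complex \<Rightarrow> 'b::{banach,second_countable_topology}"
  assumes U: "open U" and q: "locally_integrable U q"
    and 0: "\<And>k. test_function U k \<Longrightarrow> (LINT z|lebesgue_on U. k z *\<^sub>R q z) = 0"
  shows "AE z in lebesgue_on U. q z = 0"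
proof -
  have qi: "integrable lebesgue (\<lambda>z. indicator K z *\<^sub>R q z)" if "compact K" "K \<subseteq> U" for K
    using q that integrable_lebesgue_on_iff[of K q] sets_borel_lebesgue[of K] compact_imp_closed[OF that(1)]
    by (auto simp: locally_integrable_def)
  have Ul: "U \<in> sets lebesgue" using U by (intro sets_borel_lebesgue) simp
  have K0: "(LINT z|lebesgue. indicator K z *\<^sub>R q z) = 0" if K: "compact K" "K \<subseteq> U" for K
  proof (cases "K = {}")
    case False
    obtain k0 V0 where k0: "test_function U k0" "open V0" "K \<subseteq> V0" "\<And>w. w \<in> V0 \<Longrightarrow> k0 w = 1"
      using C1_cutoff[OF K(1) U K(2)] by metis
    define C where "C = closure {z. k0 z \<noteq> 0}"
    have C: "compact C" "C \<subseteq> U" using test_functionD(2,3)[OF k0(1)] by (auto simp: C_def)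
    have V0C: "V0 \<subseteq> C" using k0(4) closure_subset[of "{z. k0 z \<noteq> 0}"] by (auto simp: C_def)
    \<comment> \<open>Neighbourhoods shrinking to \<open>K\<close>, all inside the single compact
      set \<open>C\<close> on which \<open>q\<close> is integrable; this supplies the dominating
      function.\<close>
    define W where "W n = {z. infdist z K < 1 / Suc n} \<inter> V0" for n
    have oW: "open (W n)" for n unfolding W_def
      by (intro open_Int k0(2) open_Collect_less continuous_intros)
    have KW: "K \<subseteq> W n" for n using k0(3) by (auto simp: W_def)
    have "\<exists>k. test_function (W n) k \<and> (\<forall>w. 0 \<le> k w \<and> k w \<le> 1) \<and> (\<forall>w\<in>K. k w = 1)" for n
      using C1_cutoff[OF K(1) oW KW, of n] by (metis subsetD)
    then obtain k where k: "\<And>n. test_function (W n) (k n)" "\<And>n w. 0 \<le> k n w \<and> k n w \<le> 1" "\<And>n w. w \<in> K \<Longrightarrow> k n w = 1"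
      by metis
    have kU: "test_function U (k n)" for n
      using k(1)[of n] V0C C(2) unfolding test_function_def W_def by blast
    have koff: "k n z = 0" if "z \<notin> W n" for n z
      using test_functionD(4)[OF k(1)[of n], of z] test_functionD(3)[OF k(1)[of n]] that by blast
    have koffC: "k n z = 0" if "z \<notin> C" for n z using koff[of z n] that V0C by (auto simp: W_def)
    have lim: "(\<lambda>n. k n z) \<longlonglongrightarrow> indicator K z" for z
    proof (cases "z \<in> K")
      case True then show ?thesis using k(3) by simp
    next
      case z: False
      then have "infdist z K > 0"
        using in_closed_iff_infdist_zero[OF compact_imp_closed[OF K(1)] False, of z] infdist_nonneg[of z K] by linarith
      then obtain N where N: "1 / Suc N < infdist z K" using nat_approx_posE by blast
      have "k n z = 0" if "n \<ge> N" for n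
      proof (rule koff)
        have "1 / real (Suc n) \<le> 1 / real (Suc N)" using that by (simp add: frac_le)
        then show "z \<notin> W n" using N by (auto simp: W_def)
      qed
      then have "eventually (\<lambda>n. k n z = 0) sequentially" by (auto simp: eventually_sequentially)
      then show ?thesis using z by (simp add: tendsto_eventually)
    qed
    have ck: "continuous_on UNIV (k n)" for n using C1_onD(4)[OF test_functionD(1)[OF k(1)]] .
    have mk: "(\<lambda>z. k n z) \<in> borel_measurable lebesgue" for n
      by (rule measurable_completion) (use borel_measurable_continuous_onI[OF ck[of n]] in simp)
    let ?q = "\<lambda>z. indicator C z *\<^sub>R q z"
    have "(\<lambda>n. LINT z|lebesgue. k n z *\<^sub>R ?q z) \<longlonglongrightarrow> (LINT z|lebesgue. indicator K z *\<^sub>R ?q z)"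
    proof (rule integral_dominated_convergence[where w = "\<lambda>z. norm (?q z)"])
      show "(\<lambda>z. indicator K z *\<^sub>R ?q z) \<in> borel_measurable lebesgue"
        by (rule borel_measurable_scaleR[OF borel_measurable_indicator borel_measurable_integrable[OF qi[OF C]]])
          (use sets_borel_lebesgue[of K] compact_imp_closed[OF K(1)] in auto)
      show "(\<lambda>z. k n z *\<^sub>R ?q z) \<in> borel_measurable lebesgue" for n
        by (rule borel_measurable_scaleR[OF mk borel_measurable_integrable[OF qi[OF C]]])
      show "integrable lebesgue (\<lambda>z. norm (?q z))" using qi[OF C] by (rule integrable_norm)
      show "AE z in lebesgue. (\<lambda>n. k n z *\<^sub>R ?q z) \<longlonglongrightarrow> indicator K z *\<^sub>R ?q z"
        by (intro AE_I2 tendsto_scaleR lim tendsto_const)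
      show "AE z in lebesgue. norm (k n z *\<^sub>R ?q z) \<le> norm (?q z)" for n
      proof (rule AE_I2)
        show "norm (k n z *\<^sub>R ?q z) \<le> norm (?q z)" for z
          unfolding norm_scaleR[of "k n z"] using k(2)[of n z] by (intro mult_left_le_one_le) auto
      qed
    qed
    moreover have "(LINT z|lebesgue. k n z *\<^sub>R ?q z) = 0" for n
    proof -
      have "(LINT z|lebesgue. k n z *\<^sub>R ?q z) = (LINT z|lebesgue. indicator U z *\<^sub>R (k n z *\<^sub>R q z))"
        using koffC C(2) by (intro Bochner_Integration.integral_cong) (auto simp: indicator_def)
      then show ?thesis using 0[OF kU[of n]] by (simp add: integral_lebesgue_on_eq[OF Ul])
    qed
    ultimately have "(LINT z|lebesgue. indicator K z *\<^sub>R ?q z) = 0"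
      by (simp add: LIMSEQ_const_iff)
    moreover have "(\<lambda>z. indicator K z *\<^sub>R ?q z) = (\<lambda>z. indicator K z *\<^sub>R q z)"
      using k0(3) V0C by (auto simp: fun_eq_iff indicator_def)
    ultimately show ?thesis by simp
  qed simp
  have AEC: "AE z in lebesgue. z \<in> C \<longrightarrow> q z = 0" if C: "compact C" "C \<subseteq> U" for C
  proof -
    have Cl: "C \<in> sets lebesgue" using compact_imp_closed[OF C(1)] by (intro sets_borel_lebesgue) simp
    have "AE z in lebesgue. indicator C z *\<^sub>R q z = 0"
    proof (rule sigma_finite_measure.density_zero[OF sigma_finite_lebesgue qi[OF C]])
      fix A :: "complex set" assume A: "A \<in> sets lebesgue"
      then have "A \<inter> C \<in> sets lebesgue" using Cl by auto
      \<comment> \<open>Up to a null set, a measurable set is a countable union of compact sets; the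
        finite unions \<open>K n\<close> exhaust it.\<close>
      then obtain D N where DN: "fsigma D" "N \<in> null_sets lebesgue" "D \<union> N = A \<inter> C"
        using lebesgue_set_almost_fsigma by metis
      then obtain F :: "nat \<Rightarrow> complex set" where F: "range F \<subseteq> Collect compact" "D = \<Union>(range F)"
        using fsigma_Union_compact by metis
      define K where "K n = (\<Union>i\<le>n. F i)" for n
      have K: "compact (K n)" "K n \<subseteq> C" "K n \<subseteq> A" for n
        using F DN(3) unfolding K_def by (auto intro!: compact_UN)
      have "(\<lambda>n. LINT z|lebesgue. indicator (K n) z *\<^sub>R (indicator C z *\<^sub>R q z))
          \<longlonglongrightarrow> (LINT z|lebesgue. indicator A z *\<^sub>R (indicator C z *\<^sub>R q z))"
      proof (rule integral_dominated_convergence[where w = "\<lambda>z. norm (indicator C z *\<^sub>R q z)"])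
        show "(\<lambda>z. indicator A z *\<^sub>R (indicator C z *\<^sub>R q z)) \<in> borel_measurable lebesgue"
          by (rule borel_measurable_scaleR[OF borel_measurable_indicator[OF A] borel_measurable_integrable[OF qi[OF C]]])
        show "(\<lambda>z. indicator (K n) z *\<^sub>R (indicator C z *\<^sub>R q z)) \<in> borel_measurable lebesgue" for n
          by (rule borel_measurable_scaleR[OF borel_measurable_indicator borel_measurable_integrable[OF qi[OF C]]])
            (use sets_borel_lebesgue[of "K n"] compact_imp_closed[OF K(1)[of n]] in auto)
        show "integrable lebesgue (\<lambda>z. norm (indicator C z *\<^sub>R q z))" using qi[OF C] by (rule integrable_norm)
        show "AE z in lebesgue. norm (indicator (K n) z *\<^sub>R (indicator C z *\<^sub>R q z)) \<le> norm (indicator C z *\<^sub>R q z)" for n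
          by (intro AE_I2) (auto simp: indicator_def)
        show "AE z in lebesgue. (\<lambda>n. indicator (K n) z *\<^sub>R (indicator C z *\<^sub>R q z)) \<longlonglongrightarrow> indicator A z *\<^sub>R (indicator C z *\<^sub>R q z)"
          using AE_not_in[OF DN(2)]
        proof eventually_elim
          case (elim z)
          show ?case
          proof (cases "z \<in> D")
            case True
            then obtain N where "z \<in> F N" using F by blast
            then have "z \<in> K n" if "n \<ge> N" for n using that by (auto simp: K_def)
            then have "eventually (\<lambda>n. z \<in> K n) sequentially" by (auto simp: eventually_sequentially)
            then have "eventually (\<lambda>n. indicator (K n) z *\<^sub>R (indicator C z *\<^sub>R q z) = indicator A z *\<^sub>R (indicator C z *\<^sub>R q z)) sequentially"
              by eventually_elim (use K(3) in \<open>auto simp: indicator_def\<close>)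
            then show ?thesis by (rule tendsto_eventually)
          next
            case False
            then have "z \<notin> K n" for n using F by (auto simp: K_def)
            moreover have "z \<notin> A \<inter> C" using False elim DN(3) by blast
            ultimately show ?thesis by (auto simp: indicator_def)
          qed
        qed
      qed
      moreover have "(LINT z|lebesgue. indicator (K n) z *\<^sub>R (indicator C z *\<^sub>R q z)) = 0" for n
      proof -
        have "(\<lambda>z. indicator (K n) z *\<^sub>R (indicator C z *\<^sub>R q z)) = (\<lambda>z. indicator (K n) z *\<^sub>R q z)"
          using K(2)[of n] by (auto simp: fun_eq_iff indicator_def)
        then show ?thesis using K0[OF K(1)[of n]] K(2)[of n] C(2) by simp
      qed
      ultimately show "set_lebesgue_integral lebesgue A (\<lambda>z. indicator C z *\<^sub>R q z) = 0"
        by (simp add: LIMSEQ_const_iff set_lebesgue_integral_def)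
    qed
    then show ?thesis by eventually_elim (auto simp: indicator_def split: if_splits)
  qed
  obtain D N where DN: "fsigma D" "N \<in> null_sets lebesgue" "D \<union> N = U"
    using lebesgue_set_almost_fsigma[OF Ul] by metis
  then obtain F :: "nat \<Rightarrow> complex set" where F: "range F \<subseteq> Collect compact" "D = \<Union>(range F)"
    using fsigma_Union_compact by metis
  have "AE z in lebesgue. z \<in> F n \<longrightarrow> q z = 0" for n
    using F DN(3) by (intro AEC) auto
  then have "AE z in lebesgue. \<forall>n. z \<in> F n \<longrightarrow> q z = 0" by (subst AE_all_countable) blast
  then have "AE z in lebesgue. z \<in> U \<longrightarrow> q z = 0"
    using AE_not_in[OF DN(2)] by eventually_elim (use F DN(3) in blast)
  then show ?thesis using Ul by (simp add: AE_restrict_space_iff)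
qed

lemma weak_gradient_unique:
  assumes U: "open U" and w: "weak_gradient U h p q" "weak_gradient U h p' q'"
  shows "AE z in lebesgue_on U. p z = p' z" "AE z in lebesgue_on U. q z = q' z"
proof -
  have main: "AE z in lebesgue_on U. r z = r' z"
    if l: "locally_integrable U r" "locally_integrable U r'"
      and eq: "\<And>k. test_function U k \<Longrightarrow> (LINT z|lebesgue_on U. k z *\<^sub>R r z) = (LINT z|lebesgue_on U. k z *\<^sub>R r' z)"
    for r r' :: "complex \<Rightarrow> 'a"
  proof -
    have "AE z in lebesgue_on U. r z - r' z = 0"
    proof (rule AE_zero_if_orthogonal_to_test_functions[OF U])
      show "locally_integrable U (\<lambda>z. r z - r' z)" using l by (auto simp: locally_integrable_def)
      fix k assume k: "test_function U k"
      let ?C = "closure {z. k z \<noteq> 0}"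
      have C: "compact ?C" "?C \<subseteq> U" using test_functionD(2,3)[OF k] by auto
      have Ul: "U \<in> sets lebesgue" using U by (intro sets_borel_lebesgue) simp
      have Cl: "?C \<in> sets lebesgue" by (intro sets_borel_lebesgue) simp
      obtain B where B: "\<And>z. z \<in> ?C \<Longrightarrow> \<bar>k z\<bar> \<le> B"
      proof -
        have "compact (k ` ?C)"
          by (rule compact_continuous_image[OF continuous_on_subset[OF C1_onD(4)[OF test_functionD(1)[OF k]]] C(1)]) simp
        then show thesis using that compact_imp_bounded bounded_iff by (metis imageI real_norm_def)
      qed
      have i: "integrable (lebesgue_on U) (\<lambda>z. k z *\<^sub>R s z)" if "locally_integrable U s" for s :: "complex \<Rightarrow> 'a"
      proof -
        have s: "integrable lebesgue (\<lambda>z. indicator ?C z *\<^sub>R s z)"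
          using that C integrable_lebesgue_on_iff[OF Cl, of s] by (auto simp: locally_integrable_def)
        have "integrable lebesgue (\<lambda>z. k z *\<^sub>R (indicator ?C z *\<^sub>R s z))"
        proof (rule Bochner_Integration.integrable_bound)
          show "integrable lebesgue (\<lambda>z. B *\<^sub>R (indicator ?C z *\<^sub>R s z))" by (rule integrable_scaleR_right) (rule s)
          have "k \<in> borel_measurable lebesgue"
            by (rule measurable_completion)
              (use borel_measurable_continuous_onI[OF C1_onD(4)[OF test_functionD(1)[OF k]]] in simp)
          then show "(\<lambda>z. k z *\<^sub>R (indicator ?C z *\<^sub>R s z)) \<in> borel_measurable lebesgue"
            by (rule borel_measurable_scaleR[OF _ borel_measurable_integrable[OF s]])
          show "AE z in lebesgue. norm (k z *\<^sub>R (indicator ?C z *\<^sub>R s z)) \<le> norm (B *\<^sub>R (indicator ?C z *\<^sub>R s z))"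
            using B by (intro AE_I2) (force simp: indicator_def intro!: mult_right_mono)
        qed
        also have "(\<lambda>z. k z *\<^sub>R (indicator ?C z *\<^sub>R s z)) = (\<lambda>z. indicator U z *\<^sub>R (k z *\<^sub>R s z))"
        proof
          show "k z *\<^sub>R (indicator ?C z *\<^sub>R s z) = indicator U z *\<^sub>R (k z *\<^sub>R s z)" for z
            using C(2) test_functionD(4)[OF k, of z] by (cases "z \<in> ?C") auto
        qed
        finally show ?thesis by (simp add: integrable_lebesgue_on_iff[OF Ul])
      qed
      show "(LINT z|lebesgue_on U. k z *\<^sub>R (r z - r' z)) = 0"
        unfolding scaleR_diff_right using eq[OF k] i[OF l(1)] i[OF l(2)] by simp
    qed
    then show ?thesis by eventually_elim simp
  qed
  show "AE z in lebesgue_on U. p z = p' z" "AE z in lebesgue_on U. q z = q' z"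
  proof -
    have "(LINT z|lebesgue_on U. k z *\<^sub>R p z) = (LINT z|lebesgue_on U. k z *\<^sub>R p' z)"
      "(LINT z|lebesgue_on U. k z *\<^sub>R q z) = (LINT z|lebesgue_on U. k z *\<^sub>R q' z)" if "test_function U k" for k
      using w that unfolding weak_gradient_def by (metis neg_equal_iff_equal)+
    then show "AE z in lebesgue_on U. p z = p' z" "AE z in lebesgue_on U. q z = q' z"
      using w unfolding weak_gradient_def by (auto intro!: main)
  qed
qed

section \<open>Fourier series of continuous functions on the circle\<close>

lemma circle_integrable:
  fixes F :: "real \<Rightarrow> 'b::{banach,second_countable_topology}"
  assumes "continuous_on {0..2*pi} F"
  shows "integrable circle_measure F"
  using lebesgue_on_iff_lborel(1)[OF _ set_borel_measurable_continuous_open[OF assms]]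
    borel_integrable_compact[OF _ assms] by (simp add: set_integrable_def)

lemma finite_circle_measure: "finite_measure circle_measure"
  by (rule finite_measure_lebesgue_on) simp

lemma integral_circle_const: "(LINT t|circle_measure. (c::'b::{banach,second_countable_topology})) = (2 * pi) *\<^sub>R c"
  by (simp add: measure_restrict_space sets_borel_lebesgue)

lemma continuous_cis [continuous_intros]: "continuous_on S f \<Longrightarrow> continuous_on S (\<lambda>x. cis (f x))"
  unfolding cis_conv_exp by (intro continuous_intros)

lemma integral_cis: "(LINT t|circle_measure. cis (of_int n * t)) = (if n = 0 then of_real (2 * pi) else 0)"
proof (cases "n = 0")
  case True
  then show ?thesis using integral_circle_const[of "1::complex"] by (simp add: scaleR_conv_of_real)
next
  case False
  have c: "continuous_on {0..2*pi} (\<lambda>t. cis (of_int n * t))" by (intro continuous_intros)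
  have "(LINT t|circle_measure. cis (of_int n * t)) = (LINT t|lborel. indicator {0..2*pi} t *\<^sub>R cis (of_int n * t))"
    using lebesgue_on_iff_lborel(2)[OF _ set_borel_measurable_continuous_open[OF c]] by (simp add: set_lebesgue_integral_def)
  also have "\<dots> = cis (of_int n * (2 * pi)) / (\<i> * of_int n) - cis (of_int n * 0) / (\<i> * of_int n)"
  proof (rule integral_FTC_atLeastAtMost[OF _ _ c])
    fix t :: real
    have "((\<lambda>t. exp (\<i> * of_real (of_int n * t)) / (\<i> * of_int n)) has_vector_derivative exp (\<i> * of_real (of_int n * t))) (at t within {0..2*pi})"
      using False by (auto intro!: derivative_eq_intros has_vector_derivative_real_field simp: field_simps)
    then show "((\<lambda>t. cis (of_int n * t) / (\<i> * of_int n)) has_vector_derivative cis (of_int n * t)) (at t within {0..2*pi})"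
      by (simp add: cis_conv_exp)
  qed simp
  also have "cis (of_int n * (2 * pi)) = 1"
    using cis_multiple_2pi[of "of_int n"] by (simp add: mult.commute mult.left_commute)
  finally show ?thesis using False by simp
qed

text \<open>The inductive form makes closure under products an induction on the first factor;
  coefficients are recovered in \<open>trig_poly_sum\<close>.\<close>

inductive trig_poly :: "(real \<Rightarrow> complex) \<Rightarrow> bool" where
  mono: "trig_poly (\<lambda>t. c * cis (of_int n * t))"
| add: "trig_poly A \<Longrightarrow> trig_poly B \<Longrightarrow> trig_poly (\<lambda>t. A t + B t)"

lemma trig_poly_mono_mult: "trig_poly B \<Longrightarrow> trig_poly (\<lambda>t. c * cis (of_int n * t) * B t)"
proof (induction rule: trig_poly.induct)
  case (mono d m)
  have "(\<lambda>t. c * cis (of_int n * t) * (d * cis (of_int m * t))) = (\<lambda>t. (c * d) * cis (of_int (n + m) * t))"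
    by (auto simp: fun_eq_iff cis_mult[symmetric] ring_distribs)
  then show ?case using trig_poly.mono by metis
next
  case (add A B)
  then show ?case using trig_poly.add by (simp add: ring_distribs)
qed

lemma trig_poly_mult: "trig_poly A \<Longrightarrow> trig_poly B \<Longrightarrow> trig_poly (\<lambda>t. A t * B t)"
proof (induction rule: trig_poly.induct)
  case (mono c n)
  then show ?case by (rule trig_poly_mono_mult)
next
  case (add A A')
  then show ?case using trig_poly.add[of "\<lambda>t. A t * B t" "\<lambda>t. A' t * B t"] by (simp add: ring_distribs)
qed

lemma trig_poly_const: "trig_poly (\<lambda>t. c)"
  using trig_poly.mono[of c 0] by simp

lemma trig_poly_sum:
  assumes "trig_poly A"
  obtains N c where "finite N" "\<And>t. A t = (\<Sum>n\<in>N. c n * cis (of_int n * t))"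
proof -
  have "\<exists>N c. finite N \<and> (\<forall>t. A t = (\<Sum>n\<in>N. c n * cis (of_int n * t)))"
    using assms
  proof (induction rule: trig_poly.induct)
    case (mono c n)
    show ?case by (rule exI[of _ "{n}"], rule exI[of _ "\<lambda>_. c"]) simp
  next
    case (add A B)
    then obtain N c M d where *: "finite N" "\<And>t. A t = (\<Sum>n\<in>N. c n * cis (of_int n * t))"
      "finite M" "\<And>t. B t = (\<Sum>n\<in>M. d n * cis (of_int n * t))" by blast
    define c' where "c' n = (if n \<in> N then c n else 0)" for n
    define d' where "d' n = (if n \<in> M then d n else 0)" for n
    have A: "A t = (\<Sum>n\<in>N \<union> M. c' n * cis (of_int n * t))" for t
      unfolding *(2) c'_def by (rule sum.mono_neutral_cong_left) (use * in auto)
    have B: "B t = (\<Sum>n\<in>N \<union> M. d' n * cis (of_int n * t))" for t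
      unfolding *(4) d'_def by (rule sum.mono_neutral_cong_left) (use * in auto)
    have "A t + B t = (\<Sum>n\<in>N \<union> M. (c' n + d' n) * cis (of_int n * t))" for t
      by (simp only: A B sum.distrib[symmetric] distrib_right)
    then show ?case using *(1,3) by (intro exI[of _ "N \<union> M"] exI[of _ "\<lambda>n. c' n + d' n"] conjI allI finite_UnI)
  qed
  then show thesis using that by blast
qed

text \<open>By induction on the polynomial: a linear form restricted to the circle is a combination
  of cosine and sine, hence of \<open>cis t\<close> and \<open>cis (- t)\<close>, and trigonometric
  polynomials are closed under sums and products.\<close>

lemma trig_poly_real_polynomial:
  fixes p :: "complex \<Rightarrow> real"
  assumes "real_polynomial_function p"
  shows "trig_poly (\<lambda>t. of_real (p (cis t)))"
  using assms
proof (induction rule: real_polynomial_function.induct)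
  case (linear f)
  interpret bounded_linear f by fact
  have "f (cis t) = cos t * f 1 + sin t * f \<i>" for t
  proof -
    have "cis t = cos t *\<^sub>R 1 + sin t *\<^sub>R \<i>" by (simp add: complex_eq_iff)
    then have "f (cis t) = f (cos t *\<^sub>R 1 + sin t *\<^sub>R \<i>)" by simp
    then show ?thesis by (simp only: add scaleR real_scaleR_def)
  qed
  then have "(\<lambda>t. complex_of_real (f (cis t))) = (\<lambda>t. (f 1 / 2 + f \<i> / (2 * \<i>)) * cis (of_int 1 * t) + (f 1 / 2 - f \<i> / (2 * \<i>)) * cis (of_int (-1) * t))"
    by (auto simp: fun_eq_iff complex_eq_iff)
  then show ?case by (simp only:) (rule trig_poly.add[OF trig_poly.mono trig_poly.mono])
next
  case (const c) then show ?case using trig_poly_const by simp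
next
  case (add f g) then show ?case using trig_poly.add by simp
next
  case (mult f g) then show ?case using trig_poly_mult by simp
qed

lemma trig_poly_approx:
  fixes h :: "complex \<Rightarrow> complex"
  assumes "continuous_on (sphere 0 1) h" "e > 0"
  obtains N c where "finite N" "\<And>t. norm (h (cis t) - (\<Sum>n\<in>N. c n * cis (of_int n * t))) < e"
proof -
  obtain g :: "complex \<Rightarrow> complex" where g: "polynomial_function g" "\<And>z. z \<in> sphere 0 1 \<Longrightarrow> norm (h z - g z) < e"
    using Stone_Weierstrass_polynomial_function[OF compact_sphere assms] by metis
  have "real_polynomial_function (Re \<circ> g)" "real_polynomial_function (Im \<circ> g)"
    using g(1) bounded_linear_Re bounded_linear_Im unfolding polynomial_function_def by blast+
  then have "trig_poly (\<lambda>t. of_real (Re (g (cis t))))" "trig_poly (\<lambda>t. of_real (Im (g (cis t))))"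
    using trig_poly_real_polynomial[of "Re \<circ> g"] trig_poly_real_polynomial[of "Im \<circ> g"] by auto
  then have "trig_poly (\<lambda>t. of_real (Re (g (cis t))) + \<i> * of_real (Im (g (cis t))))"
    by (intro trig_poly.add trig_poly_mult trig_poly_const)
  then have "trig_poly (\<lambda>t. g (cis t))" by (simp add: complex_eq[symmetric])
  then obtain N c where "finite N" "\<And>t. g (cis t) = (\<Sum>n\<in>N. c n * cis (of_int n * t))"
    using trig_poly_sum by blast
  then show thesis using g(2) by (intro that[of N c]) (auto simp flip: \<open>\<And>t. g (cis t) = _\<close>)
qed

lemma continuous_on_circle:
  assumes "continuous_on (sphere 0 1) h"
  shows "continuous_on S (\<lambda>t. h (cis t))"
  by (rule continuous_on_compose2[OF assms]) (auto intro!: continuous_intros)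

lemma fourier_coeff_trig:
  assumes "finite N"
  shows "fourier_coeff (\<lambda>z. \<Sum>n\<in>N. c n * z powi n) m = (if m \<in> N then c m else 0)"
proof -
  have i: "integrable circle_measure (\<lambda>t. c n * cis (of_int (n - m) * t))" for n
    by (intro circle_integrable continuous_intros)
  have "(LINT t|circle_measure. (\<Sum>n\<in>N. c n * cis t powi n) * cis (- of_int m * t))
    = (LINT t|circle_measure. (\<Sum>n\<in>N. c n * cis (of_int (n - m) * t)))"
    by (simp add: cis_power_int sum_distrib_right mult.assoc cis_mult ring_distribs mult.commute[of t])
  also have "\<dots> = (\<Sum>n\<in>N. LINT t|circle_measure. c n * cis (of_int (n - m) * t))"
    by (rule Bochner_Integration.integral_sum) (rule i)
  also have "\<dots> = (\<Sum>n\<in>N. c n * (if n - m = 0 then of_real (2 * pi) else 0))"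
    by (intro sum.cong refl) (simp only: integral_mult_right_zero integral_cis)
  also have "\<dots> = (\<Sum>n\<in>N. if n = m then c m * of_real (2 * pi) else 0)"
    by (intro sum.cong refl) auto
  also have "\<dots> = (if m \<in> N then c m * of_real (2 * pi) else 0)"
    using assms by (simp add: sum.delta')
  finally show ?thesis by (simp add: fourier_coeff_def)
qed

lemma inner_trig_integral:
  assumes h: "continuous_on (sphere 0 1) h" and N: "finite N"
  shows "(LINT t|circle_measure. h (cis t) \<bullet> (\<Sum>n\<in>N. c n * cis (of_int n * t))) = 2 * pi * (\<Sum>n\<in>N. fourier_coeff h n \<bullet> c n)"
proof -
  have i: "integrable circle_measure (\<lambda>t. h (cis t) * cis (- of_int n * t))" for n
    by (intro circle_integrable continuous_intros continuous_on_circle h)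
  have e: "h (cis t) \<bullet> (c n * cis (of_int n * t)) = Re (cnj (c n) * (h (cis t) * cis (- of_int n * t)))" for n t
    by (simp add: inner_complex_def algebra_simps)
  have "(LINT t|circle_measure. h (cis t) \<bullet> (\<Sum>n\<in>N. c n * cis (of_int n * t)))
    = (LINT t|circle_measure. (\<Sum>n\<in>N. Re (cnj (c n) * (h (cis t) * cis (- of_int n * t)))))"
    by (simp only: inner_sum_right e)
  also have "\<dots> = (\<Sum>n\<in>N. LINT t|circle_measure. Re (cnj (c n) * (h (cis t) * cis (- of_int n * t))))"
    by (rule Bochner_Integration.integral_sum) (intro integrable_Re integrable_mult_right i)
  also have "\<dots> = (\<Sum>n\<in>N. Re (cnj (c n) * (LINT t|circle_measure. h (cis t) * cis (- of_int n * t))))"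
    by (intro sum.cong refl, subst integral_Re[OF integrable_mult_right[OF i]]) (simp only: integral_mult_right_zero)
  also have "\<dots> = (\<Sum>n\<in>N. 2 * pi * (fourier_coeff h n \<bullet> c n))"
    by (intro sum.cong refl) (simp add: fourier_coeff_def inner_complex_def field_simps)
  finally show ?thesis by (simp add: sum_distrib_left)
qed

text \<open>Pythagoras for square integrable functions. When the \<open>c n\<close> are the Fourier
  coefficients the last sum is 0, which gives Bessel's inequality; for any other choice the identity
  bounds the Bessel defect by the approximation error, which is how completeness is
  obtained.\<close>

lemma best_approximation:
  assumes h: "continuous_on (sphere 0 1) h" and N: "finite N"
  shows "(LINT t|circle_measure. (norm (h (cis t) - (\<Sum>n\<in>N. c n * cis (of_int n * t))))\<^sup>2)
    = (LINT t|circle_measure. (norm (h (cis t)))\<^sup>2) - 2 * pi * (\<Sum>n\<in>N. (norm (fourier_coeff h n))\<^sup>2)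
      + 2 * pi * (\<Sum>n\<in>N. (norm (c n - fourier_coeff h n))\<^sup>2)"
proof -
  let ?P = "\<lambda>t. \<Sum>n\<in>N. c n * cis (of_int n * t)"
  let ?p = "\<lambda>z. \<Sum>n\<in>N. c n * z powi n"
  have cp: "continuous_on (sphere 0 1) ?p" by (intro continuous_intros) auto
  have pP: "?p (cis t) = ?P t" for t by (simp add: cis_power_int mult.commute)
  have ch: "continuous_on {0..2*pi} (\<lambda>t. h (cis t))" by (rule continuous_on_circle[OF h])
  have cP: "continuous_on {0..2*pi} ?P" by (intro continuous_intros)
  have e: "(norm (h (cis t) - ?P t))\<^sup>2 = (norm (h (cis t)))\<^sup>2 - 2 * (h (cis t) \<bullet> ?P t) + ?P t \<bullet> ?P t" for t
    by (simp only: power2_norm_eq_inner inner_diff_left inner_diff_right) (simp add: inner_commute)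
  have PP: "(LINT t|circle_measure. ?P t \<bullet> ?P t) = 2 * pi * (\<Sum>n\<in>N. c n \<bullet> c n)"
    using inner_trig_integral[OF cp N, of c] by (simp add: pP fourier_coeff_trig[OF N] del: cis_power_int cong: sum.cong)
  have "(LINT t|circle_measure. (norm (h (cis t) - ?P t))\<^sup>2)
     = (LINT t|circle_measure. (norm (h (cis t)))\<^sup>2) - 2 * (LINT t|circle_measure. h (cis t) \<bullet> ?P t) + (LINT t|circle_measure. ?P t \<bullet> ?P t)"
    unfolding e
    by (subst Bochner_Integration.integral_add Bochner_Integration.integral_diff; (intro circle_integrable continuous_intros ch cP)?)+ simp
  also have "\<dots> = (LINT t|circle_measure. (norm (h (cis t)))\<^sup>2) - 2 * (2 * pi * (\<Sum>n\<in>N. fourier_coeff h n \<bullet> c n)) + 2 * pi * (\<Sum>n\<in>N. c n \<bullet> c n)"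
    by (simp only: PP inner_trig_integral[OF h N])
  also have "\<dots> = (LINT t|circle_measure. (norm (h (cis t)))\<^sup>2) - 2 * pi * (\<Sum>n\<in>N. (norm (fourier_coeff h n))\<^sup>2)
      + 2 * pi * (\<Sum>n\<in>N. (norm (c n - fourier_coeff h n))\<^sup>2)"
    by (simp add: power2_norm_eq_inner inner_diff_left inner_diff_right inner_commute sum.distrib sum_subtractf
        sum_distrib_left algebra_simps)
  finally show ?thesis .
qed

lemma bessel:
  assumes h: "continuous_on (sphere 0 1) h" and N: "finite N"
  shows "2 * pi * (\<Sum>n\<in>N. (norm (fourier_coeff h n))\<^sup>2) \<le> (LINT t|circle_measure. (norm (h (cis t)))\<^sup>2)"
proof -
  have "0 \<le> (LINT t|circle_measure. (norm (h (cis t) - (\<Sum>n\<in>N. fourier_coeff h n * cis (of_int n * t))))\<^sup>2)"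
    by simp
  also have "\<dots> = (LINT t|circle_measure. (norm (h (cis t)))\<^sup>2) - 2 * pi * (\<Sum>n\<in>N. (norm (fourier_coeff h n))\<^sup>2)"
    by (subst best_approximation[OF h N]) simp
  finally show ?thesis by simp
qed

lemma parseval_norm:
  assumes h: "continuous_on (sphere 0 1) h"
  shows "((\<lambda>n. (norm (fourier_coeff h n))\<^sup>2) has_sum ((LINT t|circle_measure. (norm (h (cis t)))\<^sup>2) / (2 * pi))) UNIV"
  unfolding has_sum_def tendsto_iff eventually_finite_subsets_at_top
proof (intro allI impI)
  fix e :: real assume e: "e > 0"
  define d where "d = sqrt (e / 2)"
  have d: "d > 0" "d\<^sup>2 < e" using e by (auto simp: d_def)
  obtain N c where N: "finite N" "\<And>t. norm (h (cis t) - (\<Sum>n\<in>N. c n * cis (of_int n * t))) < d"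
    using trig_poly_approx[OF h d(1)] by blast
  let ?I = "LINT t|circle_measure. (norm (h (cis t)))\<^sup>2"
  have cP: "continuous_on {0..2*pi} (\<lambda>t. (norm (h (cis t) - (\<Sum>n\<in>N. c n * cis (of_int n * t))))\<^sup>2)"
    by (intro continuous_intros continuous_on_circle h)
  show "\<exists>X. finite X \<and> X \<subseteq> UNIV \<and> (\<forall>Y. finite Y \<and> X \<subseteq> Y \<and> Y \<subseteq> UNIV \<longrightarrow>
      dist (\<Sum>n\<in>Y. (norm (fourier_coeff h n))\<^sup>2) (?I / (2 * pi)) < e)"
  proof (intro exI[of _ N] conjI allI impI)
    fix Y assume Y: "finite Y \<and> N \<subseteq> Y \<and> Y \<subseteq> (UNIV :: int set)"
    \<comment> \<open>A uniform approximation with frequencies in \<open>N\<close> bounds the Bessel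
      defect of \<open>N\<close>, and passing to the larger set \<open>Y\<close> only decreases
      it.\<close>
    have "?I - 2 * pi * (\<Sum>n\<in>N. (norm (fourier_coeff h n))\<^sup>2) \<le> (LINT t|circle_measure. (norm (h (cis t) - (\<Sum>n\<in>N. c n * cis (of_int n * t))))\<^sup>2)"
      by (subst best_approximation[OF h N(1)]) (simp add: sum_nonneg)
    also have "\<dots> \<le> (LINT t|circle_measure. d\<^sup>2)"
      using N(2) by (intro integral_mono circle_integrable cP continuous_intros power_mono) (auto intro: less_imp_le)
    also have "\<dots> = 2 * pi * d\<^sup>2" using integral_circle_const[of "d\<^sup>2"] by simp
    also have "\<dots> < 2 * pi * e" using d by simp
    finally have 1: "?I < 2 * pi * (e + (\<Sum>n\<in>N. (norm (fourier_coeff h n))\<^sup>2))" by (simp add: ring_distribs)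
    have 2: "(\<Sum>n\<in>N. (norm (fourier_coeff h n))\<^sup>2) \<le> (\<Sum>n\<in>Y. (norm (fourier_coeff h n))\<^sup>2)"
      using Y by (intro sum_mono2) auto
    have 3: "2 * pi * (\<Sum>n\<in>Y. (norm (fourier_coeff h n))\<^sup>2) \<le> ?I" using Y by (intro bessel h) auto
    have 4: "(\<Sum>n\<in>Y. (norm (fourier_coeff h n))\<^sup>2) \<le> ?I / (2 * pi)" using 3 by (simp add: field_simps)
    have 5: "?I / (2 * pi) < e + (\<Sum>n\<in>Y. (norm (fourier_coeff h n))\<^sup>2)"
    proof -
      have "?I / (2 * pi) < e + (\<Sum>n\<in>N. (norm (fourier_coeff h n))\<^sup>2)" using 1 by (simp add: field_simps)
      then show ?thesis using 2 by simp
    qed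
    show "dist (\<Sum>n\<in>Y. (norm (fourier_coeff h n))\<^sup>2) (?I / (2 * pi)) < e"
      using 4 5 by (simp add: dist_real_def)
  qed (use N in auto)
qed

lemma fourier_coeff_add:
  assumes "continuous_on (sphere 0 1) h" "continuous_on (sphere 0 1) k"
  shows "fourier_coeff (\<lambda>z. h z + k z) n = fourier_coeff h n + fourier_coeff k n"
    "fourier_coeff (\<lambda>z. h z - k z) n = fourier_coeff h n - fourier_coeff k n"
proof -
  have i: "integrable circle_measure (\<lambda>t. h (cis t) * cis (- of_int n * t))" "integrable circle_measure (\<lambda>t. k (cis t) * cis (- of_int n * t))"
    by (intro circle_integrable continuous_intros continuous_on_circle assms)+
  show "fourier_coeff (\<lambda>z. h z + k z) n = fourier_coeff h n + fourier_coeff k n"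
    "fourier_coeff (\<lambda>z. h z - k z) n = fourier_coeff h n - fourier_coeff k n"
    unfolding fourier_coeff_def ring_distribs
    using Bochner_Integration.integral_add[OF i] Bochner_Integration.integral_diff[OF i]
    by (simp_all add: add_divide_distrib diff_divide_distrib)
qed

text \<open>Polarization of the identity for norms.\<close>

lemma parseval:
  assumes h: "continuous_on (sphere 0 1) h" and k: "continuous_on (sphere 0 1) k"
  shows "((\<lambda>n. fourier_coeff h n \<bullet> fourier_coeff k n) has_sum ((LINT t|circle_measure. h (cis t) \<bullet> k (cis t)) / (2 * pi))) UNIV"
proof -
  have polar: "x \<bullet> y = ((norm (x + y))\<^sup>2 - (norm (x - y))\<^sup>2) / 4" for x y :: complex
    by (simp add: power2_norm_eq_inner inner_add_left inner_add_right inner_diff_left inner_diff_right inner_commute)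
  have c: "continuous_on (sphere 0 1) (\<lambda>z. h z + k z)" "continuous_on (sphere 0 1) (\<lambda>z. h z - k z)"
    by (intro continuous_intros h k)+
  have "((\<lambda>n. ((norm (fourier_coeff (\<lambda>z. h z + k z) n))\<^sup>2 - (norm (fourier_coeff (\<lambda>z. h z - k z) n))\<^sup>2) * (1/4)) has_sum
     ((LINT t|circle_measure. (norm (h (cis t) + k (cis t)))\<^sup>2) / (2 * pi) - (LINT t|circle_measure. (norm (h (cis t) - k (cis t)))\<^sup>2) / (2 * pi)) * (1/4)) UNIV"
    using has_sum_cmult_left[OF has_sum_add[OF parseval_norm[OF c(1)] has_sum_cmult_right[OF parseval_norm[OF c(2)], of "-1"]], of "1/4"]
    by simp
  also have "(\<lambda>n. ((norm (fourier_coeff (\<lambda>z. h z + k z) n))\<^sup>2 - (norm (fourier_coeff (\<lambda>z. h z - k z) n))\<^sup>2) * (1/4)) = (\<lambda>n. fourier_coeff h n \<bullet> fourier_coeff k n)"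
    by (simp add: polar fourier_coeff_add[OF h k])
  also have "((LINT t|circle_measure. (norm (h (cis t) + k (cis t)))\<^sup>2) / (2 * pi) - (LINT t|circle_measure. (norm (h (cis t) - k (cis t)))\<^sup>2) / (2 * pi)) * (1/4)
    = (LINT t|circle_measure. h (cis t) \<bullet> k (cis t)) / (2 * pi)"
  proof -
    have i: "integrable circle_measure (\<lambda>t. (norm (h (cis t) + k (cis t)))\<^sup>2)" "integrable circle_measure (\<lambda>t. (norm (h (cis t) - k (cis t)))\<^sup>2)"
      by (intro circle_integrable continuous_intros continuous_on_circle h k)+
    show ?thesis unfolding polar[of "h _" "k _"] integral_divide_zero Bochner_Integration.integral_diff[OF i]
      by (simp add: field_simps)
  qed
  finally show ?thesis .
qed

section \<open>Logarithmic polar coordinates\<close>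

text \<open>The radius is \<open>exp s\<close>, so that \<open>pol s t\<close> is the exponential of
  \<open>Complex s t\<close>; the unit circle is \<open>s = 0\<close> and the origin is pushed to
  minus infinity.\<close>

definition pol :: "real \<Rightarrow> real \<Rightarrow> complex" where
  "pol s t = of_real (exp s) * cis t"

lemma exp_Complex: "exp (Complex s t) = pol s t"
  by (simp add: pol_def exp_eq_polar)

lemma norm_pol [simp]: "norm (pol s t) = exp s"
  by (simp add: pol_def norm_mult)

lemma pol_neq_0 [simp]: "pol s t \<noteq> 0"
  by (metis norm_pol norm_zero exp_not_eq_zero)

lemma continuous_pol [continuous_intros]:
  "continuous_on S f \<Longrightarrow> continuous_on S g \<Longrightarrow> continuous_on S (\<lambda>x. pol (f x) (g x))"
  unfolding pol_def by (intro continuous_intros)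

lemma pol_annulus: "s < 0 \<Longrightarrow> pol s t \<in> annulus 0"
  by (simp add: annulus_def)

lemma pol_2pi: "pol s (2 * pi) = pol s 0"
  by (simp add: pol_def)

lemma open_annulus: "open (annulus \<rho>)"
  by (simp add: annulus_def open_Diff)

lemma annulus_0: "annulus 0 = ball 0 1 - {0}"
  by (simp add: annulus_def)

lemma mem_annulus: "z \<in> annulus \<rho> \<longleftrightarrow> \<rho> < norm z \<and> norm z < 1"
  by (auto simp: annulus_def)

text \<open>A domain on which \<open>exp\<close> is injective; its image is the annulus without the
  slit along the positive real axis, and the slit has measure zero.\<close>

definition log_strip :: "real \<Rightarrow> complex set" where
  "log_strip \<rho> = {w. \<rho> < exp (Re w)} \<inter> {w. Re w < 0} \<inter> {w. 0 < Im w} \<inter> {w. Im w < 2 * pi}"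

lemma open_log_strip: "open (log_strip \<rho>)"
  unfolding log_strip_def by (intro open_Int open_Collect_less continuous_intros)

lemma inj_on_exp_log_strip: "inj_on exp (log_strip \<rho>)"
proof (rule inj_onI)
  fix x y assume *: "x \<in> log_strip \<rho>" "y \<in> log_strip \<rho>" "exp x = exp y"
  then obtain n :: int where n: "x = y + of_int (2 * n) * pi * \<i>" by (auto simp: exp_eq)
  then have "Im x = Im y + 2 * n * pi" by simp
  moreover have "\<bar>Im x - Im y\<bar> < 2 * pi" using * by (auto simp: log_strip_def)
  ultimately have "\<bar>2 * of_int n * pi\<bar> < 2 * pi" by simp
  then have "\<bar>real_of_int n\<bar> < 1" by (simp add: abs_mult)
  then have "n = 0" by linarith
  then show "x = y" using n by simp
qed

lemma exp_log_strip:
  assumes "\<rho> \<ge> 0" "z \<in> annulus \<rho>" "Im z \<noteq> 0"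
  shows "z \<in> exp ` log_strip \<rho>"
proof -
  have z: "z \<noteq> 0" "\<rho> < norm z" "norm z < 1" using assms by (auto simp: mem_annulus)
  define t where "t = Arg2pi z"
  have t: "0 \<le> t" "t < 2 * pi" "z = of_real (norm z) * exp (\<i> * of_real t)"
    using Arg2pi[of z] by (auto simp: t_def is_Arg_def)
  have "t \<noteq> 0"
  proof
    assume "t = 0"
    then have "Im z = 0" using t(3) by (metis Im_complex_of_real exp_zero mult.right_neutral mult_zero_right of_real_0)
    then show False using assms by simp
  qed
  moreover have "exp (Complex (ln (norm z)) t) = z"
    using t(3) z by (simp add: exp_Complex pol_def cis_conv_exp)
  moreover have "ln (norm z) < 0" using z by simp
  ultimately show ?thesis using t z
    by (intro image_eqI[of _ _ "Complex (ln (norm z)) t"]) (auto simp: log_strip_def)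
qed

lemma AE_Im_neq: "AE z in lborel. Im z \<noteq> (c::real)"
proof -
  have "negligible {z::complex. \<i> \<bullet> z = c}" by (rule negligible_hyperplane) simp
  then have "AE z in lebesgue. Im z \<noteq> c"
    by (auto simp: negligible_iff_null_sets inner_complex_def dest!: AE_not_in)
  then show ?thesis by (simp add: AE_completion_iff)
qed

lemma integral_circle_eq_lborel:
  fixes F :: "real \<Rightarrow> 'b::{banach,second_countable_topology}"
  assumes "continuous_on {0..2*pi} F"
  shows "(LINT t|lborel. indicator {0<..<2*pi} t *\<^sub>R F t) = (LINT t|circle_measure. F t)"
proof -
  have m: "(\<lambda>t. indicator {0..2*pi} t *\<^sub>R F t) \<in> borel_measurable lborel"
    using set_borel_measurable_continuous_open[OF assms] by (simp add: set_borel_measurable_def)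
  have m': "(\<lambda>t. indicator {0<..<2*pi} t *\<^sub>R F t) \<in> borel_measurable lborel"
    using set_borel_measurable_continuous_open[OF continuous_on_subset[OF assms], of "{0<..<2*pi}"]
    by (simp add: set_borel_measurable_def subset_eq)
  have "(LINT t|lborel. indicator {0<..<2*pi} t *\<^sub>R F t) = (LINT t|lborel. indicator {0..2*pi} t *\<^sub>R F t)"
  proof (rule integral_cong_AE[OF m' m])
    show "AE t in lborel. indicator {0<..<2*pi} t *\<^sub>R F t = indicator {0..2*pi} t *\<^sub>R F t"
      using AE_lborel_singleton[of 0] AE_lborel_singleton[of "2 * pi"]
      by eventually_elim (auto simp: indicator_def)
  qed
  also have "\<dots> = (LINT t|circle_measure. F t)"
    using lebesgue_on_iff_lborel(2)[OF _ set_borel_measurable_continuous_open[OF assms]]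
    by (simp add: set_lebesgue_integral_def)
  finally show ?thesis .
qed

text \<open>Change of variables by \<open>exp\<close>, whose Jacobian is
  \<open>(exp (Re w))\<^sup>2\<close>, then Fubini in the strip. The slit missed by the strip is
  discarded by \<open>AE_Im_neq\<close>.\<close>

lemma polar_integral:
  fixes F :: "complex \<Rightarrow> 'b::euclidean_space"
  assumes \<rho>: "0 \<le> \<rho>" and F: "continuous_on (annulus 0) F"
  shows "integrable (lebesgue_on (annulus \<rho>)) F \<longleftrightarrow>
      set_integrable lborel (log_strip \<rho>) (\<lambda>w. (exp (Re w))\<^sup>2 *\<^sub>R F (exp w))"
    and "integrable (lebesgue_on (annulus \<rho>)) F \<Longrightarrow>
      set_integrable lborel {s. \<rho> < exp s \<and> s < 0} (\<lambda>s. (exp s)\<^sup>2 *\<^sub>R (LINT t|circle_measure. F (pol s t)))"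
    and "integrable (lebesgue_on (annulus \<rho>)) F \<Longrightarrow>
      (LINT z|lebesgue_on (annulus \<rho>). F z) =
      set_lebesgue_integral lborel {s. \<rho> < exp s \<and> s < 0} (\<lambda>s. (exp s)\<^sup>2 *\<^sub>R (LINT t|circle_measure. F (pol s t)))"
proof -
  let ?A = "annulus \<rho>" and ?S = "log_strip \<rho>"
  have A0: "?A \<subseteq> annulus 0" using \<rho> by (auto simp: mem_annulus)
  have hol: "exp holomorphic_on ?S" by (intro holomorphic_intros)
  have img: "exp ` ?S \<subseteq> ?A" by (auto simp: log_strip_def mem_annulus)
  have oimg: "open (exp ` ?S)" by (rule open_holomorphic_image[OF open_log_strip hol inj_on_exp_log_strip])
  have mA: "set_borel_measurable borel ?A F" and mS: "set_borel_measurable borel (exp ` ?S) F"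
    using continuous_on_subset[OF F A0] continuous_on_subset[OF continuous_on_subset[OF F A0] img] oimg open_annulus
    by (auto intro!: set_borel_measurable_continuous_open)
  have AE: "AE z in lborel. indicator ?A z *\<^sub>R F z = indicator (exp ` ?S) z *\<^sub>R F z"
    using AE_Im_neq[of 0] by eventually_elim (use exp_log_strip[OF \<rho>] img in \<open>auto simp: indicator_def\<close>)
  have d: "deriv exp z = exp z" for z :: complex by (auto intro!: DERIV_imp_deriv derivative_eq_intros)
  have i1: "set_integrable lborel ?A F \<longleftrightarrow> set_integrable lborel (exp ` ?S) F"
    unfolding set_integrable_def using mA mS AE by (intro integrable_cong_AE) (auto simp: set_borel_measurable_def)
  have i2: "set_lebesgue_integral lborel ?A F = set_lebesgue_integral lborel (exp ` ?S) F"
    unfolding set_lebesgue_integral_def using mA mS AE by (intro integral_cong_AE) (auto simp: set_borel_measurable_def)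
  note cov = set_integral_holomorphic_image[OF open_log_strip hol inj_on_exp_log_strip mS]
  show equiv: "integrable (lebesgue_on ?A) F \<longleftrightarrow> set_integrable lborel ?S (\<lambda>w. (exp (Re w))\<^sup>2 *\<^sub>R F (exp w))"
    using lebesgue_on_iff_lborel(1)[OF _ mA] i1 cov(1) open_annulus by (simp add: d)
  assume "integrable (lebesgue_on ?A) F"
  then have int: "set_integrable lborel ?S (\<lambda>w. (exp (Re w))\<^sup>2 *\<^sub>R F (exp w))" using equiv by simp
  have eq: "(LINT z|lebesgue_on ?A. F z) = set_lebesgue_integral lborel ?S (\<lambda>w. (exp (Re w))\<^sup>2 *\<^sub>R F (exp w))"
    using lebesgue_on_iff_lborel(2)[OF _ mA] i2 cov(2) open_annulus by (simp add: d)
  let ?X = "{s. \<rho> < exp s \<and> s < 0}"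
  have inner: "(LINT t|lborel. indicator ?S (Complex s t) *\<^sub>R ((exp (Re (Complex s t)))\<^sup>2 *\<^sub>R F (exp (Complex s t))))
     = indicator ?X s *\<^sub>R ((exp s)\<^sup>2 *\<^sub>R (LINT t|circle_measure. F (pol s t)))" for s
  proof (cases "s \<in> ?X")
    case True
    have c: "continuous_on {0..2*pi} (\<lambda>t. F (pol s t))"
      by (rule continuous_on_compose2[OF F]) (use True in \<open>auto intro!: continuous_intros pol_annulus\<close>)
    have "(LINT t|lborel. indicator ?S (Complex s t) *\<^sub>R ((exp (Re (Complex s t)))\<^sup>2 *\<^sub>R F (exp (Complex s t))))
      = (LINT t|lborel. (exp s)\<^sup>2 *\<^sub>R (indicator {0<..<2*pi} t *\<^sub>R F (pol s t)))"
      using True by (intro Bochner_Integration.integral_cong) (auto simp: log_strip_def exp_Complex indicator_def)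
    also have "\<dots> = (exp s)\<^sup>2 *\<^sub>R (LINT t|circle_measure. F (pol s t))"
      by (simp only: integral_scaleR_right integral_circle_eq_lborel[OF c])
    finally show ?thesis using True by simp
  next
    case False
    then have "Complex s t \<notin> ?S" for t by (auto simp: log_strip_def)
    then show ?thesis using False by simp
  qed
  note fub = integral_lborel_complex[OF int[unfolded set_integrable_def], unfolded inner]
  show "set_integrable lborel ?X (\<lambda>s. (exp s)\<^sup>2 *\<^sub>R (LINT t|circle_measure. F (pol s t)))"
    using fub(2) by (simp add: set_integrable_def)
  show "(LINT z|lebesgue_on ?A. F z) = set_lebesgue_integral lborel ?X (\<lambda>s. (exp s)\<^sup>2 *\<^sub>R (LINT t|circle_measure. F (pol s t)))"
    unfolding eq using fub(1) by (simp add: set_lebesgue_integral_def)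
qed

section \<open>Radial and angular derivatives\<close>

text \<open>This is r times the unit radial derivative: in the coordinates of \<open>pol\<close> it
  is the derivative in \<open>s\<close>, as \<open>ang\<close> is the derivative in
  \<open>t\<close>. With these two, powers of the radius disappear from the energy.\<close>

definition rad :: "(complex \<Rightarrow> 'b::real_normed_vector) \<Rightarrow> complex \<Rightarrow> 'b" where
  "rad G z = Re z *\<^sub>R pd_x G z + Im z *\<^sub>R pd_y G z"

definition ang :: "(complex \<Rightarrow> 'b::real_normed_vector) \<Rightarrow> complex \<Rightarrow> 'b" where
  "ang G z = Re z *\<^sub>R pd_y G z - Im z *\<^sub>R pd_x G z"

lemma rad_ang_norm:
  fixes G :: "complex \<Rightarrow> 'b::real_inner"
  shows "(norm (rad G z))\<^sup>2 + (norm (ang G z))\<^sup>2 = (norm z)\<^sup>2 * ((norm (pd_x G z))\<^sup>2 + (norm (pd_y G z))\<^sup>2)"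
  unfolding rad_def ang_def by (rule norm_grad_compose)

lemma rad_ang_inner:
  fixes G H :: "complex \<Rightarrow> real"
  shows "rad G z * rad H z + ang G z * ang H z = (norm z)\<^sup>2 * (pd_x G z * pd_x H z + pd_y G z * pd_y H z)"
  unfolding rad_def ang_def cmod_power2 real_scaleR_def by algebra

lemma continuous_rad_ang:
  assumes "C1_on U G"
  shows "continuous_on U (rad G)" "continuous_on U (ang G)"
  unfolding rad_def ang_def by (intro continuous_intros C1_onD[OF assms])+

lemma has_vector_derivative_pol_s:
  assumes "C1_on U G" "pol s t \<in> U"
  shows "((\<lambda>s. G (pol s t)) has_vector_derivative rad G (pol s t)) (at s within S)"
proof -
  have "((\<lambda>s. pol s t) has_derivative (\<lambda>h. h *\<^sub>R pol s t)) (at s within S)"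
    unfolding pol_def by (auto intro!: derivative_eq_intros simp: scaleR_conv_of_real)
  from has_derivative_compose[OF this C1_onD(1)[OF assms, unfolded has_grad_def]]
  show ?thesis by (simp add: has_vector_derivative_def rad_def scaleR_add_right)
qed

lemma has_vector_derivative_pol_t:
  assumes "C1_on U G" "pol s t \<in> U"
  shows "((\<lambda>t. G (pol s t)) has_vector_derivative ang G (pol s t)) (at t within S)"
proof -
  have "((\<lambda>t. exp (\<i> * complex_of_real t)) has_vector_derivative (\<i> * exp (\<i> * of_real t))) (at t within S)"
    by (auto intro!: derivative_eq_intros has_vector_derivative_real_field)
  from has_vector_derivative_mult_right[OF this, of "of_real (exp s)"]
  have "((\<lambda>t. pol s t) has_derivative (\<lambda>h. h *\<^sub>R (\<i> * pol s t))) (at t within S)"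
    by (simp add: pol_def cis_conv_exp has_vector_derivative_def mult_ac)
  from has_derivative_compose[OF this C1_onD(1)[OF assms, unfolded has_grad_def]]
  show ?thesis by (simp add: has_vector_derivative_def ang_def scaleR_add_right scaleR_diff_right algebra_simps)
qed

abbreviation circle_coeff :: "(complex \<Rightarrow> complex) \<Rightarrow> real \<Rightarrow> int \<Rightarrow> complex" where
  "circle_coeff G s n \<equiv> fourier_coeff (\<lambda>z. G (of_real (exp s) * z)) n"

lemma circle_coeff_eq: "circle_coeff G s n = (LINT t|circle_measure. G (pol s t) * cis (- of_int n * t)) / of_real (2 * pi)"
  by (simp add: fourier_coeff_def pol_def)

lemma continuous_on_dilated_circle:
  assumes "continuous_on (annulus 0) F" "s < 0"
  shows "continuous_on (sphere 0 1) (\<lambda>z. F (of_real (exp s) * z))"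
  by (rule continuous_on_compose2[OF assms(1)]) (use assms(2) in \<open>auto intro!: continuous_intros simp: mem_annulus norm_mult\<close>)

lemma continuous_pol_t:
  assumes "continuous_on (annulus 0) F" "s < 0"
  shows "continuous_on S (\<lambda>t. F (pol s t))"
  by (rule continuous_on_compose2[OF assms(1)]) (use assms(2) in \<open>auto intro!: continuous_intros pol_annulus\<close>)

lemma circle_coeff_integral:
  assumes "continuous_on (annulus 0) F" "s < 0"
  shows "circle_coeff F s n = integral {0..2*pi} (\<lambda>t. F (pol s t) * cis (- of_int n * t)) / of_real (2 * pi)"
  unfolding circle_coeff_eq
  by (subst lebesgue_integral_eq_integral) (auto intro!: circle_integrable continuous_intros continuous_pol_t assms sets_borel_lebesgue)

text \<open>Integration by parts over one period; the boundary terms cancel because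
  \<open>G (pol s t)\<close> and the exponential are both periodic in \<open>t\<close>.\<close>

lemma circle_coeff_ang:
  assumes G: "C1_on (annulus 0) G" and s: "s < 0"
  shows "circle_coeff (ang G) s n = \<i> * of_int n * circle_coeff G s n"
proof -
  let ?e = "\<lambda>t. cis (- of_int n * t)"
  have de: "(?e has_vector_derivative (- \<i> * of_int n * ?e t)) (at t within S)" for t S
    unfolding cis_conv_exp by (auto intro!: derivative_eq_intros has_vector_derivative_real_field)
  have "((\<lambda>t. G (pol s t) * (- \<i> * of_int n * ?e t) + ang G (pol s t) * ?e t) has_integral
     (G (pol s (2*pi)) * ?e (2*pi) - G (pol s 0) * ?e 0)) {0..2*pi}"
    by (rule fundamental_theorem_of_calculus, simp, rule has_vector_derivative_mult[OF has_vector_derivative_pol_t[OF G pol_annulus[OF s]] de])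
  moreover have "?e (2*pi) = 1"
    using cis_multiple_2pi[of "of_int (- n)"] by (simp add: mult.commute mult.left_commute)
  then have "G (pol s (2*pi)) * ?e (2*pi) - G (pol s 0) * ?e 0 = 0"
    by (simp only: pol_2pi) simp
  ultimately have 0: "integral {0..2*pi} (\<lambda>t. G (pol s t) * (- \<i> * of_int n * ?e t) + ang G (pol s t) * ?e t) = 0"
    by (simp add: integral_unique)
  have i1: "(\<lambda>t. G (pol s t) * (- \<i> * of_int n * ?e t)) integrable_on {0..2*pi}"
    and i2: "(\<lambda>t. ang G (pol s t) * ?e t) integrable_on {0..2*pi}"
    by (intro integrable_continuous_real continuous_intros continuous_pol_t C1_onD(4)[OF G] continuous_rad_ang(2)[OF G] s)+
  have "integral {0..2*pi} (\<lambda>t. G (pol s t) * (- \<i> * of_int n * ?e t)) = - \<i> * of_int n * integral {0..2*pi} (\<lambda>t. G (pol s t) * ?e t)"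
    by (subst integral_mult_right[symmetric]) (simp add: mult_ac)
  then have "integral {0..2*pi} (\<lambda>t. ang G (pol s t) * ?e t) = \<i> * of_int n * integral {0..2*pi} (\<lambda>t. G (pol s t) * ?e t)"
    using 0 integral_add[OF i1 i2] by (simp add: add_eq_0_iff)
  then show ?thesis
    by (simp only: circle_coeff_integral[OF C1_onD(4)[OF G] s] circle_coeff_integral[OF continuous_rad_ang(2)[OF G] s])
      (simp add: field_simps)
qed

lemma continuous_on_pol_prod:
  assumes "continuous_on (annulus 0) F"
  shows "continuous_on ({..<0} \<times> S) (\<lambda>p. F (pol (fst p) (snd p)))"
  by (rule continuous_on_compose2[OF assms]) (auto intro!: continuous_intros pol_annulus)

text \<open>Differentiation under the integral sign, justified by joint continuity of
  \<open>rad G (pol s t)\<close> for \<open>s < 0\<close>.\<close>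

lemma circle_coeff_rad:
  assumes G: "C1_on (annulus 0) G" and s: "s < 0"
  shows "((\<lambda>s. circle_coeff G s n) has_vector_derivative circle_coeff (rad G) s n) (at s)"
proof -
  have "((\<lambda>s. integral (cbox 0 (2*pi)) (\<lambda>t. G (pol s t) * cis (- of_int n * t))) has_vector_derivative
      integral (cbox 0 (2*pi)) (\<lambda>t. rad G (pol s t) * cis (- of_int n * t))) (at s within {..<0})"
  proof (rule leibniz_rule_vector_derivative)
    show "((\<lambda>s. G (pol s t) * cis (- of_int n * t)) has_vector_derivative rad G (pol x t) * cis (- of_int n * t)) (at x within {..<0})"
      if "x \<in> {..<0}" for x t
      by (rule has_vector_derivative_mult_left has_vector_derivative_pol_s[OF G])+ (use that in \<open>auto intro: pol_annulus\<close>)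
    show "(\<lambda>t. G (pol x t) * cis (- of_int n * t)) integrable_on cbox 0 (2 * pi)" if "x \<in> {..<0}" for x
      using that by (intro integrable_continuous continuous_intros continuous_pol_t C1_onD(4)[OF G]) auto
    show "continuous_on ({..<0} \<times> cbox 0 (2 * pi)) (\<lambda>(x, t). rad G (pol x t) * cis (- of_int n * t))"
      unfolding case_prod_beta
      by (intro continuous_intros continuous_on_pol_prod continuous_rad_ang(1)[OF G])
  qed (use s in auto)
  then have "((\<lambda>s. integral {0..2*pi} (\<lambda>t. G (pol s t) * cis (- of_int n * t)) / of_real (2 * pi)) has_vector_derivative
      integral {0..2*pi} (\<lambda>t. rad G (pol s t) * cis (- of_int n * t)) / of_real (2 * pi)) (at s)"
    using s by (simp add: at_within_open[of s "{..<0}"] has_vector_derivative_divide)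
  then have "((\<lambda>s. circle_coeff G s n) has_vector_derivative integral {0..2*pi} (\<lambda>t. rad G (pol s t) * cis (- of_int n * t)) / of_real (2 * pi)) (at s)"
    by (rule has_vector_derivative_transform_within_open[of _ _ _ "{..<0}"])
      (use s in \<open>auto simp: circle_coeff_integral[OF C1_onD(4)[OF G]]\<close>)
  then show ?thesis by (simp add: circle_coeff_integral[OF continuous_rad_ang(1)[OF G] s])
qed

lemma continuous_circle_coeff:
  assumes F: "continuous_on (annulus 0) F"
  shows "continuous_on {..<0} (\<lambda>s. circle_coeff F s n)"
proof -
  have "continuous_on {..<0} (\<lambda>s. integral (cbox 0 (2*pi)) (\<lambda>t. F (pol s t) * cis (- of_int n * t)))"
    by (rule integral_continuous_on_param) (auto simp: case_prod_beta intro!: continuous_intros continuous_on_pol_prod F)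
  then have "continuous_on {..<0} (\<lambda>s. integral {0..2*pi} (\<lambda>t. F (pol s t) * cis (- of_int n * t)) / of_real (2 * pi))"
    by (intro continuous_intros) auto
  then show ?thesis
    by (rule continuous_on_eq) (simp add: circle_coeff_integral[OF F])
qed

section \<open>Fourier coefficients of maps of finite energy\<close>

abbreviation grad_sq :: "(complex \<Rightarrow> 'b::real_normed_vector) \<Rightarrow> complex \<Rightarrow> real" where
  "grad_sq G z \<equiv> (norm (pd_x G z))\<^sup>2 + (norm (pd_y G z))\<^sup>2"

text \<open>Logarithmic radii increasing to 0. Dominated convergence takes a sequence rather than a
  real parameter; the offset 2 keeps every value strictly above -1, inside the range of
  \<open>energy_domination\<close>.\<close>

definition rsq :: "nat \<Rightarrow> real" where "rsq k = - 1 / (real k + 2)"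

lemma rsq: "-1 \<le> rsq k" "rsq k < 0" "-1 < rsq k"
  by (auto simp: rsq_def field_simps)

lemma rsq_mono: "j \<le> k \<Longrightarrow> rsq j \<le> rsq k"
  by (simp add: rsq_def frac_le)

lemma rsq_lim: "rsq \<longlonglongrightarrow> 0"
proof -
  have "(\<lambda>k. - (1 / real (k + 2))) \<longlonglongrightarrow> - 0"
    by (intro tendsto_minus LIMSEQ_ignore_initial_segment[OF lim_1_over_n])
  then show ?thesis by (simp add: rsq_def[abs_def] add.commute)
qed

lemma rsq_exceeds:
  assumes "s < 0" obtains k where "s \<le> rsq k"
proof -
  have "eventually (\<lambda>k. s < rsq k) sequentially" using rsq_lim assms by (rule order_tendstoD)
  then show thesis using that by (auto simp: eventually_sequentially intro: less_imp_le)
qed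

text \<open>The Jacobian \<open>(exp s)\<^sup>2\<close> is exactly absorbed by
  \<open>rad_ang_norm\<close>, so in logarithmic coordinates the energy carries no weight.\<close>

lemma polar_energy:
  assumes G: "C1_on (annulus 0) (G :: complex \<Rightarrow> 'b::euclidean_space)" and \<rho>: "0 \<le> \<rho>"
    and E: "integrable (lebesgue_on (annulus \<rho>)) (grad_sq G)"
  shows "set_integrable lborel {s. \<rho> < exp s \<and> s < 0}
       (\<lambda>s. LINT t|circle_measure. (norm (rad G (pol s t)))\<^sup>2 + (norm (ang G (pol s t)))\<^sup>2)"
    and "(LINT z|lebesgue_on (annulus \<rho>). grad_sq G z) = set_lebesgue_integral lborel {s. \<rho> < exp s \<and> s < 0}
       (\<lambda>s. LINT t|circle_measure. (norm (rad G (pol s t)))\<^sup>2 + (norm (ang G (pol s t)))\<^sup>2)"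
proof -
  have c: "continuous_on (annulus 0) (grad_sq G)" by (intro continuous_intros C1_onD[OF G])
  have eq: "(exp s)\<^sup>2 *\<^sub>R (LINT t|circle_measure. grad_sq G (pol s t))
      = (LINT t|circle_measure. (norm (rad G (pol s t)))\<^sup>2 + (norm (ang G (pol s t)))\<^sup>2)" for s
    by (simp add: rad_ang_norm)
  show "set_integrable lborel {s. \<rho> < exp s \<and> s < 0}
       (\<lambda>s. LINT t|circle_measure. (norm (rad G (pol s t)))\<^sup>2 + (norm (ang G (pol s t)))\<^sup>2)"
    using polar_integral(2)[OF \<rho> c E] unfolding eq .
  show "(LINT z|lebesgue_on (annulus \<rho>). grad_sq G z) = set_lebesgue_integral lborel {s. \<rho> < exp s \<and> s < 0}
       (\<lambda>s. LINT t|circle_measure. (norm (rad G (pol s t)))\<^sup>2 + (norm (ang G (pol s t)))\<^sup>2)"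
    using polar_integral(3)[OF \<rho> c E] unfolding eq .
qed

text \<open>The derivative of \<open>\<bar>n\<bar> \<bar>c\<^sub>n(s)\<bar>\<^sup>2\<close> is at most the \<open>n\<close>-th Fourier mode \<open>\<bar>c\<^sub>n'\<bar>\<^sup>2 + n\<^sup>2 \<bar>c\<^sub>n\<bar>\<^sup>2\<close> of the
  energy density, and these are summed by Bessel's inequality.\<close>
lemma energy_domination:
  fixes G :: "complex \<Rightarrow> complex"
  assumes G: "C1_on (annulus 0) G" and E: "integrable (lebesgue_on (annulus (exp (-1)))) (grad_sq G)"
  obtains D :: "int \<Rightarrow> real" where "D summable_on UNIV"
    "\<And>n s. -1 \<le> s \<Longrightarrow> s < 0 \<Longrightarrow> \<bar>of_int n\<bar> * (norm (circle_coeff G s n))\<^sup>2 \<le> D n"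
proof -
  note cR = continuous_rad_ang(1)[OF G] and cA = continuous_rad_ang(2)[OF G] and cG = C1_onD(4)[OF G]
  \<comment> \<open>The \<open>n\<close>-th Fourier mode of the energy on the circle of radius
    \<open>exp s\<close>; by Bessel these modes sum to at most
    \<open>En s / (2 * pi)\<close>.\<close>
  define e where "e n s = (norm (circle_coeff (rad G) s n))\<^sup>2 + (norm (circle_coeff (ang G) s n))\<^sup>2" for n s
  define En where "En s = (LINT t|circle_measure. (norm (rad G (pol s t)))\<^sup>2 + (norm (ang G (pol s t)))\<^sup>2)" for s
  have e0: "e n s \<ge> 0" for n s by (simp add: e_def)
  have En0: "En s \<ge> 0" for s unfolding En_def by (intro integral_nonneg_AE) simp
  have ce: "continuous_on {-1..s} (e n)" if "s < 0" for n s
    unfolding e_def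
    by (intro continuous_intros continuous_on_subset[OF continuous_circle_coeff[OF cR]]
        continuous_on_subset[OF continuous_circle_coeff[OF cA]]) (use that in auto)
  have bes: "(\<Sum>n\<in>N. e n s) \<le> En s / (2 * pi)" if "finite N" "s < 0" for N s
  proof -
    have "2 * pi * (\<Sum>n\<in>N. (norm (circle_coeff F s n))\<^sup>2) \<le> (LINT t|circle_measure. (norm (F (pol s t)))\<^sup>2)"
      if "continuous_on (annulus 0) F" for F :: "complex \<Rightarrow> complex"
      using bessel[OF continuous_on_dilated_circle[OF that \<open>s < 0\<close>] \<open>finite N\<close>] by (simp add: pol_def)
    from this[OF cR] this[OF cA]
    have "2 * pi * (\<Sum>n\<in>N. e n s) \<le> (LINT t|circle_measure. (norm (rad G (pol s t)))\<^sup>2) + (LINT t|circle_measure. (norm (ang G (pol s t)))\<^sup>2)"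
      by (simp add: e_def sum.distrib ring_distribs)
    also have "\<dots> = En s" unfolding En_def
      by (subst Bochner_Integration.integral_add) (auto intro!: circle_integrable continuous_intros continuous_pol_t cR cA that)
    finally show ?thesis by (simp add: field_simps)
  qed
  have X: "{s::real. exp (-1) < exp s \<and> s < 0} = {-1<..<0}" by auto
  have iE: "set_integrable lborel {-1<..<0} En"
    using polar_energy(1)[OF G _ E] unfolding X En_def by simp
  define C where "C = set_lebesgue_integral lborel {-1<..<0} En"
  define I where "I n s = (LINT x|lborel. indicator {-1..s} x *\<^sub>R e n x)" for n s
  have ie: "integrable lborel (\<lambda>x. indicator {-1..s} x *\<^sub>R e n x)" if "s < 0" for n s
    by (intro borel_integrable_compact ce that) simp
  have sumI: "(\<Sum>n\<in>N. I n s) \<le> C / (2 * pi)" if "finite N" "s < 0" for N s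
  proof -
    have "(\<Sum>n\<in>N. I n s) = (LINT x|lborel. (\<Sum>n\<in>N. indicator {-1..s} x *\<^sub>R e n x))"
      unfolding I_def by (rule Bochner_Integration.integral_sum[symmetric]) (rule ie[OF \<open>s < 0\<close>])
    also have "\<dots> \<le> (LINT x|lborel. indicator {-1<..<0} x *\<^sub>R (En x / (2 * pi)))"
    proof (rule integral_mono_AE)
      show "integrable lborel (\<lambda>x. \<Sum>n\<in>N. indicator {-1..s} x *\<^sub>R e n x)"
        by (intro Bochner_Integration.integrable_sum ie that)
      have "set_integrable lborel {-1<..<0} (\<lambda>x. En x / (2 * pi))" using iE by simp
      then show "integrable lborel (\<lambda>x. indicator {-1<..<0} x *\<^sub>R (En x / (2 * pi)))"
        by (simp only: set_integrable_def)
      show "AE x in lborel. (\<Sum>n\<in>N. indicator {-1..s} x *\<^sub>R e n x) \<le> indicator {-1<..<0} x *\<^sub>R (En x / (2 * pi))"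
        using AE_lborel_singleton[of "-1"]
      proof eventually_elim
        case (elim x)
        show ?case
        proof (cases "x \<in> {-1..s}")
          case True
          then have "x < 0" "x \<in> {-1<..<0}" using \<open>s < 0\<close> elim by auto
          then show ?thesis using bes[OF \<open>finite N\<close> \<open>x < 0\<close>] True by simp
        next
          case False
          then have z: "indicat_real {-1..s} x = 0" by (rule indicator_simps(2))
          show ?thesis unfolding z using En0[of x] by (auto simp: indicator_def)
        qed
      qed
    qed
    also have "\<dots> = C / (2 * pi)"
      unfolding C_def set_lebesgue_integral_def by simp
    finally show ?thesis .
  qed
  have Imono: "I n s \<le> I n s'" if "s \<le> s'" "s' < 0" for n s s'
    unfolding I_def using that by (intro integral_mono ie) (auto simp: indicator_def e0)
  have "\<exists>L. (\<lambda>k. I n (rsq k)) \<longlonglongrightarrow> L \<and> (\<forall>k. I n (rsq k) \<le> L)" for n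
  proof -
    have "incseq (\<lambda>k. I n (rsq k))" by (intro monoI Imono rsq_mono rsq)
    moreover have "\<forall>k. I n (rsq k) \<le> C / (2 * pi)" using sumI[of "{n}"] rsq(2) by simp
    ultimately show ?thesis by (rule incseq_convergent) blast
  qed
  then obtain L where L: "\<And>n. (\<lambda>k. I n (rsq k)) \<longlonglongrightarrow> L n" "\<And>n k. I n (rsq k) \<le> L n" by metis
  have IL: "I n s \<le> L n" if s: "s < 0" for n s
  proof -
    obtain k where "s \<le> rsq k" using rsq_exceeds[OF s] .
    then show ?thesis using Imono[of s "rsq k" n] rsq(2)[of k] L(2)[of n k] by linarith
  qed
  \<comment> \<open>The value at \<open>s = -1\<close> plus the whole energy of the mode dominates
    the value at any later \<open>s < 0\<close>. At -1 the weight \<open>\<bar>n\<bar>\<close> is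
    replaced by its square, which is what \<open>ang\<close> produces.\<close>
  define D where "D n = (norm (circle_coeff (ang G) (-1) n))\<^sup>2 + L n" for n
  have L0: "L n \<ge> 0" for n
  proof -
    have "I n (rsq 0) \<ge> 0" unfolding I_def by (intro integral_nonneg_AE) (simp add: e0)
    then show ?thesis using L(2)[of n 0] by linarith
  qed
  have "(\<Sum>n\<in>N. D n) \<le> En (-1) / (2 * pi) + C / (2 * pi)" if "finite N" for N
  proof -
    have "(\<Sum>n\<in>N. (norm (circle_coeff (ang G) (-1) n))\<^sup>2) \<le> (\<Sum>n\<in>N. e n (-1))"
      by (intro sum_mono) (simp add: e_def)
    also have "\<dots> \<le> En (-1) / (2 * pi)" by (rule bes[OF that]) simp
    finally have 1: "(\<Sum>n\<in>N. (norm (circle_coeff (ang G) (-1) n))\<^sup>2) \<le> En (-1) / (2 * pi)" .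
    have "(\<lambda>k. \<Sum>n\<in>N. I n (rsq k)) \<longlonglongrightarrow> (\<Sum>n\<in>N. L n)" by (intro tendsto_sum L)
    then have "(\<Sum>n\<in>N. L n) \<le> C / (2 * pi)"
      by (rule LIMSEQ_le_const2) (use sumI[OF that rsq(2)] in auto)
    with 1 show ?thesis by (simp add: D_def sum.distrib)
  qed
  then have "D summable_on UNIV"
    by (intro nonneg_bdd_above_summable_on bdd_aboveI2) (auto simp: D_def L0)
  moreover have "\<bar>of_int n\<bar> * (norm (circle_coeff G s n))\<^sup>2 \<le> D n" if s: "-1 \<le> s" "s < 0" for n s
  proof -
    let ?c = "\<lambda>s. circle_coeff G s n" and ?d = "\<lambda>s. circle_coeff (rad G) s n"
    have na: "norm (circle_coeff (ang G) x n) = \<bar>of_int n\<bar> * norm (?c x)" if "x < 0" for x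
      by (simp add: circle_coeff_ang[OF G that] norm_mult)
    have FTC: "(LINT x|lborel. indicator {-1..s} x *\<^sub>R (\<bar>of_int n\<bar> * (2 * (?c x \<bullet> ?d x))))
       = \<bar>of_int n\<bar> * (norm (?c s))\<^sup>2 - \<bar>of_int n\<bar> * (norm (?c (-1)))\<^sup>2"
    proof (rule integral_FTC_atLeastAtMost[OF s(1)])
      show "continuous_on {-1..s} (\<lambda>x. \<bar>of_int n\<bar> * (2 * (?c x \<bullet> ?d x)))"
        by (intro continuous_intros continuous_on_subset[OF continuous_circle_coeff[OF cR]]
        continuous_on_subset[OF continuous_circle_coeff[OF cG]]) (use s in auto)
      fix x assume x: "-1 \<le> x" "x \<le> s"
      then have "x < 0" using s by simp
      from has_vector_derivative_at_within[OF circle_coeff_rad[OF G this, of n], of "{-1..s}"]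
      have hv: "(?c has_derivative (\<lambda>h. h *\<^sub>R ?d x)) (at x within {-1..s})"
        unfolding has_vector_derivative_def .
      have "((\<lambda>x. ?c x \<bullet> ?c x) has_derivative (\<lambda>h. ?c x \<bullet> (h *\<^sub>R ?d x) + (h *\<^sub>R ?d x) \<bullet> ?c x)) (at x within {-1..s})"
        by (rule has_derivative_inner[OF hv hv])
      then have "((\<lambda>x. \<bar>of_int n\<bar> * (?c x \<bullet> ?c x)) has_derivative (\<lambda>h. \<bar>of_int n\<bar> * (?c x \<bullet> (h *\<^sub>R ?d x) + (h *\<^sub>R ?d x) \<bullet> ?c x))) (at x within {-1..s})"
        by (rule has_derivative_mult_right)
      then show "((\<lambda>x. \<bar>of_int n\<bar> * (norm (?c x))\<^sup>2) has_vector_derivative \<bar>of_int n\<bar> * (2 * (?c x \<bullet> ?d x))) (at x within {-1..s})"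
        unfolding has_vector_derivative_def power2_norm_eq_inner
        by (rule has_derivative_eq_rhs) (simp add: fun_eq_iff inner_commute algebra_simps)
    qed
    have le: "(LINT x|lborel. indicator {-1..s} x *\<^sub>R (\<bar>of_int n\<bar> * (2 * (?c x \<bullet> ?d x)))) \<le> I n s"
      unfolding I_def
    proof (rule integral_mono[OF borel_integrable_compact ie[OF s(2)]])
      show "continuous_on {-1..s} (\<lambda>x. \<bar>of_int n\<bar> * (2 * (?c x \<bullet> ?d x)))"
        by (intro continuous_intros continuous_on_subset[OF continuous_circle_coeff[OF cR]]
        continuous_on_subset[OF continuous_circle_coeff[OF cG]]) (use s in auto)
      fix x
      show "indicator {-1..s} x *\<^sub>R (\<bar>of_int n\<bar> * (2 * (?c x \<bullet> ?d x))) \<le> indicator {-1..s} x *\<^sub>R e n x"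
      proof (cases "x \<in> {-1..s}")
        case True
        then have x: "x < 0" using s by simp
        have "\<bar>of_int n\<bar> * (2 * (?c x \<bullet> ?d x)) \<le> \<bar>of_int n\<bar> * (2 * (norm (?c x) * norm (?d x)))"
          by (intro mult_left_mono norm_cauchy_schwarz) auto
        also have "\<dots> = 2 * norm (?d x) * norm (circle_coeff (ang G) x n)" by (simp add: na[OF x])
        also have "\<dots> \<le> e n x" unfolding e_def by (rule sum_squares_bound)
        finally show ?thesis using True by simp
      qed simp
    qed simp
    have "\<bar>of_int n\<bar> * (norm (?c s))\<^sup>2 \<le> \<bar>of_int n\<bar> * (norm (?c (-1)))\<^sup>2 + L n"
      using IL[OF s(2), of n] FTC le by linarith
    also have "\<bar>of_int n\<bar> * (norm (?c (-1)))\<^sup>2 \<le> (norm (circle_coeff (ang G) (-1) n))\<^sup>2"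
    proof -
      have "\<bar>real_of_int n\<bar> \<le> \<bar>real_of_int n\<bar>\<^sup>2"
      proof (cases "n = 0")
        case False
        then have "1 \<le> \<bar>real_of_int n\<bar>" by linarith
        then show ?thesis using self_le_power[of "\<bar>real_of_int n\<bar>" 2] by simp
      qed simp
      then show ?thesis unfolding na[of "-1", simplified] power_mult_distrib by (rule mult_right_mono) simp
    qed
    finally show ?thesis by (simp add: D_def)
  qed
  ultimately show thesis by (rule that)
qed

text \<open>The series is an integral for the counting measure, where the usual dominated
  convergence theorem applies.\<close>

lemma infsum_dominated_convergence:
  fixes a :: "nat \<Rightarrow> int \<Rightarrow> real"
  assumes D: "D summable_on UNIV" and b: "\<And>k n. \<bar>a k n\<bar> \<le> D n" and l: "\<And>n. (\<lambda>k. a k n) \<longlonglongrightarrow> c n"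
  shows "(\<lambda>k. \<Sum>\<^sub>\<infinity>n. a k n) \<longlonglongrightarrow> (\<Sum>\<^sub>\<infinity>n. c n)"
proof -
  have D0: "D n \<ge> 0" for n using b[of 0 n] by linarith
  have iD: "integrable (count_space UNIV) D"
    using D D0 abs_summable_equivalent[of D UNIV] unfolding Infinite_Set_Sum.abs_summable_on_def by simp
  have cb: "\<bar>c n\<bar> \<le> D n" for n
    by (rule LIMSEQ_le_const2[OF tendsto_rabs[OF l]]) (use b in auto)
  have conv: "(LINT n|count_space UNIV. u n) = (\<Sum>\<^sub>\<infinity>n. u n)" if "\<And>n. \<bar>u n\<bar> \<le> D n" for u :: "int \<Rightarrow> real"
  proof -
    have "integrable (count_space UNIV) u"
      by (rule Bochner_Integration.integrable_bound[OF iD]) (use that D0 in auto)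
    then have "Infinite_Set_Sum.abs_summable_on u UNIV" unfolding Infinite_Set_Sum.abs_summable_on_def .
    then show ?thesis using infsetsum_infsum[of u UNIV] by (simp add: infsetsum_def)
  qed
  have "(\<lambda>k. LINT n|count_space UNIV. a k n) \<longlonglongrightarrow> (LINT n|count_space UNIV. c n)"
    by (rule integral_dominated_convergence[OF _ _ iD]) (use b l in auto)
  then show ?thesis by (simp add: conv[OF b] conv[OF cb])
qed

text \<open>On each circle Parseval turns the integral into a series, and
  \<open>energy_domination\<close> for \<open>G\<close> and for \<open>H\<close> dominates its terms
  uniformly in \<open>k\<close>. The boundary functions enter through their Fourier coefficients
  alone, so they may be rough.\<close>

lemma pairing_limit:
  fixes G H g h :: "complex \<Rightarrow> complex"
  assumes G: "C1_on (annulus 0) G" "integrable (lebesgue_on (annulus (exp (-1)))) (grad_sq G)"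
    and H: "C1_on (annulus 0) H" "integrable (lebesgue_on (annulus (exp (-1)))) (grad_sq H)"
    and lg: "\<And>n. (\<lambda>k. circle_coeff G (rsq k) n) \<longlonglongrightarrow> fourier_coeff g n"
    and lh: "\<And>n. (\<lambda>k. circle_coeff H (rsq k) n) \<longlonglongrightarrow> fourier_coeff h n"
  shows "(\<lambda>n. \<bar>real_of_int n\<bar> * (norm (fourier_coeff g n))\<^sup>2) summable_on UNIV"
    and "(\<lambda>k. LINT t|circle_measure. ang G (pol (rsq k) t) \<bullet> H (pol (rsq k) t)) \<longlonglongrightarrow> dtheta_pairing g h"
proof -
  obtain D1 where D1: "D1 summable_on UNIV"
    "\<And>n s. -1 \<le> s \<Longrightarrow> s < 0 \<Longrightarrow> \<bar>of_int n\<bar> * (norm (circle_coeff G s n))\<^sup>2 \<le> D1 n"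
    using energy_domination[OF G] by blast
  obtain D2 where D2: "D2 summable_on UNIV"
    "\<And>n s. -1 \<le> s \<Longrightarrow> s < 0 \<Longrightarrow> \<bar>of_int n\<bar> * (norm (circle_coeff H s n))\<^sup>2 \<le> D2 n"
    using energy_domination[OF H] by blast
  have "\<bar>real_of_int n\<bar> * (norm (fourier_coeff g n))\<^sup>2 \<le> D1 n" for n
    by (rule LIMSEQ_le_const2[OF tendsto_mult[OF tendsto_const tendsto_power[OF tendsto_norm[OF lg]]]])
      (use D1(2)[OF rsq(1,2)] in auto)
  then show "(\<lambda>n. \<bar>real_of_int n\<bar> * (norm (fourier_coeff g n))\<^sup>2) summable_on UNIV"
    by (intro summable_on_comparison_test[OF D1(1)]) auto
  let ?a = "\<lambda>k n. (\<i> * of_int n * circle_coeff G (rsq k) n) \<bullet> circle_coeff H (rsq k) n"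
  have "(\<lambda>k. \<Sum>\<^sub>\<infinity>n. ?a k n) \<longlonglongrightarrow> (\<Sum>\<^sub>\<infinity>n. (\<i> * of_int n * fourier_coeff g n) \<bullet> fourier_coeff h n)"
  proof (rule infsum_dominated_convergence[OF summable_on_add[OF D1(1) D2(1)]])
    show "\<bar>?a k n\<bar> \<le> D1 n + D2 n" for k n
    proof -
      let ?x = "norm (circle_coeff G (rsq k) n)" and ?y = "norm (circle_coeff H (rsq k) n)"
      have "\<bar>?a k n\<bar> \<le> norm (\<i> * of_int n * circle_coeff G (rsq k) n) * ?y" by (rule Cauchy_Schwarz_ineq2)
      also have "\<dots> = \<bar>of_int n\<bar> * (?x * ?y)" by (simp add: norm_mult)
      also have "\<dots> \<le> \<bar>of_int n\<bar> * (?x\<^sup>2 + ?y\<^sup>2)"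
      proof (rule mult_left_mono)
        have "2 * ?x * ?y \<le> ?x\<^sup>2 + ?y\<^sup>2" by (rule sum_squares_bound)
        moreover have "0 \<le> ?x * ?y" by simp
        ultimately show "?x * ?y \<le> ?x\<^sup>2 + ?y\<^sup>2" by linarith
      qed simp
      also have "\<dots> \<le> D1 n + D2 n"
        using D1(2)[OF rsq(1,2), of n k] D2(2)[OF rsq(1,2), of n k] by (simp add: ring_distribs)
      finally show ?thesis .
    qed
    show "(\<lambda>k. ?a k n) \<longlonglongrightarrow> (\<i> * of_int n * fourier_coeff g n) \<bullet> fourier_coeff h n" for n
      by (intro tendsto_inner tendsto_mult tendsto_const lg lh)
  qed
  moreover have "(\<Sum>\<^sub>\<infinity>n. ?a k n) = (LINT t|circle_measure. ang G (pol (rsq k) t) \<bullet> H (pol (rsq k) t)) / (2 * pi)" for k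
  proof -
    have "((\<lambda>n. circle_coeff (ang G) (rsq k) n \<bullet> circle_coeff H (rsq k) n) has_sum
       (LINT t|circle_measure. ang G (pol (rsq k) t) \<bullet> H (pol (rsq k) t)) / (2 * pi)) UNIV"
      using parseval[OF continuous_on_dilated_circle[OF continuous_rad_ang(2)[OF G(1)] rsq(2)]
          continuous_on_dilated_circle[OF C1_onD(4)[OF H(1)] rsq(2)]] by (simp add: pol_def)
    then show ?thesis unfolding circle_coeff_ang[OF G(1) rsq(2)] by (rule infsumI)
  qed
  ultimately have "(\<lambda>k. (2 * pi) * ((LINT t|circle_measure. ang G (pol (rsq k) t) \<bullet> H (pol (rsq k) t)) / (2 * pi)))
     \<longlonglongrightarrow> 2 * pi * (\<Sum>\<^sub>\<infinity>n. (\<i> * of_int n * fourier_coeff g n) \<bullet> fourier_coeff h n)"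
    by (intro tendsto_mult tendsto_const) simp
  then show "(\<lambda>k. LINT t|circle_measure. ang G (pol (rsq k) t) \<bullet> H (pol (rsq k) t)) \<longlonglongrightarrow> dtheta_pairing g h"
    by (simp add: dtheta_pairing_def)
qed

section \<open>Nontangential limits of Dirichlet functions\<close>

lemma mean_value_circle:
  assumes H: "H holomorphic_on cball 0 r" and r: "r > 0"
  shows "((\<lambda>t. H (of_real r * cis t)) has_integral (of_real (2 * pi) * H 0)) {0..2*pi}"
proof -
  have "((\<lambda>u. H u / (u - 0)) has_contour_integral (2 * of_real pi * \<i> * H 0)) (circlepath 0 r)"
    using Cauchy_integral_circlepath_simple[OF H, of 0] r by simp
  then have "((\<lambda>t. H (of_real r * cis t) / (of_real r * cis t) * r * \<i> * cis t) has_integral (2 * of_real pi * \<i> * H 0)) {0..2*pi}"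
    unfolding circlepath_def by (subst (asm) has_contour_integral_part_circlepath_iff) auto
  then have "((\<lambda>t. - \<i> * (H (of_real r * cis t) / (of_real r * cis t) * r * \<i> * cis t)) has_integral (- \<i> * (2 * of_real pi * \<i> * H 0))) {0..2*pi}"
    by (rule has_integral_mult_right)
  then show ?thesis using r by (simp add: field_simps)
qed

text \<open>The mean value property of the holomorphic function \<open>(h z)\<^sup>2\<close>,
  followed by the triangle inequality for integrals.\<close>

lemma mean_square_circle:
  assumes h: "h holomorphic_on cball 0 r" and r: "r > 0"
  shows "2 * pi * (norm (h 0))\<^sup>2 \<le> (LINT t|circle_measure. (norm (h (of_real r * cis t)))\<^sup>2)"
proof -
  have c: "continuous_on {0..2*pi} (\<lambda>t. h (of_real r * cis t))"
    by (rule continuous_on_compose2[OF holomorphic_on_imp_continuous_on[OF h]])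
      (use r in \<open>auto intro!: continuous_intros simp: norm_mult\<close>)
  have m: "((\<lambda>t. (h (of_real r * cis t))\<^sup>2) has_integral (of_real (2 * pi) * (h 0)\<^sup>2)) {0..2*pi}"
    using mean_value_circle[of "\<lambda>z. (h z)\<^sup>2", OF _ r] h by (auto intro: holomorphic_intros)
  have i: "integrable circle_measure (\<lambda>t. (h (of_real r * cis t))\<^sup>2)"
    by (intro circle_integrable continuous_intros c)
  have "(LINT t|circle_measure. (h (of_real r * cis t))\<^sup>2) = of_real (2 * pi) * (h 0)\<^sup>2"
    using lebesgue_integral_eq_integral[OF i] m by (simp add: integral_unique sets_borel_lebesgue)
  then have "2 * pi * (norm (h 0))\<^sup>2 = norm (LINT t|circle_measure. (h (of_real r * cis t))\<^sup>2)"
    by (simp add: norm_mult norm_power)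
  also have "\<dots> \<le> (LINT t|circle_measure. norm ((h (of_real r * cis t))\<^sup>2))" by (rule integral_norm_bound)
  finally show ?thesis by (simp add: norm_power)
qed


text \<open>Keeping only the annulus \<open>R / e < \<bar>z - w\<bar> < R\<close> costs the
  constant \<open>2\<close>.\<close>
lemma mean_square_disc:
  assumes h: "h holomorphic_on cball w R" and R: "R > 0"
  shows "ennreal (R\<^sup>2 * (norm (h w))\<^sup>2) \<le> 2 * (\<integral>\<^sup>+z. ennreal ((norm (h z))\<^sup>2) * indicator (ball w R) z \<partial>lborel)"
proof -
  let ?g = "\<lambda>z. w + of_real R * z" and ?A = "annulus (exp (-1))"
  define H where "H z = h (?g z)" for z
  have Hh: "H holomorphic_on cball 0 1"
    unfolding H_def by (rule holomorphic_on_compose_gen[OF _ h, unfolded o_def])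
      (use R in \<open>auto intro!: holomorphic_intros simp: dist_norm norm_mult\<close>)
  define F where "F z = (norm (H z))\<^sup>2" for z
  have cF: "continuous_on (cball 0 1) F"
    unfolding F_def by (intro continuous_intros holomorphic_on_imp_continuous_on Hh)
  have cA: "continuous_on (annulus 0) F" "continuous_on ?A F"
    by (auto intro!: continuous_on_subset[OF cF] simp: annulus_def)
  have mA: "?A \<in> sets borel" using open_annulus by auto
  have sF: "set_integrable lborel ?A F"
  proof (rule set_integrable_subset[of lborel "cball 0 1"])
    show "set_integrable lborel (cball 0 1) F"
      unfolding set_integrable_def by (rule borel_integrable_compact[OF _ cF]) simp
  qed (use mA in \<open>auto simp: annulus_def\<close>)
  note leb = lebesgue_on_iff_lborel[OF mA set_borel_measurable_continuous_open[OF cA(2) mA]]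
  have iF: "integrable (lebesgue_on ?A) F" using leb(1) sF by simp
  have X: "{s::real. exp (-1) < exp s \<and> s < 0} = {-1<..<0}" by auto
  \<comment> \<open>On this annulus the polar weight is at least 1/9 because \<open>exp 1\<close> is
    at most 3.\<close>
  have e9: "1 / 9 \<le> (exp s)\<^sup>2" if "-1 < s" for s :: real
  proof -
    have "1 / 3 \<le> exp (-1::real)" using exp_le by (simp add: exp_minus field_simps)
    also have "\<dots> \<le> exp s" using that by simp
    finally have "(1 / 3)\<^sup>2 \<le> (exp s)\<^sup>2" by (rule power_mono) simp
    then show ?thesis by (simp add: power2_eq_square)
  qed
  have "(LINT s:{-1<..<0::real}|lborel. 2 * pi / 9 * (norm (h w))\<^sup>2)
     \<le> (LINT s:{-1<..<0}|lborel. (exp s)\<^sup>2 *\<^sub>R (LINT t|circle_measure. F (pol s t)))"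
  proof (rule set_integral_mono)
    show "set_integrable lborel {-1<..<0} (\<lambda>s. (exp s)\<^sup>2 *\<^sub>R (LINT t|circle_measure. F (pol s t)))"
      using polar_integral(2)[OF _ cA(1) iF] unfolding X by simp
    show "set_integrable lborel {-1<..<0::real} (\<lambda>s. 2 * pi / 9 * (norm (h w))\<^sup>2)"
      unfolding set_integrable_def by simp
    fix s :: real assume s: "s \<in> {-1<..<0}"
    have "2 * pi * (norm (H 0))\<^sup>2 \<le> (LINT t|circle_measure. F (pol s t))"
      unfolding F_def pol_def
      by (rule mean_square_circle[OF holomorphic_on_subset[OF Hh]]) (use s in \<open>simp_all add: cball_subset_cball_iff\<close>)
    then have "1 / 9 * (2 * pi * (norm (H 0))\<^sup>2) \<le> (exp s)\<^sup>2 * (LINT t|circle_measure. F (pol s t))"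
      using s by (intro mult_mono e9) auto
    then show "2 * pi / 9 * (norm (h w))\<^sup>2 \<le> (exp s)\<^sup>2 *\<^sub>R (LINT t|circle_measure. F (pol s t))"
      by (simp add: H_def)
  qed
  also have "\<dots> = (LINT z:?A|lborel. F z)"
    using polar_integral(3)[OF _ cA(1) iF] leb(2) unfolding X by simp
  finally have "2 * pi / 9 * (norm (h w))\<^sup>2 \<le> (LINT z:?A|lborel. F z)"
    by (simp add: set_lebesgue_integral_def)
  \<comment> \<open>\<open>2 * pi / 9\<close> exceeds 1/2 as \<open>pi > 3\<close>; this is where
    the factor 2 of the statement comes from.\<close>
  moreover have "1 / 2 * (norm (h w))\<^sup>2 \<le> 2 * pi / 9 * (norm (h w))\<^sup>2"
    using pi_gt3 by (intro mult_right_mono) auto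
  ultimately have "(norm (h w))\<^sup>2 \<le> 2 * (LINT z:?A|lborel. F z)" by linarith
  then have "ennreal ((norm (h w))\<^sup>2) \<le> 2 * ennreal (LINT z:?A|lborel. F z)"
    by (metis ennreal_leI ennreal_mult' ennreal_numeral zero_le_numeral)
  also have "ennreal (LINT z:?A|lborel. F z) = (\<integral>\<^sup>+z. ennreal (F z) * indicator ?A z \<partial>lborel)"
  proof -
    have "(\<integral>\<^sup>+z. ennreal (indicator ?A z *\<^sub>R F z) \<partial>lborel) = ennreal (LINT z:?A|lborel. F z)"
      unfolding set_lebesgue_integral_def
      by (rule nn_integral_eq_integral) (use sF in \<open>auto simp: set_integrable_def F_def\<close>)
    moreover have "(\<integral>\<^sup>+z. ennreal (F z) * indicator ?A z \<partial>lborel) = (\<integral>\<^sup>+z. ennreal (indicator ?A z *\<^sub>R F z) \<partial>lborel)"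
      by (intro nn_integral_cong) (auto simp: indicator_def)
    ultimately show ?thesis by simp
  qed
  finally have 1: "ennreal ((norm (h w))\<^sup>2) \<le> 2 * (\<integral>\<^sup>+z. ennreal (F z) * indicator ?A z \<partial>lborel)" .
  define B where "B z = ennreal ((norm (h z))\<^sup>2) * indicator (ball w R) z" for z
  have "(\<lambda>z. indicator (ball w R) z *\<^sub>R (norm (h z))\<^sup>2) \<in> borel_measurable borel"
    by (rule borel_measurable_continuous_on_indicator)
      (auto intro!: continuous_intros continuous_on_subset[OF holomorphic_on_imp_continuous_on[OF h]])
  then have "(\<lambda>z. ennreal (indicator (ball w R) z *\<^sub>R (norm (h z))\<^sup>2)) \<in> borel_measurable borel" by measurable
  also have "(\<lambda>z. ennreal (indicator (ball w R) z *\<^sub>R (norm (h z))\<^sup>2)) = B"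
    by (auto simp: B_def indicator_def)
  finally have mB: "B \<in> borel_measurable borel" .
  have injg: "inj_on ?g ?A" using R by (auto simp: inj_on_def)
  have holg: "?g holomorphic_on ?A" by (intro holomorphic_intros)
  have dg: "deriv ?g z = of_real R" for z by (rule DERIV_imp_deriv) (auto intro!: derivative_eq_intros)
  have "ennreal (R\<^sup>2) * (\<integral>\<^sup>+z. ennreal (F z) * indicator ?A z \<partial>lborel)
     = (\<integral>\<^sup>+z. ennreal (R\<^sup>2) * (ennreal (F z) * indicator ?A z) \<partial>lborel)"
  proof (rule nn_integral_cmult[symmetric])
    have "(\<lambda>z. ennreal (indicator ?A z *\<^sub>R F z)) \<in> borel_measurable borel"
      using borel_measurable_continuous_on_indicator[OF mA cA(2)] by measurable
    also have "(\<lambda>z. ennreal (indicator ?A z *\<^sub>R F z)) = (\<lambda>z. ennreal (F z) * indicator ?A z)"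
      by (auto simp: indicator_def)
    finally show "(\<lambda>z. ennreal (F z) * indicator ?A z) \<in> borel_measurable lborel" by simp
  qed
  also have "\<dots> = (\<integral>\<^sup>+z. ennreal ((norm (deriv ?g z))\<^sup>2) * B (?g z) * indicator ?A z \<partial>lborel)"
    by (intro nn_integral_cong)
      (use R in \<open>auto simp: dg B_def F_def H_def indicator_def mem_annulus dist_norm norm_mult\<close>)
  also have "\<dots> = (\<integral>\<^sup>+z. B z * indicator (?g ` ?A) z \<partial>lborel)"
    by (rule nn_integral_holomorphic_image[OF open_annulus holg injg mB, symmetric])
  also have "\<dots> \<le> (\<integral>\<^sup>+z. B z \<partial>lborel)"
    by (intro nn_integral_mono) (auto simp: indicator_def)
  finally have 2: "ennreal (R\<^sup>2) * (\<integral>\<^sup>+z. ennreal (F z) * indicator ?A z \<partial>lborel) \<le> (\<integral>\<^sup>+z. B z \<partial>lborel)" .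
  have "ennreal (R\<^sup>2 * (norm (h w))\<^sup>2) = ennreal (R\<^sup>2) * ennreal ((norm (h w))\<^sup>2)" by (simp add: ennreal_mult)
  also have "\<dots> \<le> ennreal (R\<^sup>2) * (2 * (\<integral>\<^sup>+z. ennreal (F z) * indicator ?A z \<partial>lborel))"
    by (rule mult_left_mono[OF 1]) simp
  also have "\<dots> = 2 * (ennreal (R\<^sup>2) * (\<integral>\<^sup>+z. ennreal (F z) * indicator ?A z \<partial>lborel))"
    by (simp only: mult.left_commute)
  also have "\<dots> \<le> 2 * (\<integral>\<^sup>+z. B z \<partial>lborel)" by (rule mult_left_mono[OF 2]) simp
  finally show ?thesis unfolding B_def .
qed

text \<open>The Stolz angle at the boundary point \<open>Complex 0 t\<close> in the coordinate
  \<open>w = log z\<close>: a cone of aperture \<open>K\<close> about a horizontal axis, opening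
  into the left half-plane.\<close>

definition stolz :: "real \<Rightarrow> real \<Rightarrow> complex set" where
  "stolz K t = {w. \<bar>Im w - t\<bar> < K * (- Re w)}"

lemma stolz_Re: "w \<in> stolz K t \<Longrightarrow> 0 \<le> K \<Longrightarrow> Re w < 0"
  unfolding stolz_def by (smt (verit) mem_Collect_eq mult_nonneg_nonneg mult_nonneg_nonpos abs_ge_zero)

text \<open>Tonelli: the tips \<open>\<i> t\<close> of the cones containing \<open>w\<close> fill an interval of length \<open>2 K \<bar>Re w\<bar>\<close>.\<close>
lemma stolz_energy_finite:
  assumes S: "open S" "S \<subseteq> {w. Re w < 0}" and Q: "continuous_on S Q" "\<And>w. Q w \<ge> 0"
    and I: "set_integrable lborel S Q"
  shows "AE t in lborel. \<forall>K::nat. (\<integral>\<^sup>+w. ennreal (Q w / - Re w) * indicator (S \<inter> stolz (real K) t) w \<partial>lborel) \<noteq> \<infinity>"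
proof (subst AE_all_countable, rule allI)
  fix K :: nat
  define q where "q w = indicator S w *\<^sub>R (Q w / - Re w)" for w
  have mq [measurable]: "q \<in> borel_measurable borel"
    unfolding q_def
  proof (rule borel_measurable_continuous_on_indicator)
    have "\<forall>w\<in>S. - Re w \<noteq> 0" using S(2) by auto
    then show "continuous_on S (\<lambda>w. Q w / - Re w)" by (intro continuous_intros Q)
  qed (use S in simp)
  have q0: "q w \<ge> 0" for w using S(2) Q(2)[of w] by (auto simp: q_def indicator_def intro!: divide_nonneg_nonpos)
  define P where "P = {p :: real \<times> complex. \<bar>Im (snd p) - fst p\<bar> < real K * (- Re (snd p))}"
  have "open P" unfolding P_def by (intro open_Collect_less continuous_intros)
  then have [measurable]: "P \<in> sets (lborel \<Otimes>\<^sub>M lborel)" by (simp only: lborel_prod sets_lborel borel_open)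
  have m: "(\<lambda>(t, w). ennreal (q w) * indicator P (t, w)) \<in> borel_measurable (lborel \<Otimes>\<^sub>M lborel)"
    by measurable
  have "(\<integral>\<^sup>+t. (\<integral>\<^sup>+w. ennreal (q w) * indicator P (t, w) \<partial>lborel) \<partial>lborel)
    = (\<integral>\<^sup>+w. (\<integral>\<^sup>+t. ennreal (q w) * indicator P (t, w) \<partial>lborel) \<partial>lborel)"
    by (rule lborel_pair.Fubini'[OF m, symmetric])
  also have "\<dots> = (\<integral>\<^sup>+w. ennreal (2 * K * (indicator S w *\<^sub>R Q w)) \<partial>lborel)"
  proof (rule nn_integral_cong)
    fix w :: complex
    show "(\<integral>\<^sup>+t. ennreal (q w) * indicator P (t, w) \<partial>lborel) = ennreal (2 * K * (indicator S w *\<^sub>R Q w))"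
    proof (cases "w \<in> S")
      case True
      then have R: "Re w < 0" using S(2) by auto
      have i: "indicator P (t, w) = indicator {Im w - K * (- Re w)<..<Im w + K * (- Re w)} t" for t
        by (auto simp: P_def indicator_def)
      have nn: "Im w - K * (- Re w) \<le> Im w + K * (- Re w)" using R by (simp add: mult_nonneg_nonpos)
      have "(\<integral>\<^sup>+t. ennreal (q w) * indicator P (t, w) \<partial>lborel) = ennreal (q w) * ennreal (2 * K * (- Re w))"
        unfolding i using nn by (subst nn_integral_cmult_indicator) (auto simp: algebra_simps)
      also have "\<dots> = ennreal (q w * (2 * K * (- Re w)))"
        by (rule ennreal_mult[symmetric]) (use q0 R in \<open>auto simp: mult_nonneg_nonpos\<close>)
      also have "q w * (2 * K * (- Re w)) = 2 * K * (indicator S w *\<^sub>R Q w)"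
        using R True by (simp add: q_def field_simps)
      finally show ?thesis .
    qed (simp add: q_def)
  qed
  also have "\<dots> < \<infinity>"
  proof -
    have "integrable lborel (\<lambda>w. 2 * K * (indicator S w *\<^sub>R Q w))"
      using I by (simp add: set_integrable_def)
    then show ?thesis by (simp add: nn_integral_eq_integral Q(2))
  qed
  finally have "(\<integral>\<^sup>+t. (\<integral>\<^sup>+w. ennreal (q w) * indicator P (t, w) \<partial>lborel) \<partial>lborel) \<noteq> \<infinity>" by simp
  moreover have "(\<lambda>t. \<integral>\<^sup>+w. ennreal (q w) * indicator P (t, w) \<partial>lborel) \<in> borel_measurable lborel"
    using m by measurable
  ultimately have "AE t in lborel. (\<integral>\<^sup>+w. ennreal (q w) * indicator P (t, w) \<partial>lborel) \<noteq> \<infinity>"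
    by (intro nn_integral_PInf_AE)
  moreover have "(\<integral>\<^sup>+w. ennreal (q w) * indicator P (t, w) \<partial>lborel)
     = (\<integral>\<^sup>+w. ennreal (Q w / - Re w) * indicator (S \<inter> stolz (real K) t) w \<partial>lborel)" for t
    by (intro nn_integral_cong) (auto simp: q_def P_def stolz_def indicator_def)
  ultimately show "AE t in lborel. (\<integral>\<^sup>+w. ennreal (Q w / - Re w) * indicator (S \<inter> stolz (real K) t) w \<partial>lborel) \<noteq> \<infinity>"
    by simp
qed

text \<open>The disc about \<open>w\<close> of radius \<open>R = - Re w / 2\<close> lies in the
  wider cone of aperture \<open>2 * K + 1\<close>, and \<open>- Re\<close> is below
  \<open>3 * R\<close> on it. The mean square inequality then bounds
  \<open>R\<^sup>2 * (norm (h w))\<^sup>2\<close> by \<open>6 * R * a\<close>, and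
  \<open>- Re w = 2 * R\<close> yields the constant \<open>12 * a\<close>.\<close>

lemma stolz_bound:
  fixes K :: nat
  assumes h: "h holomorphic_on {w. Re w < 0}" and t: "0 < t" "t < 2 * pi"
    and A: "(\<integral>\<^sup>+w. ennreal ((norm (h w))\<^sup>2 / - Re w) * indicator (log_strip (exp (-1)) \<inter> stolz (real (2 * K + 1)) t) w \<partial>lborel) \<noteq> \<infinity>"
  obtains C \<delta> where "C \<ge> 0" "\<delta> > 0" "\<And>w. w \<in> stolz (real K) t \<Longrightarrow> - \<delta> < Re w \<Longrightarrow> (norm (h w))\<^sup>2 \<le> C / (- Re w)"
proof -
  let ?S = "log_strip (exp (-1)) \<inter> stolz (real (2 * K + 1)) t"
  obtain a where a: "a \<ge> 0" "(\<integral>\<^sup>+w. ennreal ((norm (h w))\<^sup>2 / - Re w) * indicator ?S w \<partial>lborel) = ennreal a"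
    using A by (cases "\<integral>\<^sup>+w. ennreal ((norm (h w))\<^sup>2 / - Re w) * indicator ?S w \<partial>lborel") auto
  \<comment> \<open>Small enough to keep these discs in the strip: their imaginary parts stay within
    \<open>(2 * K + 1) * R\<close> of \<open>t\<close>, their real parts above -1.\<close>
  define \<delta> where "\<delta> = min (1/2) (min t (2 * pi - t) / (2 * K + 1))"
  have \<delta>: "\<delta> > 0" using t by (simp add: \<delta>_def)
  have bd: "(norm (h w))\<^sup>2 \<le> 12 * a / (- Re w)" if w: "w \<in> stolz (real K) t" "- \<delta> < Re w" for w
  proof -
    define R where "R = - Re w / 2"
    have Rw: "Re w = - 2 * R" by (simp add: R_def)
    have R: "R > 0" using stolz_Re[OF w(1)] by (simp add: R_def)
    have R\<delta>: "2 * R < \<delta>" using w(2) Rw by linarith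
    have inS: "w' \<in> ?S \<and> - Re w' < 3 * R" if w': "w' \<in> ball w R" for w'
    proof -
      have re: "\<bar>Re w' - Re w\<bar> < R" and im: "\<bar>Im w' - Im w\<bar> < R"
        using w' abs_Re_le_cmod[of "w' - w"] abs_Im_le_cmod[of "w' - w"]
        by (auto simp: dist_norm norm_minus_commute)
      have r1: "- 3 * R < Re w'" "Re w' < - R" using re Rw by linarith+
      have "\<bar>Im w - t\<bar> < K * (2 * R)" using w(1) Rw by (simp add: stolz_def)
      then have i1: "\<bar>Im w' - t\<bar> < (2 * K + 1) * R" using im by (simp add: algebra_simps)
      also have "\<dots> \<le> (2 * K + 1) * (- Re w')" using r1 by (intro mult_left_mono) auto
      finally have c: "w' \<in> stolz (real (2 * K + 1)) t" by (simp add: stolz_def)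
      have "R \<le> min t (2 * pi - t) / (2 * K + 1)" using R\<delta> R by (simp add: \<delta>_def)
      then have "(2 * K + 1) * R \<le> min t (2 * pi - t)" by (simp add: field_simps)
      then have "0 < Im w'" "Im w' < 2 * pi" using i1 by linarith+
      moreover have "- 1 < Re w'" using r1 R\<delta> by (simp add: \<delta>_def)
      ultimately show ?thesis using c r1 R by (auto simp: log_strip_def)
    qed
    have "ennreal (R\<^sup>2 * (norm (h w))\<^sup>2) \<le> 2 * (\<integral>\<^sup>+z. ennreal ((norm (h z))\<^sup>2) * indicator (ball w R) z \<partial>lborel)"
    proof (rule mean_square_disc[OF holomorphic_on_subset[OF h] R])
      show "cball w R \<subseteq> {w. Re w < 0}"
      proof
        fix z assume "z \<in> cball w R"
        then have "\<bar>Re z - Re w\<bar> \<le> R" using abs_Re_le_cmod[of "z - w"] by (auto simp: dist_norm norm_minus_commute)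
        then show "z \<in> {w. Re w < 0}" using Rw R by simp
      qed
    qed
    also have "(\<integral>\<^sup>+z. ennreal ((norm (h z))\<^sup>2) * indicator (ball w R) z \<partial>lborel)
        \<le> (\<integral>\<^sup>+z. ennreal (3 * R) * (ennreal ((norm (h z))\<^sup>2 / - Re z) * indicator ?S z) \<partial>lborel)"
    proof (rule nn_integral_mono)
      fix z
      show "ennreal ((norm (h z))\<^sup>2) * indicator (ball w R) z \<le> ennreal (3 * R) * (ennreal ((norm (h z))\<^sup>2 / - Re z) * indicator ?S z)"
      proof (cases "z \<in> ball w R")
        case True
        then have z: "z \<in> ?S" "- Re z < 3 * R" "Re z < 0" using inS[OF True] stolz_Re[of z] by auto
        have "(norm (h z))\<^sup>2 = - Re z * ((norm (h z))\<^sup>2 / - Re z)" using z by simp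
        also have "\<dots> \<le> 3 * R * ((norm (h z))\<^sup>2 / - Re z)"
          by (rule mult_right_mono) (use z in \<open>auto intro!: divide_nonneg_nonpos\<close>)
        finally have "ennreal ((norm (h z))\<^sup>2) \<le> ennreal (3 * R * ((norm (h z))\<^sup>2 / - Re z))" by (rule ennreal_leI)
        also have "ennreal (3 * R * ((norm (h z))\<^sup>2 / - Re z)) = ennreal (3 * R) * ennreal ((norm (h z))\<^sup>2 / - Re z)"
          by (rule ennreal_mult) (use z R in \<open>auto intro!: divide_nonneg_nonpos\<close>)
        finally show ?thesis
          by (simp only: indicator_simps(1)[OF True] indicator_simps(1)[OF z(1)] mult_1_right)
      qed simp
    qed
    also have "\<dots> = ennreal (3 * R) * ennreal a"
    proof -
      have "(\<lambda>z. ennreal ((norm (h z))\<^sup>2 / - Re z) * indicator ?S z) \<in> borel_measurable borel"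
      proof -
        have "open ?S" unfolding stolz_def
          by (intro open_Int open_log_strip open_Collect_less continuous_intros)
        moreover have "continuous_on ?S (\<lambda>z. (norm (h z))\<^sup>2 / - Re z)"
          by (intro continuous_intros continuous_on_subset[OF holomorphic_on_imp_continuous_on[OF h]])
            (auto simp: log_strip_def)
        ultimately have "(\<lambda>z. indicator ?S z *\<^sub>R ((norm (h z))\<^sup>2 / - Re z)) \<in> borel_measurable borel"
          by (intro borel_measurable_continuous_on_indicator) auto
        then have "(\<lambda>z. ennreal (indicator ?S z *\<^sub>R ((norm (h z))\<^sup>2 / - Re z))) \<in> borel_measurable borel" by measurable
        also have "(\<lambda>z. ennreal (indicator ?S z *\<^sub>R ((norm (h z))\<^sup>2 / - Re z))) = (\<lambda>z. ennreal ((norm (h z))\<^sup>2 / - Re z) * indicator ?S z)"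
          by (auto simp: indicator_def fun_eq_iff)
        finally show ?thesis .
      qed
      then have m: "(\<lambda>z. ennreal ((norm (h z))\<^sup>2 / - Re z) * indicator ?S z) \<in> borel_measurable lborel"
        by (simp only: measurable_lborel2)
      show ?thesis by (simp only: nn_integral_cmult[OF m] a(2))
    qed
    finally have "ennreal (R\<^sup>2 * (norm (h w))\<^sup>2) \<le> 2 * (ennreal (3 * R) * ennreal a)" by (simp add: mult_left_mono)
    also have "\<dots> = ennreal (6 * R * a)"
    proof -
      have "ennreal (2 * (3 * R * a)) = ennreal 2 * ennreal (3 * R * a)"
        by (rule ennreal_mult) (use R a in auto)
      moreover have "ennreal (3 * R * a) = ennreal (3 * R) * ennreal a"
        by (rule ennreal_mult) (use R a in auto)
      moreover have "6 * R * a = 2 * (3 * R * a)" by simp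
      ultimately show ?thesis by (simp only: ennreal_numeral)
    qed
    finally have "R\<^sup>2 * (norm (h w))\<^sup>2 \<le> 6 * R * a" using R a(1) by (subst (asm) ennreal_le_iff) auto
    then have "R * (norm (h w))\<^sup>2 \<le> 6 * a" using R by (simp add: power2_eq_square)
    then show ?thesis using R by (simp add: Rw field_simps)
  qed
  show thesis by (rule that[of "12 * a" \<delta>]) (use a \<delta> bd in auto)
qed

text \<open>The threshold \<open>d\<close> may depend on the aperture, and natural numbers
  \<open>K\<close> exhaust all cones.\<close>

definition ntlim :: "(complex \<Rightarrow> complex) \<Rightarrow> real \<Rightarrow> complex \<Rightarrow> bool" where
  "ntlim M t l \<longleftrightarrow> (\<forall>K::nat. \<forall>e>0. \<exists>d>0. \<forall>w\<in>stolz (real K) t. - d < Re w \<longrightarrow> norm (M w - l) < e)"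

text \<open>The bound on \<open>M'\<close> is integrable along the axis of the cone, so
  \<open>M\<close> has a limit there. From the axis, a vertical segment of length at most
  \<open>K * (- Re w)\<close> reaches any other point of the cone, and \<open>M\<close> changes
  along it by a multiple of \<open>sqrt (- Re w)\<close>.\<close>

lemma ntlim_exists:
  assumes M: "\<And>w. Re w < 0 \<Longrightarrow> (M has_field_derivative M' w) (at w)"
    and bd: "\<And>K::nat. \<exists>C d. C \<ge> 0 \<and> d > 0 \<and> (\<forall>w\<in>stolz (real K) t. - d < Re w \<longrightarrow> (norm (M' w))\<^sup>2 \<le> C / (- Re w))"
  shows "\<exists>l. ntlim M t l"
proof -
  obtain C d where C: "\<And>K::nat. C K \<ge> 0" "\<And>K::nat. d K > 0"
    "\<And>K w. w \<in> stolz (real K) t \<Longrightarrow> - d K < Re w \<Longrightarrow> (norm (M' w))\<^sup>2 \<le> C K / (- Re w)"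
    using bd by metis
  have root: "norm (M' w) \<le> sqrt (C K) / sqrt (- Re w)" if "w \<in> stolz (real K) t" "- d K < Re w" for K w
    using real_le_rsqrt[OF C(3)[OF that]] by (simp only: real_sqrt_divide)
  define u where "u s = M (Complex s t)" for s
  have axis: "Complex s t \<in> stolz (real 1) t" if "s < 0" for s using that by (simp add: stolz_def)
  have osc: "norm (u s' - u s) \<le> 2 * sqrt (C 1) * sqrt (- s)" if s: "- d 1 < s" "s < s'" "s' < 0" for s s'
  proof -
    \<comment> \<open>The comparison function is a primitive of
      \<open>sqrt (C 1) / sqrt (- x)\<close> that stays bounded as \<open>x\<close> tends to
      0.\<close>
    have "norm (u s' - u s) \<le> (- 2 * sqrt (C 1) * sqrt (- s')) - (- 2 * sqrt (C 1) * sqrt (- s))"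
    proof (rule differentiable_bound_general[OF s(2)])
      have du: "(u has_vector_derivative M' (Complex x t)) (at x within T)" if "x < 0" for x T
      proof -
        have "((\<lambda>s. Complex s t) has_vector_derivative 1) (at x within T)"
          unfolding Complex_eq has_vector_derivative_def
          by (auto intro!: derivative_eq_intros simp: scaleR_conv_of_real)
        from field_vector_diff_chain_within[OF this has_field_derivative_at_within[OF M]] that
        show ?thesis by (simp add: o_def u_def[abs_def])
      qed
      show "(u has_vector_derivative M' (Complex x t)) (at x)" if "s < x" "x < s'" for x
        using du that s by simp
      show "continuous_on {s..s'} u"
        by (rule continuous_on_vector_derivative[OF du]) (use s in auto)
      show "continuous_on {s..s'} (\<lambda>x. - 2 * sqrt (C 1) * sqrt (- x))" by (intro continuous_intros)
      show "((\<lambda>x. - 2 * sqrt (C 1) * sqrt (- x)) has_vector_derivative sqrt (C 1) / sqrt (- x)) (at x)" if "s < x" "x < s'" for x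
        using that s unfolding has_real_derivative_iff_has_vector_derivative[symmetric]
        by (auto intro!: derivative_eq_intros simp: field_simps)
      show "norm (M' (Complex x t)) \<le> sqrt (C 1) / sqrt (- x)" if "s < x" "x < s'" for x
        using root[OF axis[of x]] that s by simp
    qed
    also have "\<dots> \<le> 2 * sqrt (C 1) * sqrt (- s)" using C(1)[of 1] s by simp
    finally show ?thesis .
  qed
  obtain l where l: "\<And>s. - d 1 < s \<Longrightarrow> s < 0 \<Longrightarrow> norm (u s - l) \<le> 2 * sqrt (C 1) * sqrt (- s)"
  proof -
    define x where "x n = - d 1 / (real n + 2)" for n
    have x: "- d 1 < x n" "x n < 0" for n using C(2)[of 1] by (auto simp: x_def field_simps intro: add_pos_nonneg)
    have xlim: "x \<longlonglongrightarrow> 0"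
    proof -
      have "(\<lambda>n. - d 1 * (1 / real (n + 2))) \<longlonglongrightarrow> - d 1 * 0"
        by (intro tendsto_mult tendsto_const LIMSEQ_ignore_initial_segment[OF lim_1_over_n])
      then show ?thesis by (simp add: x_def[abs_def] add.commute)
    qed
    have xmono: "x m < x n" if "m < n" for m n using that C(2)[of 1] by (simp add: x_def field_simps)
    have slim: "(\<lambda>n. 2 * sqrt (C 1) * sqrt (- x n)) \<longlonglongrightarrow> 2 * sqrt (C 1) * sqrt (- 0)"
      by (intro tendsto_intros xlim)
    have "Cauchy (\<lambda>n. u (x n))"
    proof (rule CauchyI')
      fix e :: real assume "e > 0"
      then have "eventually (\<lambda>n. 2 * sqrt (C 1) * sqrt (- x n) < e) sequentially"
        using slim by (intro order_tendstoD) auto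
      then obtain N where N: "\<And>n. n \<ge> N \<Longrightarrow> 2 * sqrt (C 1) * sqrt (- x n) < e" by (auto simp: eventually_sequentially)
      show "\<exists>N. \<forall>m\<ge>N. \<forall>n>m. dist (u (x m)) (u (x n)) < e"
        using N osc[OF x(1) xmono x(2)] by (intro exI[of _ N]) (smt (verit) dist_norm norm_minus_commute)
    qed
    then obtain l where lim: "(\<lambda>n. u (x n)) \<longlonglongrightarrow> l" by (auto simp: Cauchy_convergent_iff convergent_def)
    have "norm (u s - l) \<le> 2 * sqrt (C 1) * sqrt (- s)" if s: "- d 1 < s" "s < 0" for s
    proof (rule LIMSEQ_le_const2)
      show "(\<lambda>n. norm (u s - u (x n))) \<longlonglongrightarrow> norm (u s - l)" by (intro tendsto_intros lim)
      have "eventually (\<lambda>n. s < x n) sequentially" using order_tendstoD(1)[OF xlim s(2)] .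
      then obtain N where "\<And>n. n \<ge> N \<Longrightarrow> s < x n" by (auto simp: eventually_sequentially)
      then show "\<exists>N. \<forall>n\<ge>N. norm (u s - u (x n)) \<le> 2 * sqrt (C 1) * sqrt (- s)"
        using osc[OF s(1) _ x(2)] by (metis norm_minus_commute)
    qed
    then show thesis by (rule that)
  qed
  have "ntlim M t l" unfolding ntlim_def
  proof (intro allI impI)
    fix K :: nat and e :: real assume e: "e > 0"
    define B where "B = 2 * sqrt (C 1) + K * sqrt (C K)"
    have B: "B \<ge> 0" using C(1) by (simp add: B_def)
    define \<delta> where "\<delta> = min (min (d 1) (d K)) ((e / (B + 1))\<^sup>2)"
    have \<delta>: "\<delta> > 0" using C(2) e B by (simp add: \<delta>_def)
    show "\<exists>d>0. \<forall>w\<in>stolz (real K) t. - d < Re w \<longrightarrow> norm (M w - l) < e"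
    proof (intro exI[of _ \<delta>] conjI ballI impI \<delta>)
      fix w assume w: "w \<in> stolz (real K) t" "- \<delta> < Re w"
      let ?s = "Re w"
      have s: "?s < 0" using stolz_Re[OF w(1)] by simp
      have s1: "- d 1 < ?s" "- d K < ?s" using w(2) by (auto simp: \<delta>_def)
      \<comment> \<open>The vertical cross-section of the cone through \<open>w\<close>: a convex
        set containing the axis point \<open>Complex ?s t\<close>, on which the mean value
        inequality applies.\<close>
      let ?T = "{z. Re z = ?s} \<inter> stolz (real K) t"
      have K0: "K * (- ?s) > 0" using w(1) by (simp add: stolz_def)
      have "convex ?T"
      proof -
        have "?T = {z. Re z = ?s} \<inter> {z. Im z < t + K * (- ?s)} \<inter> {z. Im z > t - K * (- ?s)}"
          by (auto simp: stolz_def)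
        moreover have "{z. Re z = ?s} = {z. 1 \<bullet> z = ?s}" by (simp add: inner_complex_def)
        ultimately show ?thesis
          by (simp only: convex_Int convex_hyperplane convex_halfspace_Im_lt convex_halfspace_Im_gt)
      qed
      then have "norm (M w - M (Complex ?s t)) \<le> sqrt (C K) / sqrt (- ?s) * norm (w - Complex ?s t)"
      proof (rule field_differentiable_bound)
        show "(M has_field_derivative M' z) (at z within ?T)" if "z \<in> ?T" for z
          by (rule has_field_derivative_at_within[OF M]) (use that s in auto)
        show "norm (M' z) \<le> sqrt (C K) / sqrt (- ?s)" if "z \<in> ?T" for z
          using root[of z K] that s1 by auto
        show "w \<in> ?T" "Complex ?s t \<in> ?T" using w K0 by (auto simp: stolz_def)
      qed
      also have "w - Complex ?s t = \<i> * of_real (Im w - t)" by (simp add: complex_eq_iff)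
      also have "norm (\<i> * of_real (Im w - t)) = \<bar>Im w - t\<bar>" by (simp only: norm_mult norm_ii norm_of_real mult_1 real_norm_def)
      also have "sqrt (C K) / sqrt (- ?s) * \<bar>Im w - t\<bar> \<le> sqrt (C K) / sqrt (- ?s) * (K * (- ?s))"
        by (rule mult_left_mono) (use w C(1) s in \<open>auto simp: stolz_def\<close>)
      also have "\<dots> = K * sqrt (C K) * sqrt (- ?s)"
        using s real_sqrt_pow2[of "- ?s"] by (simp add: field_simps power2_eq_square)
      finally have 1: "norm (M w - M (Complex ?s t)) \<le> K * sqrt (C K) * sqrt (- ?s)" .
      have "norm (M w - l) \<le> norm (M w - M (Complex ?s t)) + norm (M (Complex ?s t) - l)"
        by (metis norm_triangle_ineq diff_add_cancel add_diff_eq)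
      also have "\<dots> \<le> B * sqrt (- ?s)"
        using 1 l[OF s1(1) s] by (simp add: B_def u_def ring_distribs)
      also have "\<dots> \<le> (B + 1) * sqrt (- ?s)" using s by (intro mult_right_mono) auto
      also have "\<dots> < (B + 1) * (e / (B + 1))"
      proof (rule mult_strict_left_mono)
        have "- ?s < (e / (B + 1))\<^sup>2" using w(2) by (auto simp: \<delta>_def)
        then show "sqrt (- ?s) < e / (B + 1)" using e B by (intro real_less_lsqrt) auto
      qed (use B in simp)
      also have "\<dots> = e" using B by simp
      finally show "norm (M w - l) < e" .
    qed
  qed
  then show ?thesis by blast
qed

section \<open>Boundary behaviour of conformal maps\<close>

lemma convex_stolz: "convex (stolz K t)"
proof -
  have "stolz K t = {w. (Complex K 1) \<bullet> w < t} \<inter> {w. (Complex K (-1)) \<bullet> w < - t}"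
    by (auto simp: stolz_def inner_complex_def abs_less_iff)
  then show ?thesis by (simp add: convex_Int convex_halfspace_lt)
qed

text \<open>The angular derivative at \<open>Complex 0 t\<close>, with
  \<open>F (Complex 0 t)\<close> as boundary value. It transfers directions in the half-plane to
  directions at the corresponding boundary point of the domain.\<close>

definition cone_deriv :: "(complex \<Rightarrow> complex) \<Rightarrow> real \<Rightarrow> complex \<Rightarrow> bool" where
  "cone_deriv F t l \<longleftrightarrow> (\<forall>K::nat. \<forall>e>0. \<exists>d>0. \<forall>w\<in>stolz (real K) t. - d < Re w \<longrightarrow>
     norm (F w - F (Complex 0 t) - l * (w - Complex 0 t)) \<le> e * norm (w - Complex 0 t))"

lemma stolz_scale:
  assumes "w \<in> stolz K t" "0 < c"
  shows "Complex 0 t + of_real c * (w - Complex 0 t) \<in> stolz K t"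
proof -
  have "\<bar>c * (Im w - t)\<bar> < c * (K * (- Re w))"
    using assms mult_strict_left_mono[of "\<bar>Im w - t\<bar>" "K * (- Re w)" c] by (simp add: stolz_def abs_mult)
  then show ?thesis by (simp add: stolz_def algebra_simps)
qed

text \<open>The mean value inequality for \<open>F z - l * z\<close> on a truncated cone, which is
  convex. The vertex does not belong to the cone; it is approached along the segment
  \<open>x n\<close>, using continuity of \<open>F\<close> up to the boundary.\<close>

lemma ntlim_cone_deriv:
  assumes cF: "continuous_on {w. Re w \<le> 0} F"
    and F': "\<And>w. Re w < 0 \<Longrightarrow> (F has_field_derivative F' w) (at w)"
    and lim: "ntlim F' t l"
  shows "cone_deriv F t l"
  unfolding cone_deriv_def
proof (intro allI impI)
  fix K :: nat and e :: real assume e: "e > 0"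
  then obtain d where d: "d > 0" "\<And>w. w \<in> stolz (real K) t \<Longrightarrow> - d < Re w \<Longrightarrow> norm (F' w - l) < e"
    using lim unfolding ntlim_def by meson
  let ?p = "Complex 0 t"
  show "\<exists>d>0. \<forall>w\<in>stolz (real K) t. - d < Re w \<longrightarrow> norm (F w - F ?p - l * (w - ?p)) \<le> e * norm (w - ?p)"
  proof (intro exI[of _ d] conjI ballI impI d(1))
    fix w assume w: "w \<in> stolz (real K) t" "- d < Re w"
    have Rw: "Re w < 0" using stolz_Re[OF w(1)] by simp
    define S where "S = stolz (real K) t \<inter> {w. - d < Re w}"
    define k where "k z = F z - l * z" for z
    have cS: "convex S" unfolding S_def by (intro convex_Int convex_stolz convex_halfspace_Re_gt)
    define c where "c n = 1 / real (Suc n)" for n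
    define x where "x n = ?p + of_real (c n) * (w - ?p)" for n
    have c: "0 < c n" "c n \<le> 1" for n by (auto simp: c_def)
    have xS: "x n \<in> S" for n
    proof -
      have "x n \<in> stolz (real K) t" unfolding x_def by (rule stolz_scale[OF w(1) c(1)])
      moreover have "Re (x n) = c n * Re w" by (simp add: x_def)
      moreover have "c n * (- Re w) \<le> 1 * (- Re w)" using c Rw by (intro mult_right_mono) auto
      ultimately show ?thesis using w(2) by (auto simp: S_def)
    qed
    have clim: "c \<longlonglongrightarrow> 0" unfolding c_def by (rule LIMSEQ_Suc[OF lim_1_over_n])
    have "(\<lambda>n. ?p + of_real (c n) * (w - ?p)) \<longlonglongrightarrow> ?p + of_real 0 * (w - ?p)"
      by (intro tendsto_intros clim)
    then have xlim: "x \<longlonglongrightarrow> ?p" by (simp add: x_def[abs_def])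
    have kx: "norm (k w - k (x n)) \<le> e * norm (w - x n)" for n
    proof (rule field_differentiable_bound[OF cS])
      show "(k has_field_derivative F' z - l) (at z within S)" if "z \<in> S" for z
        unfolding k_def using that stolz_Re[of z "real K" t]
        by (auto intro!: derivative_eq_intros has_field_derivative_at_within[OF F'] simp: S_def)
      show "norm (F' z - l) \<le> e" if "z \<in> S" for z using d(2)[of z] that by (auto simp: S_def intro: less_imp_le)
      show "w \<in> S" using w by (simp add: S_def)
    qed (rule xS)
    have Flim: "(\<lambda>n. F (x n)) \<longlonglongrightarrow> F ?p"
      by (rule continuous_on_tendsto_compose[OF cF xlim])
        (use xS stolz_Re[of _ "real K" t] in \<open>auto simp: S_def intro!: always_eventually less_imp_le\<close>)
    have "norm (k w - k ?p) \<le> e * norm (w - ?p)"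
      by (rule LIMSEQ_le[of "\<lambda>n. norm (k w - k (x n))" _ "\<lambda>n. e * norm (w - x n)"])
        (use kx in \<open>auto simp: k_def intro!: tendsto_intros Flim xlim\<close>)
    then show "norm (F w - F ?p - l * (w - ?p)) \<le> e * norm (w - ?p)" by (simp add: k_def algebra_simps)
  qed
qed

text \<open>A cover of \<open>N\<close> pulls back to a cover of \<open>E\<close>: two points of
  \<open>E\<close> that \<open>\<phi>\<close> sends into the same \<open>A i\<close> are at distance
  at most \<open>diameter (A i) / c\<close>. Expansion is known only below distance
  \<open>r\<close>, so the argument is local, in balls of radius \<open>r / 2\<close>.\<close>

lemma length_null_expanding:
  fixes E :: "real set" and \<phi> :: "real \<Rightarrow> complex"
  assumes N: "length_null N" and c: "c > 0" and r: "r > 0"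
    and ex: "\<And>t u. t \<in> E \<Longrightarrow> u \<in> E \<Longrightarrow> \<bar>t - u\<bar> < r \<Longrightarrow> c * \<bar>t - u\<bar> \<le> norm (\<phi> t - \<phi> u)"
    and im: "\<phi> ` E \<subseteq> N"
  shows "negligible E"
  unfolding locally_negligible_alt[of E]
proof
  fix x assume x: "x \<in> E"
  let ?E = "E \<inter> ball x (r/2)"
  have close: "\<bar>t - u\<bar> < r" if "t \<in> ?E" "u \<in> ?E" for t u using that unfolding Int_iff mem_ball dist_real_def by linarith
  have "negligible ?E"
    unfolding negligible_outer_le
  proof (intro allI impI)
    fix e :: real assume e: "e > 0"
    \<comment> \<open>Intervals of half-length \<open>diameter (A i) / c\<close> have total length
      \<open>2 / c\<close> times the sum of the diameters; hence the target
      \<open>c * e / 2\<close>.\<close>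
    then have "c * e / 2 > 0" using c by simp
    then obtain A :: "nat \<Rightarrow> complex set" where A: "\<And>i. bounded (A i)" "N \<subseteq> (\<Union>i. A i)"
      "summable (\<lambda>i. diameter (A i))" "(\<Sum>i. diameter (A i)) < c * e / 2"
      using N unfolding length_null_def by metis
    define J where "J i = (if \<exists>t\<in>?E. \<phi> t \<in> A i then cball (SOME t. t \<in> ?E \<and> \<phi> t \<in> A i) (diameter (A i) / c) else {})" for i
    have sub: "?E \<subseteq> (\<Union>i. J i)"
    proof
      fix t assume t: "t \<in> ?E"
      then obtain i where i: "\<phi> t \<in> A i" using A(2) im by blast
      define u where "u = (SOME t. t \<in> ?E \<and> \<phi> t \<in> A i)"
      have u: "u \<in> ?E" "\<phi> u \<in> A i" using someI[of "\<lambda>t. t \<in> ?E \<and> \<phi> t \<in> A i" t] t i by (auto simp: u_def)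
      have "c * \<bar>u - t\<bar> \<le> norm (\<phi> u - \<phi> t)" using ex[of u t] close[OF u(1) t] t u by auto
      also have "\<dots> \<le> diameter (A i)" using diameter_bounded_bound[OF A(1) u(2) i] by (simp add: dist_norm)
      finally have "t \<in> cball u (diameter (A i) / c)" using c by (simp add: dist_real_def field_simps)
      moreover have "J i = cball u (diameter (A i) / c)" using t i by (auto simp: J_def u_def)
      ultimately show "t \<in> (\<Union>i. J i)" by blast
    qed
    have d0: "diameter (A i) \<ge> 0" for i by (rule diameter_ge_0[OF A(1)])
    have cJ: "closed (J i)" for i by (simp add: J_def)
    then have mJ: "(\<Union>i. J i) \<in> sets borel" by (intro sets.countable_UN) auto
    have eJ: "emeasure lborel (J i) \<le> ennreal (2 * diameter (A i) / c)" for i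
      using d0[of i] c by (auto simp: J_def cball_eq_atLeastAtMost)
    have "emeasure lborel (\<Union>i. J i) \<le> (\<Sum>i. emeasure lborel (J i))"
      by (rule emeasure_subadditive_countably) (use cJ in auto)
    also have "\<dots> \<le> (\<Sum>i. ennreal (2 * diameter (A i) / c))" by (intro suminf_le eJ summableI)
    also have "\<dots> = ennreal (\<Sum>i. 2 * diameter (A i) / c)"
      by (rule suminf_ennreal2) (use d0 c A(3) in \<open>auto intro!: summable_divide summable_mult\<close>)
    also have "(\<Sum>i. 2 * diameter (A i) / c) = 2 * (\<Sum>i. diameter (A i)) / c"
      using A(3) by (simp add: suminf_divide summable_mult suminf_mult)
    also have "ennreal (2 * (\<Sum>i. diameter (A i)) / c) \<le> ennreal e"
      using A(4) c by (intro ennreal_leI) (simp add: field_simps)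
    finally have em: "emeasure lborel (\<Union>i. J i) \<le> ennreal e" .
    have eq: "emeasure lebesgue (\<Union>i. J i) = emeasure lborel (\<Union>i. J i)"
      using mJ by (intro emeasure_completion[THEN trans]) (simp_all add: sets_completionI_sets main_part_sets)
    have lm: "(\<Union>i. J i) \<in> lmeasurable"
      using em eq sets_borel_lebesgue[OF mJ] by (intro fmeasurableI) (auto simp: le_less_trans)
    have "measure lebesgue (\<Union>i. J i) \<le> e"
      using em eq e by (simp add: measure_def enn2real_leI)
    then show "\<exists>T. ?E \<subseteq> T \<and> T \<in> lmeasurable \<and> measure lebesgue T \<le> e" using sub lm by blast
  qed
  then show "\<exists>U. openin (top_of_set E) U \<and> x \<in> U \<and> negligible U"
    using x r by (intro exI[of _ ?E]) (auto simp: openin_open_Int)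
qed

text \<open>Where the derivative \<open>F'\<close> has nonzero nontangential limits that are attained uniformly, \<open>F\<close> expands
  distances on the boundary: compare the two boundary points through the apex \<open>i t\<^sub>1 - \<bar>t\<^sub>1 - t\<^sub>2\<bar>\<close>.\<close>
lemma length_null_preimage:
  assumes N: "length_null N"
    and T: "\<And>t. t \<in> T \<Longrightarrow> \<exists>l. l \<noteq> 0 \<and> ntlim F' t l \<and> cone_deriv F t l"
    and im: "\<And>t. t \<in> T \<Longrightarrow> F (Complex 0 t) \<in> N"
  shows "negligible T"
proof -
  obtain l where l: "\<And>t. t \<in> T \<Longrightarrow> l t \<noteq> 0 \<and> ntlim F' t (l t) \<and> cone_deriv F t (l t)" using T by metis
  \<comment> \<open>Countably many pieces on which the limits are attained at a common scale and
    \<open>norm (l t)\<close> is bounded below, which makes the constants uniform. With tolerance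
    1/20 the errors below add up to less than half of \<open>norm (l t) * d\<close>; aperture 2
    accommodates the apex.\<close>
  define E where "E j = {t \<in> T. norm (l t) \<ge> 1 / real (Suc j) \<and>
     (\<forall>w\<in>stolz (real 2) t. - (1 / real (Suc j)) < Re w \<longrightarrow> norm (F' w - l t) \<le> norm (l t) / 20 \<and>
        norm (F w - F (Complex 0 t) - l t * (w - Complex 0 t)) \<le> norm (l t) / 20 * norm (w - Complex 0 t))}" for j
  have cover: "T = (\<Union>j. E j)"
  proof
    show "T \<subseteq> (\<Union>j. E j)"
    proof
      fix t assume t: "t \<in> T"
      then have l0: "norm (l t) / 20 > 0" and nl: "ntlim F' t (l t)" and cd: "cone_deriv F t (l t)" using l by auto
      obtain d1 where d1: "d1 > 0" "\<And>w. w \<in> stolz (real 2) t \<Longrightarrow> - d1 < Re w \<Longrightarrow> norm (F' w - l t) < norm (l t) / 20"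
        using nl l0 unfolding ntlim_def by meson
      obtain d2 where d2: "d2 > 0" "\<And>w. w \<in> stolz (real 2) t \<Longrightarrow> - d2 < Re w \<Longrightarrow>
          norm (F w - F (Complex 0 t) - l t * (w - Complex 0 t)) \<le> norm (l t) / 20 * norm (w - Complex 0 t)"
        using cd l0 unfolding cone_deriv_def by meson
      have "0 < min (norm (l t)) (min d1 d2)" using l0 d1 d2 by simp
      then obtain j where j: "1 / real (Suc j) < min (norm (l t)) (min d1 d2)" using nat_approx_posE by blast
      have "t \<in> E j" unfolding E_def mem_Collect_eq
      proof (intro conjI ballI impI t)
        show "1 / real (Suc j) \<le> norm (l t)" using j by simp
        fix w assume w: "w \<in> stolz (real 2) t" "- (1 / real (Suc j)) < Re w"
        show "norm (F' w - l t) \<le> norm (l t) / 20" using d1(2)[OF w(1)] w(2) j by simp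
        show "norm (F w - F (Complex 0 t) - l t * (w - Complex 0 t)) \<le> norm (l t) / 20 * norm (w - Complex 0 t)"
          using d2(2)[OF w(1)] w(2) j by simp
      qed
      then show "t \<in> (\<Union>j. E j)" by blast
    qed
  qed (auto simp: E_def)
  have "negligible (E j)" for j
  proof (rule length_null_expanding[OF N, of "1 / (2 * real (Suc j))" "1 / real (Suc j)" _ "\<lambda>t. F (Complex 0 t)"])
    show "(\<lambda>t. F (Complex 0 t)) ` E j \<subseteq> N" using im by (auto simp: E_def)
    fix t u assume tu: "t \<in> E j" "u \<in> E j" "\<bar>t - u\<bar> < 1 / real (Suc j)"
    show "1 / (2 * real (Suc j)) * \<bar>t - u\<bar> \<le> norm (F (Complex 0 t) - F (Complex 0 u))"
    proof (cases "t = u")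
      case False
      define d where "d = \<bar>t - u\<bar>"
      have d: "d > 0" "d < 1 / real (Suc j)" using False tu by (auto simp: d_def)
      \<comment> \<open>The apex is at distance \<open>d\<close> from \<open>Complex 0 t\<close>,
        and since \<open>\<bar>t - u\<bar> = d < 2 * d\<close> it lies in the cones of aperture 2 at
        both points.\<close>
      define w where "w = Complex (- d) t"
      have ws: "w \<in> stolz (real 2) t" "w \<in> stolz (real 2) u" "- (1 / real (Suc j)) < Re w"
        using d by (auto simp: w_def stolz_def d_def[symmetric])
      let ?a = "F w - F (Complex 0 t) - l t * (w - Complex 0 t)" and ?b = "F w - F (Complex 0 u) - l u * (w - Complex 0 u)"
      have wt: "w - Complex 0 t = - of_real d" by (simp add: w_def complex_eq_iff)
      have nwu: "norm (w - Complex 0 u) \<le> 2 * d"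
        using cmod_le[of "w - Complex 0 u"] d by (simp add: w_def d_def)
      have a: "norm ?a \<le> norm (l t) / 20 * d" and F't: "norm (F' w - l t) \<le> norm (l t) / 20"
        using tu(1) ws d(1) unfolding E_def by (auto simp: wt)
      have "norm ?b \<le> norm (l u) / 20 * norm (w - Complex 0 u)" and F'u: "norm (F' w - l u) \<le> norm (l u) / 20"
        using tu(2) ws unfolding E_def by auto
      then have "norm ?b \<le> norm (l u) / 20 * (2 * d)"
        using mult_left_mono[OF nwu, of "norm (l u) / 20"] by (meson norm_ge_zero divide_nonneg_pos order_trans zero_less_numeral)
      then have b: "norm ?b \<le> norm (l u) / 10 * d" by (simp add: mult.commute)
      have lu: "norm (l u - l t) \<le> norm (l t) / 20 + norm (l u) / 20"
        using norm_triangle_ineq[of "F' w - l t" "l u - F' w"] F't F'u by (simp add: norm_minus_commute)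
      have "norm (l u) \<le> norm (l t) + norm (l u - l t)" by (metis norm_triangle_sub)
      \<comment> \<open>Both limits are close to the common value \<open>F' w\<close>: 19/20 of
        \<open>norm (l u)\<close> is at most 21/20 of \<open>norm (l t)\<close>.\<close>
      then have lu2: "norm (l u) \<le> 21 / 19 * norm (l t)" using lu by simp
      have lu3: "norm (l u - l t) \<le> 2 / 19 * norm (l t)" using lu lu2 by simp
      have eq: "l t * (\<i> * of_real (t - u)) = (F (Complex 0 t) - F (Complex 0 u)) + (?a - ?b) - (l u - l t) * (w - Complex 0 u)"
      proof -
        have D: "\<i> * of_real (t - u) = (w - Complex 0 u) - (w - Complex 0 t)" by (simp add: complex_eq_iff)
        show ?thesis unfolding D by (simp add: algebra_simps)
      qed
      have "norm (l t) * d = norm (l t * (\<i> * of_real (t - u)))"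
        unfolding d_def norm_mult norm_of_real by simp
      also have "\<dots> \<le> norm (F (Complex 0 t) - F (Complex 0 u)) + (norm ?a + norm ?b) + norm (l u - l t) * norm (w - Complex 0 u)"
        unfolding eq using norm_triangle_ineq4[of "(F (Complex 0 t) - F (Complex 0 u)) + (?a - ?b)" "(l u - l t) * (w - Complex 0 u)"]
          norm_triangle_ineq[of "F (Complex 0 t) - F (Complex 0 u)" "?a - ?b"] norm_triangle_ineq4[of ?a ?b]
        by (simp only: norm_mult)
      also have "norm (l u - l t) * norm (w - Complex 0 u) \<le> 2 / 19 * norm (l t) * (2 * d)"
        by (rule mult_mono[OF lu3 nwu]) auto
      finally have "norm (l t) * d \<le> norm (F (Complex 0 t) - F (Complex 0 u)) + (norm (l t) / 20 * d + norm (l u) / 10 * d) + 2 / 19 * norm (l t) * (2 * d)"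
        using a b by linarith
      also have "norm (l u) / 10 * d \<le> 21 / 190 * norm (l t) * d" using lu2 d(1) by simp
      finally have "norm (l t) * d / 2 \<le> norm (F (Complex 0 t) - F (Complex 0 u))"
        using mult_nonneg_nonneg[OF norm_ge_zero[of "l t"] less_imp_le[OF d(1)]] by (simp add: field_simps)
      moreover have "1 / real (Suc j) * d \<le> norm (l t) * d" using tu(1) d(1) by (intro mult_right_mono) (auto simp: E_def)
      then have "1 / real (Suc j) * d / 2 \<le> norm (l t) * d / 2" by (rule divide_right_mono) simp
      moreover have "1 / (2 * real (Suc j)) * d = 1 / real (Suc j) * d / 2" by (simp add: field_simps)
      ultimately show ?thesis unfolding d_def[symmetric] by (metis order_trans)
    qed simp
  qed auto
  then show ?thesis unfolding cover negligible_iff_null_sets by (intro null_sets_UN)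
qed

text \<open>To first order \<open>F\<close> acts at the boundary point as multiplication by
  \<open>l\<close>, which turns the left half-plane into another half-plane. No image point enters
  the sector around \<open>n\<close> outside the closure of \<open>\<Omega>\<close>, so that
  half-plane lies on the side away from \<open>n\<close>, and \<open>n\<close> must be a positive
  multiple of \<open>l\<close>.\<close>

lemma outward_normal_cone_deriv:
  assumes n: "outward_unit_normal \<Omega> (F (Complex 0 t)) n"
    and F: "\<And>w. Re w < 0 \<Longrightarrow> F w \<in> \<Omega>" and cd: "cone_deriv F t l" and l: "l \<noteq> 0"
  shows "n = sgn l"
proof -
  let ?p = "F (Complex 0 t)"
  have n1: "norm n = 1" using n by (simp add: outward_unit_normal_def)
  have half: "(l * v) \<bullet> n \<le> 0" if v: "Re v < 0" for v
  proof (rule ccontr)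
    assume pos: "\<not> (l * v) \<bullet> n \<le> 0"
    define c where "c = (l * v) \<bullet> n"
    have c: "c > 0" using pos by (simp add: c_def)
    have cle: "c \<le> norm (l * v)" using norm_cauchy_schwarz[of "l * v" n] n1 by (simp add: c_def)
    then have lv: "norm (l * v) > 0" using c by linarith
    have v0: "norm v > 0" using v by auto
    \<comment> \<open>An aperture for which the ray in direction \<open>v\<close> lies in the
      cone.\<close>
    obtain K :: nat where K: "\<bar>Im v\<bar> / (- Re v) < real K" using reals_Archimedean2 by blast
    then have K: "\<bar>Im v\<bar> < real K * (- Re v)" using v by (simp add: field_simps)
    obtain d where d: "d > 0" "\<And>w. w \<in> stolz (real K) t \<Longrightarrow> - d < Re w \<Longrightarrow>
        norm (F w - ?p - l * (w - Complex 0 t)) \<le> c / (4 * norm v) * norm (w - Complex 0 t)"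
      using cd c v0 unfolding cone_deriv_def by (metis divide_pos_pos mult_pos_pos zero_less_numeral)
    have "c / (4 * norm (l * v)) > 0" using c lv by simp
    then obtain \<delta> where \<delta>: "\<delta> > 0" "\<And>z. z \<in> ball ?p \<delta> \<Longrightarrow> (z - ?p) \<bullet> n > c / (4 * norm (l * v)) * norm (z - ?p) \<Longrightarrow> z \<notin> closure \<Omega>"
      using n unfolding outward_unit_normal_def by metis
    \<comment> \<open>The first bound keeps \<open>w\<close> in the range of the cone derivative,
      the second keeps \<open>F w\<close> within \<open>\<delta>\<close> of the boundary
      point.\<close>
    define s where "s = min (d / (2 * (- Re v))) (\<delta> / (4 * norm (l * v)))"
    have s: "s > 0" using d(1) v \<delta>(1) lv by (simp add: s_def divide_pos_neg)
    define w where "w = Complex 0 t + of_real s * v"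
    have Rw: "Re w = s * Re v" and Iw: "Im w - t = s * Im v" by (simp_all add: w_def)
    have "Re w < 0" using Rw s v by (simp add: mult_pos_neg)
    have ws: "w \<in> stolz (real K) t" using mult_strict_left_mono[OF K s] s by (simp add: stolz_def Rw Iw abs_mult algebra_simps)
    have "s * (- Re v) \<le> d / 2"
    proof -
      have "s * (- Re v) \<le> d / (2 * (- Re v)) * (- Re v)" by (rule mult_right_mono) (use v in \<open>auto simp: s_def\<close>)
      then show ?thesis using v by simp
    qed
    then have wd: "- d < Re w" using Rw d(1) by simp
    define err where "err = F w - ?p - l * (w - Complex 0 t)"
    have "norm err \<le> c / (4 * norm v) * norm (of_real s * v)" using d(2)[OF ws wd] by (simp add: err_def w_def)
    then have err: "norm err \<le> s * c / 4" using s v0 by (simp add: norm_mult field_simps)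
    have Fw: "F w - ?p = of_real s * (l * v) + err" by (simp add: err_def w_def algebra_simps)
    have nF: "norm (F w - ?p) \<le> s * norm (l * v) + s * c / 4"
      unfolding Fw using norm_triangle_ineq[of "of_real s * (l * v)" err] err s by (simp add: norm_mult)
    also have "\<dots> \<le> s * norm (l * v) + s * norm (l * v) / 4" using cle s by simp
    finally have nF2: "norm (F w - ?p) \<le> 5 / 4 * (s * norm (l * v))" by simp
    also have "s * norm (l * v) \<le> \<delta> / 4"
    proof -
      have "s * norm (l * v) \<le> \<delta> / (4 * norm (l * v)) * norm (l * v)" by (rule mult_right_mono) (auto simp: s_def)
      then show ?thesis using lv by simp
    qed
    finally have ball: "F w \<in> ball ?p \<delta>" using \<delta>(1) by (simp add: dist_norm norm_minus_commute)
    have "c / (4 * norm (l * v)) * norm (F w - ?p) \<le> c / (4 * norm (l * v)) * (5 / 4 * (s * norm (l * v)))"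
      by (rule mult_left_mono[OF nF2]) (use c lv in simp)
    also have "\<dots> = 5 / 16 * (s * c)" using lv by (simp add: field_simps)
    also have "\<dots> < 3 / 4 * (s * c)" using s c by simp
    also have "3 / 4 * (s * c) \<le> (F w - ?p) \<bullet> n"
    proof -
      have "(of_real s * (l * v)) \<bullet> n = s * c" by (simp add: c_def scaleR_conv_of_real[symmetric])
      moreover have "\<bar>err \<bullet> n\<bar> \<le> s * c / 4" using Cauchy_Schwarz_ineq2[of err n] n1 err by simp
      ultimately show ?thesis unfolding Fw inner_add_left by linarith
    qed
    finally have "F w \<notin> closure \<Omega>" by (rule \<delta>(2)[OF ball])
    then show False using F[OF \<open>Re w < 0\<close>] closure_subset by blast
  qed
  define r where "r = l \<bullet> n"
  have r0: "r \<ge> 0" using half[of "-1"] by (simp add: r_def)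
  \<comment> \<open>The directions \<open>- s + \<i>\<close> and \<open>- s - \<i>\<close> tend to
    the edge of the half-plane as \<open>s\<close> tends to 0; the two resulting inequalities leave
    no tangential component.\<close>
  have tang: "(l * \<i>) \<bullet> n = 0"
  proof -
    have "(l * \<i>) \<bullet> n \<le> s * r" "- ((l * \<i>) \<bullet> n) \<le> s * r" if "s > 0" for s
      using half[of "- of_real s + \<i>"] half[of "- of_real s - \<i>"] that
      by (simp_all add: r_def inner_diff_left inner_add_left inner_complex_def algebra_simps)
    then have "\<bar>(l * \<i>) \<bullet> n\<bar> \<le> s * r" if "s > 0" for s using that by (simp add: abs_le_iff)
    then have "\<bar>(l * \<i>) \<bullet> n\<bar> \<le> 0 + e" if "e > 0" for e
    proof -
      have "e / (r + 1) * r \<le> e" using r0 that by (simp add: field_simps)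
      then show ?thesis using \<open>\<And>s. s > 0 \<Longrightarrow> \<bar>(l * \<i>) \<bullet> n\<bar> \<le> s * r\<close>[of "e / (r + 1)"] that r0 by simp
    qed
    then have "\<bar>(l * \<i>) \<bullet> n\<bar> \<le> 0" by (rule field_le_epsilon)
    then show ?thesis by simp
  qed
  \<comment> \<open>The inner products of \<open>l\<close> and \<open>l * \<i>\<close> with
    \<open>n\<close> are the real and the imaginary part of \<open>cnj l * n\<close>.\<close>
  have eq: "cnj l * n = of_real r"
    using tang by (simp add: complex_eq_iff r_def inner_complex_def algebra_simps)
  have "norm (cnj l * n) = norm l" using n1 by (simp add: norm_mult)
  then have "r = norm l" using r0 by (simp add: eq)
  then have "l * (cnj l * n) = l * of_real (norm l)" using eq by simp
  then have "of_real ((norm l)\<^sup>2) * n = l * of_real (norm l)" by (simp only: complex_norm_square mult.assoc)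
  then have "of_real (norm l) * (of_real (norm l) * n) = of_real (norm l) * l" by (simp add: power2_eq_square mult_ac)
  then have "of_real (norm l) * n = l" using l by simp
  then show ?thesis using l by (simp add: sgn_eq field_simps)
qed

section \<open>Uniformizations\<close>

lemma uniformizationD:
  assumes "uniformization f \<Omega>"
  shows "f holomorphic_on ball 0 1" "inj_on f (cball 0 1)" "f ` ball 0 1 = \<Omega>" "continuous_on (cball 0 1) f"
    "z \<in> sphere 0 1 \<Longrightarrow> f z \<in> frontier \<Omega>" "z \<in> ball 0 1 \<Longrightarrow> deriv f z \<noteq> 0"
    "inv_into (ball 0 1) f holomorphic_on \<Omega>" "open \<Omega>"
proof -
  obtain k where k: "homeomorphism (cball 0 1) (closure \<Omega>) f k" "f ` ball 0 1 = \<Omega>"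
    "f holomorphic_on ball 0 1" "k holomorphic_on \<Omega>"
    using assms by (auto simp: uniformization_def)
  show hol: "f holomorphic_on ball 0 1" and img: "f ` ball 0 1 = \<Omega>" by fact+
  show inj: "inj_on f (cball 0 1)" by (metis k(1) homeomorphism_def inj_on_inverseI)
  show "continuous_on (cball 0 1) f" using k(1) by (simp add: homeomorphism_def)
  have injb: "inj_on f (ball 0 1)" using inj by (rule inj_on_subset) auto
  show op: "open \<Omega>" using open_holomorphic_image[OF _ hol injb] img by simp
  show "z \<in> ball 0 1 \<Longrightarrow> deriv f z \<noteq> 0" using holomorphic_injective_imp_regular[OF hol _ injb] by auto
  show "f z \<in> frontier \<Omega>" if "z \<in> sphere 0 1"
  proof -
    have "f z \<in> closure \<Omega>" using k(1) that unfolding homeomorphism_def by (metis imageI sphere_cball subsetD)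
    moreover have "f z \<notin> \<Omega>"
    proof
      assume "f z \<in> \<Omega>"
      then obtain y where y: "y \<in> ball 0 1" "f z = f y" using img by auto
      then have "z = y" using inj that y by (auto dest!: inj_onD)
      then show False using y that by simp
    qed
    ultimately show ?thesis using op by (simp add: frontier_def interior_open)
  qed
  \<comment> \<open>On \<open>\<Omega>\<close> the inverse homeomorphism coincides with the inverse
    used in the statements, which is therefore holomorphic.\<close>
  have "k w = inv_into (ball 0 1) f w" if "w \<in> \<Omega>" for w
  proof -
    obtain z where z: "z \<in> ball 0 1" "w = f z" using \<open>w \<in> \<Omega>\<close> unfolding img[symmetric] by blast
    then have "k w = z" using k(1) by (simp add: homeomorphism_def)
    then show ?thesis using z injb by simp
  qed
  then show "inv_into (ball 0 1) f holomorphic_on \<Omega>" using holomorphic_cong[of \<Omega> \<Omega> k] k(4) by simp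
qed

lemma uniformization_inj_ball: "uniformization f \<Omega> \<Longrightarrow> inj_on f (ball 0 1)"
  by (rule inj_on_subset[OF uniformizationD(2)]) auto

lemma inverse_uniformization:
  assumes "uniformization f \<Omega>"
  shows "w \<in> \<Omega> \<Longrightarrow> inv_into (ball 0 1) f w \<in> ball 0 1" "w \<in> \<Omega> \<Longrightarrow> f (inv_into (ball 0 1) f w) = w"
    "z \<in> ball 0 1 \<Longrightarrow> inv_into (ball 0 1) f (f z) = z"
proof -
  show "inv_into (ball 0 1) f w \<in> ball 0 1" if "w \<in> \<Omega>"
    by (rule inv_into_into) (use uniformizationD(3)[OF assms] that in simp)
  show "f (inv_into (ball 0 1) f w) = w" if "w \<in> \<Omega>"
    by (rule f_inv_into_f) (use uniformizationD(3)[OF assms] that in simp)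
  show "inv_into (ball 0 1) f (f z) = z" if "z \<in> ball 0 1"
    using uniformization_inj_ball[OF assms] that by (rule inv_into_f_f)
qed

section \<open>Transition maps between uniformizations\<close>

lemma disc_automorphism_fixing_0:
  assumes h: "h holomorphic_on ball 0 1" "h ` ball 0 1 \<subseteq> ball 0 1" "h 0 = 0"
    and k: "k holomorphic_on ball 0 1" "k ` ball 0 1 \<subseteq> ball 0 1"
    and kh: "\<And>z. z \<in> ball 0 1 \<Longrightarrow> k (h z) = z"
  obtains \<alpha> where "norm \<alpha> = 1" "\<And>z. norm z < 1 \<Longrightarrow> h z = \<alpha> * z"
proof -
  have k0: "k 0 = 0" using kh[of 0] h by simp
  have b: "norm (h z) < 1" "norm (k z) < 1" if "norm z < 1" for z using that h(2) k(2) by (auto simp: image_subset_iff)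
  have z: "norm (1/2 :: complex) < 1" by simp
  \<comment> \<open>Schwarz's lemma for \<open>h\<close> and for its left inverse \<open>k\<close>
    gives equality of norms at the test point 1/2, and equality at one nonzero point forces a
    rotation.\<close>
  have "norm (h (1/2)) \<le> norm (1/2 :: complex)" by (rule Schwarz_Lemma(1)[OF h(1,3) b(1) z])
  moreover have "norm (k (h (1/2))) \<le> norm (h (1/2))" by (rule Schwarz_Lemma(1)[OF k(1) k0 b(2) b(1)[OF z]])
  ultimately have "norm (h (1/2)) = norm (1/2 :: complex)" using kh[of "1/2"] by simp
  then have "\<exists>z::complex. norm z < 1 \<and> z \<noteq> 0 \<and> norm (h z) = norm z" by (intro exI[of _ "1/2"]) simp
  then have "\<exists>\<alpha>. (\<forall>z. norm z < 1 \<longrightarrow> h z = \<alpha> * z) \<and> norm \<alpha> = 1"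
    using Schwarz_Lemma(3)[OF h(1,3) b(1) z] by blast
  then show thesis using that by blast
qed

lemma uniformization_transition:
  assumes f: "uniformization f \<Omega>" and g: "uniformization g \<Omega>"
  shows "(\<lambda>z. inv_into (ball 0 1) f (g z)) holomorphic_on ball 0 1"
    "(\<lambda>z. inv_into (ball 0 1) f (g z)) ` ball 0 1 = ball 0 1"
    "z \<in> ball 0 1 \<Longrightarrow> inv_into (ball 0 1) g (f (inv_into (ball 0 1) f (g z))) = z"
proof -
  have gO: "g z \<in> \<Omega>" and fO: "f z \<in> \<Omega>" if "z \<in> ball 0 1" for z
    using uniformizationD(3)[OF g] uniformizationD(3)[OF f] that by auto
  show "(\<lambda>z. inv_into (ball 0 1) f (g z)) holomorphic_on ball 0 1"
    by (rule holomorphic_on_compose_gen[OF uniformizationD(1)[OF g] uniformizationD(7)[OF f], unfolded o_def])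
      (use gO in auto)
  show "(\<lambda>z. inv_into (ball 0 1) f (g z)) ` ball 0 1 = ball 0 1"
  proof
    show "(\<lambda>z. inv_into (ball 0 1) f (g z)) ` ball 0 1 \<subseteq> ball 0 1" using inverse_uniformization(1)[OF f gO] by auto
    show "ball 0 1 \<subseteq> (\<lambda>z. inv_into (ball 0 1) f (g z)) ` ball 0 1"
    proof
      fix z :: complex assume z: "z \<in> ball 0 1"
      show "z \<in> (\<lambda>z. inv_into (ball 0 1) f (g z)) ` ball 0 1"
        by (rule image_eqI[of _ _ "inv_into (ball 0 1) g (f z)"])
          (use inverse_uniformization(1,2)[OF g fO[OF z]] inverse_uniformization(3)[OF f z] in auto)
    qed
  qed
  show "inv_into (ball 0 1) g (f (inv_into (ball 0 1) f (g z))) = z" if "z \<in> ball 0 1"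
    using inverse_uniformization(2)[OF f gO[OF that]] inverse_uniformization(3)[OF g that] by simp
qed

text \<open>The uniformization hidden in \<open>canonical_conditions\<close> need not be the given
  one; this lemma says how far apart the two can be.\<close>

lemma uniformization_rotation:
  assumes f: "uniformization f \<Omega>" and g: "uniformization g \<Omega>" and 0: "f 0 = g 0"
  obtains \<alpha> where "norm \<alpha> = 1" "\<And>z. norm z < 1 \<Longrightarrow> g z = f (\<alpha> * z)"
proof -
  let ?m = "\<lambda>z. inv_into (ball 0 1) f (g z)" and ?k = "\<lambda>z. inv_into (ball 0 1) g (f z)"
  have m0: "?m 0 = 0" using inverse_uniformization(3)[OF f, of 0] 0 by simp
  obtain \<alpha> where \<alpha>: "norm \<alpha> = 1" "\<And>z. norm z < 1 \<Longrightarrow> ?m z = \<alpha> * z"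
    by (rule disc_automorphism_fixing_0[OF uniformization_transition(1)[OF f g] _ m0 uniformization_transition(1)[OF g f] _
          uniformization_transition(3)[OF f g]]) (use uniformization_transition(2)[OF f g] uniformization_transition(2)[OF g f] in auto)
  have "g z = f (\<alpha> * z)" if "norm z < 1" for z
    using inverse_uniformization(2)[OF f, of "g z"] uniformizationD(3)[OF g] \<alpha>(2)[OF that] that by auto
  then show thesis using that \<alpha>(1) by blast
qed

text \<open>Composing the transition map with a Moebius map that carries 0 to the zero
  \<open>b\<close> reduces the claim to an automorphism fixing 0.\<close>

lemma uniformization_Moebius:
  assumes f: "uniformization f \<Omega>" and g: "uniformization g \<Omega>"
  obtains b \<alpha> where "norm b < 1" "norm \<alpha> = 1"
    "\<And>z. norm z < 1 \<Longrightarrow> inv_into (ball 0 1) f (g z) = \<alpha> * ((z - b) / (1 - cnj b * z))"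
proof -
  let ?m = "\<lambda>z. inv_into (ball 0 1) f (g z)" and ?k = "\<lambda>z. inv_into (ball 0 1) g (f z)"
  note m = uniformization_transition[OF f g] and k = uniformization_transition[OF g f]
  define b where "b = ?k 0"
  have b: "norm b < 1" using k(2) by (auto simp: b_def)
  have mb: "?m b = 0" using k(3)[of 0] by (simp add: b_def)
  define \<phi> where "\<phi> = Moebius_function 0 b"
  define \<psi> where "\<psi> = Moebius_function 0 (- b)"
  have h\<phi>: "\<phi> holomorphic_on ball 0 1" "\<psi> holomorphic_on ball 0 1"
    using Moebius_function_holomorphic[of b] Moebius_function_holomorphic[of "-b"] b by (auto simp: \<phi>_def \<psi>_def)
  have b\<phi>: "\<phi> z \<in> ball 0 1" "\<psi> z \<in> ball 0 1" if "z \<in> ball 0 1" for z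
    using Moebius_function_norm_lt_1[of b z] Moebius_function_norm_lt_1[of "-b" z] b that by (auto simp: \<phi>_def \<psi>_def)
  have inv: "\<phi> (\<psi> z) = z" "\<psi> (\<phi> z) = z" if "z \<in> ball 0 1" for z
    using Moebius_function_compose[of b "-b" z] Moebius_function_compose[of "-b" b z] b that by (auto simp: \<phi>_def \<psi>_def)
  have mB: "?m z \<in> ball 0 1" "?k z \<in> ball 0 1" if "z \<in> ball 0 1" for z using m(2) k(2) that by blast+
  obtain \<alpha> where \<alpha>: "norm \<alpha> = 1" "\<And>z. norm z < 1 \<Longrightarrow> ?m (\<psi> z) = \<alpha> * z"
  proof (rule disc_automorphism_fixing_0[of "\<lambda>z. ?m (\<psi> z)" "\<lambda>z. \<phi> (?k z)"])
    show "(\<lambda>z. ?m (\<psi> z)) holomorphic_on ball 0 1"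
      by (rule holomorphic_on_compose_gen[OF h\<phi>(2) m(1), unfolded o_def]) (use b\<phi> in auto)
    show "(\<lambda>z. \<phi> (?k z)) holomorphic_on ball 0 1"
      by (rule holomorphic_on_compose_gen[OF k(1) h\<phi>(1), unfolded o_def]) (use mB in auto)
    show "(\<lambda>z. ?m (\<psi> z)) ` ball 0 1 \<subseteq> ball 0 1" "(\<lambda>z. \<phi> (?k z)) ` ball 0 1 \<subseteq> ball 0 1" using b\<phi> mB by blast+
    show "?m (\<psi> 0) = 0" using mb by (simp add: \<psi>_def Moebius_function_simple)
    show "\<phi> (?k (?m (\<psi> z))) = z" if "z \<in> ball 0 1" for z using m(3)[OF b\<phi>(2)[OF that]] inv(1)[OF that] by simp
  qed blast
  have "?m z = \<alpha> * ((z - b) / (1 - cnj b * z))" if "norm z < 1" for z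
    using \<alpha>(2)[of "\<phi> z"] b\<phi>(1)[of z] inv(2)[of z] that by (auto simp: \<phi>_def Moebius_function_simple)
  then show thesis using that b \<alpha>(1) by blast
qed

text \<open>With g = f o m for a Moebius map m, the quotient g''/g' is m' times the pulled back
  f''/f', plus m''/m'. The first term keeps its L2 norm under the change of variables; the second is
  \<open>2 * cnj b / (1 - cnj b * z)\<close>, bounded since \<open>norm b < 1\<close>.\<close>

lemma uniformization_dirichlet:
  assumes f: "uniformization f \<Omega>" and g: "uniformization g \<Omega>"
    and F: "set_integrable lborel (ball 0 1) (\<lambda>z. (norm (deriv (deriv f) z / deriv f z))\<^sup>2)"
  shows "set_integrable lborel (ball 0 1) (\<lambda>z. (norm (deriv (deriv g) z / deriv g z))\<^sup>2)"
proof -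
  let ?B = "ball 0 1 :: complex set"
  define m where "m z = inv_into ?B f (g z)" for z
  have mh: "m holomorphic_on ?B" and mimg: "m ` ?B = ?B"
    using uniformization_transition[OF f g] by (simp_all add: m_def[abs_def])
  have minj: "inj_on m ?B"
    using uniformization_transition(3)[OF f g] unfolding m_def by (rule inj_on_inverseI[where g = "\<lambda>w. inv_into ?B g (f w)"])
  obtain b \<alpha> where b: "norm b < 1" "norm \<alpha> = 1" "\<And>z. norm z < 1 \<Longrightarrow> m z = \<alpha> * ((z - b) / (1 - cnj b * z))"
    using uniformization_Moebius[OF f g] unfolding m_def by metis
  have gm: "g z = f (m z)" if "z \<in> ?B" for z
    using inverse_uniformization(2)[OF f, of "g z"] uniformizationD(3)[OF g] that by (auto simp: m_def)
  have den: "norm (1 - cnj b * z) \<ge> 1 - norm b" if "z \<in> ?B" for z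
  proof -
    have "norm (cnj b * z) \<le> norm b" using that by (simp add: norm_mult mult_left_le)
    then show ?thesis using norm_triangle_ineq2[of 1 "cnj b * z"] by simp
  qed
  then have den0: "1 - cnj b * z \<noteq> 0" if "z \<in> ?B" for z using that b(1) by fastforce
  define C where "C = 1 - cnj b * b"
  have C0: "C \<noteq> 0" using den0[of b] b(1) by (simp add: C_def)
  have m': "deriv m z = \<alpha> * C / (1 - cnj b * z)\<^sup>2" if z: "z \<in> ?B" for z
  proof -
    have "((\<lambda>z. \<alpha> * ((z - b) / (1 - cnj b * z))) has_field_derivative \<alpha> * C / (1 - cnj b * z)\<^sup>2) (at z)"
    proof -
      have "((\<lambda>z. (z - b) / (1 - cnj b * z)) has_field_derivative
          (1 * (1 - cnj b * z) - (z - b) * (- cnj b)) / ((1 - cnj b * z) * (1 - cnj b * z))) (at z)"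
        by (rule DERIV_divide) (use den0[OF z] in \<open>auto intro!: derivative_eq_intros\<close>)
      also have "1 * (1 - cnj b * z) - (z - b) * (- cnj b) = C" by (simp add: C_def algebra_simps)
      finally show ?thesis using DERIV_cmult[of _ _ _ _ \<alpha>] by (fastforce simp: power2_eq_square)
    qed
    then have "(m has_field_derivative \<alpha> * C / (1 - cnj b * z)\<^sup>2) (at z)"
      by (rule has_field_derivative_transform_within_open[of _ _ _ ?B]) (use z b(3) in auto)
    then show ?thesis by (rule DERIV_imp_deriv)
  qed
  have m'': "deriv (deriv m) z = 2 * cnj b / (1 - cnj b * z) * deriv m z" if z: "z \<in> ?B" for z
  proof -
    have "((\<lambda>z. \<alpha> * C / (1 - cnj b * z)\<^sup>2) has_field_derivative 2 * cnj b / (1 - cnj b * z) * (\<alpha> * C / (1 - cnj b * z)\<^sup>2)) (at z)"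
    proof -
      have "((\<lambda>z. (1 - cnj b * z)\<^sup>2) has_field_derivative (2 * (1 - cnj b * z) * (- cnj b))) (at z)"
        by (auto intro!: derivative_eq_intros)
      moreover have "(1 - cnj b * z)\<^sup>2 \<noteq> 0" using den0[OF z] by simp
      ultimately
      have "((\<lambda>z. \<alpha> * C / (1 - cnj b * z)\<^sup>2) has_field_derivative
        (0 * (1 - cnj b * z)\<^sup>2 - \<alpha> * C * (2 * (1 - cnj b * z) * (- cnj b))) / ((1 - cnj b * z)\<^sup>2 * (1 - cnj b * z)\<^sup>2)) (at z)"
        by (rule DERIV_divide[OF DERIV_const])
      moreover have "(0 * D\<^sup>2 - \<alpha> * C * (2 * D * (- cnj b))) / (D\<^sup>2 * D\<^sup>2) = 2 * cnj b / D * (\<alpha> * C / D\<^sup>2)"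
        if "D \<noteq> 0" for D using that by (simp add: divide_simps power2_eq_square)
      note this[OF den0[OF z]]
      ultimately show ?thesis by (rule DERIV_cong)
    qed
    then have "(deriv m has_field_derivative 2 * cnj b / (1 - cnj b * z) * (\<alpha> * C / (1 - cnj b * z)\<^sup>2)) (at z)"
      by (rule has_field_derivative_transform_within_open[OF _ open_ball z m'[symmetric]])
    then show ?thesis using m'[OF z] by (simp add: DERIV_imp_deriv)
  qed
  note fh = uniformizationD(1)[OF f]
  have dfh: "deriv f holomorphic_on ?B" using fh by (rule holomorphic_deriv) simp
  have dm: "(m has_field_derivative deriv m z) (at z)" "(deriv m has_field_derivative deriv (deriv m) z) (at z)" if "z \<in> ?B" for z
    using holomorphic_derivI[OF mh open_ball that] holomorphic_derivI[OF holomorphic_deriv[OF mh open_ball] open_ball that] by auto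
  have g': "deriv g z = deriv f (m z) * deriv m z" if z: "z \<in> ?B" for z
  proof -
    have mz: "m z \<in> ?B" using mimg z by blast
    have "((\<lambda>z. f (m z)) has_field_derivative deriv f (m z) * deriv m z) (at z)"
      by (rule DERIV_chain2[OF holomorphic_derivI[OF fh _ mz] dm(1)[OF z]]) simp
    then have "(g has_field_derivative deriv f (m z) * deriv m z) (at z)"
      by (rule has_field_derivative_transform_within_open[OF _ open_ball z gm[symmetric]])
    then show ?thesis by (rule DERIV_imp_deriv)
  qed
  have quot: "deriv (deriv g) z / deriv g z = deriv (deriv f) (m z) / deriv f (m z) * deriv m z + 2 * cnj b / (1 - cnj b * z)"
    if z: "z \<in> ?B" for z
  proof -
    have mz: "m z \<in> ?B" using mimg z by blast
    have "((\<lambda>z. deriv f (m z)) has_field_derivative deriv (deriv f) (m z) * deriv m z) (at z)"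
      by (rule DERIV_chain2[OF holomorphic_derivI[OF dfh _ mz] dm(1)[OF z]]) simp
    from DERIV_mult[OF this dm(2)[OF z]]
    have "((\<lambda>z. deriv f (m z) * deriv m z) has_field_derivative deriv (deriv f) (m z) * deriv m z * deriv m z + deriv (deriv m) z * deriv f (m z)) (at z)" .
    then have "(deriv g has_field_derivative deriv (deriv f) (m z) * deriv m z * deriv m z + deriv (deriv m) z * deriv f (m z)) (at z)"
      by (rule has_field_derivative_transform_within_open[OF _ open_ball z g'[symmetric]])
    then have g'': "deriv (deriv g) z = deriv (deriv f) (m z) * deriv m z * deriv m z + deriv (deriv m) z * deriv f (m z)"
      by (rule DERIV_imp_deriv)
    have "deriv f (m z) \<noteq> 0" "deriv m z \<noteq> 0"
      using uniformizationD(6)[OF f mz] holomorphic_injective_imp_regular[OF mh _ minj z] by auto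
    then show ?thesis by (simp add: g'' g'[OF z] m''[OF z] add_divide_distrib)
  qed
  let ?q = "\<lambda>z. (norm (deriv (deriv f) z / deriv f z))\<^sup>2"
  have cq: "continuous_on ?B ?q"
    using uniformizationD(6)[OF f] holomorphic_on_imp_continuous_on[OF dfh]
      holomorphic_on_imp_continuous_on[OF holomorphic_deriv[OF dfh open_ball]] by (intro continuous_intros) auto
  have "set_integrable lborel (m ` ?B) ?q" using F mimg by simp
  then have I: "set_integrable lborel ?B (\<lambda>z. (norm (deriv m z))\<^sup>2 *\<^sub>R ?q (m z))"
    using set_integral_holomorphic_image(1)[OF open_ball mh minj set_borel_measurable_continuous_open, of ?q] cq mimg by simp
  have bound: "(norm (deriv (deriv g) z / deriv g z))\<^sup>2 \<le> 2 * ((norm (deriv m z))\<^sup>2 *\<^sub>R ?q (m z)) + 2 * (2 / (1 - norm b))\<^sup>2"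
    if z: "z \<in> ?B" for z
  proof -
    let ?x = "norm (deriv (deriv f) (m z) / deriv f (m z) * deriv m z)" and ?y = "norm (2 * cnj b / (1 - cnj b * z))"
    have "norm (deriv (deriv g) z / deriv g z) \<le> ?x + ?y" unfolding quot[OF z] by (rule norm_triangle_ineq)
    then have "(norm (deriv (deriv g) z / deriv g z))\<^sup>2 \<le> (?x + ?y)\<^sup>2" by (rule power_mono) simp
    also have "\<dots> \<le> 2 * ?x\<^sup>2 + 2 * ?y\<^sup>2" using sum_squares_bound[of ?x ?y] by (simp add: power2_sum)
    also have "?y\<^sup>2 \<le> (2 / (1 - norm b))\<^sup>2"
    proof (rule power_mono)
      show "?y \<le> 2 / (1 - norm b)" using den[OF z] b(1) by (simp add: norm_divide norm_mult) (intro frac_le; simp)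
    qed simp
    finally have "(norm (deriv (deriv g) z / deriv g z))\<^sup>2 \<le> 2 * ?x\<^sup>2 + 2 * (2 / (1 - norm b))\<^sup>2" by simp
    moreover have "?x\<^sup>2 = (norm (deriv m z))\<^sup>2 *\<^sub>R ?q (m z)"
      by (simp only: norm_mult power_mult_distrib real_scaleR_def mult.commute)
    ultimately show ?thesis by simp
  qed
  have dgh: "deriv g holomorphic_on ?B" using uniformizationD(1)[OF g] by (rule holomorphic_deriv) simp
  have cg: "continuous_on ?B (\<lambda>z. (norm (deriv (deriv g) z / deriv g z))\<^sup>2)"
    using uniformizationD(6)[OF g] holomorphic_on_imp_continuous_on[OF dgh]
      holomorphic_on_imp_continuous_on[OF holomorphic_deriv[OF dgh open_ball]] by (intro continuous_intros) auto
  show ?thesis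
  proof (rule set_integrable_bound)
    have "set_integrable lborel ?B (\<lambda>z. 2 * (2 / (1 - norm b))\<^sup>2)"
      unfolding set_integrable_def by (intro integrable_scaleR_left integrable_real_indicator) (use emeasure_bounded_finite[OF bounded_ball] in auto)
    then show "set_integrable lborel ?B (\<lambda>z. 2 * ((norm (deriv m z))\<^sup>2 *\<^sub>R ?q (m z)) + 2 * (2 / (1 - norm b))\<^sup>2)"
      by (rule set_integral_add(1)[OF set_integrable_mult_right[OF I]])
    show "set_borel_measurable lborel ?B (\<lambda>z. (norm (deriv (deriv g) z / deriv g z))\<^sup>2)"
      using set_borel_measurable_continuous_open[OF cg] by (simp add: set_borel_measurable_def)
    show "AE z in lborel. z \<in> ?B \<longrightarrow> norm ((norm (deriv (deriv g) z / deriv g z))\<^sup>2)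
        \<le> norm (2 * ((norm (deriv m z))\<^sup>2 *\<^sub>R ?q (m z)) + 2 * (2 / (1 - norm b))\<^sup>2)"
    proof (intro AE_I2 impI)
      fix z assume "z \<in> ?B"
      from bound[OF this]
      show "norm ((norm (deriv (deriv g) z / deriv g z))\<^sup>2) \<le> norm (2 * ((norm (deriv m z))\<^sup>2 *\<^sub>R ?q (m z)) + 2 * (2 / (1 - norm b))\<^sup>2)"
        by simp
    qed
  qed
qed

text \<open>The logarithm exists because the disc is contractible and \<open>deriv f\<close> has no
  zero. Its derivative is the quotient in the Weil-Petersson condition, which thus says that
  \<open>L\<close> belongs to the Dirichlet space.\<close>

lemma uniformization_log_deriv:
  assumes f: "uniformization f \<Omega>"
  obtains L where "L holomorphic_on ball 0 1" "\<And>z. z \<in> ball 0 1 \<Longrightarrow> deriv f z = exp (L z)"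
    "\<And>z. z \<in> ball 0 1 \<Longrightarrow> deriv L z = deriv (deriv f) z / deriv f z"
proof -
  let ?B = "ball 0 1 :: complex set"
  have dfh: "deriv f holomorphic_on ?B" using uniformizationD(1)[OF f] by (rule holomorphic_deriv) simp
  have "contractible ?B" by (intro convex_imp_contractible) simp
  then obtain L where L: "L holomorphic_on ?B" "\<And>z. z \<in> ?B \<Longrightarrow> deriv f z = exp (L z)"
    using contractible_imp_holomorphic_log[OF dfh] uniformizationD(6)[OF f] by metis
  have "deriv L z = deriv (deriv f) z / deriv f z" if z: "z \<in> ?B" for z
  proof -
    have "((\<lambda>z. exp (L z)) has_field_derivative exp (L z) * deriv L z) (at z)"
      by (rule DERIV_chain2[OF DERIV_exp holomorphic_derivI[OF L(1) _ z]]) simp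
    then have "(deriv f has_field_derivative exp (L z) * deriv L z) (at z)"
      by (rule has_field_derivative_transform_within_open[of _ _ _ ?B]) (use z L(2) in auto)
    then show ?thesis using L(2)[OF z] by (simp add: DERIV_imp_deriv)
  qed
  then show thesis using that L by blast
qed

text \<open>\<open>weil_petersson_curve\<close> speaks of the inside of a curve, the theorem of a
  domain having that curve as frontier. A connected set that misses the frontier and meets
  \<open>\<Omega>\<close> lies in \<open>\<Omega>\<close>; applied to the two complementary
  components, this excludes the unbounded one and fills the bounded one.\<close>

lemma inside_frontier_eq:
  assumes "open \<Omega>" "connected \<Omega>" "bounded \<Omega>" "\<Omega> \<noteq> {}" "jordan_curve (frontier \<Omega>)"
  shows "inside (frontier \<Omega>) = \<Omega>"
proof -
  obtain c where c: "simple_path c" "pathfinish c = pathstart c" "path_image c = frontier \<Omega>"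
    using assms(5) by (auto simp: jordan_curve_def)
  note J = Jordan_inside_outside[OF c(1,2), unfolded c(3)]
  have disj: "\<Omega> \<inter> frontier \<Omega> = {}" using assms(1) by (simp add: frontier_def interior_open)
  have comp: "T \<subseteq> \<Omega>" if "connected T" "T \<inter> frontier \<Omega> = {}" "T \<inter> \<Omega> \<noteq> {}" for T
    using connected_Int_frontier[OF that(1,3)] that(2) by blast
  have un: "inside (frontier \<Omega>) \<union> outside (frontier \<Omega>) = - frontier \<Omega>" by (rule inside_Un_outside)
  have out: "outside (frontier \<Omega>) \<inter> \<Omega> = {}"
  proof (rule ccontr)
    assume "outside (frontier \<Omega>) \<inter> \<Omega> \<noteq> {}"
    then have "outside (frontier \<Omega>) \<subseteq> \<Omega>" using comp J un by blast
    then show False using J bounded_subset[OF assms(3)] by blast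
  qed
  then have "\<Omega> \<subseteq> inside (frontier \<Omega>)" using un disj by blast
  moreover have "inside (frontier \<Omega>) \<inter> \<Omega> \<noteq> {}" using calculation assms(4) by blast
  then have "inside (frontier \<Omega>) \<subseteq> \<Omega>"
    using comp[of "inside (frontier \<Omega>)"] J inside_no_overlap by blast
  ultimately show ?thesis by blast
qed

section \<open>Boundary limits of log(z f'(z)) and the boundary frame\<close>

lemma integrable_lebesgue_on_subset:
  fixes h :: "'a::euclidean_space \<Rightarrow> 'b::{banach,second_countable_topology}"
  assumes "integrable (lebesgue_on B) h" "A \<subseteq> B" "A \<in> sets lebesgue" "B \<in> sets lebesgue"
  shows "integrable (lebesgue_on A) h"
  unfolding integrable_lebesgue_on_iff[OF assms(3)] set_integrable_def[symmetric]
proof (rule set_integrable_subset[OF _ assms(3,2)])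
  show "set_integrable lebesgue B h"
    unfolding set_integrable_def integrable_lebesgue_on_iff[OF assms(4), symmetric] by (rule assms(1))
qed

text \<open>The half-plane form of \<open>z f'(z)\<close>, with \<open>z = exp w\<close> and \<open>f' = exp L\<close>.\<close>
definition logM :: "(complex \<Rightarrow> complex) \<Rightarrow> complex \<Rightarrow> complex" where
  "logM L w = w + L (exp w)"

lemma exp_half_plane: "Re w < 0 \<Longrightarrow> exp w \<in> ball 0 1"
  by simp

lemma logM_deriv:
  assumes L: "L holomorphic_on ball 0 1" and w: "Re w < 0"
  shows "(logM L has_field_derivative 1 + exp w * deriv L (exp w)) (at w)"
proof -
  have "((\<lambda>w. L (exp w)) has_field_derivative deriv L (exp w) * exp w) (at w)"
    by (rule DERIV_chain2[OF holomorphic_derivI[OF L open_ball exp_half_plane[OF w]] DERIV_exp])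
  then show ?thesis unfolding logM_def[abs_def] by (auto intro!: derivative_eq_intros)
qed

text \<open>\<open>1 / z + deriv L z\<close> is the logarithmic derivative of
  \<open>z * exp (L z)\<close>; an annulus of positive inner radius excludes its pole, so the term
  \<open>1 / z\<close> is bounded there.\<close>

lemma dirichlet_annulus:
  assumes L: "L holomorphic_on ball 0 1" and E: "integrable (lebesgue_on (ball 0 1)) (\<lambda>z. (norm (deriv L z))\<^sup>2)"
    and \<rho>: "\<rho> > 0"
  shows "continuous_on (annulus 0) (\<lambda>z. 1 / z + deriv L z)"
    and "integrable (lebesgue_on (annulus \<rho>)) (\<lambda>z. (norm (1 / z + deriv L z))\<^sup>2)"
proof -
  let ?A = "annulus \<rho>"
  have dL: "deriv L holomorphic_on ball 0 1" using L by (rule holomorphic_deriv) simp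
  define X where "X z = (norm (1 / z + deriv L z))\<^sup>2" for z
  show cY: "continuous_on (annulus 0) (\<lambda>z. 1 / z + deriv L z)"
    by (intro continuous_intros continuous_on_subset[OF holomorphic_on_imp_continuous_on[OF dL]]) (auto simp: annulus_0)
  have cX: "continuous_on (annulus 0) X" unfolding X_def by (intro continuous_intros cY)
  have A: "?A \<in> sets borel" "?A \<in> sets lebesgue" using open_annulus by (auto intro: sets_borel_lebesgue)
  have iA: "integrable (lebesgue_on ?A) (\<lambda>z. (norm (deriv L z))\<^sup>2)"
    by (rule integrable_lebesgue_on_subset[OF E]) (use A in \<open>auto simp: annulus_def intro: sets_borel_lebesgue\<close>)
  have cXA: "continuous_on ?A X" by (rule continuous_on_subset[OF cX]) (use \<rho> in \<open>auto simp: mem_annulus\<close>)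
  have "integrable (lebesgue_on ?A) X"
  proof (rule Bochner_Integration.integrable_bound)
    have "?A \<in> lmeasurable" using open_annulus by (intro lmeasurable_open) (auto simp: annulus_def bounded_diff)
    then show "integrable (lebesgue_on ?A) (\<lambda>z. 2 * (1 / \<rho>)\<^sup>2 + 2 * (norm (deriv L z))\<^sup>2)"
      using iA by (intro Bochner_Integration.integrable_add integrable_mult_right finite_measure.integrable_const finite_measure_lebesgue_on)
    show "X \<in> borel_measurable (lebesgue_on ?A)"
      by (rule lebesgue_on_iff_lborel(3)[OF A(1) set_borel_measurable_continuous_open[OF cXA A(1)]])
    show "AE z in lebesgue_on ?A. norm (X z) \<le> norm (2 * (1 / \<rho>)\<^sup>2 + 2 * (norm (deriv L z))\<^sup>2)"
    proof (rule AE_I2)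
      fix z assume "z \<in> space (lebesgue_on ?A)"
      then have z: "\<rho> < norm z" using A(2) by (auto simp: mem_annulus)
      let ?x = "norm (1 / z)" and ?y = "norm (deriv L z)"
      have "?x \<le> 1 / \<rho>" using z \<rho> by (simp add: norm_divide frac_le)
      then have x: "?x\<^sup>2 \<le> (1 / \<rho>)\<^sup>2" by (rule power_mono) simp
      have "X z \<le> (?x + ?y)\<^sup>2" unfolding X_def by (rule power_mono[OF norm_triangle_ineq]) simp
      also have "\<dots> \<le> 2 * ?x\<^sup>2 + 2 * ?y\<^sup>2" using sum_squares_bound[of ?x ?y] by (simp add: power2_sum)
      finally have "X z \<le> 2 * (1 / \<rho>)\<^sup>2 + 2 * (norm (deriv L z))\<^sup>2" using x by linarith
      then show "norm (X z) \<le> norm (2 * (1 / \<rho>)\<^sup>2 + 2 * (norm (deriv L z))\<^sup>2)" by (simp add: X_def)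
    qed
  qed
  then show "integrable (lebesgue_on ?A) (\<lambda>z. (norm (1 / z + deriv L z))\<^sup>2)" unfolding X_def .
qed

text \<open>Pulled back by \<open>exp\<close>, the derivative of \<open>logM L\<close> has in the
  strip the energy of \<open>1 / z + deriv L z\<close> in the annulus.
  \<open>stolz_energy_finite\<close> turns this into a finite weighted energy over all cones at
  almost every \<open>t\<close>, then \<open>stolz_bound\<close> and \<open>ntlim_exists\<close>
  produce the limit.\<close>

lemma logM_ntlim:
  assumes L: "L holomorphic_on ball 0 1" and E: "integrable (lebesgue_on (ball 0 1)) (\<lambda>z. (norm (deriv L z))\<^sup>2)"
  shows "AE t in lborel. t \<in> {0<..<2*pi} \<longrightarrow> (\<exists>l. ntlim (logM L) t l)"
proof -
  let ?B = "ball 0 1 :: complex set" and ?S = "log_strip (exp (-1))" and ?A = "annulus (exp (-1))"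
  define h where "h w = 1 + exp w * deriv L (exp w)" for w
  define Q where "Q w = (norm (h w))\<^sup>2" for w
  have dL: "deriv L holomorphic_on ?B" using L by (rule holomorphic_deriv) simp
  have hh: "h holomorphic_on {w. Re w < 0}"
    unfolding h_def by (intro holomorphic_intros holomorphic_on_compose_gen[OF _ dL, unfolded o_def]) auto
  define X where "X z = (norm (1 / z + deriv L z))\<^sup>2" for z
  have cX: "continuous_on (annulus 0) X" and iX: "integrable (lebesgue_on ?A) X"
    unfolding X_def using dirichlet_annulus[OF L E exp_gt_zero] by (auto intro!: continuous_intros)
  have QX: "(exp (Re w))\<^sup>2 *\<^sub>R X (exp w) = Q w" for w
  proof -
    have "h w = exp w * (1 / exp w + deriv L (exp w))" by (simp add: h_def ring_distribs)
    then show ?thesis by (simp add: Q_def X_def norm_mult power_mult_distrib)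
  qed
  have "set_integrable lborel ?S (\<lambda>w. (exp (Re w))\<^sup>2 *\<^sub>R X (exp w))" using polar_integral(1)[OF _ cX, of "exp (-1)"] iX by simp
  then have iQ: "set_integrable lborel ?S Q" unfolding QX .
  have cQ: "continuous_on ?S Q" unfolding Q_def
    by (intro continuous_intros continuous_on_subset[OF holomorphic_on_imp_continuous_on[OF hh]]) (auto simp: log_strip_def)
  have "AE t in lborel. \<forall>K::nat. (\<integral>\<^sup>+w. ennreal (Q w / - Re w) * indicator (?S \<inter> stolz (real K) t) w \<partial>lborel) \<noteq> \<infinity>"
    by (rule stolz_energy_finite[OF open_log_strip _ cQ _ iQ]) (auto simp: log_strip_def Q_def)
  then show ?thesis
  proof eventually_elim
    case (elim t)
    show ?case
    proof
      assume t: "t \<in> {0<..<2*pi}"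
      show "\<exists>l. ntlim (logM L) t l"
      proof (rule ntlim_exists)
        show "(logM L has_field_derivative h w) (at w)" if "Re w < 0" for w
          unfolding h_def by (rule logM_deriv[OF L that])
        fix K :: nat
        \<comment> \<open>A bound in the cone of aperture \<open>K\<close> costs finite energy in
          the one of aperture \<open>2 * K + 1\<close>.\<close>
        have fin: "(\<integral>\<^sup>+w. ennreal ((norm (h w))\<^sup>2 / - Re w) * indicator (?S \<inter> stolz (real (2 * K + 1)) t) w \<partial>lborel) \<noteq> \<infinity>"
          using elim[rule_format, of "2 * K + 1"] unfolding Q_def .
        have t: "0 < t" "t < 2 * pi" using t by auto
        obtain C d where "C \<ge> 0" "d > 0"
          "\<And>w. w \<in> stolz (real K) t \<Longrightarrow> - d < Re w \<Longrightarrow> (norm (h w))\<^sup>2 \<le> C / (- Re w)"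
          by (rule stolz_bound[OF hh t fin]) blast
        then show "\<exists>C d. C \<ge> 0 \<and> d > 0 \<and> (\<forall>w\<in>stolz (real K) t. - d < Re w \<longrightarrow> (norm (h w))\<^sup>2 \<le> C / (- Re w))"
          by blast
      qed
    qed
  qed
qed

lemma ntlim_exp:
  assumes "ntlim M t l" shows "ntlim (\<lambda>w. exp (M w)) t (exp l)"
  unfolding ntlim_def
proof (intro allI impI)
  fix K :: nat and e :: real assume "e > 0"
  then obtain d where d: "d > 0" "\<And>z. norm (z - l) < d \<Longrightarrow> norm (exp z - exp l) < e"
    using isCont_exp[of l] unfolding continuous_at_eps_delta by (metis dist_norm)
  then obtain d' where "d' > 0" "\<And>w. w \<in> stolz (real K) t \<Longrightarrow> - d' < Re w \<Longrightarrow> norm (M w - l) < d"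
    using assms unfolding ntlim_def by meson
  then show "\<exists>d>0. \<forall>w\<in>stolz (real K) t. - d < Re w \<longrightarrow> norm (exp (M w) - exp l) < e"
    using d(2) by blast
qed

text \<open>The composition of \<open>f\<close> with \<open>exp\<close> has derivative
  \<open>exp (logM L w)\<close>, whose nontangential limits \<open>exp l\<close> are never 0. They
  are angular derivatives, so they determine the normal; parameters that land in the exceptional set
  \<open>N\<close> are negligible by \<open>length_null_preimage\<close>.\<close>

lemma frame_at_boundary:
  assumes f: "uniformization f \<Omega>" and L: "L holomorphic_on ball 0 1" "\<And>z. z \<in> ball 0 1 \<Longrightarrow> deriv f z = exp (L z)"
    and E: "integrable (lebesgue_on (ball 0 1)) (\<lambda>z. (norm (deriv L z))\<^sup>2)"
    and fr: "normal_tangent_frame \<Omega> \<nu> \<tau>"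
  shows "AE t in circle_measure. \<exists>l. ntlim (logM L) t l \<and> \<nu> (f (cis t)) = sgn (exp l) \<and> \<tau> (f (cis t)) = \<i> * sgn (exp l)"
proof -
  obtain N where N: "length_null N" "\<And>p. p \<in> frontier \<Omega> - N \<Longrightarrow> outward_unit_normal \<Omega> p (\<nu> p) \<and> \<tau> p = \<i> * \<nu> p"
    using fr by (auto simp: normal_tangent_frame_def)
  define F where "F w = f (exp w)" for w
  define F' where "F' w = exp (logM L w)" for w
  have cF: "continuous_on {w. Re w \<le> 0} F"
    unfolding F_def by (rule continuous_on_compose2[OF uniformizationD(4)[OF f]]) (auto intro!: continuous_intros)
  have dF: "(F has_field_derivative F' w) (at w)" if "Re w < 0" for w
  proof -
    have "(F has_field_derivative deriv f (exp w) * exp w) (at w)"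
      unfolding F_def
      by (rule DERIV_chain2[OF holomorphic_derivI[OF uniformizationD(1)[OF f] open_ball exp_half_plane[OF that]] DERIV_exp])
    then show ?thesis using L(2)[OF exp_half_plane[OF that]] by (simp add: F'_def logM_def exp_add mult.commute)
  qed
  have FO: "F w \<in> \<Omega>" if "Re w < 0" for w using uniformizationD(3)[OF f] exp_half_plane[OF that] by (auto simp: F_def)
  have F0: "F (Complex 0 t) = f (cis t)" for t by (simp add: F_def exp_Complex pol_def)
  have nt: "ntlim F' t (exp l) \<and> cone_deriv F t (exp l)" if "ntlim (logM L) t l" for t l
    using ntlim_exp[OF that] ntlim_cone_deriv[OF cF dF, of t "exp l"] unfolding F'_def by blast
  define T where "T = {t. (\<exists>l. ntlim (logM L) t l) \<and> F (Complex 0 t) \<in> N}"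
  have "negligible T"
  proof (rule length_null_preimage[OF N(1)])
    fix t assume t: "t \<in> T"
    then show "F (Complex 0 t) \<in> N" by (simp add: T_def)
    obtain l where "ntlim (logM L) t l" using t by (auto simp: T_def)
    from nt[OF this] show "\<exists>l. l \<noteq> 0 \<and> ntlim F' t l \<and> cone_deriv F t l" by (intro exI[of _ "exp l"]) simp
  qed
  then have AT: "AE t in lborel. t \<notin> T"
    using AE_not_in[of T lebesgue] by (simp add: negligible_iff_null_sets AE_completion_iff)
  have "AE t in lborel. t \<in> {0..2*pi} \<longrightarrow> (\<exists>l. ntlim (logM L) t l \<and> \<nu> (f (cis t)) = sgn (exp l) \<and> \<tau> (f (cis t)) = \<i> * sgn (exp l))"
    using logM_ntlim[OF L(1) E] AT AE_lborel_singleton[of 0] AE_lborel_singleton[of "2 * pi"]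
  proof eventually_elim
    case (elim t)
    show ?case
    proof
      assume "t \<in> {0..2*pi}"
      then have "t \<in> {0<..<2*pi}" using elim by auto
      then obtain l where l: "ntlim (logM L) t l" using elim by blast
      have "f (cis t) \<in> frontier \<Omega> - N" using uniformizationD(5)[OF f, of "cis t"] elim(2) l by (auto simp: T_def F0)
      then have p: "outward_unit_normal \<Omega> (f (cis t)) (\<nu> (f (cis t)))" "\<tau> (f (cis t)) = \<i> * \<nu> (f (cis t))" using N(2) by auto
      have "\<nu> (f (cis t)) = sgn (exp l)"
        by (rule outward_normal_cone_deriv[of \<Omega> F t]) (use p(1) nt[OF l] FO in \<open>auto simp: F0\<close>)
      then show "\<exists>l. ntlim (logM L) t l \<and> \<nu> (f (cis t)) = sgn (exp l) \<and> \<tau> (f (cis t)) = \<i> * sgn (exp l)"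
        using l p(2) by auto
    qed
  qed
  then show ?thesis
    by (subst AE_restrict_space_iff) (auto simp: AE_completion_iff intro!: sets_borel_lebesgue)
qed

section \<open>Boundary values of circle-valued maps of finite energy\<close>

text \<open>The frame comes without any measurability assumption; completeness of Lebesgue measure
  supplies it from an almost everywhere limit of continuous functions.\<close>

lemma borel_measurable_circle_AE:
  fixes h h' :: "real \<Rightarrow> complex"
  assumes h: "h \<in> borel_measurable circle_measure" and e: "AE t in circle_measure. h t = h' t"
  shows "h' \<in> borel_measurable circle_measure"
proof -
  let ?I = "{0..2*pi}"
  have s: "?I \<in> sets lebesgue" by simp
  have "(\<lambda>t. indicator ?I t *\<^sub>R h t) \<in> borel_measurable lebesgue"
    using h borel_measurable_restrict_space_iff[of ?I lebesgue h] s by simp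
  moreover have "AE t in lebesgue. indicator ?I t *\<^sub>R h t = indicator ?I t *\<^sub>R h' t"
    using e by (subst (asm) AE_restrict_space_iff) (auto elim!: eventually_mono simp: indicator_def)
  ultimately have "(\<lambda>t. indicator ?I t *\<^sub>R h' t) \<in> borel_measurable lebesgue"
    by (rule borel_measurable_AE)
  then show ?thesis
    using borel_measurable_restrict_space_iff[of ?I lebesgue h'] s by simp
qed

text \<open>Bounded convergence on a space of finite measure, along \<open>rsq\<close>, once the
  limit is known to be measurable.\<close>

lemma radial_limit_L2:
  fixes F h :: "complex \<Rightarrow> complex"
  assumes F: "continuous_on (annulus 0) F" and B: "\<And>z. z \<in> annulus 0 \<Longrightarrow> norm (F z) \<le> B"
    and lim: "AE t in circle_measure. (\<lambda>k. F (pol (rsq k) t)) \<longlonglongrightarrow> h (cis t)"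
  shows "(\<lambda>t. h (cis t)) \<in> borel_measurable circle_measure"
    and "AE t in circle_measure. norm (h (cis t)) \<le> B"
    and "L2 circle_measure (\<lambda>t. h (cis t))"
    and "(\<lambda>k. circle_coeff F (rsq k) n) \<longlonglongrightarrow> fourier_coeff h n"
    and "(\<lambda>k. LINT t|circle_measure. (norm (F (pol (rsq k) t) - h (cis t)))\<^sup>2) \<longlonglongrightarrow> 0"
proof -
  interpret finite_measure circle_measure by (rule finite_circle_measure)
  have m: "(\<lambda>t. F (pol (rsq k) t)) \<in> borel_measurable circle_measure" for k
    using circle_integrable[OF continuous_pol_t[OF F rsq(2)]] by (rule borel_measurable_integrable)
  have B': "norm (F (pol (rsq k) t)) \<le> B" for k t by (intro B pol_annulus rsq)
  have "(\<lambda>t. lim (\<lambda>k. F (pol (rsq k) t))) \<in> borel_measurable circle_measure"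
    by (rule borel_measurable_lim_metric) (rule m)
  moreover have "AE t in circle_measure. lim (\<lambda>k. F (pol (rsq k) t)) = h (cis t)"
    using lim by eventually_elim (rule limI)
  ultimately show mh: "(\<lambda>t. h (cis t)) \<in> borel_measurable circle_measure"
    by (rule borel_measurable_circle_AE)
  show b: "AE t in circle_measure. norm (h (cis t)) \<le> B"
    using lim
  proof eventually_elim
    case (elim t)
    show ?case by (rule LIMSEQ_le_const2[OF tendsto_norm[OF elim]]) (use B' in auto)
  qed
  have "integrable circle_measure (\<lambda>t. (norm (h (cis t)))\<^sup>2)"
  proof (rule integrable_const_bound)
    show "AE t in circle_measure. norm ((norm (h (cis t)))\<^sup>2) \<le> B\<^sup>2"
      using b by eventually_elim (simp add: power_mono)
  qed (use mh in measurable)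
  then show "L2 circle_measure (\<lambda>t. h (cis t))" using mh by (simp add: L2_def)
  have mc: "(\<lambda>t. cis (- of_int n * t)) \<in> borel_measurable circle_measure"
    by (rule borel_measurable_integrable[OF circle_integrable]) (intro continuous_intros)
  have "(\<lambda>k. LINT t|circle_measure. F (pol (rsq k) t) * cis (- of_int n * t))
      \<longlonglongrightarrow> (LINT t|circle_measure. h (cis t) * cis (- of_int n * t))"
  proof (rule integral_dominated_convergence[where w="\<lambda>_. B"])
    show "AE t in circle_measure. (\<lambda>k. F (pol (rsq k) t) * cis (- of_int n * t)) \<longlonglongrightarrow> h (cis t) * cis (- of_int n * t)"
      using lim by eventually_elim (intro tendsto_intros)
    show "AE t in circle_measure. norm (F (pol (rsq k) t) * cis (- of_int n * t)) \<le> B" for k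
      using B' by (simp add: norm_mult)
    show "(\<lambda>t. h (cis t) * cis (- of_int n * t)) \<in> borel_measurable circle_measure"
      by (intro borel_measurable_times mh mc)
    show "(\<lambda>t. F (pol (rsq k) t) * cis (- of_int n * t)) \<in> borel_measurable circle_measure" for k
      by (intro borel_measurable_times m mc)
  qed simp
  then show "(\<lambda>k. circle_coeff F (rsq k) n) \<longlonglongrightarrow> fourier_coeff h n"
    unfolding circle_coeff_eq fourier_coeff_def by (intro tendsto_divide tendsto_const) simp_all
  have "(\<lambda>k. LINT t|circle_measure. (norm (F (pol (rsq k) t) - h (cis t)))\<^sup>2) \<longlonglongrightarrow> (LINT t|circle_measure. 0)"
  proof (rule integral_dominated_convergence[where w="\<lambda>_. (2 * B)\<^sup>2"])
    show "AE t in circle_measure. (\<lambda>k. (norm (F (pol (rsq k) t) - h (cis t)))\<^sup>2) \<longlonglongrightarrow> 0"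
      using lim
    proof eventually_elim
      case (elim t)
      have "(\<lambda>k. (norm (F (pol (rsq k) t) - h (cis t)))\<^sup>2) \<longlonglongrightarrow> (norm (h (cis t) - h (cis t)))\<^sup>2"
        by (intro tendsto_intros elim)
      then show ?case by simp
    qed
    show "AE t in circle_measure. norm ((norm (F (pol (rsq k) t) - h (cis t)))\<^sup>2) \<le> (2 * B)\<^sup>2" for k
      using b
    proof eventually_elim
      case (elim t)
      have "norm (F (pol (rsq k) t) - h (cis t)) \<le> 2 * B"
        using norm_triangle_ineq4[of "F (pol (rsq k) t)" "h (cis t)"] B'[of k t] elim by linarith
      from power_mono[OF this norm_ge_zero, of 2] show ?case by simp
    qed
    show "(\<lambda>t. (norm (F (pol (rsq k) t) - h (cis t)))\<^sup>2) \<in> borel_measurable circle_measure" for k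
      by (intro borel_measurable_power measurable_compose[OF _ borel_measurable_norm] borel_measurable_diff m mh)
  qed simp_all
  then show "(\<lambda>k. LINT t|circle_measure. (norm (F (pol (rsq k) t) - h (cis t)))\<^sup>2) \<longlonglongrightarrow> 0" by simp
qed

section \<open>Dilations and their convergence in L2\<close>

lemma annulus_mono: "a \<le> b \<Longrightarrow> annulus b \<subseteq> annulus a"
  by (auto simp: mem_annulus)

lemma annulus_scaled_image:
  assumes "0 < r" "0 \<le> \<rho>"
  shows "(\<lambda>z. of_real r * z) ` annulus \<rho> = {z. r * \<rho> < norm z \<and> norm z < r}"
proof (intro set_eqI iffI)
  fix z :: complex assume z: "z \<in> {z. r * \<rho> < norm z \<and> norm z < r}"
  then have "z / of_real r \<in> annulus \<rho>"
    using assms by (auto simp: mem_annulus norm_divide field_simps)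
  moreover have "z = of_real r * (z / of_real r)" using assms by simp
  ultimately show "z \<in> (\<lambda>z. of_real r * z) ` annulus \<rho>" by (rule rev_image_eqI)
qed (use assms in \<open>auto simp: mem_annulus norm_mult\<close>)

text \<open>As \<open>rsq k\<close> is above -1, all dilates of an annulus stay in one larger
  annulus of inner radius \<open>exp (-1) * \<rho>\<close>, which later carries the dominating
  function.\<close>

lemma dilation_annulus:
  assumes "z \<in> annulus \<rho>" "0 \<le> \<rho>"
  shows "of_real (exp (rsq k)) * z \<in> annulus (exp (-1) * \<rho>)" "of_real (exp (rsq k)) * z \<in> annulus 0"
proof -
  have e: "exp (-1) < exp (rsq k)" "exp (rsq k) < 1" using rsq[of k] by simp_all
  have z: "\<rho> < norm z" "norm z < 1" using assms by (auto simp: mem_annulus)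
  have n: "exp (-1) * \<rho> < exp (rsq k) * norm z" using e z assms by (intro mult_strict_mono') auto
  have "exp (rsq k) * norm z < 1 * 1" using e z assms(2) by (intro mult_strict_mono) auto
  with n show "of_real (exp (rsq k)) * z \<in> annulus (exp (-1) * \<rho>)"
    by (simp add: mem_annulus norm_mult)
  then show "of_real (exp (rsq k)) * z \<in> annulus 0"
    using annulus_mono[of 0 "exp (-1) * \<rho>"] assms(2) by auto
qed

lemma dilation_tendsto:
  fixes h :: "complex \<Rightarrow> 'b::topological_space"
  assumes "continuous_on (annulus 0) h" "z \<in> annulus 0"
  shows "(\<lambda>k. h (of_real (exp (rsq k)) * z)) \<longlonglongrightarrow> h z"
proof -
  have "(\<lambda>k. of_real (exp (rsq k)) * z) \<longlonglongrightarrow> of_real (exp 0) * z"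
    by (intro tendsto_intros rsq_lim)
  moreover have "isCont h z"
    using continuous_on_eq_continuous_at[OF open_annulus] assms by blast
  ultimately show ?thesis by (intro isCont_tendsto_compose[of z h]) simp_all
qed

text \<open>A dilation has constant Jacobian, so the integral becomes one over the ring
  \<open>S k\<close>; these rings converge to the annulus off the null sphere of radius
  \<open>\<rho>\<close>.\<close>

lemma dilation_norm_integral:
  fixes h :: "complex \<Rightarrow> 'b::euclidean_space"
  assumes h: "continuous_on (annulus 0) h" and \<rho>: "0 \<le> \<rho>"
    and I: "integrable (lebesgue_on (annulus (exp (-1) * \<rho>))) (\<lambda>z. (norm (h z))\<^sup>2)"
  shows "integrable (lebesgue_on (annulus \<rho>)) (\<lambda>z. (norm (h (of_real (exp (rsq k)) * z)))\<^sup>2)"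
    and "(\<lambda>k. LINT z|lebesgue_on (annulus \<rho>). (norm (h (of_real (exp (rsq k)) * z)))\<^sup>2)
      \<longlonglongrightarrow> (LINT z|lebesgue_on (annulus \<rho>). (norm (h z))\<^sup>2)"
proof -
  let ?A = "annulus \<rho>" and ?A' = "annulus (exp (-1) * \<rho>)" and ?q = "\<lambda>z. (norm (h z))\<^sup>2"
  let ?r = "\<lambda>k. exp (rsq k)"
  define S where "S k = (\<lambda>z. of_real (?r k) * z) ` ?A" for k
  have Seq: "S k = {z. ?r k * \<rho> < norm z \<and> norm z < ?r k}" for k
    unfolding S_def by (rule annulus_scaled_image) (use \<rho> in auto)
  have A0: "?A \<subseteq> annulus 0" and A'0: "?A' \<subseteq> annulus 0"
    using \<rho> by (auto intro!: annulus_mono)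
  have SA': "S k \<subseteq> ?A'" for k unfolding S_def using dilation_annulus(1)[OF _ \<rho>] by blast
  have cq: "continuous_on (annulus 0) ?q" by (intro continuous_intros h)
  have oS: "open (S k)" for k unfolding S_def
    by (rule open_holomorphic_image[OF open_annulus]) (auto intro!: holomorphic_intros inj_onI)
  have bq: "set_borel_measurable borel U ?q" if "U \<subseteq> annulus 0" "open U" for U
    by (rule set_borel_measurable_continuous_open[OF continuous_on_subset[OF cq that(1)]]) (use that in simp)
  have iA': "set_integrable lborel ?A' ?q"
    using I lebesgue_on_iff_lborel(1)[OF _ bq[OF A'0 open_annulus]] open_annulus by simp
  have iS: "set_integrable lborel (S k) ?q" for k
    by (rule set_integrable_subset[OF iA']) (use SA' oS in auto)
  have cov: "set_integrable lborel (S k) ?q \<longleftrightarrow> set_integrable lborel ?A (\<lambda>z. (?r k)\<^sup>2 *\<^sub>R ?q (of_real (?r k) * z))"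
    "set_lebesgue_integral lborel (S k) ?q = set_lebesgue_integral lborel ?A (\<lambda>z. (?r k)\<^sup>2 *\<^sub>R ?q (of_real (?r k) * z))" for k
  proof -
    have d: "deriv (\<lambda>z. of_real (?r k) * z) z = of_real (?r k)" for z :: complex
      by (auto intro!: DERIV_imp_deriv derivative_eq_intros)
    have H: "(\<lambda>z::complex. of_real (?r k) * z) holomorphic_on ?A" "inj_on (\<lambda>z::complex. of_real (?r k) * z) ?A"
      by (auto intro!: holomorphic_intros inj_onI)
    note * = set_integral_holomorphic_image[OF open_annulus H bq[of "S k", unfolded S_def]]
    show "set_integrable lborel (S k) ?q \<longleftrightarrow> set_integrable lborel ?A (\<lambda>z. (?r k)\<^sup>2 *\<^sub>R ?q (of_real (?r k) * z))"
      "set_lebesgue_integral lborel (S k) ?q = set_lebesgue_integral lborel ?A (\<lambda>z. (?r k)\<^sup>2 *\<^sub>R ?q (of_real (?r k) * z))"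
      using *[folded S_def] SA'[of k] A'0 oS[of k] by (auto simp: d)
  qed
  have cA: "continuous_on ?A (\<lambda>z. ?q (of_real (?r k) * z))" for k
    by (rule continuous_on_compose2[OF cq]) (use dilation_annulus(2)[OF _ \<rho>] in \<open>auto intro!: continuous_intros\<close>)
  have bA: "set_borel_measurable borel ?A (\<lambda>z. ?q (of_real (?r k) * z))" for k
    by (rule set_borel_measurable_continuous_open[OF cA]) (use open_annulus in simp)
  have leb: "integrable (lebesgue_on ?A) (\<lambda>z. ?q (of_real (?r k) * z)) \<longleftrightarrow> set_integrable lborel ?A (\<lambda>z. ?q (of_real (?r k) * z))"
    "(LINT z|lebesgue_on ?A. ?q (of_real (?r k) * z)) = set_lebesgue_integral lborel ?A (\<lambda>z. ?q (of_real (?r k) * z))" for k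
    using lebesgue_on_iff_lborel(1,2)[OF _ bA[of k]] open_annulus by simp_all
  show "integrable (lebesgue_on ?A) (\<lambda>z. ?q (of_real (?r k) * z))" for k
    using iS[of k] unfolding leb cov(1) by simp
  have val: "(LINT z|lebesgue_on ?A. ?q (of_real (?r k) * z)) = (1 / (?r k)\<^sup>2) * (LINT z|lborel. indicator (S k) z *\<^sub>R ?q z)" for k
    using cov(2)[of k] unfolding leb by (simp add: set_lebesgue_integral_def field_simps)
  have "(\<lambda>k. LINT z|lborel. indicator (S k) z *\<^sub>R ?q z) \<longlonglongrightarrow> (LINT z|lborel. indicator ?A z *\<^sub>R ?q z)"
  proof (rule integral_dominated_convergence[where w="\<lambda>z. indicator ?A' z *\<^sub>R ?q z"])
    show "(\<lambda>z. indicator ?A z *\<^sub>R ?q z) \<in> borel_measurable lborel"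
      using bq[OF A0 open_annulus] by (simp add: set_borel_measurable_def)
    show "(\<lambda>z. indicator (S k) z *\<^sub>R ?q z) \<in> borel_measurable lborel" for k
      using iS[of k] unfolding set_integrable_def by (rule borel_measurable_integrable)
    show "integrable lborel (\<lambda>z. indicator ?A' z *\<^sub>R ?q z)" using iA' by (simp add: set_integrable_def)
    show "AE z in lborel. norm (indicator (S k) z *\<^sub>R ?q z) \<le> indicator ?A' z *\<^sub>R ?q z" for k
      using SA'[of k] by (auto simp: indicator_def)
    have "AE z in lebesgue. z \<notin> sphere (0::complex) \<rho>"
      using negligible_sphere[of "0::complex" \<rho>] by (auto simp: negligible_iff_null_sets dest!: AE_not_in)
    then have "AE z in lborel. z \<notin> sphere (0::complex) \<rho>" by (simp add: AE_completion_iff)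
    then show "AE z in lborel. (\<lambda>k. indicator (S k) z *\<^sub>R ?q z) \<longlonglongrightarrow> indicator ?A z *\<^sub>R ?q z"
    proof eventually_elim
      case (elim z)
      have r: "?r \<longlonglongrightarrow> 1" using tendsto_exp[OF rsq_lim] by simp
      have "eventually (\<lambda>k. z \<in> S k \<longleftrightarrow> z \<in> ?A) sequentially"
      proof (cases "z \<in> ?A")
        case True
        then have z: "\<rho> < norm z" "norm z < 1" by (auto simp: mem_annulus)
        have "eventually (\<lambda>k. norm z < ?r k) sequentially" using order_tendstoD(1)[OF r z(2)] .
        then show ?thesis
        proof eventually_elim
          case (elim k)
          have "?r k * \<rho> \<le> 1 * \<rho>" using rsq(2)[of k] \<rho> by (intro mult_right_mono) auto
          then show ?case using True z elim by (auto simp: Seq)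
        qed
      next
        case False
        then consider "norm z < \<rho>" | "1 \<le> norm z" using elim by (force simp: mem_annulus)
        then show ?thesis
        proof cases
          case 1
          have "(\<lambda>k. ?r k * \<rho>) \<longlonglongrightarrow> 1 * \<rho>" by (intro tendsto_intros r)
          then have "eventually (\<lambda>k. norm z < ?r k * \<rho>) sequentially" using 1 by (intro order_tendstoD(1)) auto
          then show ?thesis by eventually_elim (use False in \<open>auto simp: Seq\<close>)
        next
          case 2
          have "\<not> norm z < ?r k" for k using rsq(2)[of k] 2 by (smt (verit) exp_less_one_iff)
          then show ?thesis using False by (intro always_eventually) (auto simp: Seq)
        qed
      qed
      then have "eventually (\<lambda>k. indicator (S k) z *\<^sub>R ?q z = indicator ?A z *\<^sub>R ?q z) sequentially"
        by eventually_elim (simp add: indicator_def)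
      then show ?case by (rule tendsto_eventually)
    qed
  qed
  then have "(\<lambda>k. (1 / (?r k)\<^sup>2) * (LINT z|lborel. indicator (S k) z *\<^sub>R ?q z)) \<longlonglongrightarrow> (1 / (exp 0)\<^sup>2) * (LINT z|lborel. indicator ?A z *\<^sub>R ?q z)"
    by (intro tendsto_intros rsq_lim) auto
  moreover have "(LINT z|lebesgue_on ?A. ?q z) = (LINT z|lborel. indicator ?A z *\<^sub>R ?q z)"
    using lebesgue_on_iff_lborel(2)[OF _ bq[OF A0 open_annulus]] open_annulus by (simp add: set_lebesgue_integral_def)
  ultimately show "(\<lambda>k. LINT z|lebesgue_on ?A. ?q (of_real (?r k) * z)) \<longlonglongrightarrow> (LINT z|lebesgue_on ?A. ?q z)"
    unfolding val by simp
qed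

lemma sq_triangle:
  fixes x y :: "'b::real_inner"
  shows "(norm (x + y))\<^sup>2 \<le> 2 * (norm x)\<^sup>2 + 2 * (norm y)\<^sup>2" "(norm (x - y))\<^sup>2 \<le> 2 * (norm x)\<^sup>2 + 2 * (norm y)\<^sup>2"
proof -
  have "(norm (x - y))\<^sup>2 + (norm (x + y))\<^sup>2 = 2 * (norm x)\<^sup>2 + 2 * (norm y)\<^sup>2"
    by (simp add: power2_norm_eq_inner inner_diff_left inner_diff_right inner_add_left inner_add_right inner_commute)
  then show "(norm (x + y))\<^sup>2 \<le> 2 * (norm x)\<^sup>2 + 2 * (norm y)\<^sup>2" "(norm (x - y))\<^sup>2 \<le> 2 * (norm x)\<^sup>2 + 2 * (norm y)\<^sup>2"
    using zero_le_power2[of "norm (x + y)"] zero_le_power2[of "norm (x - y)"] by linarith+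
qed

text \<open>Pointwise convergence together with convergence of norms gives convergence in L2.
  Scheffe's lemma treats the squared norms, dominated convergence a truncation of the squared
  difference.\<close>

lemma dilation_L2:
  fixes h :: "complex \<Rightarrow> 'b::euclidean_space"
  assumes h: "continuous_on (annulus 0) h" and \<rho>: "0 \<le> \<rho>"
    and I: "integrable (lebesgue_on (annulus (exp (-1) * \<rho>))) (\<lambda>z. (norm (h z))\<^sup>2)"
  shows "integrable (lebesgue_on (annulus \<rho>)) (\<lambda>z. (norm (h (of_real (exp (rsq k)) * z) - h z))\<^sup>2)"
    and "(\<lambda>k. LINT z|lebesgue_on (annulus \<rho>). (norm (h (of_real (exp (rsq k)) * z) - h z))\<^sup>2) \<longlonglongrightarrow> 0"
proof -
  let ?M = "lebesgue_on (annulus \<rho>)" and ?q = "\<lambda>z. (norm (h z))\<^sup>2"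
  define a where "a k z = h (of_real (exp (rsq k)) * z)" for k z
  note ia = dilation_norm_integral(1)[OF h \<rho> I, folded a_def] and la = dilation_norm_integral(2)[OF h \<rho> I, folded a_def]
  have A0: "annulus \<rho> \<subseteq> annulus 0" using \<rho> by (auto simp: mem_annulus)
  have sp: "space ?M = annulus \<rho>" by simp
  have "exp (-1) * \<rho> \<le> 1 * \<rho>" using \<rho> by (intro mult_right_mono) auto
  then have iq: "integrable ?M ?q"
    by (intro integrable_lebesgue_on_subset[OF I]) (use open_annulus in \<open>auto simp: mem_annulus intro!: sets_borel_lebesgue\<close>)
  have ca: "continuous_on (annulus \<rho>) (a k)" for k unfolding a_def
    by (rule continuous_on_compose2[OF h]) (use dilation_annulus(2)[OF _ \<rho>] in \<open>auto intro!: continuous_intros\<close>)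
  have sA: "annulus \<rho> \<in> sets lebesgue" using open_annulus by (simp add: sets_borel_lebesgue)
  have ma: "a k \<in> borel_measurable ?M" for k
    by (rule continuous_imp_measurable_on_sets_lebesgue[OF ca sA])
  have mh: "h \<in> borel_measurable ?M"
    by (rule continuous_imp_measurable_on_sets_lebesgue[OF continuous_on_subset[OF h A0] sA])
  have lim: "(\<lambda>k. a k z) \<longlonglongrightarrow> h z" if "z \<in> annulus \<rho>" for z
    unfolding a_def by (rule dilation_tendsto[OF h]) (use that A0 in auto)
  have md: "(\<lambda>z. (norm (a k z - h z))\<^sup>2) \<in> borel_measurable ?M" for k
    by (rule borel_measurable_power[OF measurable_compose[OF borel_measurable_diff[OF ma mh] borel_measurable_norm]])
  have id: "integrable ?M (\<lambda>z. (norm (a k z - h z))\<^sup>2)" for k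
    by (rule Bochner_Integration.integrable_bound[OF _ md, of "\<lambda>z. 2 * (norm (a k z))\<^sup>2 + 2 * (norm (h z))\<^sup>2"])
      (use sq_triangle(2) in \<open>auto intro!: Bochner_Integration.integrable_add integrable_mult_right ia iq\<close>)
  show "integrable ?M (\<lambda>z. (norm (h (of_real (exp (rsq k)) * z) - h z))\<^sup>2)" for k using id by (simp add: a_def)
  define T where "T k z = \<bar>(norm (a k z))\<^sup>2 - (norm (h z))\<^sup>2\<bar>" for k z
  have iT: "integrable ?M (T k)" for k unfolding T_def[abs_def]
    by (intro integrable_abs Bochner_Integration.integrable_diff ia iq)
  have T0: "(\<lambda>k. LINT z|?M. T k z) \<longlonglongrightarrow> 0"
  proof -
    have "(\<lambda>k. \<integral>\<^sup>+z. norm ((norm (a k z))\<^sup>2 - (norm (h z))\<^sup>2) \<partial>?M) \<longlonglongrightarrow> 0"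
    proof (rule Scheffe_lemma1[OF ia iq])
      show "AE z in ?M. (\<lambda>k. (norm (a k z))\<^sup>2) \<longlonglongrightarrow> (norm (h z))\<^sup>2"
        by (rule AE_I2) (auto intro!: tendsto_intros lim simp: sp)
      have "(\<lambda>k. \<integral>\<^sup>+z. ennreal (norm ((norm (a k z))\<^sup>2)) \<partial>?M) \<longlonglongrightarrow> (\<integral>\<^sup>+z. ennreal (norm ((norm (h z))\<^sup>2)) \<partial>?M)"
        using tendsto_ennrealI[OF la] by (simp add: nn_integral_eq_integral ia iq)
      then show "limsup (\<lambda>k. \<integral>\<^sup>+z. ennreal (norm ((norm (a k z))\<^sup>2)) \<partial>?M) \<le> (\<integral>\<^sup>+z. ennreal (norm ((norm (h z))\<^sup>2)) \<partial>?M)"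
        by (simp add: lim_imp_Limsup)
    qed
    then have "(\<lambda>k. ennreal (LINT z|?M. T k z)) \<longlonglongrightarrow> ennreal 0"
      using nn_integral_eq_integral[OF iT] by (simp add: T_def[abs_def])
    then show ?thesis
      by (rule iffD1[OF tendsto_ennreal_iff, rotated 2]) (auto intro!: integral_nonneg_AE simp: T_def always_eventually)
  qed
  \<comment> \<open>The truncation level comes from
    \<open>2 * (norm a)\<^sup>2 + 2 * (norm h)\<^sup>2\<close>, a bound for the squared difference:
    it equals \<open>4 * (norm h)\<^sup>2\<close> plus twice a difference of squares, which
    \<open>T\<close> controls.\<close>
  define m where "m k z = min ((norm (a k z - h z))\<^sup>2) (4 * (norm (h z))\<^sup>2)" for k z
  have mm: "m k \<in> borel_measurable ?M" for k unfolding m_def[abs_def]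
    by (intro borel_measurable_min md borel_measurable_times borel_measurable_const borel_measurable_power measurable_compose[OF _ borel_measurable_norm] mh)
  have i4: "integrable ?M (\<lambda>z. 4 * (norm (h z))\<^sup>2)" by (intro integrable_mult_right iq)
  have "(\<lambda>k. LINT z|?M. m k z) \<longlonglongrightarrow> (LINT z|?M. 0)"
  proof (rule integral_dominated_convergence[OF _ mm i4])
    show "AE z in ?M. (\<lambda>k. m k z) \<longlonglongrightarrow> 0"
    proof (rule AE_I2)
      fix z assume z: "z \<in> space ?M"
      have "(\<lambda>k. m k z) \<longlonglongrightarrow> min ((norm (h z - h z))\<^sup>2) (4 * (norm (h z))\<^sup>2)"
        unfolding m_def using z lim[of z] unfolding sp by (intro tendsto_intros tendsto_min) auto
      then show "(\<lambda>k. m k z) \<longlonglongrightarrow> 0" by simp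
    qed
    show "AE z in ?M. norm (m k z) \<le> 4 * (norm (h z))\<^sup>2" for k by (rule AE_I2) (simp add: m_def)
  qed simp
  then have m0: "(\<lambda>k. LINT z|?M. m k z) \<longlonglongrightarrow> 0" by simp
  have im: "integrable ?M (m k)" for k
    by (rule Bochner_Integration.integrable_bound[OF i4 mm]) (simp add: m_def)
  have "(\<lambda>k. (LINT z|?M. m k z) + 2 * (LINT z|?M. T k z)) \<longlonglongrightarrow> 0 + 2 * 0"
    by (intro tendsto_intros m0 T0)
  then have up: "(\<lambda>k. (LINT z|?M. m k z) + 2 * (LINT z|?M. T k z)) \<longlonglongrightarrow> 0" by simp
  show "(\<lambda>k. LINT z|?M. (norm (h (of_real (exp (rsq k)) * z) - h z))\<^sup>2) \<longlonglongrightarrow> 0"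
    unfolding a_def[symmetric]
  proof (rule tendsto_sandwich[OF _ _ tendsto_const up])
    show "eventually (\<lambda>k. 0 \<le> (LINT z|?M. (norm (a k z - h z))\<^sup>2)) sequentially"
      by (intro always_eventually allI integral_nonneg_AE) simp
    have "(LINT z|?M. (norm (a k z - h z))\<^sup>2) \<le> (LINT z|?M. m k z) + 2 * (LINT z|?M. T k z)" for k
    proof -
      have "(LINT z|?M. (norm (a k z - h z))\<^sup>2) \<le> (LINT z|?M. m k z + 2 * T k z)"
      proof (rule integral_mono[OF id])
        show "integrable ?M (\<lambda>z. m k z + 2 * T k z)"
          by (intro Bochner_Integration.integrable_add integrable_mult_right im iT)
        show "(norm (a k z - h z))\<^sup>2 \<le> m k z + 2 * T k z" for z
          using sq_triangle(2)[of "a k z" "h z"] unfolding m_def T_def by (smt (verit))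
      qed
      also have "\<dots> = (LINT z|?M. m k z) + 2 * (LINT z|?M. T k z)"
        by (subst Bochner_Integration.integral_add) (auto intro!: im iT)
      finally show ?thesis .
    qed
    then show "eventually (\<lambda>k. (LINT z|?M. (norm (a k z - h z))\<^sup>2) \<le> (LINT z|?M. m k z) + 2 * (LINT z|?M. T k z)) sequentially"
      by simp
  qed
qed


section \<open>Traces of unimodular maps of finite energy\<close>

lemma L2_bounded:
  fixes F :: "complex \<Rightarrow> complex"
  assumes "open U" "bounded U" "continuous_on U F" "\<And>z. z \<in> U \<Longrightarrow> norm (F z) \<le> B"
  shows "L2 (lebesgue_on U) F"
proof -
  have U: "U \<in> sets lebesgue" using assms(1) by (simp add: sets_borel_lebesgue)
  have m: "F \<in> borel_measurable (lebesgue_on U)" by (rule continuous_imp_measurable_on_sets_lebesgue[OF assms(3) U])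
  have "finite_measure (lebesgue_on U)"
    using assms by (intro finite_measure_lebesgue_on lmeasurable_open)
  then have "integrable (lebesgue_on U) (\<lambda>z. B\<^sup>2)"
    by (rule finite_measure.integrable_const)
  then have "integrable (lebesgue_on U) (\<lambda>z. (norm (F z))\<^sup>2)"
  proof (rule Bochner_Integration.integrable_bound)
    show "(\<lambda>z. (norm (F z))\<^sup>2) \<in> borel_measurable (lebesgue_on U)" using m by measurable
    show "AE z in lebesgue_on U. norm ((norm (F z))\<^sup>2) \<le> norm (B\<^sup>2)"
      by (rule AE_I2) (use power_mono[OF assms(4) norm_ge_zero, of _ 2] in simp)
  qed
  then show ?thesis using m by (simp add: L2_def)
qed

lemma L2_grad:
  assumes U: "open U" and h: "C1_on U h" and E: "integrable (lebesgue_on U) (grad_sq h)"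
  shows "L2 (lebesgue_on U) (pd_x h)" "L2 (lebesgue_on U) (pd_y h)"
proof -
  have U: "U \<in> sets lebesgue" using U by (simp add: sets_borel_lebesgue)
  have m: "pd_x h \<in> borel_measurable (lebesgue_on U)" "pd_y h \<in> borel_measurable (lebesgue_on U)"
    by (rule continuous_imp_measurable_on_sets_lebesgue[OF C1_onD(2)[OF h] U],
        rule continuous_imp_measurable_on_sets_lebesgue[OF C1_onD(3)[OF h] U])
  have "integrable (lebesgue_on U) (\<lambda>z. (norm (pd_x h z))\<^sup>2)" "integrable (lebesgue_on U) (\<lambda>z. (norm (pd_y h z))\<^sup>2)"
    by (rule Bochner_Integration.integrable_bound[OF E];
        use m in \<open>auto intro!: borel_measurable_power measurable_compose[OF _ borel_measurable_norm]\<close>)+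
  then show "L2 (lebesgue_on U) (pd_x h)" "L2 (lebesgue_on U) (pd_y h)" using m by (simp_all add: L2_def)
qed

text \<open>Energy is asked for on annuli only, since the maps of interest wind around 0 and have
  infinite energy there. The limit is taken along the fixed sequence \<open>rsq\<close>, the one
  used for all circle integrals.\<close>

locale finite_energy_trace =
  fixes W g :: "complex \<Rightarrow> complex"
  assumes C1: "C1_on (annulus 0) W"
    and norm_1: "z \<in> annulus 0 \<Longrightarrow> norm (W z) = 1"
    and energy: "\<rho> > 0 \<Longrightarrow> integrable (lebesgue_on (annulus \<rho>)) (grad_sq W)"
    and limit: "AE t in circle_measure. (\<lambda>k. W (pol (rsq k) t)) \<longlonglongrightarrow> g (cis t)"
begin

text \<open>\<open>H\<close> is the second argument of the pairing behind
  \<open>angular_current\<close>. Its energy is controlled because \<open>W\<close> is unimodular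
  while \<open>\<phi>\<close> and its derivatives are bounded on the disc.\<close>

lemma product:
  assumes \<phi>: "C1_on UNIV (\<phi> :: complex \<Rightarrow> real)"
  defines "H \<equiv> \<lambda>z. \<phi> z *\<^sub>R (\<i> * W z)"
  shows "C1_on (annulus 0) H" "\<rho> > 0 \<Longrightarrow> integrable (lebesgue_on (annulus \<rho>)) (grad_sq H)"
    "(\<lambda>k. circle_coeff H (rsq k) n) \<longlonglongrightarrow> fourier_coeff (\<lambda>z. \<phi> z *\<^sub>R (\<i> * g z)) n"
proof -
  have bl: "bounded_linear (\<lambda>z::complex. \<i> * z)" by (rule bounded_linear_mult_right)
  have \<phi>': "C1_on (annulus 0) \<phi>" by (rule C1_on_subset[OF \<phi>]) simp
  have C1H: "C1_on (annulus 0) H" unfolding H_def by (intro C1_on_scaleR \<phi>' C1_on_linear[OF bl] C1)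
  then show "C1_on (annulus 0) H" .
  have "bounded (F ` cball 0 1)" if "continuous_on UNIV F" for F :: "complex \<Rightarrow> real"
    by (intro compact_imp_bounded compact_continuous_image continuous_on_subset[OF that] compact_cball) simp
  then have "\<exists>B. \<forall>z\<in>cball 0 1. \<bar>F z\<bar> \<le> B" if "continuous_on UNIV F" for F :: "complex \<Rightarrow> real"
    using that by (auto simp: bounded_iff)
  then obtain B B1 B2 where B: "\<And>z. z \<in> cball 0 1 \<Longrightarrow> \<bar>\<phi> z\<bar> \<le> B" "\<And>z. z \<in> cball 0 1 \<Longrightarrow> \<bar>pd_x \<phi> z\<bar> \<le> B1" "\<And>z. z \<in> cball 0 1 \<Longrightarrow> \<bar>pd_y \<phi> z\<bar> \<le> B2"
    using C1_onD(2-4)[OF \<phi>] by metis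
  have cb: "z \<in> cball 0 1" if "z \<in> annulus 0" for z using that by (simp add: mem_annulus)
  have gr: "has_grad H (\<phi> z *\<^sub>R (\<i> * pd_x W z) + pd_x \<phi> z *\<^sub>R (\<i> * W z)) (\<phi> z *\<^sub>R (\<i> * pd_y W z) + pd_y \<phi> z *\<^sub>R (\<i> * W z)) z"
    if "z \<in> annulus 0" for z
    unfolding H_def by (rule has_grad_scaleR[OF C1_onD(1)[OF \<phi>' that] has_grad_linear[OF bl C1_onD(1)[OF C1 that]]])
  have sq: "(norm (a *\<^sub>R (\<i> * x) + b *\<^sub>R (\<i> * y)))\<^sup>2 \<le> 2 * (A\<^sup>2 * (norm x)\<^sup>2) + 2 * D\<^sup>2"
    if "\<bar>a\<bar> \<le> A" "\<bar>b\<bar> \<le> D" "norm y = 1" for a b A D and x y :: complex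
  proof -
    have "norm (a *\<^sub>R (\<i> * x) + b *\<^sub>R (\<i> * y)) \<le> \<bar>a\<bar> * norm x + \<bar>b\<bar>"
      using norm_triangle_ineq[of "a *\<^sub>R (\<i> * x)" "b *\<^sub>R (\<i> * y)"] that(3) by (simp add: norm_mult)
    also have "\<dots> \<le> A * norm x + D" using that by (intro add_mono mult_right_mono) auto
    finally have "(norm (a *\<^sub>R (\<i> * x) + b *\<^sub>R (\<i> * y)))\<^sup>2 \<le> (A * norm x + D)\<^sup>2" by (rule power_mono) simp
    also have "\<dots> \<le> 2 * (A * norm x)\<^sup>2 + 2 * D\<^sup>2"
      using sum_squares_bound[of "A * norm x" D] by (simp add: power2_sum)
    finally show ?thesis by (simp add: power_mult_distrib)
  qed
  show "integrable (lebesgue_on (annulus \<rho>)) (grad_sq H)" if "\<rho> > 0"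
  proof (rule Bochner_Integration.integrable_bound)
    interpret finite_measure "lebesgue_on (annulus \<rho>)"
      by (rule finite_measure_lebesgue_on) (auto intro!: lmeasurable_open open_annulus bounded_subset[OF bounded_ball[of 0 1]] simp: annulus_def)
    show "integrable (lebesgue_on (annulus \<rho>)) (\<lambda>z. 2 * B\<^sup>2 * grad_sq W z + (2 * B1\<^sup>2 + 2 * B2\<^sup>2))"
      by (intro Bochner_Integration.integrable_add[OF integrable_mult_right[OF energy[OF that]]] integrable_const)
    have A0: "annulus \<rho> \<subseteq> annulus 0" using that by (intro annulus_mono) simp
    have "continuous_on (annulus \<rho>) (grad_sq H)"
      by (rule continuous_on_subset[OF _ A0]) (intro continuous_intros C1_onD[OF C1H])
    then show "grad_sq H \<in> borel_measurable (lebesgue_on (annulus \<rho>))"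
      by (rule continuous_imp_measurable_on_sets_lebesgue) (simp add: open_annulus sets_borel_lebesgue)
    show "AE z in lebesgue_on (annulus \<rho>). norm (grad_sq H z) \<le> norm (2 * B\<^sup>2 * grad_sq W z + (2 * B1\<^sup>2 + 2 * B2\<^sup>2))"
    proof (rule AE_I2)
      fix z assume "z \<in> space (lebesgue_on (annulus \<rho>))"
      then have z: "z \<in> annulus 0" using A0 by auto
      have "grad_sq H z \<le> 2 * B\<^sup>2 * grad_sq W z + (2 * B1\<^sup>2 + 2 * B2\<^sup>2)"
        unfolding has_grad_pd[OF gr[OF z]]
        using sq[OF B(1,2)[OF cb[OF z]] norm_1[OF z], of "pd_x W z"] sq[OF B(1,3)[OF cb[OF z]] norm_1[OF z], of "pd_y W z"]
        by (simp add: ring_distribs)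
      then show "norm (grad_sq H z) \<le> norm (2 * B\<^sup>2 * grad_sq W z + (2 * B1\<^sup>2 + 2 * B2\<^sup>2))" by simp
    qed
  qed
  show "(\<lambda>k. circle_coeff H (rsq k) n) \<longlonglongrightarrow> fourier_coeff (\<lambda>z. \<phi> z *\<^sub>R (\<i> * g z)) n"
  proof (rule radial_limit_L2(4)[OF C1_onD(4)[OF C1H]])
    show "norm (H z) \<le> B" if "z \<in> annulus 0" for z
      using B(1)[OF cb[OF that]] norm_1[OF that] by (simp add: H_def norm_mult)
    show "AE t in circle_measure. (\<lambda>k. H (pol (rsq k) t)) \<longlonglongrightarrow> \<phi> (cis t) *\<^sub>R (\<i> * g (cis t))"
      using limit
    proof eventually_elim
      case (elim t)
      have "(\<lambda>k. pol (rsq k) t) \<longlonglongrightarrow> of_real (exp 0) * cis t"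
        unfolding pol_def by (intro tendsto_intros rsq_lim)
      moreover have "isCont \<phi> (cis t)" using C1_onD(4)[OF \<phi>] by (simp add: continuous_on_eq_continuous_at)
      ultimately have "(\<lambda>k. \<phi> (pol (rsq k) t)) \<longlonglongrightarrow> \<phi> (cis t)"
        by (intro isCont_tendsto_compose[of "cis t" \<phi>]) simp_all
      then show ?case unfolding H_def by (intro tendsto_intros elim)
    qed
  qed
qed

lemma trace_bounds:
  shows "L2 circle_measure (\<lambda>t. g (cis t))" "AE t in circle_measure. norm (g (cis t)) = 1"
    "(\<lambda>k. circle_coeff W (rsq k) n) \<longlonglongrightarrow> fourier_coeff g n"
    "(\<lambda>k. LINT t|circle_measure. (norm (W (pol (rsq k) t) - g (cis t)))\<^sup>2) \<longlonglongrightarrow> 0"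
proof -
  have B: "norm (W z) \<le> 1" if "z \<in> annulus 0" for z using norm_1[OF that] by simp
  note * = radial_limit_L2[OF C1_onD(4)[OF C1] B limit]
  show "L2 circle_measure (\<lambda>t. g (cis t))" "(\<lambda>k. circle_coeff W (rsq k) n) \<longlonglongrightarrow> fourier_coeff g n"
    "(\<lambda>k. LINT t|circle_measure. (norm (W (pol (rsq k) t) - g (cis t)))\<^sup>2) \<longlonglongrightarrow> 0"
    using *(3) *(4)[of n] *(5) by simp_all
  show "AE t in circle_measure. norm (g (cis t)) = 1"
    using limit
  proof eventually_elim
    case (elim t)
    have "(\<lambda>k. norm (W (pol (rsq k) t))) \<longlonglongrightarrow> norm (g (cis t))" by (intro tendsto_norm elim)
    moreover have "norm (W (pol (rsq k) t)) = 1" for k by (intro norm_1 pol_annulus rsq)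
    ultimately show ?case by (simp add: LIMSEQ_const_iff)
  qed
qed

text \<open>\<open>angular_current\<close> is a Fourier pairing and not an integral; here it becomes
  a limit of genuine integrals on interior circles.\<close>

lemma current_limit:
  assumes \<phi>: "C1_on UNIV (\<phi> :: complex \<Rightarrow> real)"
  shows "(\<lambda>k. LINT t|circle_measure. ang W (pol (rsq k) t) \<bullet> (\<phi> (pol (rsq k) t) *\<^sub>R (\<i> * W (pol (rsq k) t))))
     \<longlonglongrightarrow> angular_current g \<phi>"
  unfolding angular_current_def
  by (rule pairing_limit(2)[OF C1 energy product(1)[OF \<phi>] product(2)[OF \<phi>] trace_bounds(3) product(3)[OF \<phi>]]) simp_all

lemma H_half_S1_trace: "H_half_S1 g"
proof -
  have "(\<lambda>n. \<bar>real_of_int n\<bar> * (norm (fourier_coeff g n))\<^sup>2) summable_on UNIV"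
    by (rule pairing_limit(1)[OF C1 energy C1 energy trace_bounds(3) trace_bounds(3)]) simp_all
  then show ?thesis using trace_bounds(1,2) by (simp add: H_half_S1_def H_half_def)
qed

text \<open>The dilations of \<open>W\<close> are C1 across the unit circle; a cutoff that equals 1
  near the closed annulus makes them globally C1, as \<open>outer_trace\<close> requires of its
  approximants.\<close>

lemma outer_trace_trace:
  assumes \<rho>: "0 < \<rho>" "\<rho> < 1"
  shows "outer_trace \<rho> W g"
proof -
  let ?A = "annulus \<rho>" and ?r = "\<lambda>k. exp (rsq k)"
  let ?M = "lebesgue_on ?A"
  have A0: "?A \<subseteq> annulus 0" using \<rho> by (intro annulus_mono) simp
  have CA: "C1_on ?A W" by (rule C1_on_subset[OF C1 A0])
  define K where "K = {z::complex. \<rho> \<le> norm z \<and> norm z \<le> 1}"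
  \<comment> \<open>The domain of the dilated map, which reaches beyond the unit circle.\<close>
  define U where "U k = {z::complex. 0 < norm z \<and> norm z < 1 / ?r k}" for k
  have K: "compact K"
  proof -
    have "K = cball 0 1 - ball 0 \<rho>" by (auto simp: K_def)
    then show ?thesis by (simp add: compact_diff)
  qed
  have U: "open (U k)" for k unfolding U_def
    by (intro open_Collect_conj open_Collect_less continuous_intros)
  have KU: "K \<subseteq> U k" for k
  proof -
    have "1 < 1 / ?r k" using rsq(2)[of k] by (subst less_divide_eq_1_pos) auto
    then show ?thesis using \<rho> unfolding K_def U_def by (auto intro: le_less_trans simp del: less_divide_eq_1_pos)
  qed
  have CU: "C1_on (U k) (\<lambda>z. W (of_real (?r k) * z))" for k
    by (rule C1_on_compose_holomorphic[OF C1 U]) (auto intro!: holomorphic_intros simp: U_def mem_annulus norm_mult field_simps)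
  have "\<exists>V. C1_on UNIV V \<and> (\<forall>z\<in>K. V z = W (of_real (?r k) * z)) \<and>
      (\<forall>z\<in>?A. pd_x V z = of_real (?r k) * pd_x W (of_real (?r k) * z) \<and> pd_y V z = of_real (?r k) * pd_y W (of_real (?r k) * z))" for k
  proof -
    obtain b V where b: "test_function (U k) b" "open V" "K \<subseteq> V" "\<And>w. w \<in> V \<Longrightarrow> b w = 1"
      using C1_cutoff[OF K U KU] by metis
    let ?V = "\<lambda>z. b z *\<^sub>R W (of_real (?r k) * z)"
    have eq: "?V z = W (of_real (?r k) * z)" if "z \<in> V" for z using b(4)[OF that] by simp
    have "pd_x ?V z = of_real (?r k) * pd_x W (of_real (?r k) * z) \<and> pd_y ?V z = of_real (?r k) * pd_y W (of_real (?r k) * z)"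
      if z: "z \<in> ?A" for z
    proof -
      have zV: "z \<in> V" using z b(3) by (auto simp: K_def mem_annulus)
      have "of_real (?r k) * z \<in> annulus 0" using dilation_annulus(2)[OF z] \<rho> by simp
      then have "has_grad (\<lambda>z. W (of_real (?r k) * z)) (?r k *\<^sub>R pd_x W (of_real (?r k) * z)) (?r k *\<^sub>R pd_y W (of_real (?r k) * z)) z"
        using has_grad_compose_holomorphic[OF C1_onD(1)[OF C1], of "\<lambda>z. of_real (?r k) * z" z "of_real (?r k)"]
        by (auto intro!: derivative_eq_intros)
      then have "has_grad ?V (?r k *\<^sub>R pd_x W (of_real (?r k) * z)) (?r k *\<^sub>R pd_y W (of_real (?r k) * z)) z"
        using has_grad_cong[OF b(2) zV, of ?V "\<lambda>z. W (of_real (?r k) * z)"] eq by blast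
      from has_grad_pd[OF this] show ?thesis by (simp add: scaleR_conv_of_real)
    qed
    then show ?thesis using test_function_times_C1(1)[OF b(1) U CU] eq b(3) by (intro exI[of _ ?V]) auto
  qed
  then obtain V where V: "\<And>k. C1_on UNIV (V k)" "\<And>k z. z \<in> K \<Longrightarrow> V k z = W (of_real (?r k) * z)"
    "\<And>k z. z \<in> ?A \<Longrightarrow> pd_x (V k) z = of_real (?r k) * pd_x W (of_real (?r k) * z)"
    "\<And>k z. z \<in> ?A \<Longrightarrow> pd_y (V k) z = of_real (?r k) * pd_y W (of_real (?r k) * z)"
    by metis
  have bA: "bounded ?A" by (rule bounded_subset[OF bounded_ball[of 0 1]]) (auto simp: annulus_def)
  have bA': "bounded (annulus (exp (-1) * \<rho>))" by (rule bounded_subset[OF bounded_ball[of 0 1]]) (auto simp: annulus_def)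
  have LW: "L2 ?M W"
    by (rule L2_bounded[OF open_annulus bA C1_onD(4)[OF CA], of 1]) (use norm_1 A0 in auto)
  note Lg = L2_grad[OF open_annulus CA energy[OF \<rho>(1)]]
  have e\<rho>: "0 < exp (-1) * \<rho>" using \<rho> by simp
  have A'0: "annulus (exp (-1) * \<rho>) \<subseteq> annulus 0" using e\<rho> by (intro annulus_mono) linarith
  have iW: "integrable (lebesgue_on (annulus (exp (-1) * \<rho>))) (\<lambda>z. (norm (W z))\<^sup>2)"
    using L2_bounded[OF open_annulus bA' C1_onD(4)[OF C1_on_subset[OF C1 A'0]], of 1] norm_1 A'0 by (force simp: L2_def)
  note dW = dilation_L2[OF C1_onD(4)[OF C1] less_imp_le[OF \<rho>(1)] iW]
  have iD: "integrable ?M (\<lambda>z. (norm (of_real (?r k) * d (of_real (?r k) * z) - d z))\<^sup>2)"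
    "(\<lambda>k. LINT z|?M. (norm (of_real (?r k) * d (of_real (?r k) * z) - d z))\<^sup>2) \<longlonglongrightarrow> 0"
    if d: "continuous_on (annulus 0) d" and dE: "\<And>z. (norm (d z))\<^sup>2 \<le> grad_sq W z" for d :: "complex \<Rightarrow> complex" and k
  proof -
    \<comment> \<open>Dilating \<open>z * d z\<close> produces the factor \<open>?r k\<close> that
      the chain rule puts in front of \<open>d\<close>, so \<open>dilation_L2\<close> applies as it
      stands; dividing by \<open>norm z\<close>, which exceeds \<open>\<rho>\<close>, returns to
      \<open>d\<close>.\<close>
    let ?h = "\<lambda>z. z * d z"
    have ch: "continuous_on (annulus 0) ?h" by (intro continuous_intros d)
    have sA': "annulus (exp (-1) * \<rho>) \<in> sets lebesgue" using open_annulus by (simp add: sets_borel_lebesgue)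
    have ih: "integrable (lebesgue_on (annulus (exp (-1) * \<rho>))) (\<lambda>z. (norm (?h z))\<^sup>2)"
    proof (rule Bochner_Integration.integrable_bound[OF energy[OF e\<rho>]])
      show "(\<lambda>z. (norm (?h z))\<^sup>2) \<in> borel_measurable (lebesgue_on (annulus (exp (-1) * \<rho>)))"
        by (intro continuous_imp_measurable_on_sets_lebesgue continuous_intros continuous_on_subset[OF d A'0] sA')
      show "AE z in lebesgue_on (annulus (exp (-1) * \<rho>)). norm ((norm (?h z))\<^sup>2) \<le> norm (grad_sq W z)"
      proof (rule AE_I2)
        fix z assume "z \<in> space (lebesgue_on (annulus (exp (-1) * \<rho>)))"
        then have "norm z \<le> 1" by (simp add: mem_annulus)
        then have "norm (?h z) \<le> norm (d z)" by (simp add: norm_mult mult_left_le_one_le)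
        then have "(norm (?h z))\<^sup>2 \<le> (norm (d z))\<^sup>2" by (rule power_mono) simp
        then show "norm ((norm (?h z))\<^sup>2) \<le> norm (grad_sq W z)" using dE[of z] by (simp only: real_norm_def abs_of_nonneg zero_le_power2 add_nonneg_nonneg)
      qed
    qed
    note dh = dilation_L2[OF ch less_imp_le[OF \<rho>(1)] ih]
    let ?D = "\<lambda>k z. (norm (of_real (?r k) * d (of_real (?r k) * z) - d z))\<^sup>2"
    let ?E = "\<lambda>k z. (norm (?h (of_real (?r k) * z) - ?h z))\<^sup>2"
    have le: "?D k z \<le> (1 / \<rho>\<^sup>2) * ?E k z" if "z \<in> ?A" for k z
    proof -
      have "?h (of_real (?r k) * z) - ?h z = z * (of_real (?r k) * d (of_real (?r k) * z) - d z)"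
        by (simp add: algebra_simps)
      then have "?E k z = (norm z)\<^sup>2 * ?D k z" by (simp only: norm_mult power_mult_distrib)
      moreover have "\<rho>\<^sup>2 * ?D k z \<le> (norm z)\<^sup>2 * ?D k z"
        using that \<rho> by (intro mult_right_mono power_mono) (auto simp: mem_annulus)
      ultimately show ?thesis using \<rho> by (simp add: field_simps)
    qed
    have mD: "?D k \<in> borel_measurable ?M" for k
      by (intro continuous_imp_measurable_on_sets_lebesgue continuous_intros continuous_on_compose2[OF d] continuous_on_subset[OF d A0])
        (use dilation_annulus(2)[of _ \<rho>] \<rho> in \<open>auto simp: open_annulus sets_borel_lebesgue\<close>)
    show iD: "integrable ?M (?D k)" for k
      by (rule Bochner_Integration.integrable_bound[OF integrable_mult_right[OF dh(1)[of k], of "1 / \<rho>\<^sup>2"] mD])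
        (rule AE_I2, use le in simp)
    have up: "(\<lambda>k. (1 / \<rho>\<^sup>2) * (LINT z|?M. ?E k z)) \<longlonglongrightarrow> 0"
      using tendsto_mult_right_zero[OF dh(2)] .
    show "(\<lambda>k. LINT z|?M. ?D k z) \<longlonglongrightarrow> 0"
    proof (rule tendsto_sandwich[OF _ _ tendsto_const up])
      show "eventually (\<lambda>k. 0 \<le> (LINT z|?M. ?D k z)) sequentially"
        by (intro always_eventually allI integral_nonneg_AE) simp
      have "(LINT z|?M. ?D k z) \<le> (LINT z|?M. (1 / \<rho>\<^sup>2) * ?E k z)" for k
        by (rule integral_mono[OF iD integrable_mult_right[OF dh(1)]]) (use le in simp)
      then show "eventually (\<lambda>k. (LINT z|?M. ?D k z) \<le> (1 / \<rho>\<^sup>2) * (LINT z|?M. ?E k z)) sequentially"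
        by simp
    qed
  qed
  have dx: "(norm (pd_x W z))\<^sup>2 \<le> grad_sq W z" and dy: "(norm (pd_y W z))\<^sup>2 \<le> grad_sq W z" for z by simp_all
  note ix = iD[OF C1_onD(2)[OF C1] dx] and iy = iD[OF C1_onD(3)[OF C1] dy]
  let ?S = "\<lambda>k z. (norm (W (of_real (?r k) * z) - W z))\<^sup>2 + (norm (of_real (?r k) * pd_x W (of_real (?r k) * z) - pd_x W z))\<^sup>2
     + (norm (of_real (?r k) * pd_y W (of_real (?r k) * z) - pd_y W z))\<^sup>2"
  have "(\<lambda>k. (LINT z|?M. (norm (W (of_real (?r k) * z) - W z))\<^sup>2)
      + (LINT z|?M. (norm (of_real (?r k) * pd_x W (of_real (?r k) * z) - pd_x W z))\<^sup>2)
      + (LINT z|?M. (norm (of_real (?r k) * pd_y W (of_real (?r k) * z) - pd_y W z))\<^sup>2)) \<longlonglongrightarrow> 0 + 0 + 0"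
    by (intro tendsto_add dW(2) ix(2) iy(2))
  then have "(\<lambda>k. LINT z|?M. ?S k z) \<longlonglongrightarrow> 0"
    by (simp add: Bochner_Integration.integral_add Bochner_Integration.integrable_add dW(1) ix(1) iy(1))
  moreover have "(LINT z|?M. (norm (V k z - W z))\<^sup>2 + (norm (pd_x (V k) z - pd_x W z))\<^sup>2 + (norm (pd_y (V k) z - pd_y W z))\<^sup>2)
      = (LINT z|?M. ?S k z)" for k
    by (rule Bochner_Integration.integral_cong[OF refl]) (use V(2,3,4) in \<open>auto simp: K_def mem_annulus\<close>)
  ultimately have 1: "(\<lambda>k. LINT z|?M. (norm (V k z - W z))\<^sup>2 + (norm (pd_x (V k) z - pd_x W z))\<^sup>2 + (norm (pd_y (V k) z - pd_y W z))\<^sup>2) \<longlonglongrightarrow> 0"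
    by simp
  have "V k (cis t) = W (pol (rsq k) t)" for k t
    using V(2)[of "cis t" k] \<rho> by (simp add: K_def pol_def)
  then have 2: "(\<lambda>k. LINT t|circle_measure. (norm (V k (cis t) - g (cis t)))\<^sup>2) \<longlonglongrightarrow> 0"
    using trace_bounds(4) by simp
  show ?thesis
    unfolding outer_trace_def
    by (intro conjI LW trace_bounds(1) exI[of _ "pd_x W"] exI[of _ "pd_y W"] exI[of _ V] weak_gradient_C1[OF open_annulus CA] Lg V(1) 1 2 allI)
qed

end

section \<open>The logarithm of a derivative in the Dirichlet space\<close>

text \<open>Here \<open>x\<close> is the logarithmic derivative of \<open>P\<close>, and
  \<open>ln (norm (P z))\<close> is locally the real part of a logarithm of \<open>P\<close>. The
  computation through the norm avoids choosing a branch.\<close>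

lemma has_grad_ln_norm:
  assumes P: "(P has_field_derivative P z * x) (at z)" "P z \<noteq> 0"
  shows "has_grad (\<lambda>z. ln (norm (P z))) (Re x) (- Im x) z"
proof -
  have "(norm has_derivative (\<lambda>h. h \<bullet> sgn (P z))) (at (P z))"
    using has_derivative_norm[OF P(2)] by (simp add: inner_commute)
  from has_derivative_compose[OF P(1)[unfolded has_field_derivative_def] this]
  have "((\<lambda>z. norm (P z)) has_derivative (\<lambda>h. (P z * x * h) \<bullet> sgn (P z))) (at z)" .
  then have "has_grad (\<lambda>z. norm (P z)) ((P z * x) \<bullet> sgn (P z)) ((P z * x * \<i>) \<bullet> sgn (P z)) z"
    unfolding has_grad_def
  proof (rule has_derivative_eq_rhs, intro ext)
    fix h
    have "P z * x * h = Re h *\<^sub>R (P z * x) + Im h *\<^sub>R (P z * x * \<i>)"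
      by (simp add: complex_eq_iff algebra_simps)
    then show "(P z * x * h) \<bullet> sgn (P z) = Re h *\<^sub>R ((P z * x) \<bullet> sgn (P z)) + Im h *\<^sub>R ((P z * x * \<i>) \<bullet> sgn (P z))"
      by (simp add: inner_add_left)
  qed
  from has_grad_real_compose[OF this DERIV_ln_divide[of "norm (P z)"]] P(2)
  have "has_grad (\<lambda>z. ln (norm (P z))) (1 / norm (P z) * ((P z * x) \<bullet> sgn (P z))) (1 / norm (P z) * ((P z * x * \<i>) \<bullet> sgn (P z))) z"
    by simp
  moreover have "1 / norm (P z) * ((P z * y) \<bullet> sgn (P z)) = Re y" for y
  proof -
    have "(P z * y) \<bullet> P z = (norm (P z))\<^sup>2 * Re y"
      unfolding inner_complex_def cmod_power2 by (simp add: power2_eq_square algebra_simps)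
    then show ?thesis using P(2) by (simp add: sgn_div_norm power2_eq_square field_simps)
  qed
  from this[of x] this[of "x * \<i>"]
  have "1 / norm (P z) * ((P z * x) \<bullet> sgn (P z)) = Re x" "1 / norm (P z) * ((P z * x * \<i>) \<bullet> sgn (P z)) = - Im x"
    by (simp_all add: mult.assoc)
  ultimately show ?thesis by simp
qed

text \<open>Multiplying \<open>P\<close> by \<open>exp (- ln (norm (P z)))\<close> strips the
  modulus part from the logarithmic derivative: what remains, \<open>x - Re x\<close> and
  \<open>\<i> * x + Im x\<close>, is purely imaginary. The gradient \<open>(Im x, Re x)\<close> of
  the argument is conjugate to the one in \<open>has_grad_ln_norm\<close>.\<close>

lemma has_grad_sgn:
  assumes P: "(P has_field_derivative P z * x) (at z)" "P z \<noteq> 0"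
  shows "has_grad (\<lambda>z. c * sgn (P z)) (\<i> * of_real (Im x) * (c * sgn (P z))) (\<i> * of_real (Re x) * (c * sgn (P z))) z"
proof -
  have "isCont P z" using P(1) by (rule DERIV_isCont)
  then obtain e where e: "e > 0" "\<And>w. dist z w < e \<Longrightarrow> P w \<noteq> 0"
    using continuous_at_avoid[of z P 0] P(2) by auto
  let ?E = "\<lambda>z. exp (- ln (norm (P z)))"
  have E: "has_grad ?E (- ?E z * Re x) (- ?E z * (- Im x)) z"
    by (rule has_grad_real_compose[OF has_grad_ln_norm[OF P]]) (auto intro!: derivative_eq_intros)
  have "has_grad (\<lambda>z. ?E z *\<^sub>R (c * P z)) (?E z *\<^sub>R (c * (P z * x)) + (- ?E z * Re x) *\<^sub>R (c * P z))
      (?E z *\<^sub>R (\<i> * (c * (P z * x))) + (- ?E z * (- Im x)) *\<^sub>R (c * P z)) z"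
    by (rule has_grad_scaleR[OF E has_grad_holomorphic]) (auto intro!: derivative_eq_intros P)
  moreover have ez: "?E z *\<^sub>R (c * P z) = c * sgn (P z)"
    using P(2) by (simp add: exp_minus sgn_div_norm scaleR_conv_of_real field_simps)
  have "?E z *\<^sub>R (c * (P z * x)) + (- ?E z * Re x) *\<^sub>R (c * P z) = (x - Re x) * (?E z *\<^sub>R (c * P z))"
    by (simp add: scaleR_conv_of_real algebra_simps)
  moreover have "?E z *\<^sub>R (\<i> * (c * (P z * x))) + (- ?E z * (- Im x)) *\<^sub>R (c * P z) = (\<i> * x + Im x) * (?E z *\<^sub>R (c * P z))"
    by (simp add: scaleR_conv_of_real algebra_simps)
  moreover have "x - Re x = \<i> * of_real (Im x)" "\<i> * x + Im x = \<i> * of_real (Re x)"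
    by (simp_all add: complex_eq_iff)
  ultimately have "has_grad (\<lambda>z. ?E z *\<^sub>R (c * P z)) (\<i> * of_real (Im x) * (c * sgn (P z))) (\<i> * of_real (Re x) * (c * sgn (P z))) z"
    by (simp only: ez)
  moreover have "?E w *\<^sub>R (c * P w) = c * sgn (P w)" if "w \<in> ball z e" for w
    using e(2)[of w] that by (simp add: exp_minus sgn_div_norm scaleR_conv_of_real field_simps)
  ultimately show ?thesis
    using has_grad_cong[of "ball z e" z "\<lambda>z. ?E z *\<^sub>R (c * P z)" "\<lambda>z. c * sgn (P z)"] e(1) by auto
qed

text \<open>The case \<open>n = 0\<close> of \<open>circle_coeff_rad\<close> and
  \<open>circle_coeff_ang\<close>, applied to a real function.\<close>

lemma circle_mean:
  fixes F :: "complex \<Rightarrow> real"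
  assumes F: "C1_on (annulus 0) F" and s: "s < 0"
  shows "((\<lambda>s. LINT t|circle_measure. F (pol s t)) has_vector_derivative (LINT t|circle_measure. rad F (pol s t))) (at s)"
    and "(LINT t|circle_measure. ang F (pol s t)) = 0"
proof -
  let ?G = "\<lambda>z. complex_of_real (F z)"
  have G: "C1_on (annulus 0) ?G" by (rule C1_on_linear[OF bounded_linear_of_real F])
  have gr: "has_grad ?G (of_real (pd_x F z)) (of_real (pd_y F z)) z" if "z \<in> annulus 0" for z
    by (rule has_grad_linear[OF bounded_linear_of_real C1_onD(1)[OF F that]])
  have ra: "rad ?G z = of_real (rad F z)" "ang ?G z = of_real (ang F z)" if "z \<in> annulus 0" for z
    unfolding rad_def ang_def has_grad_pd(1,2)[OF gr[OF that]] by (simp_all add: scaleR_conv_of_real)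
  have cc: "circle_coeff ?G s 0 = of_real ((LINT t|circle_measure. F (pol s t)) / (2 * pi))" for s
    using circle_coeff_eq[of ?G s 0] by simp
  have cr: "circle_coeff (rad ?G) s 0 = of_real ((LINT t|circle_measure. rad F (pol s t)) / (2 * pi))"
    "circle_coeff (ang ?G) s 0 = of_real ((LINT t|circle_measure. ang F (pol s t)) / (2 * pi))"
    using circle_coeff_eq[of "rad ?G" s 0] circle_coeff_eq[of "ang ?G" s 0] ra[OF pol_annulus[OF s]] by simp_all
  have "((\<lambda>s. 2 * pi * Re (circle_coeff ?G s 0)) has_vector_derivative 2 * pi * Re (circle_coeff (rad ?G) s 0)) (at s)"
    by (intro has_vector_derivative_mult_right bounded_linear.has_vector_derivative[OF bounded_linear_Re] circle_coeff_rad[OF G s])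
  then show "((\<lambda>s. LINT t|circle_measure. F (pol s t)) has_vector_derivative (LINT t|circle_measure. rad F (pol s t))) (at s)"
    unfolding cc cr by simp
  show "(LINT t|circle_measure. ang F (pol s t)) = 0"
    using circle_coeff_ang[OF G s, of 0] unfolding cr by (simp add: cc)
qed

text \<open>The map \<open>exp (w / 2)\<close> sends the strip injectively into the disc with
  Jacobian \<open>exp (Re w) / 4\<close>, which up to the factor 4 is the polar form of the
  integrand; boundedness of the image gives integrability.\<close>

lemma inverse_norm_integrable: "integrable (lebesgue_on (annulus 0)) (\<lambda>z::complex. 1 / norm z)"
proof -
  let ?S = "log_strip 0" and ?g = "\<lambda>w::complex. exp (w / 2)"
  have c: "continuous_on (annulus 0) (\<lambda>z::complex. 1 / norm z)"
    by (intro continuous_intros) (auto simp: mem_annulus)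
  have hol: "?g holomorphic_on ?S" by (intro holomorphic_intros) auto
  have inj: "inj_on ?g ?S"
  proof (rule inj_onI)
    fix x y assume *: "x \<in> ?S" "y \<in> ?S" "exp (x / 2) = exp (y / 2)"
    then have "exp x = exp y" by (metis exp_double mult.commute nonzero_mult_div_cancel_left times_divide_eq_right zero_neq_numeral)
    then show "x = y" using inj_on_exp_log_strip *(1,2) by (auto dest: inj_onD)
  qed
  have og: "open (?g ` ?S)" by (rule open_holomorphic_image[OF open_log_strip hol inj])
  have m: "set_borel_measurable borel (?g ` ?S) (\<lambda>_. 1::real)"
    using og by (intro set_borel_measurable_continuous_open continuous_intros) simp
  have "bounded (?g ` ?S)"
    by (rule bounded_subset[OF bounded_ball[of 0 1]]) (auto simp: log_strip_def)
  then have "set_integrable lborel (?g ` ?S) (\<lambda>_. 1::real)"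
    using og emeasure_bounded_finite[of "?g ` ?S"] by (simp add: set_integrable_def integrable_indicator_iff)
  then have "set_integrable lborel ?S (\<lambda>w. (norm (deriv ?g w))\<^sup>2 *\<^sub>R 1::real)"
    using set_integral_holomorphic_image(1)[OF open_log_strip hol inj m] by simp
  moreover have "(norm (deriv ?g w))\<^sup>2 *\<^sub>R (1::real) = exp (Re w) / 4" for w
  proof -
    have d: "deriv ?g w = exp (w / 2) / 2"
      by (rule DERIV_imp_deriv) (auto intro!: derivative_eq_intros)
    show ?thesis unfolding d by (simp add: norm_divide power_divide exp_double[symmetric])
  qed
  ultimately have "set_integrable lborel ?S (\<lambda>w. exp (Re w) / 4)" by (simp only:)
  then have "set_integrable lborel ?S (\<lambda>w. exp (Re w))" by simp
  moreover have "(exp (Re w))\<^sup>2 *\<^sub>R (1 / norm (exp w)) = exp (Re w)" for w :: complex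
    by (simp add: power2_eq_square)
  ultimately show ?thesis using polar_integral(1)[OF order_refl c] by simp
qed


text \<open>By Parseval it is enough to bound the modes: for \<open>n \<noteq> 0\<close> the weight
  \<open>\<bar>n\<bar>\<close> is at least 1, so \<open>energy_domination\<close> applies, and the
  mode 0 is \<open>L 0\<close> by the mean value property.\<close>

lemma circle_log_bounded:
  assumes L: "L holomorphic_on ball 0 1" and E: "integrable (lebesgue_on (ball 0 1)) (\<lambda>z. (norm (deriv L z))\<^sup>2)"
  obtains C where "\<And>s. -1 \<le> s \<Longrightarrow> s < 0 \<Longrightarrow> (LINT t|circle_measure. (norm (L (pol s t)))\<^sup>2) \<le> C"
proof -
  have A: "annulus \<rho> \<subseteq> ball 0 1" for \<rho> by (auto simp: annulus_def)
  have d: "(L has_field_derivative deriv L z) (at z)" if "z \<in> ball 0 1" for z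
    using holomorphic_derivI[OF L open_ball that] .
  have cd: "continuous_on (ball 0 1) (deriv L)"
    by (intro holomorphic_on_imp_continuous_on holomorphic_deriv L open_ball)
  have gr: "has_grad L (deriv L z) (\<i> * deriv L z) z" if "z \<in> annulus 0" for z
    by (rule has_grad_holomorphic[OF d]) (use that in \<open>simp add: mem_annulus\<close>)
  have C1: "C1_on (annulus 0) L"
    by (rule C1_onI[OF gr]) (auto intro!: continuous_intros continuous_on_subset[OF cd A])
  have "integrable (lebesgue_on (annulus (exp (-1)))) (\<lambda>z. 2 * (norm (deriv L z))\<^sup>2)"
    by (intro integrable_mult_right integrable_lebesgue_on_subset[OF E A]) (simp_all add: open_annulus sets_borel_lebesgue)
  then have En: "integrable (lebesgue_on (annulus (exp (-1)))) (grad_sq L)"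
  proof (rule iffD1[OF Bochner_Integration.integrable_cong[OF refl], rotated])
    fix z assume "z \<in> space (lebesgue_on (annulus (exp (-1))))"
    then have "z \<in> annulus 0" using annulus_mono[of 0 "exp (-1)"] by auto
    from has_grad_pd[OF gr[OF this]] show "2 * (norm (deriv L z))\<^sup>2 = grad_sq L z" by (simp add: norm_mult)
  qed
  obtain D where D: "D summable_on UNIV"
    "\<And>n s. -1 \<le> s \<Longrightarrow> s < 0 \<Longrightarrow> \<bar>of_int n\<bar> * (norm (circle_coeff L s n))\<^sup>2 \<le> D n"
    using energy_domination[OF C1 En] by blast
  define D' where "D' n = D n + (if n = 0 then (norm (L 0))\<^sup>2 else 0)" for n :: int
  have sD': "D' summable_on UNIV" unfolding D'_def
  proof (rule summable_on_add[OF D(1)])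
    have "(\<lambda>n::int. if n = 0 then (norm (L 0))\<^sup>2 else 0) summable_on {0}" by (rule summable_on_finite) simp
    then show "(\<lambda>n::int. if n = 0 then (norm (L 0))\<^sup>2 else 0) summable_on UNIV"
      by (rule iffD1[OF summable_on_cong_neutral, rotated 3]) auto
  qed
  have "(LINT t|circle_measure. (norm (L (pol s t)))\<^sup>2) \<le> 2 * pi * infsum D' UNIV" if s: "-1 \<le> s" "s < 0" for s
  proof -
    have "((\<lambda>n. (norm (circle_coeff L s n))\<^sup>2) has_sum ((LINT t|circle_measure. (norm (L (pol s t)))\<^sup>2) / (2 * pi))) UNIV"
      using parseval_norm[OF continuous_on_dilated_circle[OF C1_onD(4)[OF C1] s(2)]] by (simp add: pol_def)
    moreover have "(norm (circle_coeff L s n))\<^sup>2 \<le> D' n" for n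
    proof (cases "n = 0")
      case True
      have "((\<lambda>t. L (of_real (exp s) * cis t)) has_integral (of_real (2 * pi) * L 0)) {0..2*pi}"
        by (rule mean_value_circle[OF holomorphic_on_subset[OF L]]) (use s in \<open>simp_all add: cball_subset_ball_iff\<close>)
      then have "circle_coeff L s 0 = L 0"
        using circle_coeff_integral[OF C1_onD(4)[OF C1] s(2), of 0] by (simp add: pol_def integral_unique)
      then show ?thesis using True D(2)[OF s, of 0] by (simp add: D'_def)
    next
      case False
      then have "1 * (norm (circle_coeff L s n))\<^sup>2 \<le> \<bar>of_int n\<bar> * (norm (circle_coeff L s n))\<^sup>2"
        by (intro mult_right_mono[OF _ zero_le_power2]) linarith
      then show ?thesis using D(2)[OF s, of n] False by (simp add: D'_def)
    qed
    ultimately have "(LINT t|circle_measure. (norm (L (pol s t)))\<^sup>2) / (2 * pi) \<le> infsum D' UNIV"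
      using sD' by (intro has_sum_mono[OF _ has_sum_infsum]) auto
    then show ?thesis by (simp add: field_simps)
  qed
  then show thesis by (rule that)
qed

text \<open>\<open>H1\<close> asks for the function itself to be square integrable, not just its
  gradient. The uniform bound on circles is integrated near the boundary, and continuity covers the
  remaining closed disc.\<close>

lemma dirichlet_L2:
  assumes L: "L holomorphic_on ball 0 1" and E: "integrable (lebesgue_on (ball 0 1)) (\<lambda>z. (norm (deriv L z))\<^sup>2)"
  shows "integrable (lebesgue_on (ball 0 1)) (\<lambda>z. (norm (L z))\<^sup>2)"
proof -
  obtain C where C: "\<And>s. -1 \<le> s \<Longrightarrow> s < 0 \<Longrightarrow> (LINT t|circle_measure. (norm (L (pol s t)))\<^sup>2) \<le> C"
    using circle_log_bounded[OF L E] by blast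
  let ?q = "\<lambda>z. (norm (L z))\<^sup>2" and ?S = "log_strip (exp (-1))"
  have cL: "continuous_on (ball 0 1) L" by (rule holomorphic_on_imp_continuous_on[OF L])
  have A: "annulus \<rho> \<subseteq> ball 0 1" for \<rho> by (auto simp: annulus_def)
  have cq: "continuous_on (annulus 0) ?q" by (intro continuous_intros continuous_on_subset[OF cL A])
  have cS: "continuous_on ?S (\<lambda>w. (exp (Re w))\<^sup>2 *\<^sub>R ?q (exp w))"
    by (intro continuous_intros continuous_on_compose2[OF cq]) (auto simp: log_strip_def mem_annulus)
  have mS: "(\<lambda>w. indicator ?S w *\<^sub>R ((exp (Re w))\<^sup>2 *\<^sub>R ?q (exp w))) \<in> borel_measurable borel"
    using set_borel_measurable_continuous_open[OF cS] open_log_strip by (simp add: set_borel_measurable_def)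
  have "set_integrable lborel ?S (\<lambda>w. (exp (Re w))\<^sup>2 *\<^sub>R ?q (exp w))"
    unfolding set_integrable_def
  proof (rule integrableI_bounded)
    have "(\<integral>\<^sup>+y. ennreal (norm (indicator ?S (Complex s y) *\<^sub>R ((exp s)\<^sup>2 *\<^sub>R ?q (exp (Complex s y))))) \<partial>lborel)
        \<le> ennreal C * indicator {-1<..<0} s" for s
    proof (cases "s \<in> {-1<..<0}")
      case True
      then have s: "-1 \<le> s" "s < 0" by auto
      have c: "continuous_on {0..2*pi} (\<lambda>t. ?q (pol s t))" by (rule continuous_pol_t[OF cq s(2)])
      have "(\<integral>\<^sup>+y. ennreal (norm (indicator ?S (Complex s y) *\<^sub>R ((exp s)\<^sup>2 *\<^sub>R ?q (exp (Complex s y))))) \<partial>lborel)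
        \<le> (\<integral>\<^sup>+y. ennreal (indicator {0..2*pi} y *\<^sub>R ?q (pol s y)) \<partial>lborel)"
      proof (rule nn_integral_mono)
        fix y :: real
        have "(exp s)\<^sup>2 * ?q (pol s y) \<le> 1 * ?q (pol s y)"
          using s by (intro mult_right_mono power_le_one) auto
        then show "ennreal (norm (indicator ?S (Complex s y) *\<^sub>R ((exp s)\<^sup>2 *\<^sub>R ?q (exp (Complex s y)))))
          \<le> ennreal (indicator {0..2*pi} y *\<^sub>R ?q (pol s y))"
          by (intro ennreal_leI) (auto simp: indicator_def log_strip_def exp_Complex)
      qed
      also have "\<dots> = ennreal (LINT y|lborel. indicator {0..2*pi} y *\<^sub>R ?q (pol s y))"
        by (intro nn_integral_eq_integral borel_integrable_compact c) (auto simp: indicator_def)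
      also have "(LINT y|lborel. indicator {0..2*pi} y *\<^sub>R ?q (pol s y)) = (LINT t|circle_measure. ?q (pol s t))"
        using lebesgue_on_iff_lborel(2)[OF _ set_borel_measurable_continuous_open[OF c]]
        by (simp add: set_lebesgue_integral_def)
      also have "ennreal \<dots> \<le> ennreal C" by (intro ennreal_leI C s)
      finally show ?thesis using True by simp
    next
      case False
      then have "Complex s y \<notin> ?S" for y by (auto simp: log_strip_def)
      then show ?thesis by simp
    qed
    then have "(\<integral>\<^sup>+x. \<integral>\<^sup>+y. ennreal (norm (indicator ?S (Complex x y) *\<^sub>R ((exp x)\<^sup>2 *\<^sub>R ?q (exp (Complex x y))))) \<partial>lborel \<partial>lborel)
        \<le> (\<integral>\<^sup>+x. ennreal C * indicator {-1<..<0::real} x \<partial>lborel)"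
      by (intro nn_integral_mono)
    also have "\<dots> < \<infinity>" by (simp add: nn_integral_cmult_indicator ennreal_mult_less_top)
    finally show "(\<integral>\<^sup>+w. ennreal (norm (indicator ?S w *\<^sub>R ((exp (Re w))\<^sup>2 *\<^sub>R ?q (exp w)))) \<partial>lborel) < \<infinity>"
      by (subst nn_integral_lborel_complex) (use mS in \<open>auto intro!: measurable_compose[OF mS] borel_measurable_norm\<close>)
  qed (use mS in simp)
  then have 1: "integrable (lebesgue_on (annulus (exp (-1)))) ?q"
    using polar_integral(1)[OF _ cq, of "exp (-1)"] by simp
  have e1: "cball 0 (exp (-1)) \<subseteq> (ball 0 1 :: complex set)" by (simp add: cball_subset_ball_iff)
  have "integrable (lebesgue_on (cball 0 (exp (-1)))) ?q"
    using locally_integrable_continuous[OF continuous_on_power[OF continuous_on_norm[OF cL]]] e1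
    by (auto simp: locally_integrable_def)
  from Bochner_Integration.integrable_add[OF 1[unfolded integrable_lebesgue_on_iff[OF sets_borel_lebesgue[OF borel_open[OF open_annulus]]]]
    this[unfolded integrable_lebesgue_on_iff[OF lmeasurable_cball[THEN fmeasurableD]]]]
  have "integrable lebesgue (\<lambda>z. indicator (annulus (exp (-1))) z *\<^sub>R ?q z + indicator (cball 0 (exp (-1))) z *\<^sub>R ?q z)" .
  moreover have "indicator (annulus (exp (-1))) z *\<^sub>R ?q z + indicator (cball 0 (exp (-1))) z *\<^sub>R ?q z = indicator (ball 0 1) z *\<^sub>R ?q z" for z
    using e1 by (auto simp: indicator_def annulus_def)
  ultimately show ?thesis by (simp add: integrable_lebesgue_on_iff)
qed


section \<open>The Neumann problem\<close>

text \<open>Integrands built from the gradient of \<open>\<Phi>\<close> are continuous only off the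
  pole at 0, a null set.\<close>

lemma annulus_0_integral:
  fixes F :: "complex \<Rightarrow> 'b::euclidean_space"
  assumes F: "continuous_on (annulus 0) F"
  shows "integrable (lebesgue_on (ball 0 1)) F \<longleftrightarrow> integrable (lebesgue_on (annulus 0)) F"
    "(LINT z|lebesgue_on (ball 0 1). F z) = (LINT z|lebesgue_on (annulus 0). F z)"
proof -
  have s: "annulus 0 \<in> sets lebesgue" "ball (0::complex) 1 \<in> sets lebesgue" by (simp_all add: open_annulus sets_borel_lebesgue)
  have 0: "AE z in lebesgue. z \<noteq> (0::complex)"
    using AE_not_in[of "{0::complex}" lebesgue] negligible_sing[of "0::complex"] by (simp add: negligible_iff_null_sets)
  have AE: "AE z in lebesgue. indicator (annulus 0) z *\<^sub>R F z = indicator (ball 0 1) z *\<^sub>R F z"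
    using 0 by eventually_elim (auto simp: annulus_0 indicator_def)
  have m: "(\<lambda>z. indicator (annulus 0) z *\<^sub>R F z) \<in> borel_measurable lebesgue"
    using continuous_imp_measurable_on_sets_lebesgue[OF F s(1)] borel_measurable_restrict_space_iff[of "annulus 0" lebesgue F] s by simp
  have m': "(\<lambda>z. indicator (ball 0 1) z *\<^sub>R F z) \<in> borel_measurable lebesgue"
    by (rule borel_measurable_AE[OF m AE])
  show "integrable (lebesgue_on (ball 0 1)) F \<longleftrightarrow> integrable (lebesgue_on (annulus 0)) F"
    unfolding integrable_lebesgue_on_iff[OF s(1)] integrable_lebesgue_on_iff[OF s(2)]
    using integrable_cong_AE[OF m m' AE] by simp
  show "(LINT z|lebesgue_on (ball 0 1). F z) = (LINT z|lebesgue_on (annulus 0). F z)"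
    unfolding integral_lebesgue_on_eq[OF s(1)] integral_lebesgue_on_eq[OF s(2)]
    using integral_cong_AE[OF m m' AE] by simp
qed

text \<open>\<open>H1\<close> provides some square integrable weak gradient; by uniqueness it agrees
  almost everywhere with the classical one.\<close>

lemma H1_C1_energy:
  fixes h :: "complex \<Rightarrow> 'b::euclidean_space"
  assumes U: "open U" and C: "C1_on U h" and H: "H1 U h"
  shows "integrable (lebesgue_on U) (grad_sq h)"
proof -
  obtain p q where pq: "weak_gradient U h p q" "L2 (lebesgue_on U) p" "L2 (lebesgue_on U) q"
    using H by (auto simp: H1_def)
  note AE = weak_gradient_unique[OF U weak_gradient_C1[OF U C] pq(1)]
  have "integrable (lebesgue_on U) (\<lambda>z. (norm (p z))\<^sup>2 + (norm (q z))\<^sup>2)"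
    using pq(2,3) by (simp add: L2_def)
  then show ?thesis
  proof (rule Bochner_Integration.integrable_cong_AE_imp)
    show "grad_sq h \<in> borel_measurable (lebesgue_on U)"
      by (intro continuous_imp_measurable_on_sets_lebesgue continuous_intros C1_onD[OF C]) (simp add: U sets_borel_lebesgue)
    show "AE z in lebesgue_on U. (norm (p z))\<^sup>2 + (norm (q z))\<^sup>2 = grad_sq h z"
      using AE by eventually_elim simp
  qed
qed

lemma C1_bounded_on_disc:
  fixes \<phi> :: "complex \<Rightarrow> real"
  assumes \<phi>: "C1_on UNIV \<phi>"
  obtains B where "\<And>z. z \<in> ball 0 1 \<Longrightarrow> \<bar>\<phi> z\<bar> \<le> B \<and> \<bar>pd_x \<phi> z\<bar> \<le> B \<and> \<bar>pd_y \<phi> z\<bar> \<le> B"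
proof -
  have "bounded ((\<lambda>z. \<bar>\<phi> z\<bar> + \<bar>pd_x \<phi> z\<bar> + \<bar>pd_y \<phi> z\<bar>) ` cball 0 1)"
    by (intro compact_imp_bounded compact_continuous_image continuous_intros compact_cball)
      (auto intro: continuous_on_subset[OF C1_onD(2)[OF \<phi>]] continuous_on_subset[OF C1_onD(3)[OF \<phi>]] continuous_on_subset[OF C1_onD(4)[OF \<phi>]])
  then obtain B where "\<And>z. z \<in> cball 0 1 \<Longrightarrow> \<bar>\<phi> z\<bar> + \<bar>pd_x \<phi> z\<bar> + \<bar>pd_y \<phi> z\<bar> \<le> B"
    by (fastforce simp: bounded_real)
  then have "\<bar>\<phi> z\<bar> \<le> B \<and> \<bar>pd_x \<phi> z\<bar> \<le> B \<and> \<bar>pd_y \<phi> z\<bar> \<le> B" if "z \<in> ball 0 1" for z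
    using that by (smt (verit) ball_subset_cball subsetD)
  then show thesis by (rule that)
qed

text \<open>The pole does not spoil the weak formulation: the gradient of \<open>ln (norm z)\<close>
  has size \<open>1 / norm z\<close>, which is integrable in the plane, and the gradient of
  \<open>\<Psi>\<close> is square integrable on a set of finite measure.\<close>

lemma log_plus_finite_energy:
  fixes \<Psi> \<Phi> :: "complex \<Rightarrow> real"
  assumes \<Psi>: "C1_on (ball 0 1) \<Psi>" "integrable (lebesgue_on (ball 0 1)) (grad_sq \<Psi>)"
    and \<Phi>: "\<forall>z\<in>annulus 0. \<Phi> z = ln (norm z) + \<Psi> z"
  shows "z \<in> annulus 0 \<Longrightarrow> has_grad \<Phi> (Re (1 / z) + pd_x \<Psi> z) (- Im (1 / z) + pd_y \<Psi> z) z"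
    and "C1_on (annulus 0) \<Phi>"
    and "C1_on UNIV (\<phi> :: complex \<Rightarrow> real) \<Longrightarrow> integrable (lebesgue_on (annulus 0)) (\<lambda>z. pd_x \<Phi> z * pd_x \<phi> z + pd_y \<Phi> z * pd_y \<phi> z)"
proof -
  have A: "annulus 0 \<subseteq> ball 0 1" by (auto simp: annulus_def)
  have "((\<lambda>z. z) has_field_derivative z * (1 / z)) (at z)" if "z \<in> annulus 0" for z :: complex
    using that by (simp add: annulus_0)
  then have gl: "has_grad (\<lambda>z. ln (norm z)) (Re (1 / z)) (- Im (1 / z)) z" if "z \<in> annulus 0" for z :: complex
    by (rule has_grad_ln_norm[of "\<lambda>z. z"]) (use that in \<open>simp_all add: annulus_0\<close>)
  show gr: "has_grad \<Phi> (Re (1 / z) + pd_x \<Psi> z) (- Im (1 / z) + pd_y \<Psi> z) z" if z: "z \<in> annulus 0" for z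
  proof -
    have "has_grad (\<lambda>z. ln (norm z) + \<Psi> z) (Re (1 / z) + pd_x \<Psi> z) (- Im (1 / z) + pd_y \<Psi> z) z"
      using z A by (intro has_grad_add gl C1_onD(1)[OF \<Psi>(1)]) auto
    then show ?thesis using has_grad_cong[OF open_annulus z, of \<Phi> "\<lambda>z. ln (norm z) + \<Psi> z"] \<Phi> by blast
  qed
  note c\<Psi> = continuous_on_subset[OF C1_onD(2)[OF \<Psi>(1)] A] continuous_on_subset[OF C1_onD(3)[OF \<Psi>(1)] A]
  show C: "C1_on (annulus 0) \<Phi>"
    by (rule C1_onI[OF gr]) (auto intro!: continuous_intros c\<Psi>[unfolded annulus_0] simp: annulus_0)
  assume \<phi>: "C1_on UNIV \<phi>"
  obtain B where B: "\<And>z. z \<in> ball 0 1 \<Longrightarrow> \<bar>\<phi> z\<bar> \<le> B \<and> \<bar>pd_x \<phi> z\<bar> \<le> B \<and> \<bar>pd_y \<phi> z\<bar> \<le> B"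
    using C1_bounded_on_disc[OF \<phi>] by blast
  have B0: "B \<ge> 0" using B[of 0] abs_ge_zero[of "\<phi> 0"] by (simp del: abs_ge_zero)
  have "annulus 0 \<in> sets lebesgue" by (simp add: open_annulus sets_borel_lebesgue)
  note iE = integrable_lebesgue_on_subset[OF \<Psi>(2) A this]
  interpret finite_measure "lebesgue_on (annulus 0)"
    by (rule finite_measure_lebesgue_on) (auto intro!: lmeasurable_open open_annulus bounded_subset[OF bounded_ball A])
  show "integrable (lebesgue_on (annulus 0)) (\<lambda>z. pd_x \<Phi> z * pd_x \<phi> z + pd_y \<Phi> z * pd_y \<phi> z)"
  proof (rule Bochner_Integration.integrable_bound)
    show "integrable (lebesgue_on (annulus 0)) (\<lambda>z. B * (2 * (1 / norm z) + (2 + grad_sq \<Psi> z)))"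
      by (intro integrable_mult_right Bochner_Integration.integrable_add inverse_norm_integrable integrable_const iE) simp
    have "continuous_on (annulus 0) (\<lambda>z. pd_x \<Phi> z * pd_x \<phi> z + pd_y \<Phi> z * pd_y \<phi> z)"
      by (intro continuous_intros C1_onD[OF C] continuous_on_subset[OF C1_onD(2)[OF \<phi>]] continuous_on_subset[OF C1_onD(3)[OF \<phi>]]) auto
    then show "(\<lambda>z. pd_x \<Phi> z * pd_x \<phi> z + pd_y \<Phi> z * pd_y \<phi> z) \<in> borel_measurable (lebesgue_on (annulus 0))"
      by (rule continuous_imp_measurable_on_sets_lebesgue) (simp add: open_annulus sets_borel_lebesgue)
    show "AE z in lebesgue_on (annulus 0). norm (pd_x \<Phi> z * pd_x \<phi> z + pd_y \<Phi> z * pd_y \<phi> z) \<le> norm (B * (2 * (1 / norm z) + (2 + grad_sq \<Psi> z)))"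
    proof (rule AE_I2)
      fix z assume "z \<in> space (lebesgue_on (annulus 0))"
      then have z: "z \<in> annulus 0" "z \<in> ball 0 1" using A by auto
      \<comment> \<open>Square integrable implies integrable on a finite measure space, in this
        crude pointwise form.\<close>
      have sq: "\<bar>x\<bar> \<le> 1 + x\<^sup>2" for x :: real
      proof -
        have "0 \<le> (\<bar>x\<bar> - 1)\<^sup>2" by simp
        then have "2 * \<bar>x\<bar> \<le> 1 + x\<^sup>2" by (simp add: power2_diff)
        then show ?thesis using abs_ge_zero[of x] by linarith
      qed
      have n: "\<bar>Re (1 / z)\<bar> \<le> 1 / norm z" "\<bar>Im (1 / z)\<bar> \<le> 1 / norm z"
        using abs_Re_le_cmod[of "1 / z"] abs_Im_le_cmod[of "1 / z"] by (simp_all add: norm_divide)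
      have 1: "\<bar>pd_x \<Phi> z\<bar> \<le> 1 / norm z + (1 + (pd_x \<Psi> z)\<^sup>2)" "\<bar>pd_y \<Phi> z\<bar> \<le> 1 / norm z + (1 + (pd_y \<Psi> z)\<^sup>2)"
        unfolding has_grad_pd(1,2)[OF gr[OF z(1)]] using n sq[of "pd_x \<Psi> z"] sq[of "pd_y \<Psi> z"] by linarith+
      have "\<bar>pd_x \<Phi> z * pd_x \<phi> z\<bar> \<le> (1 / norm z + (1 + (pd_x \<Psi> z)\<^sup>2)) * B" "\<bar>pd_y \<Phi> z * pd_y \<phi> z\<bar> \<le> (1 / norm z + (1 + (pd_y \<Psi> z)\<^sup>2)) * B"
        unfolding abs_mult using 1 B[OF z(2)] by (auto intro!: mult_mono order_trans[OF _ 1(1)])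
      then have "norm (pd_x \<Phi> z * pd_x \<phi> z + pd_y \<Phi> z * pd_y \<phi> z) \<le> (1 / norm z + (1 + (pd_x \<Psi> z)\<^sup>2)) * B + (1 / norm z + (1 + (pd_y \<Psi> z)\<^sup>2)) * B"
        unfolding real_norm_def by (intro order_trans[OF abs_triangle_ineq] add_mono)
      also have "\<dots> = B * (2 * (1 / norm z) + (2 + grad_sq \<Psi> z))" by (simp add: algebra_simps)
      also have "\<dots> \<le> norm \<dots>" by (simp only: real_norm_def abs_ge_self)
      finally show "norm (pd_x \<Phi> z * pd_x \<phi> z + pd_y \<Phi> z * pd_y \<phi> z) \<le> norm (B * (2 * (1 / norm z) + (2 + grad_sq \<Psi> z)))" .
    qed
  qed
qed


text \<open>The difference \<open>D\<close> cannot be tested against itself: it is C1 on the open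
  disc, whereas test functions are C1 on the plane. Its dilations extend past the circle and become
  admissible after a cutoff; as their gradients tend to that of \<open>D\<close> in L2, the energy
  of \<open>D\<close> vanishes.\<close>

lemma neumann_unique:
  assumes 1: "neumann_solution G \<Phi>" and 2: "neumann_solution G \<Phi>'" and z: "z \<in> annulus 0"
  shows "pd_x \<Phi> z = pd_x \<Phi>' z" "pd_y \<Phi> z = pd_y \<Phi>' z"
proof -
  have A: "annulus 0 \<subseteq> ball 0 1" by (auto simp: annulus_def)
  obtain \<Psi> where \<Psi>: "C1_on (ball 0 1) \<Psi>" "H1 (ball 0 1) \<Psi>" "\<forall>z\<in>annulus 0. \<Phi> z = ln (norm z) + \<Psi> z"
    using 1 by (auto simp: neumann_solution_def annulus_0)
  obtain \<Psi>' where \<Psi>': "C1_on (ball 0 1) \<Psi>'" "H1 (ball 0 1) \<Psi>'" "\<forall>z\<in>annulus 0. \<Phi>' z = ln (norm z) + \<Psi>' z"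
    using 2 by (auto simp: neumann_solution_def annulus_0)
  note E = H1_C1_energy[OF open_ball \<Psi>(1,2)] and E' = H1_C1_energy[OF open_ball \<Psi>'(1,2)]
  note l = log_plus_finite_energy[OF \<Psi>(1) E \<Psi>(3)] and l' = log_plus_finite_energy[OF \<Psi>'(1) E' \<Psi>'(3)]
  define D where "D z = \<Psi> z - \<Psi>' z" for z
  have CD: "C1_on (ball 0 1) D" unfolding D_def[abs_def] by (intro C1_on_diff \<Psi> \<Psi>')
  have gD: "pd_x D z = pd_x \<Psi> z - pd_x \<Psi>' z" "pd_y D z = pd_y \<Psi> z - pd_y \<Psi>' z" if "z \<in> ball 0 1" for z
  proof -
    have "has_grad D (pd_x \<Psi> z - pd_x \<Psi>' z) (pd_y \<Psi> z - pd_y \<Psi>' z) z"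
      unfolding D_def[abs_def] by (intro has_grad_diff C1_onD(1)[OF \<Psi>(1) that] C1_onD(1)[OF \<Psi>'(1) that])
    from has_grad_pd[OF this] show "pd_x D z = pd_x \<Psi> z - pd_x \<Psi>' z" "pd_y D z = pd_y \<Psi> z - pd_y \<Psi>' z" by simp_all
  qed
  have eqD: "pd_x D z = pd_x \<Phi> z - pd_x \<Phi>' z" "pd_y D z = pd_y \<Phi> z - pd_y \<Phi>' z" if "z \<in> annulus 0" for z
    using that A unfolding has_grad_pd(1,2)[OF l(1)[OF that]] has_grad_pd(1,2)[OF l'(1)[OF that]] by (subst gD; force)+
  let ?M = "lebesgue_on (annulus 0)"
  have sA: "annulus 0 \<in> sets lebesgue" by (simp add: open_annulus sets_borel_lebesgue)
  have cD: "continuous_on (annulus 0) (pd_x D)" "continuous_on (annulus 0) (pd_y D)"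
    using C1_onD(2,3)[OF CD] A by (auto intro: continuous_on_subset)
  have iD: "integrable ?M (grad_sq D)"
  proof (rule Bochner_Integration.integrable_bound)
    show "integrable ?M (\<lambda>z. 2 * grad_sq \<Psi> z + 2 * grad_sq \<Psi>' z)"
      by (intro integrable_mult_right Bochner_Integration.integrable_add integrable_lebesgue_on_subset[OF E A sA] integrable_lebesgue_on_subset[OF E' A sA]) simp_all
    show "grad_sq D \<in> borel_measurable ?M"
      by (intro continuous_imp_measurable_on_sets_lebesgue continuous_intros cD sA)
    have sq: "(x - y)\<^sup>2 \<le> 2 * x\<^sup>2 + 2 * y\<^sup>2" for x y :: real
      using zero_le_power2[of "x + y"] by (simp add: power2_eq_square algebra_simps)
    have "grad_sq D z \<le> 2 * grad_sq \<Psi> z + 2 * grad_sq \<Psi>' z" if "z \<in> annulus 0" for z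
      using sq[of "pd_x \<Psi> z" "pd_x \<Psi>' z"] sq[of "pd_y \<Psi> z" "pd_y \<Psi>' z"] gD[of z] that A by force
    then show "AE z in ?M. norm (grad_sq D z) \<le> norm (2 * grad_sq \<Psi> z + 2 * grad_sq \<Psi>' z)"
      by (intro AE_I2) simp
  qed
  have zero: "(LINT z|?M. pd_x D z * pd_x \<phi> z + pd_y D z * pd_y \<phi> z) = 0" if \<phi>: "C1_on UNIV \<phi>" for \<phi> :: "complex \<Rightarrow> real"
  proof -
    let ?F = "\<lambda>\<Phi> z. pd_x \<Phi> z * pd_x \<phi> z + pd_y \<Phi> z * pd_y \<phi> z"
    have c: "continuous_on (annulus 0) (?F \<Phi>)" "continuous_on (annulus 0) (?F \<Phi>')"
      using C1_onD(2,3)[OF l(2)] C1_onD(2,3)[OF l'(2)] C1_onD(2,3)[OF \<phi>]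
      by (auto intro!: continuous_intros intro: continuous_on_subset)
    have "(LINT z|lebesgue_on (ball 0 1). ?F \<Phi> z) = (LINT z|lebesgue_on (ball 0 1). ?F \<Phi>' z)"
      using 1 2 \<phi> by (simp add: neumann_solution_def)
    then have "(LINT z|?M. ?F \<Phi> z) = (LINT z|?M. ?F \<Phi>' z)"
      unfolding annulus_0_integral(2)[OF c(1)] annulus_0_integral(2)[OF c(2)] .
    then have "(LINT z|?M. ?F \<Phi> z - ?F \<Phi>' z) = 0"
      by (simp add: Bochner_Integration.integral_diff[OF l(3)[OF \<phi>] l'(3)[OF \<phi>]])
    moreover have "(LINT z|?M. ?F \<Phi> z - ?F \<Phi>' z) = (LINT z|?M. ?F D z)"
      by (rule Bochner_Integration.integral_cong) (simp_all add: eqD algebra_simps)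
    ultimately show ?thesis by simp
  qed
  let ?r = "\<lambda>k. exp (rsq k)"
  have orth: "(LINT z|?M. pd_x D z * pd_x D (of_real (?r k) * z) + pd_y D z * pd_y D (of_real (?r k) * z)) = 0" for k
  proof -
    let ?U = "ball (0::complex) (1 / ?r k)" and ?E = "\<lambda>z. D (of_real (?r k) * z)"
    have r: "0 < ?r k" "?r k < 1" using rsq(2)[of k] by auto
    have "1 < 1 / ?r k" using r by (subst less_divide_eq_1_pos) auto
    then have K: "cball 0 1 \<subseteq> ?U" by (simp add: cball_subset_ball_iff)
    have CE: "C1_on ?U ?E"
      by (rule C1_on_compose_holomorphic[OF CD open_ball]) (use r in \<open>auto intro!: holomorphic_intros simp: norm_mult field_simps\<close>)
    obtain b V where b: "test_function ?U b" "open V" "cball 0 1 \<subseteq> V" "\<And>w. w \<in> V \<Longrightarrow> b w = 1"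
      using C1_cutoff[OF compact_cball open_ball K] by metis
    let ?\<phi> = "\<lambda>z. b z *\<^sub>R ?E z"
    have g\<phi>: "pd_x ?\<phi> z = ?r k * pd_x D (of_real (?r k) * z) \<and> pd_y ?\<phi> z = ?r k * pd_y D (of_real (?r k) * z)" if z: "z \<in> annulus 0" for z
    proof -
      have zV: "z \<in> V" using z b(3) by (auto simp: mem_annulus)
      have "of_real (?r k) * z \<in> annulus 0" using dilation_annulus(2)[OF z] by simp
      then have "of_real (?r k) * z \<in> ball 0 1" using A by blast
      then have "has_grad ?E (?r k *\<^sub>R pd_x D (of_real (?r k) * z)) (?r k *\<^sub>R pd_y D (of_real (?r k) * z)) z"
        using has_grad_compose_holomorphic[OF C1_onD(1)[OF CD], of "\<lambda>z. of_real (?r k) * z" z "of_real (?r k)"]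
        by (auto intro!: derivative_eq_intros)
      then have "has_grad ?\<phi> (?r k *\<^sub>R pd_x D (of_real (?r k) * z)) (?r k *\<^sub>R pd_y D (of_real (?r k) * z)) z"
        using has_grad_cong[OF b(2) zV, of ?\<phi> ?E] b(4) by (smt (verit) scaleR_one)
      from has_grad_pd[OF this] show ?thesis by simp
    qed
    have "(LINT z|?M. ?r k * (pd_x D z * pd_x D (of_real (?r k) * z) + pd_y D z * pd_y D (of_real (?r k) * z)))
        = (LINT z|?M. pd_x D z * pd_x ?\<phi> z + pd_y D z * pd_y ?\<phi> z)"
      by (rule Bochner_Integration.integral_cong) (use g\<phi> in \<open>simp_all add: algebra_simps\<close>)
    also have "\<dots> = 0" by (rule zero[OF test_function_times_C1(1)[OF b(1) open_ball CE]])
    finally show ?thesis using r by simp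
  qed
  \<comment> \<open>Packing the gradient into one complex number makes the energy a squared norm, to
    which the dilation lemmas apply.\<close>
  define h where "h z = Complex (pd_x D z) (pd_y D z)" for z
  have hn: "(norm (h z))\<^sup>2 = grad_sq D z" for z by (simp add: h_def cmod_power2)
  have ch: "continuous_on (annulus 0) h" unfolding h_def[abs_def] Complex_eq by (intro continuous_intros cD)
  have ih: "integrable (lebesgue_on (annulus (exp (-1) * 0))) (\<lambda>z. (norm (h z))\<^sup>2)" using iD by (simp add: hn)
  have ih': "integrable ?M (\<lambda>z. (norm (h z))\<^sup>2)" using iD by (simp add: hn)
  note n = dilation_norm_integral(1)[OF ch order_refl ih] and d = dilation_L2[OF ch order_refl ih]
  have "(LINT z|?M. (norm (h z))\<^sup>2) \<le> (LINT z|?M. (norm (h (of_real (?r k) * z) - h z))\<^sup>2)" for k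
  proof -
    \<comment> \<open>Polarization: since the mixed integral vanishes, the energy of
      \<open>D\<close> is at most the squared L2 distance from its gradient to the dilated
      one.\<close>
    have "2 * (pd_x D z * pd_x D w + pd_y D z * pd_y D w) = (norm (h z))\<^sup>2 + (norm (h w))\<^sup>2 - (norm (h w - h z))\<^sup>2" for z w
      unfolding h_def cmod_power2 by (simp add: power2_eq_square algebra_simps)
    then have "2 * (LINT z|?M. pd_x D z * pd_x D (of_real (?r k) * z) + pd_y D z * pd_y D (of_real (?r k) * z))
      = (LINT z|?M. (norm (h z))\<^sup>2 + (norm (h (of_real (?r k) * z)))\<^sup>2 - (norm (h (of_real (?r k) * z) - h z))\<^sup>2)"
      by (simp only: Bochner_Integration.integral_mult_right_zero[symmetric])
    also have "\<dots> = (LINT z|?M. (norm (h z))\<^sup>2) + (LINT z|?M. (norm (h (of_real (?r k) * z)))\<^sup>2) - (LINT z|?M. (norm (h (of_real (?r k) * z) - h z))\<^sup>2)"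
      using ih' n[of k] d(1)[of k] by simp
    moreover have "0 \<le> (LINT z|?M. (norm (h (of_real (?r k) * z)))\<^sup>2)" by (intro integral_nonneg_AE) simp
    ultimately show ?thesis using orth[of k] by linarith
  qed
  then have "(LINT z|?M. (norm (h z))\<^sup>2) \<le> 0" by (intro LIMSEQ_le_const[OF d(2)]) auto
  moreover have "0 \<le> (LINT z|?M. (norm (h z))\<^sup>2)" by (intro integral_nonneg_AE) simp
  ultimately have "(LINT z|?M. (norm (h z))\<^sup>2) = 0" by linarith
  then have "AE z in ?M. (norm (h z))\<^sup>2 = 0"
    using integral_nonneg_eq_0_iff_AE[OF ih'] by simp
  then have AE: "AE z in lebesgue. z \<in> annulus 0 \<longrightarrow> h z = 0"
    using sA by (subst (asm) AE_restrict_space_iff) (auto elim!: eventually_mono)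
  \<comment> \<open>An open null set is empty, so the continuous function \<open>h\<close> vanishes
    everywhere and not merely almost everywhere.\<close>
  have oN: "open {z \<in> annulus 0. h z \<noteq> 0}"
    using continuous_open_preimage[OF ch open_annulus, of "- {0}"] by (auto simp: vimage_def Int_def open_Compl)
  have "AE z in lebesgue. z \<notin> {z \<in> annulus 0. h z \<noteq> 0}" using AE by simp
  then have "negligible {z \<in> annulus 0. h z \<noteq> 0}"
    using AE_iff_null_sets[OF sets_borel_lebesgue[OF borel_open[OF oN]]] by (simp add: negligible_iff_null_sets)
  with oN have "{z \<in> annulus 0. h z \<noteq> 0} = {}" using open_not_negligible by blast
  then have "h z = 0" using z by auto
  then show "pd_x \<Phi> z = pd_x \<Phi>' z" "pd_y \<Phi> z = pd_y \<Phi>' z"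
    using eqD[OF z] by (auto simp: h_def complex_eq_iff)
qed


section \<open>The model map on the disc\<close>

locale dirichlet_log =
  fixes L :: "complex \<Rightarrow> complex"
  assumes holomorphic: "L holomorphic_on ball 0 1"
    and energy: "integrable (lebesgue_on (ball 0 1)) (\<lambda>z. (norm (deriv L z))\<^sup>2)"
begin

text \<open>\<open>P\<close> stands for z f'(z) and \<open>X\<close> for its logarithmic derivative.
  \<open>potential\<close> and \<open>direction\<close> carry its modulus and its argument, hence
  are conjugate to each other.\<close>

definition P :: "complex \<Rightarrow> complex" where "P z = z * exp (L z)"
definition X :: "complex \<Rightarrow> complex" where "X z = 1 / z + deriv L z"
definition potential :: "complex \<Rightarrow> real" where "potential z = ln (norm (P z))"
definition direction :: "complex \<Rightarrow> complex \<Rightarrow> complex" where "direction c z = c * sgn (P z)"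

lemma L_deriv: "z \<in> ball 0 1 \<Longrightarrow> (L has_field_derivative deriv L z) (at z)"
  by (rule holomorphic_derivI[OF holomorphic open_ball])

lemma P_deriv:
  assumes "z \<in> annulus 0"
  shows "(P has_field_derivative P z * X z) (at z)" "P z \<noteq> 0"
proof -
  have z: "z \<noteq> 0" "z \<in> ball 0 1" using assms by (auto simp: annulus_0)
  have "(P has_field_derivative exp (L z) + z * (exp (L z) * deriv L z)) (at z)"
    unfolding P_def[abs_def] by (auto intro!: derivative_eq_intros L_deriv z)
  moreover have "exp (L z) + z * (exp (L z) * deriv L z) = P z * X z"
    using z by (simp add: P_def X_def algebra_simps)
  ultimately show "(P has_field_derivative P z * X z) (at z)" by simp
  show "P z \<noteq> 0" using z by (simp add: P_def)
qed

lemma continuous_X: "continuous_on (annulus 0) X"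
  using dirichlet_annulus(1)[OF holomorphic energy zero_less_one] by (simp add: X_def[abs_def])

lemma has_grad_potential: "z \<in> annulus 0 \<Longrightarrow> has_grad potential (Re (X z)) (- Im (X z)) z"
  unfolding potential_def[abs_def] by (rule has_grad_ln_norm[OF P_deriv])

lemma has_grad_direction:
  "z \<in> annulus 0 \<Longrightarrow> has_grad (direction c) (\<i> * of_real (Im (X z)) * direction c z) (\<i> * of_real (Re (X z)) * direction c z) z"
  unfolding direction_def[abs_def] by (rule has_grad_sgn[OF P_deriv])

lemma norm_direction: "z \<in> annulus 0 \<Longrightarrow> norm c = 1 \<Longrightarrow> norm (direction c z) = 1"
  using P_deriv(2) by (simp add: direction_def norm_mult norm_sgn)

lemma continuous_direction: "continuous_on (annulus 0) (direction c)"
proof (rule continuous_at_imp_continuous_on, rule ballI)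
  fix z assume "z \<in> annulus 0"
  from has_derivative_continuous[OF has_grad_direction[OF this, of c, unfolded has_grad_def]]
  show "isCont (direction c) z" .
qed

lemma C1_direction: "C1_on (annulus 0) (direction c)"
  by (rule C1_onI[OF has_grad_direction]) (auto intro!: continuous_intros continuous_X continuous_direction)

lemma grad_sq_direction:
  assumes "z \<in> annulus 0" "norm c = 1"
  shows "grad_sq (direction c) z = (norm (X z))\<^sup>2"
  using norm_direction[OF assms] has_grad_pd(1,2)[OF has_grad_direction[OF assms(1), of c]]
  by (simp add: norm_mult cmod_power2)

lemma energy_direction:
  assumes "norm c = 1" "\<rho> > 0"
  shows "integrable (lebesgue_on (annulus \<rho>)) (grad_sq (direction c))"
proof (rule iffD1[OF Bochner_Integration.integrable_cong[OF refl] dirichlet_annulus(2)[OF holomorphic energy assms(2)]])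
  fix z assume "z \<in> space (lebesgue_on (annulus \<rho>))"
  then have "z \<in> annulus 0" using annulus_mono[of 0 \<rho>] assms(2) by auto
  from grad_sq_direction[OF this assms(1)] show "(norm (1 / z + deriv L z))\<^sup>2 = grad_sq (direction c) z" by (simp add: X_def)
qed

lemma polar_potential:
  assumes "z \<in> annulus 0"
  shows "rad potential z = Re (z * X z)" "ang potential z = - Im (z * X z)"
  using has_grad_pd(1,2)[OF has_grad_potential[OF assms]] by (simp_all add: rad_def ang_def)

text \<open>The conjugacy read on circles: by \<open>polar_potential\<close> the right-hand side is
  \<open>y * rad potential z\<close>, so this is the Neumann condition before passage to the
  boundary.\<close>

lemma direction_current:
  assumes "z \<in> annulus 0" "norm c = 1"
  shows "ang (direction c) z \<bullet> (y *\<^sub>R (\<i> * direction c z)) = y * Re (z * X z)"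
proof -
  let ?u = "direction c z"
  have "ang (direction c) z = Re (z * X z) *\<^sub>R (\<i> * ?u)"
    using has_grad_pd(1,2)[OF has_grad_direction[OF assms(1), of c]] unfolding ang_def
    by (simp add: scaleR_conv_of_real algebra_simps)
  moreover have "(\<i> * ?u) \<bullet> (\<i> * ?u) = 1"
    using norm_direction[OF assms] by (simp add: power2_norm_eq_inner[symmetric] norm_mult)
  ultimately show ?thesis by simp
qed

text \<open>The radial approach is the axis of the cone, so aperture 1 is enough; \<open>sgn\<close>
  is continuous at the limit because \<open>exp l\<close> is not 0.\<close>

lemma direction_limit:
  assumes "ntlim (logM L) t l"
  shows "(\<lambda>k. direction c (pol (rsq k) t)) \<longlonglongrightarrow> c * sgn (exp l)"
proof -
  have "(\<lambda>k. logM L (Complex (rsq k) t)) \<longlonglongrightarrow> l"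
  proof (rule LIMSEQ_I)
    fix e :: real assume "e > 0"
    then obtain d where d: "d > 0" "\<And>w. w \<in> stolz (real 1) t \<Longrightarrow> - d < Re w \<Longrightarrow> norm (logM L w - l) < e"
      using assms unfolding ntlim_def by metis
    have "eventually (\<lambda>k. - d < rsq k) sequentially" using d(1) by (intro order_tendstoD(1)[OF rsq_lim]) simp
    then obtain N where N: "\<And>k. k \<ge> N \<Longrightarrow> - d < rsq k" by (auto simp: eventually_sequentially)
    show "\<exists>N. \<forall>k\<ge>N. norm (logM L (Complex (rsq k) t) - l) < e"
      using d(2) N rsq(2) by (intro exI[of _ N]) (auto simp: stolz_def)
  qed
  then have "(\<lambda>k. c * sgn (exp (logM L (Complex (rsq k) t)))) \<longlonglongrightarrow> c * sgn (exp l)"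
    by (intro tendsto_intros) auto
  moreover have "exp (logM L (Complex (rsq k) t)) = P (pol (rsq k) t)" for k
    by (simp add: logM_def P_def exp_add exp_Complex)
  ultimately show ?thesis by (simp add: direction_def)
qed

lemma potential_decomposition:
  shows "C1_on (ball 0 1) (\<lambda>z. Re (L z))" "integrable (lebesgue_on (ball 0 1)) (grad_sq (\<lambda>z. Re (L z)))" "H1 (ball 0 1) (\<lambda>z. Re (L z))"
    "\<forall>z\<in>annulus 0. potential z = ln (norm z) + Re (L z)"
proof -
  have gr: "has_grad (\<lambda>z. Re (L z)) (Re (deriv L z)) (Re (\<i> * deriv L z)) z" if "z \<in> ball 0 1" for z
    by (rule has_grad_linear[OF bounded_linear_Re has_grad_holomorphic[OF L_deriv[OF that]]])
  have cd: "continuous_on (ball 0 1) (deriv L)"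
    by (intro holomorphic_on_imp_continuous_on holomorphic_deriv holomorphic open_ball)
  show C1: "C1_on (ball 0 1) (\<lambda>z. Re (L z))"
    by (rule C1_onI[OF gr]) (auto intro!: continuous_intros cd)
  show E: "integrable (lebesgue_on (ball 0 1)) (grad_sq (\<lambda>z. Re (L z)))"
  proof (rule iffD1[OF Bochner_Integration.integrable_cong[OF refl] energy])
    fix z assume "z \<in> space (lebesgue_on (ball (0::complex) 1))"
    then have "z \<in> ball 0 1" by simp
    from has_grad_pd(1,2)[OF gr[OF this]] show "(norm (deriv L z))\<^sup>2 = grad_sq (\<lambda>z. Re (L z)) z"
      by (simp add: cmod_power2)
  qed
  have m: "(\<lambda>z. Re (L z)) \<in> borel_measurable (lebesgue_on (ball 0 1))"
    by (intro continuous_imp_measurable_on_sets_lebesgue C1_onD(4)[OF C1]) simp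
  have "integrable (lebesgue_on (ball 0 1)) (\<lambda>z. (norm (Re (L z)))\<^sup>2)"
  proof (rule Bochner_Integration.integrable_bound[OF dirichlet_L2[OF holomorphic energy]])
    show "(\<lambda>z. (norm (Re (L z)))\<^sup>2) \<in> borel_measurable (lebesgue_on (ball 0 1))" using m by measurable
    show "AE z in lebesgue_on (ball 0 1). norm ((norm (Re (L z)))\<^sup>2) \<le> norm ((norm (L z))\<^sup>2)"
      by (rule AE_I2) (simp add: cmod_power2)
  qed
  then show "H1 (ball 0 1) (\<lambda>z. Re (L z))"
    unfolding H1_def using m weak_gradient_C1[OF open_ball C1] L2_grad[OF open_ball C1 E] by (auto simp: L2_def)
  show "\<forall>z\<in>annulus 0. potential z = ln (norm z) + Re (L z)"
    by (auto simp: potential_def P_def annulus_0 norm_mult ln_mult)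
qed

text \<open>With \<open>J(s) = \<integral> \<phi> \<partial>\<^sub>r\<Phi>\<close> on the circle of radius \<open>e\<^sup>s\<close>, harmonicity of \<open>\<Phi>\<close> turns \<open>J'\<close> into
  the energy density, and \<open>J \<rightarrow> 2 \<pi> \<phi>(0)\<close> as \<open>s \<rightarrow> -\<infinity>\<close>.\<close>
lemma green:
  fixes \<phi> :: "complex \<Rightarrow> real"
  assumes \<phi>: "C1_on UNIV \<phi>"
    and lim: "(\<lambda>k. LINT t|circle_measure. \<phi> (pol (rsq k) t) * Re (pol (rsq k) t * X (pol (rsq k) t))) \<longlonglongrightarrow> c"
  shows "(LINT z|lebesgue_on (ball 0 1). pd_x potential z * pd_x \<phi> z + pd_y potential z * pd_y \<phi> z) = c - 2 * pi * \<phi> 0"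
proof -
  note pot = log_plus_finite_energy[OF potential_decomposition(1,2,4)]
  let ?F = "\<lambda>z. pd_x potential z * pd_x \<phi> z + pd_y potential z * pd_y \<phi> z"
  have \<phi>': "C1_on (annulus 0) \<phi>" by (rule C1_on_subset[OF \<phi>]) simp
  have cF: "continuous_on (annulus 0) ?F"
    by (intro continuous_intros C1_onD[OF pot(2)] C1_onD[OF \<phi>'])
  \<comment> \<open>\<open>z * X z\<close> with its singularity at 0 removed. Its real part is
    \<open>rad potential\<close>, minus its imaginary part is \<open>ang potential\<close>, and its
    value 1 at the origin accounts for the Dirac mass.\<close>
  define h where "h z = 1 + z * deriv L z" for z
  have hh: "h holomorphic_on ball 0 1" unfolding h_def[abs_def] by (intro holomorphic_intros holomorphic) simp_all
  have h: "z * X z = h z" if "z \<in> annulus 0" for z using that by (simp add: X_def h_def annulus_0 algebra_simps)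
  have A: "annulus 0 \<subseteq> ball 0 1" by (auto simp: annulus_def)
  have gh: "has_grad h (deriv h z) (\<i> * deriv h z) z" if "z \<in> annulus 0" for z
    by (rule has_grad_holomorphic[OF holomorphic_derivI[OF hh open_ball]]) (use that A in blast)
  define \<xi> \<eta> where "\<xi> z = Re (h z)" and "\<eta> z = Im (h z)" for z
  have g\<xi>: "has_grad \<xi> (Re (deriv h z)) (Re (\<i> * deriv h z)) z" and g\<eta>: "has_grad \<eta> (Im (deriv h z)) (Im (\<i> * deriv h z)) z"
    if "z \<in> annulus 0" for z
    unfolding \<xi>_def[abs_def] \<eta>_def[abs_def]
    by (rule has_grad_linear[OF bounded_linear_Re gh[OF that]], rule has_grad_linear[OF bounded_linear_Im gh[OF that]])
  have cdh: "continuous_on (annulus 0) (deriv h)"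
    by (intro holomorphic_on_imp_continuous_on holomorphic_deriv holomorphic_on_subset[OF hh A] open_annulus)
  have C\<xi>: "C1_on (annulus 0) \<xi>" by (rule C1_onI[OF g\<xi>]) (auto intro!: continuous_intros cdh)
  have C\<eta>: "C1_on (annulus 0) \<eta>" by (rule C1_onI[OF g\<eta>]) (auto intro!: continuous_intros cdh)
  have CR: "rad \<xi> z = ang \<eta> z" if "z \<in> annulus 0" for z
    using has_grad_pd(1,2)[OF g\<xi>[OF that]] has_grad_pd(1,2)[OF g\<eta>[OF that]] by (simp add: rad_def ang_def algebra_simps)
  have prod: "rad (\<lambda>z. \<phi> z * k z) z = rad \<phi> z * k z + \<phi> z * rad k z" "ang (\<lambda>z. \<phi> z * k z) z = ang \<phi> z * k z + \<phi> z * ang k z"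
    if "C1_on (annulus 0) k" "z \<in> annulus 0" for z and k :: "complex \<Rightarrow> real"
    using has_grad_pd(1,2)[OF has_grad_mult[OF C1_onD(1)[OF \<phi>' that(2)] C1_onD(1)[OF that]]]
    by (simp_all add: rad_def ang_def algebra_simps)
  define J K where "J s = (LINT t|circle_measure. \<phi> (pol s t) * \<xi> (pol s t))"
    and "K s = (LINT t|circle_measure. rad \<phi> (pol s t) * \<xi> (pol s t) - ang \<phi> (pol s t) * \<eta> (pol s t))" for s
  have cont: "continuous_on (annulus 0) (rad \<phi>)" "continuous_on (annulus 0) (ang \<phi>)"
    "continuous_on (annulus 0) (rad \<xi>)" "continuous_on (annulus 0) (ang \<eta>)"
    "continuous_on (annulus 0) \<phi>" "continuous_on (annulus 0) \<xi>" "continuous_on (annulus 0) \<eta>"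
    by (intro continuous_rad_ang[OF \<phi>'] continuous_rad_ang[OF C\<xi>] continuous_rad_ang[OF C\<eta>] C1_onD(4) \<phi>' C\<xi> C\<eta>)+
  \<comment> \<open>The derivative of \<open>J\<close> contains \<open>\<phi> * rad \<xi>\<close>,
    which is \<open>\<phi> * ang \<eta>\<close> by Cauchy-Riemann. Integration by parts in the angle
    moves \<open>ang\<close> onto \<open>\<phi>\<close>, because a full angular derivative has mean
    0.\<close>
  have J': "(J has_vector_derivative K s) (at s)" if s: "s < 0" for s
  proof -
    note mem = pol_annulus[OF s]
    have "(J has_vector_derivative (LINT t|circle_measure. rad (\<lambda>z. \<phi> z * \<xi> z) (pol s t))) (at s)"
      unfolding J_def[abs_def] by (rule circle_mean(1)[OF C1_on_mult[OF \<phi>' C\<xi>] s])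
    also have "(LINT t|circle_measure. rad (\<lambda>z. \<phi> z * \<xi> z) (pol s t))
        = (LINT t|circle_measure. (rad \<phi> (pol s t) * \<xi> (pol s t) - ang \<phi> (pol s t) * \<eta> (pol s t)) + ang (\<lambda>z. \<phi> z * \<eta> z) (pol s t))"
      using prod[OF C\<xi> mem] prod[OF C\<eta> mem] CR[OF mem] by simp
    also have "\<dots> = K s + (LINT t|circle_measure. ang (\<lambda>z. \<phi> z * \<eta> z) (pol s t))"
      unfolding K_def
      by (intro Bochner_Integration.integral_add circle_integrable continuous_intros continuous_pol_t[OF _ s] cont
          continuous_rad_ang(2)[OF C1_on_mult[OF \<phi>' C\<eta>]])
    finally show ?thesis using circle_mean(2)[OF C1_on_mult[OF \<phi>' C\<eta>] s] by simp
  qed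
  have cK: "continuous_on {a..b} K" if "b < 0" for a b
  proof -
    have "continuous_on (annulus 0) (\<lambda>z. rad \<phi> z * \<xi> z - ang \<phi> z * \<eta> z)" by (intro continuous_intros cont)
    then have c: "continuous_on (annulus 0) (\<lambda>z. complex_of_real (rad \<phi> z * \<xi> z - ang \<phi> z * \<eta> z))"
      by (rule continuous_on_of_real)
    have "continuous_on {a..b} (\<lambda>s. 2 * pi * Re (circle_coeff (\<lambda>z. complex_of_real (rad \<phi> z * \<xi> z - ang \<phi> z * \<eta> z)) s 0))"
      by (intro continuous_intros continuous_on_subset[OF continuous_circle_coeff[OF c]]) (use that in auto)
    moreover have "2 * pi * Re (circle_coeff (\<lambda>z. complex_of_real (rad \<phi> z * \<xi> z - ang \<phi> z * \<eta> z)) s 0) = K s" for s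
    proof -
      have "circle_coeff (\<lambda>z. complex_of_real (rad \<phi> z * \<xi> z - ang \<phi> z * \<eta> z)) s 0 = of_real (K s / (2 * pi))"
        unfolding K_def using circle_coeff_eq[of "\<lambda>z. complex_of_real (rad \<phi> z * \<xi> z - ang \<phi> z * \<eta> z)" s 0]
        by (simp del: of_real_diff of_real_mult)
      then show ?thesis by simp
    qed
    ultimately show ?thesis by simp
  qed
  have Keq: "(exp s)\<^sup>2 *\<^sub>R (LINT t|circle_measure. ?F (pol s t)) = K s" if s: "s < 0" for s
  proof -
    have "(exp s)\<^sup>2 * ?F (pol s t) = rad \<phi> (pol s t) * \<xi> (pol s t) - ang \<phi> (pol s t) * \<eta> (pol s t)" for t
      using rad_ang_inner[of potential "pol s t" \<phi>] polar_potential[OF pol_annulus[OF s]] h[OF pol_annulus[OF s]]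
      by (simp add: \<xi>_def \<eta>_def algebra_simps)
    then show ?thesis unfolding K_def by (simp only: real_scaleR_def Bochner_Integration.integral_mult_right_zero[symmetric])
  qed
  have X: "{s::real. 0 < exp s \<and> s < 0} = {..<0}" by auto
  note I = pot(3)[OF \<phi>]
  have iK: "integrable lborel (\<lambda>s. indicator {..<0} s *\<^sub>R K s)"
  proof -
    have "integrable lborel (\<lambda>s. indicator {..<0} s *\<^sub>R ((exp s)\<^sup>2 *\<^sub>R (LINT t|circle_measure. ?F (pol s t))))"
      using polar_integral(2)[OF order_refl cF I] unfolding X set_integrable_def .
    moreover have "indicator {..<0} s *\<^sub>R ((exp s)\<^sup>2 *\<^sub>R (LINT t|circle_measure. ?F (pol s t))) = indicator {..<0} s *\<^sub>R K s" for s
      using Keq[of s] by (cases "s < 0") auto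
    ultimately show ?thesis by (simp only:)
  qed
  have val: "(LINT z|lebesgue_on (annulus 0). ?F z) = (LINT s|lborel. indicator {..<0} s *\<^sub>R K s)"
    unfolding polar_integral(3)[OF order_refl cF I] X set_lebesgue_integral_def
    by (rule Bochner_Integration.integral_cong) (use Keq in \<open>auto simp: indicator_def\<close>)
  \<comment> \<open>These intervals exhaust the negative half-line: left ends go to the puncture,
    right ends to the unit circle.\<close>
  have FTC: "(LINT s|lborel. indicator {- real (k + 2)..rsq k} s *\<^sub>R K s) = J (rsq k) - J (- real (k + 2))" for k
  proof (rule integral_FTC_atLeastAtMost)
    show "- real (k + 2) \<le> rsq k" using rsq(1)[of k] by linarith
    show "(J has_vector_derivative K x) (at x within {- real (k + 2)..rsq k})" if "- real (k + 2) \<le> x" "x \<le> rsq k" for x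
      by (rule has_vector_derivative_at_within[OF J']) (use that rsq(2)[of k] in linarith)
  qed (rule cK[OF rsq(2)])
  have D: "(\<lambda>k. LINT s|lborel. indicator {- real (k + 2)..rsq k} s *\<^sub>R K s) \<longlonglongrightarrow> (LINT s|lborel. indicator {..<0} s *\<^sub>R K s)"
  proof (rule integral_dominated_convergence)
    show "integrable lborel (\<lambda>s. norm (indicator {..<0} s *\<^sub>R K s))" using iK by (rule integrable_norm)
    show "(\<lambda>s. indicator {..<0} s *\<^sub>R K s) \<in> borel_measurable lborel" using iK by (rule borel_measurable_integrable)
    show "(\<lambda>s. indicator {- real (k + 2)..rsq k} s *\<^sub>R K s) \<in> borel_measurable lborel" for k
      by (rule borel_measurable_integrable[OF borel_integrable_compact[OF compact_Icc cK[OF rsq(2)]]])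
    show "AE s in lborel. norm (indicator {- real (k + 2)..rsq k} s *\<^sub>R K s) \<le> norm (indicator {..<0} s *\<^sub>R K s)" for k
      using rsq(2)[of k] by (intro AE_I2) (auto simp: indicator_def)
    show "AE s in lborel. (\<lambda>k. indicator {- real (k + 2)..rsq k} s *\<^sub>R K s) \<longlonglongrightarrow> indicator {..<0} s *\<^sub>R K s"
    proof (rule AE_I2)
      fix s :: real
      show "(\<lambda>k. indicator {- real (k + 2)..rsq k} s *\<^sub>R K s) \<longlonglongrightarrow> indicator {..<0} s *\<^sub>R K s"
      proof (cases "s < 0")
        case True
        obtain N :: nat where N: "- s \<le> real N" using real_arch_simple by blast
        have "eventually (\<lambda>k. s < rsq k) sequentially" using order_tendstoD(1)[OF rsq_lim True] .
        moreover have "eventually (\<lambda>k. N \<le> k) sequentially" by (rule eventually_ge_at_top)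
        ultimately have "eventually (\<lambda>k. indicator {- real (k + 2)..rsq k} s *\<^sub>R K s = indicator {..<0} s *\<^sub>R K s) sequentially"
          by eventually_elim (use N True in \<open>auto simp: indicator_def\<close>)
        then show ?thesis by (rule tendsto_eventually)
      next
        case False
        have "s \<notin> {- real (k + 2)..rsq k}" for k using False rsq(2)[of k] by auto
        then show ?thesis using False by simp
      qed
    qed
  qed
  have Jl: "(\<lambda>k. J (rsq k)) \<longlonglongrightarrow> c"
    using lim unfolding J_def \<xi>_def h[OF pol_annulus[OF rsq(2)]] .
  have J0: "(\<lambda>k. J (- real (k + 2))) \<longlonglongrightarrow> 2 * pi * \<phi> 0"
  proof -
    define q where "q z = \<phi> z * \<xi> z" for z
    have "continuous_on (ball 0 1) h" by (rule holomorphic_on_imp_continuous_on[OF hh])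
    then have cq: "continuous_on (ball 0 1) q"
      unfolding q_def[abs_def] \<xi>_def by (intro continuous_intros continuous_on_subset[OF C1_onD(4)[OF \<phi>]]) auto
    have qi: "isCont q 0" using cq by (simp add: continuous_on_eq_continuous_at)
    have q0: "q 0 = \<phi> 0" by (simp add: q_def \<xi>_def h_def)
    have "(\<lambda>k. LINT t|circle_measure. q (pol (- real (k + 2)) t)) \<longlonglongrightarrow> 2 * pi * q 0"
    proof (rule LIMSEQ_I)
      fix e :: real assume e: "e > 0"
      \<comment> \<open>Over a parameter interval of length \<open>2 * pi\<close> this tolerance
        integrates to \<open>e / 2\<close>.\<close>
      then obtain d where d: "d > 0" "\<And>z. norm z < d \<Longrightarrow> \<bar>q z - q 0\<bar> < e / (4 * pi)"
        using qi[unfolded continuous_at_eps_delta, rule_format, of "e / (4 * pi)"] by (auto simp: dist_norm)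
      have "(\<lambda>k. exp (-1) ^ k) \<longlonglongrightarrow> (0::real)" by (intro LIMSEQ_power_zero) simp
      then have "(\<lambda>k. exp (- real k)) \<longlonglongrightarrow> 0" by (simp add: exp_of_nat_mult[symmetric])
      then have "(\<lambda>k. exp (- real (k + 2))) \<longlonglongrightarrow> 0" by (rule LIMSEQ_ignore_initial_segment)
      then have "eventually (\<lambda>k. exp (- real (k + 2)) < d) sequentially" using d(1) by (rule order_tendstoD)
      then obtain N where N: "\<And>k. k \<ge> N \<Longrightarrow> exp (- real (k + 2)) < d" by (auto simp: eventually_sequentially)
      have "\<bar>(LINT t|circle_measure. q (pol (- real (k + 2)) t)) - 2 * pi * q 0\<bar> < e" if k: "k \<ge> N" for k
      proof -
        let ?s = "- real (k + 2)"
        have c: "continuous_on {0..2*pi} (\<lambda>t. q (pol ?s t))"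
          by (rule continuous_pol_t[OF continuous_on_subset[OF cq A]]) simp
        have "(LINT t|circle_measure. q (pol ?s t)) - 2 * pi * q 0 = (LINT t|circle_measure. q (pol ?s t) - q 0)"
          using Bochner_Integration.integral_diff[OF circle_integrable[OF c] circle_integrable[OF continuous_on_const, of "q 0"]]
          integral_circle_const[of "q 0"] by (simp only: real_scaleR_def)
        also have "\<bar>\<dots>\<bar> \<le> (LINT t|circle_measure. e / (4 * pi))"
          unfolding real_norm_def[symmetric]
        proof (rule Bochner_Integration.integral_norm_bound_integral)
          show "integrable circle_measure (\<lambda>t. q (pol ?s t) - q 0)" "integrable circle_measure (\<lambda>t. e / (4 * pi))"
            by (intro circle_integrable continuous_intros c)+
          show "norm (q (pol ?s t) - q 0) \<le> e / (4 * pi)" for t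
            using d(2)[of "pol ?s t"] N[OF k] by simp
        qed
        also have "\<dots> = e / 2" using integral_circle_const[of "e / (4 * pi)"] by simp
        also have "\<dots> < e" using e by simp
        finally show ?thesis .
      qed
      then show "\<exists>N. \<forall>k\<ge>N. norm ((LINT t|circle_measure. q (pol (- real (k + 2)) t)) - 2 * pi * q 0) < e"
        unfolding real_norm_def by blast
    qed
    then show ?thesis unfolding q0 by (simp add: J_def q_def)
  qed
  have "(\<lambda>k. J (rsq k) - J (- real (k + 2))) \<longlonglongrightarrow> c - 2 * pi * \<phi> 0" by (intro tendsto_diff Jl J0)
  with D have "(LINT s|lborel. indicator {..<0} s *\<^sub>R K s) = c - 2 * pi * \<phi> 0"
    unfolding FTC by (rule LIMSEQ_unique)
  then show ?thesis unfolding annulus_0_integral(2)[OF cF] val .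
qed

end

text \<open>The constant \<open>c\<close> treats both data together: it is 1 for the normal and
  \<open>\<i>\<close> for the tangent.\<close>

locale dirichlet_trace = dirichlet_log +
  fixes c :: complex and g :: "complex \<Rightarrow> complex"
  assumes norm_c: "norm c = 1"
    and trace: "AE t in circle_measure. \<exists>l. ntlim (logM L) t l \<and> g (cis t) = c * sgn (exp l)"
begin

sublocale finite_energy_trace "direction c" g
proof
  show "AE t in circle_measure. (\<lambda>k. direction c (pol (rsq k) t)) \<longlonglongrightarrow> g (cis t)"
    using trace by eventually_elim (use direction_limit[of _ _ c] in auto)
qed (auto intro: C1_direction norm_direction norm_c energy_direction)

lemma neumann_solution_potential: "neumann_solution g potential"
  unfolding neumann_solution_def
proof (intro conjI allI impI)
  show "\<exists>\<Psi>. C1_on (ball 0 1) \<Psi> \<and> H1 (ball 0 1) \<Psi> \<and> (\<forall>z\<in>ball 0 1 - {0}. potential z = ln (norm z) + \<Psi> z)"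
    using potential_decomposition unfolding annulus_0 by blast
  fix \<phi> :: "complex \<Rightarrow> real" assume \<phi>: "C1_on UNIV \<phi>"
  show "(LINT z|lebesgue_on (ball 0 1). pd_x potential z * pd_x \<phi> z + pd_y potential z * pd_y \<phi> z) = angular_current g \<phi> - 2 * pi * \<phi> 0"
    using current_limit[OF \<phi>, unfolded direction_current[OF pol_annulus[OF rsq(2)] norm_c]] by (rule green[OF \<phi>])
qed

lemma H_half_degree_trace: "H_half_degree g = 1"
proof -
  have "pd_x (\<lambda>z::complex. 1::real) z = 0" "pd_y (\<lambda>z::complex. 1::real) z = 0" for z
    by (rule has_grad_pd[OF has_grad_const])+
  then have "angular_current g (\<lambda>_. 1) - 2 * pi * 1 = 0"
    using neumann_solution_potential C1_on_const[of UNIV "1::real"] unfolding neumann_solution_def by force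
  then show ?thesis by (simp add: H_half_degree_def)
qed

end

section \<open>Uniqueness of traces\<close>

text \<open>Integrate the derivative of \<open>(s - ln \<rho>) \<integral> |D|\<^sup>2\<close> over the circles of radius \<open>e\<^sup>s\<close>.\<close>
lemma trace_inequality:
  fixes D :: "complex \<Rightarrow> complex"
  assumes \<rho>: "0 < \<rho>" "\<rho> < 1" and D: "C1_on UNIV D"
  shows "- ln \<rho> * \<rho>\<^sup>2 * (LINT t|circle_measure. (norm (D (cis t)))\<^sup>2)
    \<le> (1 - ln \<rho>) * (LINT z|lebesgue_on (annulus \<rho>). (norm (D z))\<^sup>2 + grad_sq D z)"
proof -
  define a where "a = ln \<rho>"
  have a: "a < 0" and \<rho>a: "\<rho> = exp a" using \<rho> by (simp_all add: a_def)
  have D': "C1_on (annulus 0) D" by (rule C1_on_subset[OF D]) simp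
  define q where "q z = (norm (D z))\<^sup>2" for z
  have q: "q z = D z \<bullet> D z" for z by (simp add: q_def power2_norm_eq_inner)
  have gq: "has_grad q (D z \<bullet> pd_x D z + pd_x D z \<bullet> D z) (D z \<bullet> pd_y D z + pd_y D z \<bullet> D z) z" if "z \<in> annulus 0" for z
    unfolding q[abs_def] by (rule has_grad_bilinear[OF bounded_bilinear_inner C1_onD(1)[OF D' that] C1_onD(1)[OF D' that]])
  have C1q: "C1_on (annulus 0) q"
    by (rule C1_onI[OF gq]) (assumption, intro continuous_intros C1_onD[OF D'], intro continuous_intros C1_onD[OF D'])
  have rq: "\<bar>rad q z\<bar> \<le> (norm (D z))\<^sup>2 + (norm (rad D z))\<^sup>2" if "z \<in> annulus 0" for z
  proof -
    have "rad q z = 2 * (D z \<bullet> rad D z)"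
      using has_grad_pd(1,2)[OF gq[OF that]] by (simp add: rad_def inner_add_right inner_commute algebra_simps)
    also have "\<bar>\<dots>\<bar> \<le> 2 * (norm (D z) * norm (rad D z))"
      unfolding abs_mult by (intro mult_mono Cauchy_Schwarz_ineq2) simp_all
    also have "\<dots> \<le> (norm (D z))\<^sup>2 + (norm (rad D z))\<^sup>2" using sum_squares_bound[of "norm (D z)" "norm (rad D z)"] by simp
    finally show ?thesis .
  qed
  let ?F = "\<lambda>z. (norm (D z))\<^sup>2 + grad_sq D z"
  have cF: "continuous_on (annulus 0) ?F" by (intro continuous_intros C1_onD[OF D'])
  have sA: "annulus \<rho> \<in> sets lebesgue" by (simp add: open_annulus sets_borel_lebesgue)
  have iF: "integrable (lebesgue_on (annulus \<rho>)) ?F"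
  proof -
    have "continuous_on UNIV ?F" by (intro continuous_intros C1_onD[OF D])
    then have "integrable (lebesgue_on (cball 0 1)) ?F"
      using locally_integrable_continuous[of UNIV ?F] by (auto simp: locally_integrable_def)
    then show ?thesis by (rule integrable_lebesgue_on_subset) (auto simp: mem_annulus sA)
  qed
  define N where "N s = (LINT t|circle_measure. (norm (D (pol s t)))\<^sup>2 + (norm (rad D (pol s t)))\<^sup>2)" for s
  define m where "m s = (LINT t|circle_measure. q (pol s t))" for s
  define m' where "m' s = (LINT t|circle_measure. rad q (pol s t))" for s
  define E where "E s = (exp s)\<^sup>2 *\<^sub>R (LINT t|circle_measure. ?F (pol s t))" for s
  note cont = C1_onD(4)[OF D'] continuous_rad_ang(1)[OF D'] continuous_rad_ang(1)[OF C1q] C1_onD(4)[OF C1q]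
  have iN: "integrable circle_measure (\<lambda>t. (norm (D (pol s t)))\<^sup>2 + (norm (rad D (pol s t)))\<^sup>2)" if "s < 0" for s
    by (intro circle_integrable continuous_intros continuous_pol_t[OF _ that] cont)
  have im: "integrable circle_measure (\<lambda>t. q (pol s t))" "integrable circle_measure (\<lambda>t. rad q (pol s t))" if "s < 0" for s
    by (intro circle_integrable continuous_pol_t[OF _ that] cont)+
  have m0: "0 \<le> m s" for s unfolding m_def by (intro integral_nonneg_AE) (simp add: q_def)
  have mN: "m s \<le> N s" if "s < 0" for s
    unfolding m_def N_def by (rule integral_mono[OF im(1)[OF that] iN[OF that]]) (simp add: q_def)
  have m'N: "m' s \<le> N s" if s: "s < 0" for s
    unfolding m'_def N_def
  proof (rule integral_mono[OF im(2)[OF s] iN[OF s]])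
    show "rad q (pol s t) \<le> (norm (D (pol s t)))\<^sup>2 + (norm (rad D (pol s t)))\<^sup>2" for t
      using rq[OF pol_annulus[OF s], of t] by linarith
  qed
  have NE: "\<rho>\<^sup>2 * N s \<le> E s" if s: "a < s" "s < 0" for s
  proof -
    have "\<rho> \<le> exp s" using s(1) by (simp add: \<rho>a)
    then have r: "\<rho>\<^sup>2 \<le> (exp s)\<^sup>2" using \<rho> by (intro power_mono) auto
    have r1: "\<rho>\<^sup>2 \<le> 1" using \<rho> by (intro power_le_one) auto
    have "\<rho>\<^sup>2 * ((norm (D z))\<^sup>2 + (norm (rad D z))\<^sup>2) \<le> (exp s)\<^sup>2 * ?F z" if z: "norm z = exp s" for z
    proof -
      have "\<rho>\<^sup>2 * (norm (D z))\<^sup>2 \<le> (exp s)\<^sup>2 * (norm (D z))\<^sup>2" by (intro mult_right_mono r) simp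
      moreover have "\<rho>\<^sup>2 * (norm (rad D z))\<^sup>2 \<le> 1 * (norm (rad D z))\<^sup>2" by (intro mult_right_mono r1) simp
      moreover have "(norm (rad D z))\<^sup>2 + (norm (ang D z))\<^sup>2 = (exp s)\<^sup>2 * grad_sq D z" using rad_ang_norm[of D z] z by simp
      moreover have "0 \<le> (norm (ang D z))\<^sup>2" by simp
      ultimately show ?thesis by (simp only: distrib_left)
    qed
    then have "(LINT t|circle_measure. \<rho>\<^sup>2 * ((norm (D (pol s t)))\<^sup>2 + (norm (rad D (pol s t)))\<^sup>2))
        \<le> (LINT t|circle_measure. (exp s)\<^sup>2 * ?F (pol s t))"
      by (intro integral_mono integrable_mult_right iN[OF s(2)] circle_integrable[OF continuous_pol_t[OF cF s(2)]]) simp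
    then show ?thesis by (simp only: N_def E_def Bochner_Integration.integral_mult_right_zero real_scaleR_def)
  qed
  have N0: "0 \<le> N s" for s unfolding N_def by (intro integral_nonneg_AE) simp
  \<comment> \<open>The left side is the derivative of \<open>(s - a) * m s\<close>. The weight
    vanishes at the inner circle, so no boundary term arises there, and it is at most
    \<open>- a\<close> up to the unit circle.\<close>
  have key: "m s + (s - a) * m' s \<le> (1 - a) / \<rho>\<^sup>2 * E s" if s: "a < s" "s < 0" for s
  proof -
    have "(s - a) * m' s \<le> (s - a) * N s" using s m'N[OF s(2)] by (intro mult_left_mono) auto
    also have "\<dots> \<le> (- a) * N s" using s N0 by (intro mult_right_mono) auto
    finally have "m s + (s - a) * m' s \<le> N s + (- a) * N s" using mN[OF s(2)] by linarith
    also have "\<dots> = (1 - a) / \<rho>\<^sup>2 * (\<rho>\<^sup>2 * N s)" using \<rho> by (simp add: field_simps)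
    also have "\<dots> \<le> (1 - a) / \<rho>\<^sup>2 * E s" using a NE[OF s] by (intro mult_left_mono) auto
    finally show ?thesis .
  qed
  have X: "{s. \<rho> < exp s \<and> s < 0} = {a<..<0}"
    by (auto simp: \<rho>a)
  have iE: "integrable lborel (\<lambda>s. indicator {a<..<0} s *\<^sub>R E s)"
    using polar_integral(2)[OF _ cF iF] \<rho> unfolding X E_def set_integrable_def by simp
  have vE: "(LINT z|lebesgue_on (annulus \<rho>). ?F z) = (LINT s|lborel. indicator {a<..<0} s *\<^sub>R E s)"
    using polar_integral(3)[OF _ cF iF] \<rho> unfolding X E_def set_lebesgue_integral_def by simp
  have dm: "(m has_vector_derivative m' s) (at s)" if "s < 0" for s
    unfolding m_def[abs_def] m'_def by (rule circle_mean(1)[OF C1q that])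
  have cm: "continuous_on {..<0} m"
    by (rule continuous_at_imp_continuous_on) (use has_vector_derivative_continuous[OF dm] in auto)
  have cm': "continuous_on {..<0} m'"
  proof -
    have c: "continuous_on (annulus 0) (\<lambda>z. complex_of_real (rad q z))" by (intro continuous_on_of_real cont)
    have "continuous_on {..<0} (\<lambda>s. 2 * pi * Re (circle_coeff (\<lambda>z. complex_of_real (rad q z)) s 0))"
      by (intro continuous_on_mult continuous_on_const continuous_on_Re continuous_circle_coeff c)
    moreover have "m' s = 2 * pi * Re (circle_coeff (\<lambda>z. complex_of_real (rad q z)) s 0)" for s
      unfolding m'_def using circle_coeff_eq[of "\<lambda>z. complex_of_real (rad q z)" s 0] by simp
    ultimately show ?thesis by simp
  qed
  have bound: "(rsq k - a) * m (rsq k) \<le> (1 - a) / \<rho>\<^sup>2 * (LINT s|lborel. indicator {a<..<0} s *\<^sub>R E s)" if k: "a \<le> rsq k" for k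
  proof -
    have "(LINT s|lborel. indicator {a..rsq k} s *\<^sub>R (m s + (s - a) * m' s)) = (rsq k - a) * m (rsq k) - (a - a) * m a"
    proof (rule integral_FTC_atLeastAtMost[OF k])
      show "((\<lambda>s. (s - a) * m s) has_vector_derivative m x + (x - a) * m' x) (at x within {a..rsq k})" if "a \<le> x" "x \<le> rsq k" for x
      proof -
        have "x < 0" using that rsq(2)[of k] by linarith
        have "((\<lambda>s. s - a) has_real_derivative 1) (at x)" by (auto intro!: derivative_eq_intros)
        from DERIV_mult[OF this dm[OF \<open>x < 0\<close>, folded has_real_derivative_iff_has_vector_derivative]]
        have "((\<lambda>s. (s - a) * m s) has_real_derivative m x + (x - a) * m' x) (at x)" by (simp add: mult.commute)
        then show ?thesis
          unfolding has_real_derivative_iff_has_vector_derivative by (rule has_vector_derivative_at_within)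
      qed
      show "continuous_on {a..rsq k} (\<lambda>s. m s + (s - a) * m' s)"
        using rsq(2)[of k] by (intro continuous_intros continuous_on_subset[OF cm] continuous_on_subset[OF cm']) auto
    qed
    then have "(rsq k - a) * m (rsq k) = (LINT s|lborel. indicator {a..rsq k} s *\<^sub>R (m s + (s - a) * m' s))" by simp
    also have "\<dots> \<le> (LINT s|lborel. (1 - a) / \<rho>\<^sup>2 * (indicator {a<..<0} s *\<^sub>R E s))"
    proof (rule integral_mono_AE)
      show "integrable lborel (\<lambda>s. indicator {a..rsq k} s *\<^sub>R (m s + (s - a) * m' s))"
        using rsq(2)[of k] by (intro borel_integrable_compact continuous_intros continuous_on_subset[OF cm] continuous_on_subset[OF cm']) auto
      show "integrable lborel (\<lambda>s. (1 - a) / \<rho>\<^sup>2 * (indicator {a<..<0} s *\<^sub>R E s))" by (intro integrable_mult_right iE)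
      show "AE s in lborel. indicator {a..rsq k} s *\<^sub>R (m s + (s - a) * m' s) \<le> (1 - a) / \<rho>\<^sup>2 * (indicator {a<..<0} s *\<^sub>R E s)"
        using AE_lborel_singleton[of a]
      proof eventually_elim
        case (elim s)
        show ?case
        proof (cases "a < s \<and> s < 0")
          case True
          have "0 \<le> E s" unfolding E_def by (intro scaleR_nonneg_nonneg integral_nonneg_AE) auto
          then have "0 \<le> (1 - a) / \<rho>\<^sup>2 * E s" using a by (intro mult_nonneg_nonneg) auto
          then show ?thesis using True key[of s] by (auto simp: indicator_def)
        next
          case False
          then have "s \<notin> {a..rsq k}" "s \<notin> {a<..<0}" using elim rsq(2)[of k] by auto
          then show ?thesis by simp
        qed
      qed
    qed
    finally show ?thesis by simp
  qed
  have lim: "(\<lambda>k. (rsq k - a) * m (rsq k)) \<longlonglongrightarrow> (0 - a) * (LINT t|circle_measure. (norm (D (cis t)))\<^sup>2)"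
  proof (intro tendsto_intros rsq_lim)
    have "bounded (D ` cball 0 1)"
      by (intro compact_imp_bounded compact_continuous_image continuous_on_subset[OF C1_onD(4)[OF D]] compact_cball) simp
    then obtain B where B: "\<And>z. z \<in> cball 0 1 \<Longrightarrow> norm (D z) \<le> B" by (force simp: bounded_iff)
    interpret finite_measure circle_measure by (rule finite_circle_measure)
    have cD: "isCont D z" for z using C1_onD(4)[OF D] by (simp add: continuous_on_eq_continuous_at)
    have cc: "continuous_on {0..2*pi} (\<lambda>t. (norm (D (cis t)))\<^sup>2)"
      by (intro continuous_intros continuous_on_compose2[OF C1_onD(4)[OF D]]) auto
    show "(\<lambda>k. m (rsq k)) \<longlonglongrightarrow> (LINT t|circle_measure. (norm (D (cis t)))\<^sup>2)"
      unfolding m_def q_def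
    proof (rule integral_dominated_convergence[where w="\<lambda>_. B\<^sup>2"])
      show "(\<lambda>t. (norm (D (cis t)))\<^sup>2) \<in> borel_measurable circle_measure"
        using circle_integrable[OF cc] by (rule borel_measurable_integrable)
      show "(\<lambda>t. (norm (D (pol (rsq k) t)))\<^sup>2) \<in> borel_measurable circle_measure" for k
        using im(1)[OF rsq(2), of k] unfolding q_def by (rule borel_measurable_integrable)
      show "AE t in circle_measure. (\<lambda>k. (norm (D (pol (rsq k) t)))\<^sup>2) \<longlonglongrightarrow> (norm (D (cis t)))\<^sup>2"
      proof (rule AE_I2)
        fix t
        have "(\<lambda>k. pol (rsq k) t) \<longlonglongrightarrow> of_real (exp 0) * cis t"
          unfolding pol_def by (intro tendsto_intros rsq_lim)
        then have "(\<lambda>k. D (pol (rsq k) t)) \<longlonglongrightarrow> D (cis t)"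
          by (intro isCont_tendsto_compose[OF cD]) simp
        then show "(\<lambda>k. (norm (D (pol (rsq k) t)))\<^sup>2) \<longlonglongrightarrow> (norm (D (cis t)))\<^sup>2" by (intro tendsto_intros)
      qed
      show "AE t in circle_measure. norm ((norm (D (pol (rsq k) t)))\<^sup>2) \<le> B\<^sup>2" for k
      proof (rule AE_I2)
        fix t
        have "norm (D (pol (rsq k) t)) \<le> B" using rsq(2)[of k] by (intro B) simp
        from power_mono[OF this norm_ge_zero, of 2]
        show "norm ((norm (D (pol (rsq k) t)))\<^sup>2) \<le> B\<^sup>2" by simp
      qed
    qed simp
  qed
  have "(0 - a) * (LINT t|circle_measure. (norm (D (cis t)))\<^sup>2) \<le> (1 - a) / \<rho>\<^sup>2 * (LINT s|lborel. indicator {a<..<0} s *\<^sub>R E s)"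
  proof (rule LIMSEQ_le_const2[OF lim])
    have "eventually (\<lambda>k. a < rsq k) sequentially" using order_tendstoD(1)[OF rsq_lim a] .
    then show "\<exists>N. \<forall>k\<ge>N. (rsq k - a) * m (rsq k) \<le> (1 - a) / \<rho>\<^sup>2 * (LINT s|lborel. indicator {a<..<0} s *\<^sub>R E s)"
      using bound unfolding eventually_sequentially by (meson less_imp_le)
  qed
  then show ?thesis unfolding vE a_def[symmetric] using \<rho> by (simp add: field_simps)
qed


lemma L2_diff:
  fixes F G :: "'a \<Rightarrow> complex"
  assumes "L2 M F" "L2 M G"
  shows "integrable M (\<lambda>x. (norm (F x - G x))\<^sup>2)"
proof (rule Bochner_Integration.integrable_bound)
  show "integrable M (\<lambda>x. 2 * (norm (F x))\<^sup>2 + 2 * (norm (G x))\<^sup>2)"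
    using assms by (intro Bochner_Integration.integrable_add integrable_mult_right) (simp_all add: L2_def)
  show "(\<lambda>x. (norm (F x - G x))\<^sup>2) \<in> borel_measurable M"
    using assms by (intro borel_measurable_power measurable_compose[OF _ borel_measurable_norm] borel_measurable_diff) (simp_all add: L2_def)
  show "AE x in M. norm ((norm (F x - G x))\<^sup>2) \<le> norm (2 * (norm (F x))\<^sup>2 + 2 * (norm (G x))\<^sup>2)"
    using sq_triangle(2) by (intro AE_I2) simp
qed

lemma L2_continuous_annulus:
  fixes F :: "complex \<Rightarrow> complex"
  assumes "continuous_on UNIV F"
  shows "L2 (lebesgue_on (annulus \<rho>)) F"
proof -
  have "bounded (F ` cball 0 1)"
    by (intro compact_imp_bounded compact_continuous_image continuous_on_subset[OF assms] compact_cball) simp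
  then obtain B where B: "\<forall>z\<in>cball 0 1. norm (F z) \<le> B" unfolding bounded_iff by blast
  show ?thesis
    by (rule L2_bounded[OF open_annulus _ continuous_on_subset[OF assms], of _ B])
      (use B in \<open>auto simp: annulus_def intro: bounded_subset[OF bounded_ball]\<close>)
qed

text \<open>Multiplying the first approximants by \<open>R\<close> and subtracting the second ones
  gives C1 functions tending to 0 together with their gradients, so by
  \<open>trace_inequality\<close> their boundary values tend to 0. These also tend to
  \<open>(R - 1) * h\<close>, and \<open>h\<close> is unimodular.\<close>

lemma outer_trace_rigid:
  assumes \<rho>: "0 < \<rho>" "\<rho> < 1" and W: "C1_on (annulus \<rho>) W"
    and t1: "outer_trace \<rho> W h" and t2: "outer_trace \<rho> (\<lambda>z. R * W z) h"
    and h1: "AE t in circle_measure. norm (h (cis t)) = 1"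
  shows "R = 1"
proof -
  let ?M = "lebesgue_on (annulus \<rho>)"
  obtain p q V where 1: "weak_gradient (annulus \<rho>) W p q" "L2 ?M p" "L2 ?M q" "\<And>n. C1_on UNIV (V n)"
    "(\<lambda>n. LINT z|?M. (norm (V n z - W z))\<^sup>2 + (norm (pd_x (V n) z - p z))\<^sup>2 + (norm (pd_y (V n) z - q z))\<^sup>2) \<longlonglongrightarrow> 0"
    "(\<lambda>n. LINT t|circle_measure. (norm (V n (cis t) - h (cis t)))\<^sup>2) \<longlonglongrightarrow> 0"
    and LW: "L2 ?M W" and Lh: "L2 circle_measure (\<lambda>t. h (cis t))"
    using t1 unfolding outer_trace_def by blast
  obtain p' q' V' where 2: "weak_gradient (annulus \<rho>) (\<lambda>z. R * W z) p' q'" "L2 ?M p'" "L2 ?M q'" "\<And>n. C1_on UNIV (V' n)"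
    "(\<lambda>n. LINT z|?M. (norm (V' n z - R * W z))\<^sup>2 + (norm (pd_x (V' n) z - p' z))\<^sup>2 + (norm (pd_y (V' n) z - q' z))\<^sup>2) \<longlonglongrightarrow> 0"
    "(\<lambda>n. LINT t|circle_measure. (norm (V' n (cis t) - h (cis t)))\<^sup>2) \<longlonglongrightarrow> 0"
    and LW': "L2 ?M (\<lambda>z. R * W z)"
    using t2 unfolding outer_trace_def by blast
  note bl = bounded_linear_mult_right[of R]
  have CRW: "C1_on (annulus \<rho>) (\<lambda>z. R * W z)" by (rule C1_on_linear[OF bl W])
  have pdRW: "pd_x (\<lambda>z. R * W z) z = R * pd_x W z" "pd_y (\<lambda>z. R * W z) z = R * pd_y W z" if "z \<in> annulus \<rho>" for z
    using has_grad_pd(1,2)[OF has_grad_linear[OF bl C1_onD(1)[OF W that]]] by simp_all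
  \<comment> \<open>The two trace hypotheses bring unrelated weak gradients; each one agrees almost
    everywhere with a classical gradient.\<close>
  have AEpq: "AE z in ?M. p' z = R * p z \<and> q' z = R * q z"
    using weak_gradient_unique[OF open_annulus weak_gradient_C1[OF open_annulus W] 1(1)]
      weak_gradient_unique[OF open_annulus weak_gradient_C1[OF open_annulus CRW] 2(1)] AE_space
    by eventually_elim (use pdRW in auto)
  define I where "I n z = (norm (V n z - W z))\<^sup>2 + (norm (pd_x (V n) z - p z))\<^sup>2 + (norm (pd_y (V n) z - q z))\<^sup>2" for n z
  define I' where "I' n z = (norm (V' n z - R * W z))\<^sup>2 + (norm (pd_x (V' n) z - p' z))\<^sup>2 + (norm (pd_y (V' n) z - q' z))\<^sup>2" for n z
  have iI: "integrable ?M (I n)" for n unfolding I_def[abs_def]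
    by (intro Bochner_Integration.integrable_add L2_diff LW 1(2,3) L2_continuous_annulus C1_onD[OF 1(4)])
  have iI': "integrable ?M (I' n)" for n unfolding I'_def[abs_def]
    by (intro Bochner_Integration.integrable_add L2_diff LW' 2(2,3) L2_continuous_annulus C1_onD[OF 2(4)])
  define D where "D n z = R * V n z - V' n z" for n z
  have CD: "C1_on UNIV (D n)" for n unfolding D_def[abs_def] by (intro C1_on_diff C1_on_linear[OF bl] 1(4) 2(4))
  have gD: "pd_x (D n) z = R * pd_x (V n) z - pd_x (V' n) z" "pd_y (D n) z = R * pd_y (V n) z - pd_y (V' n) z" for n z
    using has_grad_pd(1,2)[OF has_grad_diff[OF has_grad_linear[OF bl C1_onD(1)[OF 1(4)]] C1_onD(1)[OF 2(4)]], of z n n]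
    unfolding D_def[abs_def] by simp_all
  have iD: "integrable ?M (\<lambda>z. (norm (D n z))\<^sup>2 + grad_sq (D n) z)" for n
    using L2_continuous_annulus[OF C1_onD(2)[OF CD]] L2_continuous_annulus[OF C1_onD(3)[OF CD]] L2_continuous_annulus[OF C1_onD(4)[OF CD]]
    by (intro Bochner_Integration.integrable_add) (simp_all add: L2_def)
  have sq: "(norm (R * a - b))\<^sup>2 \<le> 2 * (norm R)\<^sup>2 * (norm (a - w))\<^sup>2 + 2 * (norm (b - R * w))\<^sup>2" for a b w
  proof -
    have e: "R * a - b = R * (a - w) - (b - R * w)" by (simp add: algebra_simps)
    have "(norm (R * a - b))\<^sup>2 \<le> 2 * (norm (R * (a - w)))\<^sup>2 + 2 * (norm (b - R * w))\<^sup>2"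
      unfolding e by (rule sq_triangle(2))
    then show ?thesis by (simp only: norm_mult power_mult_distrib mult.assoc)
  qed
  have DI: "(LINT z|?M. (norm (D n z))\<^sup>2 + grad_sq (D n) z) \<le> 2 * (norm R)\<^sup>2 * (LINT z|?M. I n z) + 2 * (LINT z|?M. I' n z)" for n
  proof -
    have "(LINT z|?M. (norm (D n z))\<^sup>2 + grad_sq (D n) z) \<le> (LINT z|?M. 2 * (norm R)\<^sup>2 * I n z + 2 * I' n z)"
    proof (rule integral_mono_AE[OF iD])
      show "integrable ?M (\<lambda>z. 2 * (norm R)\<^sup>2 * I n z + 2 * I' n z)"
        by (intro Bochner_Integration.integrable_add integrable_mult_right iI iI')
      show "AE z in ?M. (norm (D n z))\<^sup>2 + grad_sq (D n) z \<le> 2 * (norm R)\<^sup>2 * I n z + 2 * I' n z"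
        using AEpq
      proof eventually_elim
        case (elim z)
        show ?case
          using sq[of "V n z" "V' n z" "W z"] sq[of "pd_x (V n) z" "pd_x (V' n) z" "p z"] sq[of "pd_y (V n) z" "pd_y (V' n) z" "q z"]
          unfolding gD I_def I'_def D_def elim[THEN conjunct1] elim[THEN conjunct2] distrib_left by linarith
      qed
    qed
    also have "\<dots> = 2 * (norm R)\<^sup>2 * (LINT z|?M. I n z) + 2 * (LINT z|?M. I' n z)"
      using iI iI' by simp
    finally show ?thesis .
  qed
  define N where "N F = (LINT t|circle_measure. (norm (F t))\<^sup>2)" for F :: "real \<Rightarrow> complex"
  define e where "e = - ln \<rho> * \<rho>\<^sup>2"
  define C where "C = (1 - ln \<rho>) / e"
  have l: "ln \<rho> < 0" using \<rho> by simp
  have e: "e > 0" unfolding e_def by (rule mult_pos_pos) (use l \<rho> in simp_all)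
  have C: "C \<ge> 0" unfolding C_def using e l by (intro divide_nonneg_pos) simp_all
  have ND: "N (\<lambda>t. D n (cis t)) \<le> C * (2 * (norm R)\<^sup>2 * (LINT z|?M. I n z) + 2 * (LINT z|?M. I' n z))" for n
  proof -
    have "e * N (\<lambda>t. D n (cis t)) \<le> (1 - ln \<rho>) * (LINT z|?M. (norm (D n z))\<^sup>2 + grad_sq (D n) z)"
      unfolding e_def N_def by (rule trace_inequality[OF \<rho> CD])
    then have "N (\<lambda>t. D n (cis t)) \<le> (1 - ln \<rho>) * (LINT z|?M. (norm (D n z))\<^sup>2 + grad_sq (D n) z) / e"
      unfolding pos_le_divide_eq[OF e] by (simp only: mult.commute)
    also have "\<dots> = C * (LINT z|?M. (norm (D n z))\<^sup>2 + grad_sq (D n) z)" unfolding C_def by (rule times_divide_eq_left[symmetric])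
    also have "\<dots> \<le> C * (2 * (norm R)\<^sup>2 * (LINT z|?M. I n z) + 2 * (LINT z|?M. I' n z))"
      by (intro mult_left_mono DI C)
    finally show ?thesis .
  qed
  have Lc: "L2 circle_measure (\<lambda>t. F (cis t))" if "C1_on UNIV F" for F :: "complex \<Rightarrow> complex"
  proof -
    have c: "continuous_on {0..2*pi} (\<lambda>t. F (cis t))"
      by (intro continuous_on_compose2[OF C1_onD(4)[OF that]] continuous_intros) auto
    show ?thesis unfolding L2_def
      by (intro conjI borel_measurable_integrable[OF circle_integrable] circle_integrable continuous_intros c)
  qed
  have bound: "2 * pi * (norm (R - 1))\<^sup>2 \<le> 2 * N (\<lambda>t. D n (cis t)) + (4 * (norm R)\<^sup>2 * N (\<lambda>t. V n (cis t) - h (cis t)) + 4 * N (\<lambda>t. V' n (cis t) - h (cis t)))" for n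
  proof -
    have i: "integrable circle_measure (\<lambda>t. (norm (D n (cis t)))\<^sup>2)" "integrable circle_measure (\<lambda>t. (norm (V n (cis t) - h (cis t)))\<^sup>2)"
      "integrable circle_measure (\<lambda>t. (norm (V' n (cis t) - h (cis t)))\<^sup>2)"
      using Lc[OF CD, of n] L2_diff[OF Lc[OF 1(4)] Lh] L2_diff[OF Lc[OF 2(4)] Lh] by (simp_all add: L2_def)
    have "(LINT t|circle_measure. (norm (R - 1))\<^sup>2)
      \<le> (LINT t|circle_measure. 2 * (norm (D n (cis t)))\<^sup>2 + (4 * (norm R)\<^sup>2 * (norm (V n (cis t) - h (cis t)))\<^sup>2 + 4 * (norm (V' n (cis t) - h (cis t)))\<^sup>2))"
    proof (rule integral_mono_AE)
      show "integrable circle_measure (\<lambda>t. (norm (R - 1))\<^sup>2)" by (rule circle_integrable) simp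
      show "integrable circle_measure (\<lambda>t. 2 * (norm (D n (cis t)))\<^sup>2 + (4 * (norm R)\<^sup>2 * (norm (V n (cis t) - h (cis t)))\<^sup>2 + 4 * (norm (V' n (cis t) - h (cis t)))\<^sup>2))"
        by (intro Bochner_Integration.integrable_add integrable_mult_right i)
      show "AE t in circle_measure. (norm (R - 1))\<^sup>2 \<le> 2 * (norm (D n (cis t)))\<^sup>2 + (4 * (norm R)\<^sup>2 * (norm (V n (cis t) - h (cis t)))\<^sup>2 + 4 * (norm (V' n (cis t) - h (cis t)))\<^sup>2)"
        using h1
      proof eventually_elim
        case (elim t)
        let ?d = "D n (cis t)" and ?v = "V n (cis t) - h (cis t)" and ?v' = "V' n (cis t) - h (cis t)"
        \<comment> \<open>The constant is isolated by writing its defect in terms of the three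
          quantities that tend to 0 in the mean.\<close>
        have "(R - 1) * h (cis t) = ?d - (R * ?v - ?v')" by (simp add: D_def algebra_simps)
        then have "(norm (R - 1))\<^sup>2 = (norm (?d - (R * ?v - ?v')))\<^sup>2"
          using elim by (metis norm_mult mult.right_neutral)
        also have "\<dots> \<le> 2 * (norm ?d)\<^sup>2 + 2 * (norm (R * ?v - ?v'))\<^sup>2" by (rule sq_triangle(2))
        also have "(norm (R * ?v - ?v'))\<^sup>2 \<le> 2 * (norm (R * ?v))\<^sup>2 + 2 * (norm ?v')\<^sup>2" by (rule sq_triangle(2))
        finally show ?case by (simp add: norm_mult power_mult_distrib)
      qed
    qed
    also have "\<dots> = 2 * N (\<lambda>t. D n (cis t)) + (4 * (norm R)\<^sup>2 * N (\<lambda>t. V n (cis t) - h (cis t)) + 4 * N (\<lambda>t. V' n (cis t) - h (cis t)))"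
      unfolding N_def using i by simp
    finally show ?thesis unfolding integral_circle_const by simp
  qed
  have lims: "(\<lambda>n. LINT z|?M. I n z) \<longlonglongrightarrow> 0" "(\<lambda>n. LINT z|?M. I' n z) \<longlonglongrightarrow> 0"
    "(\<lambda>n. N (\<lambda>t. V n (cis t) - h (cis t))) \<longlonglongrightarrow> 0" "(\<lambda>n. N (\<lambda>t. V' n (cis t) - h (cis t))) \<longlonglongrightarrow> 0"
    using 1(5,6) 2(5,6) unfolding I_def I'_def N_def by simp_all
  have "2 * pi * (norm (R - 1))\<^sup>2 \<le> 2 * (C * (2 * (norm R)\<^sup>2 * 0 + 2 * 0)) + (4 * (norm R)\<^sup>2 * 0 + 4 * 0)"
  proof (rule LIMSEQ_le_const)
    show "(\<lambda>n. 2 * (C * (2 * (norm R)\<^sup>2 * (LINT z|?M. I n z) + 2 * (LINT z|?M. I' n z)))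
        + (4 * (norm R)\<^sup>2 * N (\<lambda>t. V n (cis t) - h (cis t)) + 4 * N (\<lambda>t. V' n (cis t) - h (cis t))))
      \<longlonglongrightarrow> 2 * (C * (2 * (norm R)\<^sup>2 * 0 + 2 * 0)) + (4 * (norm R)\<^sup>2 * 0 + 4 * 0)"
      by (intro tendsto_intros lims)
    have "2 * pi * (norm (R - 1))\<^sup>2 \<le> 2 * (C * (2 * (norm R)\<^sup>2 * (LINT z|?M. I n z) + 2 * (LINT z|?M. I' n z)))
        + (4 * (norm R)\<^sup>2 * N (\<lambda>t. V n (cis t) - h (cis t)) + 4 * N (\<lambda>t. V' n (cis t) - h (cis t)))" for n
      using bound[of n] ND[of n] by linarith
    then show "\<exists>N'. \<forall>n\<ge>N'. 2 * pi * (norm (R - 1))\<^sup>2 \<le> 2 * (C * (2 * (norm R)\<^sup>2 * (LINT z|?M. I n z) + 2 * (LINT z|?M. I' n z)))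
        + (4 * (norm R)\<^sup>2 * N (\<lambda>t. V n (cis t) - h (cis t)) + 4 * N (\<lambda>t. V' n (cis t) - h (cis t)))"
      by blast
  qed
  then have "(norm (R - 1))\<^sup>2 \<le> 0" using pi_gt_zero by (simp add: mult_le_0_iff del: power2_less_eq_zero_iff power_eq_0_iff)
  then show "R = 1" by simp
qed

text \<open>Compositions with \<open>f\<close> agree with the disc model only inside the disc and
  off 0. Every ingredient of \<open>outer_trace\<close> that involves the map sees it on the annulus
  alone.\<close>

lemma outer_trace_cong:
  assumes eq: "\<And>z. z \<in> annulus \<rho> \<Longrightarrow> W z = W' z" and t: "outer_trace \<rho> W h"
  shows "outer_trace \<rho> W' h"
proof -
  let ?M = "lebesgue_on (annulus \<rho>)"
  have meas: "W' \<in> borel_measurable ?M" if "W \<in> borel_measurable ?M"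
    using that measurable_cong[of ?M W W' borel] eq by simp
  have i2: "integrable ?M (\<lambda>z. (norm (W z))\<^sup>2) \<longleftrightarrow> integrable ?M (\<lambda>z. (norm (W' z))\<^sup>2)"
    by (rule Bochner_Integration.integrable_cong) (use eq in auto)
  have li: "locally_integrable (annulus \<rho>) W'" if "locally_integrable (annulus \<rho>) W"
    unfolding locally_integrable_def
  proof (intro allI impI)
    fix K assume K: "compact K \<and> K \<subseteq> annulus \<rho>"
    then have "integrable (lebesgue_on K) W" using that by (auto simp: locally_integrable_def)
    then show "integrable (lebesgue_on K) W'"
      by (rule iffD1[OF Bochner_Integration.integrable_cong[OF refl], rotated]) (use K eq in auto)
  qed
  have wg: "weak_gradient (annulus \<rho>) W' p q" if "weak_gradient (annulus \<rho>) W p q" for p q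
  proof -
    have e: "(LINT z|?M. pd_x \<phi> z *\<^sub>R W z) = (LINT z|?M. pd_x \<phi> z *\<^sub>R W' z)"
      "(LINT z|?M. pd_y \<phi> z *\<^sub>R W z) = (LINT z|?M. pd_y \<phi> z *\<^sub>R W' z)" for \<phi> :: "complex \<Rightarrow> real"
      by (rule Bochner_Integration.integral_cong; use eq in simp)+
    show ?thesis using that li unfolding weak_gradient_def e by blast
  qed
  have L2: "L2 ?M W'" using t meas i2 unfolding outer_trace_def L2_def by blast
  have conv: "(LINT z|?M. (norm (V n z - W z))\<^sup>2 + (norm (pd_x (V n) z - p z))\<^sup>2 + (norm (pd_y (V n) z - q z))\<^sup>2)
    = (LINT z|?M. (norm (V n z - W' z))\<^sup>2 + (norm (pd_x (V n) z - p z))\<^sup>2 + (norm (pd_y (V n) z - q z))\<^sup>2)"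
    for p q and V :: "nat \<Rightarrow> complex \<Rightarrow> complex" and n
    by (rule Bochner_Integration.integral_cong) (use eq in auto)
  show ?thesis
    using t L2 wg unfolding outer_trace_def conv by blast
qed

section \<open>The canonical harmonic map of a uniformization\<close>

text \<open>Near a zero with derivative 1 the quotient \<open>c * (m w / (w - a))\<close> is close
  to \<open>c\<close>, hence off the nonpositive axis. The segment from \<open>u w\<close> to
  \<open>w - a\<close> then misses 0, and a linear homotopy compares the loop with a small circle
  about 0.\<close>

lemma winding_number_simple_zero:
  assumes m: "(m has_field_derivative 1) (at a)" "m a = 0" and c: "c \<notin> \<real>\<^sub>\<le>\<^sub>0"
    and U: "open U" "a \<in> U" and u: "continuous_on (U - {a}) u" "\<And>w. w \<in> U - {a} \<Longrightarrow> u w = c * sgn (m w)"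
  shows "eventually (\<lambda>\<rho>. winding_number (u \<circ> circlepath a \<rho>) 0 = 1) (at_right 0)"
proof -
  have "((\<lambda>w. m w / (w - a)) \<longlongrightarrow> 1) (at a)"
    using m unfolding has_field_derivative_iff by simp
  then have "((\<lambda>w. c * (m w / (w - a))) \<longlongrightarrow> c * 1) (at a)" by (intro tendsto_intros)
  moreover have "open (- \<real>\<^sub>\<le>\<^sub>0 :: complex set)" by (simp add: open_Compl)
  ultimately have "eventually (\<lambda>w. c * (m w / (w - a)) \<in> - \<real>\<^sub>\<le>\<^sub>0) (at a)"
    using c by (intro topological_tendstoD) auto
  then obtain d where d: "d > 0" "\<And>w. w \<noteq> a \<Longrightarrow> dist w a < d \<Longrightarrow> c * (m w / (w - a)) \<notin> \<real>\<^sub>\<le>\<^sub>0"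
    unfolding eventually_at by auto
  obtain e where e: "e > 0" "ball a e \<subseteq> U" using U open_contains_ball by blast
  have "winding_number (u \<circ> circlepath a \<rho>) 0 = 1" if \<rho>: "0 < \<rho>" "\<rho> < min d e" for \<rho>
  proof -
    have pi: "path_image (circlepath a \<rho>) \<subseteq> U - {a}" using \<rho> e(2) by (auto simp: dist_norm)
    have "homotopic_loops (-{0}) (u \<circ> circlepath a \<rho>) (circlepath 0 \<rho>)"
    proof (rule homotopic_loops_linear)
      show "path (u \<circ> circlepath a \<rho>)"
        by (rule path_continuous_image[OF path_circlepath continuous_on_subset[OF u(1) pi]])
      show "pathfinish (u \<circ> circlepath a \<rho>) = pathstart (u \<circ> circlepath a \<rho>)"
        by (simp add: pathfinish_compose pathstart_compose)
      fix t :: real assume t: "t \<in> {0..1}"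
      define w where "w = circlepath a \<rho> t"
      have wU: "w \<in> U - {a}" using pi t unfolding w_def path_image_def by blast
      have wa: "circlepath 0 \<rho> t = w - a" by (simp add: w_def circlepath)
      have "dist w a = \<rho>"
        using \<rho>(1) by (simp add: w_def circlepath dist_norm norm_mult)
      then have q: "c * (m w / (w - a)) \<notin> \<real>\<^sub>\<le>\<^sub>0" using d(2)[of w] wU \<rho> by auto
      have "0 \<notin> closed_segment (u w) (w - a)"
      proof
        assume "0 \<in> closed_segment (u w) (w - a)"
        then obtain s where s: "0 \<le> s" "s \<le> 1" "(1 - s) *\<^sub>R (c * sgn (m w)) + s *\<^sub>R (w - a) = 0"
          using u(2)[OF wU] by (auto simp: in_segment)
        have wa0: "w - a \<noteq> 0" using wU by simp
        have mw: "m w \<noteq> 0" using q by (auto simp: nonpos_Reals_def)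
        have "s \<noteq> 1" using s(3) wa0 by auto
        then have s1: "1 - s > 0" using s(2) by simp
        \<comment> \<open>If 0 lay on the segment, \<open>u w\<close> would be a nonpositive
          multiple of \<open>w - a\<close>, which places the quotient on the excluded axis.\<close>
        have "c * (m w / (w - a)) = of_real (- s * norm (m w) / (1 - s))"
        proof -
          have e: "of_real (1 - s) * (c * m w) = - of_real (s * norm (m w)) * (w - a)"
          proof -
            have "norm (m w) *\<^sub>R ((1 - s) *\<^sub>R (c * sgn (m w)) + s *\<^sub>R (w - a)) = 0" unfolding s(3) by simp
            then have "of_real (1 - s) * (c * m w) + of_real (s * norm (m w)) * (w - a) = 0"
              using mw by (simp add: sgn_div_norm scaleR_conv_of_real algebra_simps)
            then show ?thesis by (simp add: eq_neg_iff_add_eq_0)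
          qed
          have "of_real (1 - s) \<noteq> (0::complex)" using s1 by (simp only: of_real_eq_0_iff)
          then show ?thesis using e wa0 by (simp only: of_real_divide of_real_mult of_real_minus) (simp add: divide_simps mult.commute)
        qed
        moreover have "- s * norm (m w) / (1 - s) \<le> 0" using s s1 by (simp add: divide_nonpos_pos mult_nonneg_nonneg)
        ultimately show False using q by (metis nonpos_Reals_of_real_iff)
      qed
      then show "closed_segment ((u \<circ> circlepath a \<rho>) t) (circlepath 0 \<rho> t) \<subseteq> - {0}"
        using wa by (auto simp: w_def)
    qed simp_all
    from winding_number_homotopic_loops[OF this]
    show ?thesis using winding_number_circlepath_centre[OF \<rho>(1), of 0] by simp
  qed
  then show ?thesis using d(1) e(1) by (auto simp: eventually_at_right intro!: exI[of _ "min d e"])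
qed

text \<open>\<open>v\<close> and \<open>\<i> * v\<close> form an orthonormal basis, and the last two
  hypotheses prescribe the coordinates of \<open>h\<close> in it up to sign.\<close>

lemma norm_1_derivative:
  fixes h v :: complex
  assumes "norm v = 1" "h \<bullet> v = 0" "h \<bullet> (- \<i> * v) = r"
  shows "h = - of_real r * (\<i> * v)"
proof -
  have v: "(Re v)\<^sup>2 + (Im v)\<^sup>2 = 1" using assms(1) by (simp add: cmod_power2[symmetric])
  have 1: "Re h * Re v + Im h * Im v = 0" "Re h * Im v - Im h * Re v = r"
    using assms(2,3) by (simp_all add: inner_complex_def)
  have "Re h = Re h * ((Re v)\<^sup>2 + (Im v)\<^sup>2)" "Im h = Im h * ((Re v)\<^sup>2 + (Im v)\<^sup>2)" unfolding v by simp_all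
  moreover have "Re h * ((Re v)\<^sup>2 + (Im v)\<^sup>2) = Re v * (Re h * Re v + Im h * Im v) + Im v * (Re h * Im v - Im h * Re v)"
    "Im h * ((Re v)\<^sup>2 + (Im v)\<^sup>2) = Im v * (Re h * Re v + Im h * Im v) - Re v * (Re h * Im v - Im h * Re v)"
    by (simp_all add: power2_eq_square algebra_simps)
  ultimately show ?thesis unfolding 1 by (simp add: complex_eq_iff)
qed

text \<open>Differentiate the constant function \<open>h z \<bullet> h z\<close>.\<close>

lemma norm_1_orthogonal:
  fixes h :: "complex \<Rightarrow> complex"
  assumes U: "open U" "w \<in> U" and g: "has_grad h A B w" and n: "\<And>w. w \<in> U \<Longrightarrow> norm (h w) = 1"
  shows "A \<bullet> h w = 0" "B \<bullet> h w = 0"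
proof -
  have "has_grad (\<lambda>z. h z \<bullet> h z) (h w \<bullet> A + A \<bullet> h w) (h w \<bullet> B + B \<bullet> h w) w"
    by (rule has_grad_bilinear[OF bounded_bilinear_inner g g])
  moreover have "h z \<bullet> h z = 1" if "z \<in> U" for z using n[OF that] by (simp add: power2_norm_eq_inner[symmetric])
  ultimately have "has_grad (\<lambda>z. 1::real) (h w \<bullet> A + A \<bullet> h w) (h w \<bullet> B + B \<bullet> h w) w"
    using has_grad_cong[OF U, of "\<lambda>z. h z \<bullet> h z" "\<lambda>z. 1"] by blast
  from has_grad_pd(1,2)[OF this] has_grad_pd(1,2)[OF has_grad_const[of "1::real" w]]
  show "A \<bullet> h w = 0" "B \<bullet> h w = 0" by (simp_all add: inner_commute)
qed

text \<open>\<open>u\<close> is tied to \<open>f\<close> through \<open>u_eq\<close> and not by a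
  formula, so that one and the same map can instantiate the locale for several uniformizations of
  \<open>\<Omega>\<close>.\<close>

locale uniformized_trace = dirichlet_trace L c "g \<circ> f" for L c and g f :: "complex \<Rightarrow> complex" +
  fixes \<Omega> :: "complex set" and a :: complex and u :: "complex \<Rightarrow> complex"
  assumes unif: "uniformization f \<Omega>" and f_0: "f 0 = a"
    and log_deriv: "z \<in> ball 0 1 \<Longrightarrow> deriv f z = exp (L z)"
    and u_eq: "w \<in> \<Omega> - {a} \<Longrightarrow> u w = direction c (inv_into (ball 0 1) f w)"
begin

abbreviation k :: "complex \<Rightarrow> complex" where "k \<equiv> inv_into (ball 0 1) f"

lemma open_punctured: "open (\<Omega> - {a})" using uniformizationD(8)[OF unif] by (simp add: open_delete)

lemma k_annulus:
  assumes "w \<in> \<Omega> - {a}" shows "k w \<in> annulus 0"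
  using inverse_uniformization(1,2)[OF unif, of w] assms f_0 by (auto simp: annulus_0)

lemma k_deriv: "w \<in> \<Omega> \<Longrightarrow> (k has_field_derivative deriv k w) (at w)"
  by (rule holomorphic_derivI[OF uniformizationD(7,8)[OF unif]])

lemma a_mem: "a \<in> \<Omega>" using uniformizationD(3)[OF unif] f_0 by force

lemma k_a: "k a = 0" using inverse_uniformization(3)[OF unif, of 0] f_0 by simp

lemma P_k_deriv:
  assumes "w \<in> \<Omega> - {a}"
  shows "((\<lambda>w. P (k w)) has_field_derivative P (k w) * (X (k w) * deriv k w)) (at w)" "P (k w) \<noteq> 0"
  using DERIV_chain2[OF P_deriv(1)[OF k_annulus[OF assms]] k_deriv] P_deriv(2)[OF k_annulus[OF assms]] assms
  by (simp_all add: mult.assoc)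

text \<open>Composition with the inverse map multiplies the logarithmic derivative by
  \<open>deriv k w\<close>; the formula in the disc carries over with \<open>X\<close> replaced by
  this product.\<close>

lemma has_grad_u:
  assumes w: "w \<in> \<Omega> - {a}"
  shows "has_grad u (\<i> * of_real (Im (X (k w) * deriv k w)) * u w) (\<i> * of_real (Re (X (k w) * deriv k w)) * u w) w"
  using has_grad_sgn[OF P_k_deriv[OF w], of c] has_grad_cong[OF open_punctured w, of u "\<lambda>w. c * sgn (P (k w))"]
    u_eq w by (simp add: direction_def)

lemma norm_u: "w \<in> \<Omega> - {a} \<Longrightarrow> norm (u w) = 1"
  using u_eq norm_direction[OF k_annulus norm_c] by simp

lemma C1_u: "C1_on (\<Omega> - {a}) u"
proof (rule C1_on_cong[OF open_punctured])
  show "C1_on (\<Omega> - {a}) (\<lambda>w. direction c (k w))"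
    by (rule C1_on_compose_holomorphic[OF C1_direction open_punctured holomorphic_on_subset[OF uniformizationD(7)[OF unif]]])
      (use k_annulus in auto)
qed (simp add: u_eq)

lemma has_grad_potential_k:
  "w \<in> \<Omega> - {a} \<Longrightarrow> has_grad (potential \<circ> k) (Re (X (k w) * deriv k w)) (- Im (X (k w) * deriv k w)) w"
  unfolding potential_def[abs_def] comp_def by (rule has_grad_ln_norm[OF P_k_deriv])

text \<open>Pairing with \<open>- \<i> * u\<close> turns the two partial derivatives into
  \<open>- Im\<close> and \<open>- Re\<close> of the logarithmic derivative, and
  \<open>hodge_star\<close> rotates this pair into \<open>Re\<close> and \<open>- Im\<close>, the
  gradient of the potential.\<close>

lemma hodge_u:
  assumes w: "w \<in> \<Omega> - {a}"
  shows "hodge_star (pd_x u w \<bullet> (- \<i> * u w), pd_y u w \<bullet> (- \<i> * u w)) = (pd_x (potential \<circ> k) w, pd_y (potential \<circ> k) w)"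
proof -
  have "(\<i> * of_real r * u w) \<bullet> (- \<i> * u w) = - r" for r
  proof -
    have "(\<i> * of_real r * u w) \<bullet> (- \<i> * u w) = - r * (norm (u w))\<^sup>2"
      unfolding inner_complex_def cmod_power2 by (simp add: power2_eq_square algebra_simps)
    then show ?thesis using norm_u[OF w] by simp
  qed
  then show ?thesis
    unfolding has_grad_pd(1,2)[OF has_grad_u[OF w]] has_grad_pd(1,2)[OF has_grad_potential_k[OF w]] hodge_star_def
    by (simp only: fst_conv snd_conv minus_minus)
qed

lemma bounded_domain: "bounded \<Omega>"
proof -
  have "bounded (f ` cball 0 1)"
    using uniformizationD(4)[OF unif] by (intro compact_imp_bounded compact_continuous_image compact_cball)
  then show ?thesis by (rule bounded_subset) (use uniformizationD(3)[OF unif] in auto)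
qed

text \<open>By conformal invariance the energy of \<open>u\<close> is that of
  \<open>direction c\<close> on the image under \<open>k\<close>. Removing a disc about
  \<open>a\<close> keeps this image away from 0, where the energy is not integrable.\<close>

lemma H1_u:
  assumes \<rho>: "\<rho> > 0"
  shows "H1 (\<Omega> - cball a \<rho>) u"
proof -
  let ?U = "\<Omega> - cball a \<rho>"
  have U: "open ?U" "?U \<subseteq> \<Omega> - {a}" "bounded ?U"
    using uniformizationD(8)[OF unif] \<rho> bounded_domain by (auto intro: open_Diff bounded_subset)
  have CU: "C1_on ?U u" by (rule C1_on_subset[OF C1_u U(2)])
  have L: "L2 (lebesgue_on ?U) u"
    by (rule L2_bounded[OF U(1,3) C1_onD(4)[OF CU], of 1]) (rule eq_refl[OF norm_u[OF subsetD[OF U(2)]]])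
  have "isCont f 0"
    using holomorphic_on_imp_continuous_on[OF uniformizationD(1)[OF unif]] by (simp add: continuous_on_eq_continuous_at)
  \<comment> \<open>Continuity of \<open>f\<close> at 0 turns the removed disc about
    \<open>a\<close> into a removed disc about 0; the radius is halved afterwards because
    \<open>annulus\<close> has a strict inequality.\<close>
  then obtain \<delta> where \<delta>: "\<delta> > 0" "\<And>z. norm z < \<delta> \<Longrightarrow> dist (f z) a < \<rho>"
    using \<rho> f_0 unfolding continuous_at_eps_delta by (auto simp: dist_norm)
  have kU: "k ` ?U \<subseteq> annulus (\<delta> / 2)"
  proof
    fix z assume "z \<in> k ` ?U"
    then obtain w where w: "w \<in> \<Omega>" "w \<notin> cball a \<rho>" "z = k w" by auto
    then have z: "z \<in> ball 0 1" "f z = w" using inverse_uniformization(1,2)[OF unif] by auto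
    have "\<not> norm z < \<delta>" using \<delta>(2)[of z] w z by (auto simp: dist_commute)
    then show "z \<in> annulus (\<delta> / 2)" using z \<delta>(1) by (simp add: mem_annulus)
  qed
  have hk: "k holomorphic_on ?U" by (rule holomorphic_on_subset[OF uniformizationD(7)[OF unif]]) auto
  have ik: "inj_on k ?U" using inverse_uniformization(2)[OF unif] by (intro inj_on_inverseI[of _ f]) auto
  have ok: "open (k ` ?U)" by (rule open_holomorphic_image[OF U(1) hk ik])
  let ?q = "grad_sq (direction c)"
  have A0: "annulus (\<delta> / 2) \<subseteq> annulus 0" using \<delta>(1) by (intro annulus_mono) simp
  have cq: "continuous_on (annulus 0) ?q" by (intro continuous_intros C1_onD[OF C1_direction])
  have bq: "set_borel_measurable borel V ?q" if "open V" "V \<subseteq> annulus 0" for V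
    by (rule set_borel_measurable_continuous_open[OF continuous_on_subset[OF cq that(2)]]) (use that in simp)
  have "set_integrable lborel (annulus (\<delta> / 2)) ?q"
    using energy_direction[OF norm_c, of "\<delta> / 2"] \<delta>(1) lebesgue_on_iff_lborel(1)[OF _ bq[OF open_annulus A0]] open_annulus by simp
  then have "set_integrable lborel (k ` ?U) ?q" by (rule set_integrable_subset) (use kU ok in auto)
  then have i: "set_integrable lborel ?U (\<lambda>w. (norm (deriv k w))\<^sup>2 *\<^sub>R ?q (k w))"
    using set_integral_holomorphic_image(1)[OF U(1) hk ik bq[OF ok order_trans[OF kU A0]]] by simp
  have eq: "(norm (deriv k w))\<^sup>2 *\<^sub>R ?q (k w) = grad_sq u w" if "w \<in> ?U" for w
  proof -
    have w: "w \<in> \<Omega> - {a}" using that U(2) by blast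
    have aux: "(norm (\<i> * of_real r * u w))\<^sup>2 = r\<^sup>2" for r
      using norm_u[OF w] by (simp add: norm_mult)
    have "(Im Y)\<^sup>2 + (Re Y)\<^sup>2 = (norm Y)\<^sup>2" for Y by (simp add: cmod_power2)
    then show ?thesis
      unfolding grad_sq_direction[OF k_annulus[OF w] norm_c] has_grad_pd(1,2)[OF has_grad_u[OF w]] aux
      by (simp only: norm_mult power_mult_distrib real_scaleR_def mult.commute)
  qed
  have bu: "set_borel_measurable borel ?U (grad_sq u)"
    by (intro set_borel_measurable_continuous_open continuous_intros C1_onD[OF CU]) (use U in simp)
  have "set_integrable lborel ?U (grad_sq u)"
    using i eq unfolding set_integrable_def by (smt (verit) Bochner_Integration.integrable_cong indicator_simps(2) scale_zero_left)
  then have E: "integrable (lebesgue_on ?U) (grad_sq u)"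
    using lebesgue_on_iff_lborel(1)[OF _ bu] U(1) by simp
  show ?thesis
    unfolding H1_def using L weak_gradient_C1[OF U(1) CU] L2_grad[OF U(1) CU E] by blast
qed

text \<open>\<open>P\<close> composed with \<open>k\<close> vanishes at \<open>a\<close> with
  derivative 1: the value f'(0) coming from \<open>P\<close> cancels against the derivative of the
  inverse map.\<close>

lemma winding_u:
  assumes "c \<notin> \<real>\<^sub>\<le>\<^sub>0"
  shows "eventually (\<lambda>\<rho>. winding_number (u \<circ> circlepath a \<rho>) 0 = 1) (at_right 0)"
proof (rule winding_number_simple_zero[OF _ _ assms uniformizationD(8)[OF unif] a_mem C1_onD(4)[OF C1_u]])
  have "(P has_field_derivative exp (L 0)) (at 0)"
    unfolding P_def[abs_def] by (auto intro!: derivative_eq_intros L_deriv)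
  from DERIV_chain2[OF _ k_deriv[OF a_mem], of P "exp (L 0)"] this k_a
  have "((\<lambda>w. P (k w)) has_field_derivative exp (L 0) * deriv k a) (at a)" by simp
  moreover have "exp (L 0) * deriv k a = 1"
  proof -
    have "(f has_field_derivative exp (L 0)) (at (k a))"
      using holomorphic_derivI[OF uniformizationD(1)[OF unif] open_ball, of 0] log_deriv[of 0] k_a by simp
    from DERIV_chain2[OF this k_deriv[OF a_mem]]
    have "((\<lambda>w. f (k w)) has_field_derivative exp (L 0) * deriv k a) (at a)" .
    moreover have "((\<lambda>w. f (k w)) has_field_derivative 1) (at a)"
      by (rule has_field_derivative_transform_within_open[OF DERIV_ident uniformizationD(8)[OF unif] a_mem])
        (simp add: inverse_uniformization(2)[OF unif])
    ultimately show ?thesis by (rule DERIV_unique)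
  qed
  ultimately show "((\<lambda>w. P (k w)) has_field_derivative 1) (at a)" by simp
  show "P (k a) = 0" by (simp add: k_a P_def)
qed (simp add: u_eq direction_def)

lemma outer_trace_u:
  assumes \<rho>: "0 < \<rho>" "\<rho> < 1"
  shows "outer_trace \<rho> (u \<circ> f) (g \<circ> f)"
proof (rule outer_trace_cong[OF _ outer_trace_trace[OF \<rho>]])
  fix z assume "z \<in> annulus \<rho>"
  then have z: "z \<in> ball 0 1" "z \<noteq> 0" using \<rho> by (auto simp: mem_annulus)
  have k: "k (f z) = z" by (rule inverse_uniformization(3)[OF unif z(1)])
  then have "f z \<noteq> a" using k_a z(2) by metis
  then have "f z \<in> \<Omega> - {a}" using z(1) uniformizationD(3)[OF unif] by auto
  from u_eq[OF this] show "direction c z = (u \<circ> f) z" by (simp add: k)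
qed

lemma canonical_conditions_u:
  assumes "c \<notin> \<real>\<^sub>\<le>\<^sub>0"
  shows "canonical_conditions \<Omega> g a u"
  unfolding canonical_conditions_def
proof (intro conjI exI ballI)
  show "\<forall>\<^sub>F \<rho> in at_right 0. H1 (\<Omega> - cball a \<rho>) u"
    using eventually_at_right_less[of 0] by eventually_elim (rule H1_u)
  show "outer_trace \<rho> (u \<circ> f) (g \<circ> f)" if "\<rho> \<in> {0<..<1}" for \<rho> using that outer_trace_u by simp
qed (use C1_u norm_u winding_u[OF assms] unif f_0 H_half_S1_trace H_half_degree_trace neumann_solution_potential hodge_u in auto)

text \<open>The Neumann problem determines \<open>d\<Phi>\<close>, hence \<open>\<langle>dw, - \<i> w\<rangle>\<close>, so that a competitor is a
  constant multiple of \<open>u\<close>, and the trace determines the constant.\<close>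
lemma unique:
  assumes C1': "C1_on (\<Omega> - {a}) w'" and n': "\<And>w. w \<in> \<Omega> - {a} \<Longrightarrow> norm (w' w) = 1"
    and t': "outer_trace (1/2) (w' \<circ> f) (g \<circ> f)" and N: "neumann_solution (g \<circ> f) \<Phi>"
    and h': "\<And>w. w \<in> \<Omega> - {a} \<Longrightarrow> hodge_star (pd_x w' w \<bullet> (- \<i> * w' w), pd_y w' w \<bullet> (- \<i> * w' w)) = (pd_x (\<Phi> \<circ> k) w, pd_y (\<Phi> \<circ> k) w)"
    and w: "w \<in> \<Omega> - {a}"
  shows "w' w = u w"
proof -
  obtain \<Psi> where \<Psi>: "C1_on (ball 0 1) \<Psi>" "H1 (ball 0 1) \<Psi>" "\<forall>z\<in>annulus 0. \<Phi> z = ln (norm z) + \<Psi> z"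
    using N by (auto simp: neumann_solution_def annulus_0)
  note C\<Phi> = log_plus_finite_energy(2)[OF \<Psi>(1) H1_C1_energy[OF open_ball \<Psi>(1,2)] \<Psi>(3)]
  have pd: "pd_x (\<Phi> \<circ> k) w = pd_x (potential \<circ> k) w" "pd_y (\<Phi> \<circ> k) w = pd_y (potential \<circ> k) w" if w: "w \<in> \<Omega> - {a}" for w
  proof -
    note kw = k_annulus[OF w]
    have C\<Phi>0: "C1_on (annulus 0) potential" by (rule log_plus_finite_energy(2)[OF potential_decomposition(1,2,4)])
    have kd: "(k has_field_derivative deriv k w) (at w)" using w by (intro k_deriv) auto
    note eq = neumann_unique[OF N neumann_solution_potential kw]
    show "pd_x (\<Phi> \<circ> k) w = pd_x (potential \<circ> k) w" "pd_y (\<Phi> \<circ> k) w = pd_y (potential \<circ> k) w"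
      unfolding comp_def has_grad_pd(1,2)[OF has_grad_compose_holomorphic[OF C1_onD(1)[OF C\<Phi> kw] kd]]
        has_grad_pd(1,2)[OF has_grad_compose_holomorphic[OF C1_onD(1)[OF C\<Phi>0 kw] kd]] eq by simp_all
  qed
  have der: "pd_x w' w = \<i> * of_real (Im (X (k w) * deriv k w)) * w' w" "pd_y w' w = \<i> * of_real (Re (X (k w) * deriv k w)) * w' w"
    if w: "w \<in> \<Omega> - {a}" for w
  proof -
    have "pd_x w' w \<bullet> (- \<i> * w' w) = - Im (X (k w) * deriv k w)" "pd_y w' w \<bullet> (- \<i> * w' w) = - Re (X (k w) * deriv k w)"
      using h'[OF w] unfolding pd[OF w] has_grad_pd(1,2)[OF has_grad_potential_k[OF w]] hodge_star_def by auto
    from norm_1_derivative[OF n'[OF w] norm_1_orthogonal(1)[OF open_punctured w C1_onD(1)[OF C1' w] n'] this(1)]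
      norm_1_derivative[OF n'[OF w] norm_1_orthogonal(2)[OF open_punctured w C1_onD(1)[OF C1' w] n'] this(2)]
    show "pd_x w' w = \<i> * of_real (Im (X (k w) * deriv k w)) * w' w" "pd_y w' w = \<i> * of_real (Re (X (k w) * deriv k w)) * w' w"
      by (simp_all add: algebra_simps)
  qed
  \<comment> \<open>Both maps are unimodular, so this is their quotient; equal logarithmic
    derivatives make its gradient vanish.\<close>
  define R where "R w = w' w * cnj (u w)" for w
  have gR: "(R has_derivative (\<lambda>h. 0)) (at w)" if w: "w \<in> \<Omega> - {a}" for w
  proof -
    have "has_grad R (w' w * cnj (\<i> * of_real (Im (X (k w) * deriv k w)) * u w) + pd_x w' w * cnj (u w))
       (w' w * cnj (\<i> * of_real (Re (X (k w) * deriv k w)) * u w) + pd_y w' w * cnj (u w)) w"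
      unfolding R_def[abs_def]
      by (rule has_grad_mult[OF C1_onD(1)[OF C1' w] has_grad_linear[OF bounded_linear_cnj has_grad_u[OF w]]])
    then have "has_grad R 0 0 w" unfolding der[OF w] by (simp add: algebra_simps)
    then show ?thesis by (simp add: has_grad_def)
  qed
  \<comment> \<open>Removing a point does not disconnect an open connected planar set, so the
    locally constant \<open>R\<close> is globally constant.\<close>
  have conn: "connected (\<Omega> - {a})"
  proof (rule connected_open_delete)
    show "open \<Omega>" by (rule uniformizationD(8)[OF unif])
    have "connected (f ` ball 0 1)"
      by (intro connected_continuous_image holomorphic_on_imp_continuous_on uniformizationD(1)[OF unif] convex_connected convex_ball)
    then show "connected \<Omega>" using uniformizationD(3)[OF unif] by simp
  qed simp
  have const: "R w = R v" if "v \<in> \<Omega> - {a}" for v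
    by (rule has_derivative_zero_unique_connected[OF open_punctured conn _ w that]) (rule gR)
  have w'R: "w' v = R w * u v" if v: "v \<in> \<Omega> - {a}" for v
  proof -
    have "R w * u v = R v * u v" using const[OF v] by (rule arg_cong)
    also have "\<dots> = w' v * (u v * cnj (u v))" by (simp add: R_def mult_ac)
    finally show ?thesis using norm_u[OF v] by (simp add: complex_norm_square[symmetric])
  qed
  have "R w = 1"
  proof (rule outer_trace_rigid[OF _ _ C1_on_subset[OF C1_direction[of c]] outer_trace_trace])
    show "annulus (1/2) \<subseteq> annulus 0" by (rule annulus_mono) simp
    show "outer_trace (1 / 2) (\<lambda>z. R w * direction c z) (g \<circ> f)"
    proof (rule outer_trace_cong[OF _ t'])
      fix z assume "z \<in> annulus (1/2)"
      then have z: "z \<in> ball 0 1" "z \<noteq> 0" by (auto simp: mem_annulus)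
      have k: "k (f z) = z" by (rule inverse_uniformization(3)[OF unif z(1)])
      then have "f z \<noteq> a" using k_a z(2) by metis
      then have fz: "f z \<in> \<Omega> - {a}" using z(1) uniformizationD(3)[OF unif] by auto
      show "(w' \<circ> f) z = R w * direction c z" using w'R[OF fz] u_eq[OF fz] by (simp add: k)
    qed
    show "AE t in circle_measure. norm ((g \<circ> f) (cis t)) = 1" by (rule trace_bounds(2))
  qed simp_all
  then show ?thesis using w'R[OF w] by simp
qed

end


section \<open>Normal and tangential data for an arbitrary uniformization\<close>

lemma dirichlet_lebesgue:
  assumes L: "L holomorphic_on ball 0 1" and I: "set_integrable lborel (ball 0 1) (\<lambda>z. (norm (deriv L z))\<^sup>2)"
  shows "integrable (lebesgue_on (ball 0 1)) (\<lambda>z. (norm (deriv L z))\<^sup>2)"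
proof -
  have "continuous_on (ball 0 1) (\<lambda>z. (norm (deriv L z))\<^sup>2)"
    by (intro continuous_intros holomorphic_on_imp_continuous_on holomorphic_deriv L open_ball)
  then have "set_borel_measurable borel (ball 0 1) (\<lambda>z. (norm (deriv L z))\<^sup>2)"
    by (rule set_borel_measurable_continuous_open) simp
  from lebesgue_on_iff_lborel(1)[OF _ this] I show ?thesis by simp
qed

text \<open>The locale is instantiated at \<open>f\<close> for existence and at the uniformization
  supplied by a competitor for uniqueness. Both describe the same \<open>u\<close>: if h(z) =
  f(\<alpha> z), then z h'(z) is the value of z f'(z) at the rotated point.\<close>

lemma canonical_harmonic_map_direction:
  assumes f: "uniformization f \<Omega>" "f 0 = a"
    and I: "set_integrable lborel (ball 0 1) (\<lambda>z. (norm (deriv (deriv f) z / deriv f z))\<^sup>2)"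
    and fr: "normal_tangent_frame \<Omega> \<nu> \<tau>"
    and g: "g = \<nu> \<and> c = 1 \<or> g = \<tau> \<and> c = \<i>"
    and u: "\<And>w. w \<in> \<Omega> - {a} \<Longrightarrow> u w = c * sgn (inv_into (ball 0 1) f w * deriv f (inv_into (ball 0 1) f w))"
  shows "canonical_harmonic_map \<Omega> g a u"
proof -
  have c: "c \<notin> \<real>\<^sub>\<le>\<^sub>0" "norm c = 1" using g by (auto simp: complex_nonpos_Reals_iff)
  have trace: "\<exists>L. uniformized_trace L c g h \<Omega> a u" if h: "uniformization h \<Omega>" "h 0 = a" for h
  proof -
    obtain L where L: "L holomorphic_on ball 0 1" "\<And>z. z \<in> ball 0 1 \<Longrightarrow> deriv h z = exp (L z)"
      "\<And>z. z \<in> ball 0 1 \<Longrightarrow> deriv L z = deriv (deriv h) z / deriv h z"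
      using uniformization_log_deriv[OF h(1)] by blast
    have "set_integrable lborel (ball 0 1) (\<lambda>z. (norm (deriv L z))\<^sup>2)"
      using uniformization_dirichlet[OF f(1) h(1) I] L(3)
      by (subst set_integrable_cong[OF refl refl, of _ _ "\<lambda>z. (norm (deriv (deriv h) z / deriv h z))\<^sup>2"]) auto
    then have E: "integrable (lebesgue_on (ball 0 1)) (\<lambda>z. (norm (deriv L z))\<^sup>2)"
      by (rule dirichlet_lebesgue[OF L(1)])
    interpret dirichlet_log L by standard (rule L(1), rule E)
    obtain \<alpha> where \<alpha>: "norm \<alpha> = 1" "\<And>z. norm z < 1 \<Longrightarrow> h z = f (\<alpha> * z)"
      using uniformization_rotation[OF f(1) h(1)] f(2) h(2) by metis
    have "uniformized_trace L c g h \<Omega> a u"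
    proof
      show "norm c = 1" by (rule c)
      show "AE t in circle_measure. \<exists>l. ntlim (logM L) t l \<and> (g \<circ> h) (cis t) = c * sgn (exp l)"
      proof -
        have "AE t in circle_measure. \<exists>l. ntlim (logM L) t l \<and> \<nu> (h (cis t)) = sgn (exp l) \<and> \<tau> (h (cis t)) = \<i> * sgn (exp l)"
          by (rule frame_at_boundary[OF h(1) L(1) _ E fr]) (rule L(2))
        then show ?thesis by eventually_elim (use g in auto)
      qed
      show "uniformization h \<Omega>" "h 0 = a" by (rule h)+
      show "deriv h z = exp (L z)" if "z \<in> ball 0 1" for z by (rule L(2)[OF that])
      fix w assume w: "w \<in> \<Omega> - {a}"
      define z where "z = inv_into (ball 0 1) h w"
      have z: "z \<in> ball 0 1" "h z = w" using inverse_uniformization(1,2)[OF h(1), of w] w by (simp_all add: z_def)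
      then have az: "\<alpha> * z \<in> ball 0 1" using \<alpha>(1) by (simp add: norm_mult)
      \<comment> \<open>The two inverses differ by the same rotation as the maps themselves.\<close>
      have kf: "inv_into (ball 0 1) f w = \<alpha> * z"
        using inverse_uniformization(3)[OF f(1) az] \<alpha>(2)[of z] z by simp
      have "((\<lambda>z. f (\<alpha> * z)) has_field_derivative deriv f (\<alpha> * z) * \<alpha>) (at z)"
        by (rule DERIV_chain2[where g="\<lambda>z. \<alpha> * z", OF holomorphic_derivI[OF uniformizationD(1)[OF f(1)] open_ball az]])
          (auto intro!: derivative_eq_intros)
      then have "(h has_field_derivative deriv f (\<alpha> * z) * \<alpha>) (at z)"
        by (rule has_field_derivative_transform_within_open[OF _ open_ball z(1)]) (simp add: \<alpha>(2))
      then have "deriv h z = deriv f (\<alpha> * z) * \<alpha>" by (rule DERIV_imp_deriv)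
      then show "u w = direction c (inv_into (ball 0 1) h w)"
        unfolding u[OF w] kf direction_def P_def z_def[symmetric] L(2)[OF z(1), symmetric] by (simp add: mult_ac)
    qed
    then show ?thesis by blast
  qed
  obtain L where "uniformized_trace L c g f \<Omega> a u" using trace[OF f] by blast
  then interpret f: uniformized_trace L c g f \<Omega> a u .
  show ?thesis
    unfolding canonical_harmonic_map_def
  proof (intro conjI allI impI ballI)
    show "canonical_conditions \<Omega> g a u" by (rule f.canonical_conditions_u[OF c(1)])
    fix w' w assume w': "canonical_conditions \<Omega> g a w'" and w: "w \<in> \<Omega> - {a}"
    obtain h \<Phi> where h: "uniformization h \<Omega>" "h 0 = a" "\<forall>\<rho>\<in>{0<..<1}. outer_trace \<rho> (w' \<circ> h) (g \<circ> h)"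
      "neumann_solution (g \<circ> h) \<Phi>"
      "\<forall>z\<in>\<Omega> - {a}. hodge_star (pd_x w' z \<bullet> (- \<i> * w' z), pd_y w' z \<bullet> (- \<i> * w' z)) =
             (pd_x (\<Phi> \<circ> inv_into (ball 0 1) h) z, pd_y (\<Phi> \<circ> inv_into (ball 0 1) h) z)"
      and C: "C1_on (\<Omega> - {a}) w'" "\<forall>z\<in>\<Omega> - {a}. norm (w' z) = 1"
      using w' unfolding canonical_conditions_def by blast
    obtain L' where "uniformized_trace L' c g h \<Omega> a u" using trace[OF h(1,2)] by blast
    then interpret h: uniformized_trace L' c g h \<Omega> a u .
    show "w' w = u w"
      by (rule h.unique[OF C(1) C(2)[rule_format] _ h(4) h(5)[rule_format] w]) (use h(3) in auto)
  qed
qed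


text \<open>The definition supplies a uniformization of the inside of the curve, which is
  \<open>\<Omega>\<close> by \<open>inside_frontier_eq\<close>; a continuous integrand with finite
  nonnegative integral is integrable in the sense used by the change of variables.\<close>

lemma weil_petersson_uniformization:
  assumes "open \<Omega>" "connected \<Omega>" "bounded \<Omega>" "\<Omega> \<noteq> {}" "weil_petersson_curve (frontier \<Omega>)"
  obtains f where "uniformization f \<Omega>" "set_integrable lborel (ball 0 1) (\<lambda>z. (norm (deriv (deriv f) z / deriv f z))\<^sup>2)"
proof -
  have j: "jordan_curve (frontier \<Omega>)" using assms(5) by (simp add: weil_petersson_curve_def)
  obtain f where f: "uniformization f \<Omega>"
    and fin: "(\<integral>\<^sup>+z\<in>ball 0 1. ennreal ((norm (deriv (deriv f) z / deriv f z))\<^sup>2) \<partial>lebesgue) < \<infinity>"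
    using assms(5) inside_frontier_eq[OF assms(1-4) j] unfolding weil_petersson_curve_def by auto
  let ?F = "\<lambda>z. (norm (deriv (deriv f) z / deriv f z))\<^sup>2"
  have h: "deriv f holomorphic_on ball 0 1" "deriv (deriv f) holomorphic_on ball 0 1"
    by (intro holomorphic_deriv uniformizationD(1)[OF f] open_ball)+
  have "continuous_on (ball 0 1) ?F"
    using uniformizationD(6)[OF f] by (intro continuous_intros holomorphic_on_imp_continuous_on h) auto
  then have m: "(\<lambda>z. indicator (ball 0 1) z *\<^sub>R ?F z) \<in> borel_measurable lborel"
    using set_borel_measurable_continuous_open[of "ball 0 1" ?F] by (simp add: set_borel_measurable_def)
  have eq: "ennreal (?F z) * indicator (ball 0 1) z = ennreal (norm (indicator (ball 0 1) z *\<^sub>R ?F z))" for z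
    by (simp add: indicator_def)
  have "(\<lambda>z. ennreal (norm (indicator (ball 0 1) z *\<^sub>R ?F z))) \<in> borel_measurable lborel" using m by measurable
  then have "(\<integral>\<^sup>+z. ennreal (norm (indicator (ball 0 1) z *\<^sub>R ?F z)) \<partial>lborel) < \<infinity>"
    using fin unfolding eq by (simp add: nn_integral_completion)
  then have "set_integrable lborel (ball 0 1) ?F"
    unfolding set_integrable_def by (intro integrableI_bounded m)
  with f show thesis by (rule that)
qed

lemma polar_derivs_holomorphic:
  assumes "(f has_field_derivative d) (at z)"
  shows "angular_deriv f z = \<i> * (z * d)" "radial_deriv f z = (z * d) /\<^sub>R norm z"
proof -
  note pd = has_grad_pd(1,2)[OF has_grad_holomorphic[OF assms]]
  have "Re z *\<^sub>R d + Im z *\<^sub>R (\<i> * d) = z * d" by (simp add: complex_eq_iff)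
  then show "radial_deriv f z = (z * d) /\<^sub>R norm z" unfolding radial_deriv_def pd by simp
  show "angular_deriv f z = \<i> * (z * d)" unfolding angular_deriv_def pd by (simp add: complex_eq_iff)
qed

theorem proposition4p3:
  fixes \<Omega> :: "complex set" and a :: complex
    and \<nu> \<tau> f :: "complex \<Rightarrow> complex"
  assumes "open \<Omega>" "connected \<Omega>" "bounded \<Omega>" "simply_connected \<Omega>"
    and "weil_petersson_curve (frontier \<Omega>)"
    and "normal_tangent_frame \<Omega> \<nu> \<tau>"
    and "a \<in> \<Omega>"
    and "uniformization f \<Omega>" and "f 0 = a"
  shows "canonical_harmonic_map \<Omega> \<tau> a
           ((\<lambda>z. angular_deriv f z /\<^sub>R norm (angular_deriv f z)) \<circ> inv_into (ball 0 1) f) \<and>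
         canonical_harmonic_map \<Omega> \<nu> a
           ((\<lambda>z. radial_deriv f z /\<^sub>R norm (radial_deriv f z)) \<circ> inv_into (ball 0 1) f)"
proof -
  note f = \<open>uniformization f \<Omega>\<close> \<open>f 0 = a\<close>
  obtain f0 where f0: "uniformization f0 \<Omega>"
    "set_integrable lborel (ball 0 1) (\<lambda>z. (norm (deriv (deriv f0) z / deriv f0 z))\<^sup>2)"
    by (rule weil_petersson_uniformization[OF assms(1-3) _ assms(5)]) (use \<open>a \<in> \<Omega>\<close> in auto)
  note canonical = canonical_harmonic_map_direction[OF f uniformization_dirichlet[OF f0(1) f(1) f0(2)] \<open>normal_tangent_frame \<Omega> \<nu> \<tau>\<close>]
  have k: "inv_into (ball 0 1) f w \<in> ball 0 1" "inv_into (ball 0 1) f w \<noteq> 0" if "w \<in> \<Omega> - {a}" for w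
    using inverse_uniformization(1,2)[OF f(1), of w] that f(2) by auto
  have d: "(f has_field_derivative deriv f z) (at z)" if "z \<in> ball 0 1" for z
    by (rule holomorphic_derivI[OF uniformizationD(1)[OF f(1)] open_ball that])
  show ?thesis
  proof (intro conjI)
    show "canonical_harmonic_map \<Omega> \<tau> a ((\<lambda>z. angular_deriv f z /\<^sub>R norm (angular_deriv f z)) \<circ> inv_into (ball 0 1) f)"
    proof (rule canonical[of _ \<i>])
      fix w assume w: "w \<in> \<Omega> - {a}"
      show "((\<lambda>z. angular_deriv f z /\<^sub>R norm (angular_deriv f z)) \<circ> inv_into (ball 0 1) f) w
        = \<i> * sgn (inv_into (ball 0 1) f w * deriv f (inv_into (ball 0 1) f w))"
        by (simp add: polar_derivs_holomorphic(1)[OF d[OF k(1)[OF w]]] sgn_div_norm norm_mult)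
    qed simp
    show "canonical_harmonic_map \<Omega> \<nu> a ((\<lambda>z. radial_deriv f z /\<^sub>R norm (radial_deriv f z)) \<circ> inv_into (ball 0 1) f)"
    proof (rule canonical[of _ 1])
      fix w assume w: "w \<in> \<Omega> - {a}"
      show "((\<lambda>z. radial_deriv f z /\<^sub>R norm (radial_deriv f z)) \<circ> inv_into (ball 0 1) f) w
        = 1 * sgn (inv_into (ball 0 1) f w * deriv f (inv_into (ball 0 1) f w))"
        \<comment> \<open>The factor \<open>1 / norm z\<close> inside \<open>radial_deriv\<close> is
          removed by the normalization because \<open>z\<close> is not 0.\<close>
        using k(2)[OF w] by (simp add: polar_derivs_holomorphic(2)[OF d[OF k(1)[OF w]]] sgn_div_norm norm_mult)
    qed simp
  qed
qed

end
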